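(* Let $n\ge1$, let $\Lambda$ be a $\Pi_{\mathcal A}$-algebra, $G_\bullet\to\Lambda$ a free simplicial resolution with CW basis $(\overline G_i)$, $V^{\langle n+1\rangle}_\bullet$ an $(n+1)$-truncated realization of $\tau_{n+1}G_\bullet$, and $\bar d_0:\overline V_{n+2}\to C_{n+1}V^{\langle n+1\rangle}_\bullet$ a map realizing the attaching map of $\overline G_{n+2}$. Then the last higher homotopy operation $\langle\langle\Psi^{n+2}_0\rangle\rangle$ has a minimal value. Consequently the operation is non-empty, and it vanishes if any minimal value vanishes.
   Context: GENERAL SETTING. $\mathcal M$ is a pointed, cofibrantly generated, right proper simplicial model category with a collection $\mathcal A$ of homotopy cogroup objects; $\mathcal M_{\mathcal A}$ is the smallest full subcategory containing $\mathcal A$ and closed under suspensions, arbitrary coproducts and weak equivalences. $\Pi_{\mathcal A}$ is the full subcategory of $\mathrm{ho}\,\mathcal M$ on finite coproducts of suspensions of objects of $\mathcal A$. A $\Pi_{\mathcal A}$-algebra is a functor $\Lambda:\Pi_{\mathcal A}^{op}\to\mathrm{Set}_*$ taking coproducts to products, with values $\Lambda\{B\}$; $\pi_{\mathcal A}Y$ is $B\mapsto[B,Y]$. $\tau_m$ is $m$-truncation of simplicial objects. $s\mathcal M$ has the resolution model structure: weak equivalences are maps inducing weak equivalences of simplicial groups $[\Sigma^iA,-]$ for $A\in\mathcal A$, $i\ge0$. For Reedy fibrant $X_\bullet$: $C_mX=\bigcap_{i\ge1}\ker(d_i:X_m\to X_{m-1})$, $Z_mX=\ker(d_0|_{C_mX})$,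 $\pi^\natural_mX=\mathrm{coker}((d_0)_*:\pi_{\mathcal A}C_{m+1}X\to\pi_{\mathcal A}Z_mX)$. Standing assumption: $s\mathcal M$ is an $E^2$-model category, i.e. it has functorial Postnikov sections with respect to $\pi^\natural_*$ ($\mathbf P_m=\mathrm{csk}_{m+1}$ on Reedy fibrant objects), classifying objects $B\Lambda$, Eilenberg–Mac Lane objects $E_\Lambda(K,m)$ over $B\Lambda$, functorial $k$-invariants, and a realization functor $J:s\mathcal M\to\mathcal M$ with $[A,JX]\cong\Lambda\{A\}$ when $X$ is cofibrant and $\pi_{\mathcal A}X\simeq B\Lambda$; moreover $\pi_{\mathcal A}C_mX\cong C_m\pi_{\mathcal A}X$ for Reedy fibrant $X$. DATA. A CW object $G_\bullet$ has $G_m=\overline G_m\amalg L_mG$ ($L_m$ the latching object), $d_i|_{\overline G_m}=0$ for $i\ge1$; $d_0|_{\overline G_m}:\overline G_m\to Z_{m-1}G$ is the attaching map; here each $\overline G_m$ is free. $V^{\langle n+1\rangle}_\bullet$ is a Reedy fibrant $(n+1)$-truncated CW object over $\mathcal M$, with CW basis objects $\overline V_i\in\mathcal M_{\mathcal A}$, $\pi_{\mathcal A}\overline V_i\cong\overline G_i$, $\tau_{n+1}\pi_{\mathcal A}V^{\langle n+1\rangle}_\bullet\cong\tau_{n+1}G_\bullet$; $\overline V_{n+2}\in\mathcal M_{\mathcal A}$ is cofibrant with $\pi_{\mathcal A}\overline V_{n+2}\cong\overline G_{n+2}$, and $\bar d_0$ induces the attaching map of $\overline G_{n+2}$. Thus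 $d_i\bar d_0=0$ for $i\ge1$ and $d_0\bar d_0\sim0$. HIGHER HOMOTOPY OPERATIONS. Put $N=n$, $V=V^{\langle n+1\rangle}_\bullet$, $B=\overline V_{n+2}$, $a=\bar d_0:B\to V_{N+1}$. A $k$-flag is $\varphi=(i_1<\dots<i_k)$ with $0\le i_1$, $i_k\le N+1$; $|\varphi|=k$. The flag complex $K_\varphi$ is the simplicial set whose $j$-simplices are expressions $d_{I_0}|d_{I_1}|\cdots|d_{I_{j+1}}$ with $j+1$ bars, each $d_{I_t}$ a (possibly empty) composite of face maps written with increasing indices, such that deleting all bars gives $d_{i_1}\cdots d_{i_k}$ by the simplicial identities; $\partial_i$ removes the $(i+1)$st bar, $s_i$ repeats it. For $k\ge1$, $\partial_0K_\varphi$ (resp. $\widetilde\partial K_\varphi$) is spanned by the faces $\partial_0\sigma$ (resp. $\partial_k\sigma$) of the $k$-simplices $\sigma$; $\partial K_\varphi=\partial_0K_\varphi\cup\widetilde\partial K_\varphi$ is the boundary $(k-1)$-sphere of the $k$-ball $K_\varphi$. $\partial_0K_\varphi$ is the union of the subcomplexes $d_{i_j-j+1}\circ K_{\varphi^{\hat j}}$, where $\varphi^{\hat j}$ omits $i_j$ and $d\circ\sigma$ is $\sigma$ with $d$ composed on the left. A level-$k$ lift is a family of simplicial maps $h_\varphi:K_\varphi\to\mathrm{map}_{\mathcal M}(B,V_{N+1-|\varphi|})$ for $|\varphi|\le k$ with $h_\emptyset=a$, $h_\varphi=0$ on $\widetilde\partial K_\varphi$, and $h_\varphi(d_{i_j-j+1}\circ\sigma)=d_{i_j-j+1}\circ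 h_{\varphi^{\hat j}}(\sigma)$. Given a level-$N$ lift and an $(N+1)$-flag $\varphi$, $f_\varphi:\partial K_\varphi\to\mathrm{map}_{\mathcal M}(B,V_0)$ is $0$ on $\widetilde\partial K_\varphi$ and $d_{i_j-j+1}\circ h_{\varphi^{\hat j}}$ on $d_{i_j-j+1}\circ K_{\varphi^{\hat j}}$; it factors through $\partial K_\varphi/\widetilde\partial K_\varphi\simeq S^N$, with adjoint $\tilde f_\varphi:\Sigma^NB\to V_0$. $\Psi^{N+2}_0$ is the set of $(N+1)$-flags, and $\langle\langle\Psi^{N+2}_0\rangle\rangle\subseteq[\bigvee_{\varphi\in\Psi^{N+2}_0}\Sigma^NB,V_0]$ is the set of all classes $[\bigvee\tilde f_\varphi]$ (values) obtained from level-$N$ lifts; it vanishes if it contains $0$. A value is minimal if it is represented by a level-$N$ lift such that $\tilde f_\varphi$ is constant for all $\varphi\neq\varphi_0:=(0<1<\dots<N)$, and for each $1\le k\le N$ every nondegenerate $k$-simplex of the flag complexes of $k$-flags, other than $\tau_k=|d_0|d_0|\cdots|d_0|$ ($k+1$ bars), is sent to zero. *)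

theory Defs
  imports "HOL-Library.Equipollence" "HOL-Library.Extended_Nat" "HOL-Algebra.Group"
begin

section \<open>Categories\<close>

text \<open>
  Hom-sets are not required to be disjoint; composition \<open>cmp C g f\<close> is only constrained on
  composable pairs.  Maps together with their source and target are triples \<open>(X, Y, f)\<close>.
  A type \<open>'s\<close> plays the role of the universe of small sets: a set is small if it has strictly
  smaller cardinality than \<open>'s\<close> (for \<open>'s\<close> of inaccessible cardinality this is a Grothendieck
  universe).
\<close>

record ('o, 'a) cat =
  ob :: "'o set"
  ar :: "'o \<Rightarrow> 'o \<Rightarrow> 'a set"
  idt :: "'o \<Rightarrow> 'a"
  cmp :: "'a \<Rightarrow> 'a \<Rightarrow> 'a"

definition small :: "'s itself \<Rightarrow> 'x set \<Rightarrow> bool" where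
  "small u S \<longleftrightarrow> S \<prec> (UNIV :: 's set)"

definition category :: "('o, 'a) cat \<Rightarrow> bool" where
  "category C \<longleftrightarrow>
     (\<forall>X\<in>ob C. idt C X \<in> ar C X X) \<and>
     (\<forall>X\<in>ob C. \<forall>Y\<in>ob C. \<forall>Z\<in>ob C. \<forall>f\<in>ar C X Y. \<forall>g\<in>ar C Y Z. cmp C g f \<in> ar C X Z) \<and>
     (\<forall>X\<in>ob C. \<forall>Y\<in>ob C. \<forall>f\<in>ar C X Y. cmp C f (idt C X) = f \<and> cmp C (idt C Y) f = f) \<and>
     (\<forall>X\<in>ob C. \<forall>Y\<in>ob C. \<forall>Z\<in>ob C. \<forall>W\<in>ob C. \<forall>f\<in>ar C X Y. \<forall>g\<in>ar C Y Z. \<forall>h\<in>ar C Z W.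
        cmp C h (cmp C g f) = cmp C (cmp C h g) f)"

definition opp :: "('o, 'a) cat \<Rightarrow> ('o, 'a) cat" where
  "opp C = \<lparr>ob = ob C, ar = (\<lambda>X Y. ar C Y X), idt = idt C, cmp = (\<lambda>g f. cmp C f g)\<rparr>"

definition arrs :: "('o, 'a) cat \<Rightarrow> ('o \<times> 'o \<times> 'a) set" where
  "arrs C = {(X, Y, f). X \<in> ob C \<and> Y \<in> ob C \<and> f \<in> ar C X Y}"

definition is_iso :: "('o, 'a) cat \<Rightarrow> 'o \<Rightarrow> 'o \<Rightarrow> 'a \<Rightarrow> bool" where
  "is_iso C X Y f \<longleftrightarrow> f \<in> ar C X Y \<and>
     (\<exists>g\<in>ar C Y X. cmp C g f = idt C X \<and> cmp C f g = idt C Y)"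

definition is_functor ::
  "('o, 'a) cat \<Rightarrow> ('p, 'b) cat \<Rightarrow> ('o \<Rightarrow> 'p) \<Rightarrow> ('o \<Rightarrow> 'o \<Rightarrow> 'a \<Rightarrow> 'b) \<Rightarrow> bool" where
  "is_functor C D Fo Fa \<longleftrightarrow>
     (\<forall>X\<in>ob C. Fo X \<in> ob D \<and> Fa X X (idt C X) = idt D (Fo X)) \<and>
     (\<forall>X\<in>ob C. \<forall>Y\<in>ob C. \<forall>f\<in>ar C X Y. Fa X Y f \<in> ar D (Fo X) (Fo Y)) \<and>
     (\<forall>X\<in>ob C. \<forall>Y\<in>ob C. \<forall>Z\<in>ob C. \<forall>f\<in>ar C X Y. \<forall>g\<in>ar C Y Z.
        Fa X Z (cmp C g f) = cmp D (Fa Y Z g) (Fa X Y f))"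

definition nat_tr ::
  "('o, 'a) cat \<Rightarrow> ('p, 'b) cat \<Rightarrow> ('o \<Rightarrow> 'p) \<Rightarrow> ('o \<Rightarrow> 'o \<Rightarrow> 'a \<Rightarrow> 'b) \<Rightarrow>
    ('o \<Rightarrow> 'p) \<Rightarrow> ('o \<Rightarrow> 'o \<Rightarrow> 'a \<Rightarrow> 'b) \<Rightarrow> ('o \<Rightarrow> 'b) \<Rightarrow> bool" where
  "nat_tr C D Fo Fa Go Ga t \<longleftrightarrow>
     (\<forall>X\<in>ob C. t X \<in> ar D (Fo X) (Go X)) \<and>
     (\<forall>X\<in>ob C. \<forall>Y\<in>ob C. \<forall>f\<in>ar C X Y. cmp D (Ga X Y f) (t X) = cmp D (t Y) (Fa X Y f))"

definition is_cone ::
  "('o, 'a) cat \<Rightarrow> ('j, 'b) cat \<Rightarrow> ('j \<Rightarrow> 'o) \<Rightarrow> ('j \<Rightarrow> 'j \<Rightarrow> 'b \<Rightarrow> 'a) \<Rightarrow> 'o \<Rightarrow> ('j \<Rightarrow> 'a) \<Rightarrow> bool" where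
  "is_cone C D Fo Fa L p \<longleftrightarrow> L \<in> ob C \<and> (\<forall>j\<in>ob D. p j \<in> ar C L (Fo j)) \<and>
     (\<forall>j\<in>ob D. \<forall>k\<in>ob D. \<forall>u\<in>ar D j k. cmp C (Fa j k u) (p j) = p k)"

definition is_limit ::
  "('o, 'a) cat \<Rightarrow> ('j, 'b) cat \<Rightarrow> ('j \<Rightarrow> 'o) \<Rightarrow> ('j \<Rightarrow> 'j \<Rightarrow> 'b \<Rightarrow> 'a) \<Rightarrow> 'o \<Rightarrow> ('j \<Rightarrow> 'a) \<Rightarrow> bool" where
  "is_limit C D Fo Fa L p \<longleftrightarrow> is_cone C D Fo Fa L p \<and>
     (\<forall>T t. is_cone C D Fo Fa T t \<longrightarrow> (\<exists>!h. h \<in> ar C T L \<and> (\<forall>j\<in>ob D. cmp C (p j) h = t j)))"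

definition is_colimit ::
  "('o, 'a) cat \<Rightarrow> ('j, 'b) cat \<Rightarrow> ('j \<Rightarrow> 'o) \<Rightarrow> ('j \<Rightarrow> 'j \<Rightarrow> 'b \<Rightarrow> 'a) \<Rightarrow> 'o \<Rightarrow> ('j \<Rightarrow> 'a) \<Rightarrow> bool" where
  "is_colimit C D Fo Fa L i \<longleftrightarrow> is_limit (opp C) (opp D) Fo (\<lambda>j k. Fa k j) L i"

definition complete :: "'s itself \<Rightarrow> ('o, 'a) cat \<Rightarrow> bool" where
  "complete u C \<longleftrightarrow>
     (\<forall>(D :: ('s, 's) cat) Fo Fa. category D \<and> small u (ob D) \<and>
        (\<forall>j\<in>ob D. \<forall>k\<in>ob D. small u (ar D j k)) \<and> is_functor D C Fo Fa
        \<longrightarrow> (\<exists>L p. is_limit C D Fo Fa L p))"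

definition is_coprod ::
  "('o, 'a) cat \<Rightarrow> 'i set \<Rightarrow> ('i \<Rightarrow> 'o) \<Rightarrow> 'o \<Rightarrow> ('i \<Rightarrow> 'a) \<Rightarrow> bool" where
  "is_coprod C I X P i \<longleftrightarrow> P \<in> ob C \<and> (\<forall>j\<in>I. i j \<in> ar C (X j) P) \<and>
     (\<forall>T\<in>ob C. \<forall>t. (\<forall>j\<in>I. t j \<in> ar C (X j) T) \<longrightarrow>
        (\<exists>!h. h \<in> ar C P T \<and> (\<forall>j\<in>I. cmp C h (i j) = t j)))"

definition is_pullback ::
  "('o, 'a) cat \<Rightarrow> 'o \<Rightarrow> 'o \<Rightarrow> 'o \<Rightarrow> 'a \<Rightarrow> 'a \<Rightarrow> 'o \<Rightarrow> 'a \<Rightarrow> 'a \<Rightarrow> bool" where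
  "is_pullback C X Y Z f g P p q \<longleftrightarrow> P \<in> ob C \<and> p \<in> ar C P X \<and> q \<in> ar C P Y \<and>
     cmp C f p = cmp C g q \<and>
     (\<forall>T\<in>ob C. \<forall>a\<in>ar C T X. \<forall>b\<in>ar C T Y. cmp C f a = cmp C g b \<longrightarrow>
        (\<exists>!h. h \<in> ar C T P \<and> cmp C p h = a \<and> cmp C q h = b))"

definition is_zero :: "('o, 'a) cat \<Rightarrow> 'o \<Rightarrow> bool" where
  "is_zero C Z \<longleftrightarrow> Z \<in> ob C \<and> (\<forall>X\<in>ob C. (\<exists>!f. f \<in> ar C X Z) \<and> (\<exists>!f. f \<in> ar C Z X))"

definition zarr :: "('o, 'a) cat \<Rightarrow> 'o \<Rightarrow> 'o \<Rightarrow> 'a" where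
  "zarr C X Y = (THE f. \<exists>Z g h. is_zero C Z \<and> g \<in> ar C X Z \<and> h \<in> ar C Z Y \<and> f = cmp C h g)"

text \<open>A cogroup object: comultiplication \<open>m\<close> into the coproduct \<open>A + A\<close> making every \<open>C(A, Y)\<close>
  a group whose unit is the zero map.\<close>

definition cogroup_object :: "('o, 'a) cat \<Rightarrow> 'o \<Rightarrow> bool" where
  "cogroup_object C A \<longleftrightarrow> A \<in> ob C \<and>
     (\<exists>P i m. is_coprod C {0, 1 :: nat} (\<lambda>_. A) P i \<and> m \<in> ar C A P \<and>
        (\<forall>Y\<in>ob C. group
           \<lparr>carrier = ar C A Y,
            mult = (\<lambda>f g. cmp C (THE h. h \<in> ar C P Y \<and> cmp C h (i 0) = f \<and> cmp C h (i 1) = g) m),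
            one = zarr C A Y\<rparr>))"


section \<open>Model structures\<close>

definition retract_of :: "('o, 'a) cat \<Rightarrow> 'o \<times> 'o \<times> 'a \<Rightarrow> 'o \<times> 'o \<times> 'a \<Rightarrow> bool" where
  "retract_of C = (\<lambda>(X, Y, f) (X', Y', g).
     \<exists>i\<in>ar C X X'. \<exists>r\<in>ar C X' X. \<exists>j\<in>ar C Y Y'. \<exists>s\<in>ar C Y' Y.
       cmp C r i = idt C X \<and> cmp C s j = idt C Y \<and> cmp C g i = cmp C j f \<and> cmp C f r = cmp C s g)"

definition lifts :: "('o, 'a) cat \<Rightarrow> 'o \<times> 'o \<times> 'a \<Rightarrow> 'o \<times> 'o \<times> 'a \<Rightarrow> bool" where
  "lifts C = (\<lambda>(A, B, i) (X, Y, p). \<forall>u\<in>ar C A X. \<forall>v\<in>ar C B Y. cmp C p u = cmp C v i \<longrightarrow>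
     (\<exists>h\<in>ar C B X. cmp C h i = u \<and> cmp C p h = v))"

definition rlp :: "('o, 'a) cat \<Rightarrow> ('o \<times> 'o \<times> 'a) set \<Rightarrow> ('o \<times> 'o \<times> 'a) set" where
  "rlp C I = {p \<in> arrs C. \<forall>i\<in>I. lifts C i p}"

definition llp :: "('o, 'a) cat \<Rightarrow> ('o \<times> 'o \<times> 'a) set \<Rightarrow> ('o \<times> 'o \<times> 'a) set" where
  "llp C I = {i \<in> arrs C. \<forall>p\<in>I. lifts C i p}"

definition model_structure ::
  "('o, 'a) cat \<Rightarrow> ('o \<times> 'o \<times> 'a) set \<Rightarrow> ('o \<times> 'o \<times> 'a) set \<Rightarrow> ('o \<times> 'o \<times> 'a) set \<Rightarrow> bool" where
  "model_structure C W Co Fi \<longleftrightarrow>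
     W \<subseteq> arrs C \<and> Co \<subseteq> arrs C \<and> Fi \<subseteq> arrs C \<and>
     (\<forall>X Y Z f g. (X, Y, f) \<in> arrs C \<and> (Y, Z, g) \<in> arrs C \<longrightarrow>
        ((X, Y, f) \<in> W \<and> (Y, Z, g) \<in> W \<longrightarrow> (X, Z, cmp C g f) \<in> W) \<and>
        ((X, Y, f) \<in> W \<and> (X, Z, cmp C g f) \<in> W \<longrightarrow> (Y, Z, g) \<in> W) \<and>
        ((Y, Z, g) \<in> W \<and> (X, Z, cmp C g f) \<in> W \<longrightarrow> (X, Y, f) \<in> W)) \<and>
     (\<forall>K\<in>{W, Co, Fi}. \<forall>g\<in>K. \<forall>f\<in>arrs C. retract_of C f g \<longrightarrow> f \<in> K) \<and>
     (\<forall>i\<in>Co \<inter> W. \<forall>p\<in>Fi. lifts C i p) \<and>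
     (\<forall>i\<in>Co. \<forall>p\<in>Fi \<inter> W. lifts C i p) \<and>
     (\<forall>X Y f. (X, Y, f) \<in> arrs C \<longrightarrow>
        (\<exists>T i p. (X, T, i) \<in> Co \<inter> W \<and> (T, Y, p) \<in> Fi \<and> f = cmp C p i) \<and>
        (\<exists>T i p. (X, T, i) \<in> Co \<and> (T, Y, p) \<in> Fi \<inter> W \<and> f = cmp C p i))"

definition right_proper :: "('o, 'a) cat \<Rightarrow> ('o \<times> 'o \<times> 'a) set \<Rightarrow> ('o \<times> 'o \<times> 'a) set \<Rightarrow> bool" where
  "right_proper C W Fi \<longleftrightarrow>
     (\<forall>X Y Z f g P p q. (X, Z, f) \<in> W \<and> (Y, Z, g) \<in> Fi \<and> is_pullback C X Y Z f g P p q
        \<longrightarrow> (P, Y, q) \<in> W)"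

text \<open>Homotopy pullback of \<open>A \<rightarrow>k E \<leftarrow>z B\<close>, with \<open>A\<close>, \<open>B\<close>, \<open>E\<close> fibrant: replace \<open>z\<close> by a fibration.\<close>

definition is_hopullback ::
  "('o, 'a) cat \<Rightarrow> ('o \<times> 'o \<times> 'a) set \<Rightarrow> ('o \<times> 'o \<times> 'a) set \<Rightarrow>
    'o \<Rightarrow> 'o \<Rightarrow> 'o \<Rightarrow> 'a \<Rightarrow> 'a \<Rightarrow> 'o \<Rightarrow> 'a \<Rightarrow> 'a \<Rightarrow> bool" where
  "is_hopullback C W Fi A B E k z P t b \<longleftrightarrow> cmp C k t = cmp C z b \<and>
     (\<exists>T w q Q a c h. (B, T, w) \<in> W \<and> (T, E, q) \<in> Fi \<and> cmp C q w = z \<and>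
        is_pullback C A T E k q Q a c \<and> (P, Q, h) \<in> W \<and> cmp C a h = t \<and> cmp C c h = cmp C w b)"

subsection \<open>Cofibrant generation\<close>

definition ord_cat :: "'s rel \<Rightarrow> ('s, 's \<times> 's) cat" where
  "ord_cat r = \<lparr>ob = Field r, ar = (\<lambda>a b. if (a, b) \<in> r then {(a, b)} else {}),
     idt = (\<lambda>a. (a, a)), cmp = (\<lambda>g f. (fst f, snd g))\<rparr>"

definition is_succ :: "'s rel \<Rightarrow> 's \<Rightarrow> 's \<Rightarrow> bool" where
  "is_succ r a b \<longleftrightarrow> a \<in> underS r b \<and> (\<forall>c\<in>underS r b. (c, a) \<in> r)"

text \<open>Transfinite sequences indexed by a well-order, continuous at limit elements.\<close>

definition trans_seq ::
  "('o, 'a) cat \<Rightarrow> 's rel \<Rightarrow> ('s \<Rightarrow> 'o) \<Rightarrow> ('s \<Rightarrow> 's \<Rightarrow> 'a) \<Rightarrow> bool" where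
  "trans_seq C r X x \<longleftrightarrow> is_functor (ord_cat r) C X (\<lambda>a b _. x a b) \<and>
     (\<forall>b\<in>Field r. underS r b \<noteq> {} \<and> (\<nexists>a. is_succ r a b) \<longrightarrow>
        is_colimit C (ord_cat (Restr r (underS r b))) X (\<lambda>a b _. x a b) (X b) (\<lambda>a. x a b))"

definition pushouts :: "('o, 'a) cat \<Rightarrow> ('o \<times> 'o \<times> 'a) set \<Rightarrow> ('o \<times> 'o \<times> 'a) set" where
  "pushouts C I = {(Y, Z, g). \<exists>(A, B, i)\<in>I. \<exists>u v. Y \<in> ob C \<and> u \<in> ar C A Y \<and>
     is_pullback (opp C) B Y A i u Z v g}"

definition rel_cells :: "'s itself \<Rightarrow> ('o, 'a) cat \<Rightarrow> ('o \<times> 'o \<times> 'a) set \<Rightarrow> ('o \<times> 'o \<times> 'a) set" where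
  "rel_cells u C I = {(Y, L, f). \<exists>(r :: 's rel) X x i a. Well_order r \<and> small u (Field r) \<and>
     a \<in> Field r \<and> underS r a = {} \<and> trans_seq C r X x \<and>
     (\<forall>b c. is_succ r b c \<longrightarrow> (X b, X c, x b c) \<in> pushouts C I) \<and>
     is_colimit C (ord_cat r) X (\<lambda>a b _. x a b) L i \<and> Y = X a \<and> f = i a}"

text \<open>Smallness of an object relative to a class of maps: from some cardinal on, \<open>C(W, -)\<close> commutes
  with colimits of sequences (in that class) indexed by regular cardinals.\<close>

definition small_object :: "'s itself \<Rightarrow> ('o, 'a) cat \<Rightarrow> ('o \<times> 'o \<times> 'a) set \<Rightarrow> 'o \<Rightarrow> bool" where
  "small_object u C D W \<longleftrightarrow>
     (\<exists>k :: 's rel. Card_order k \<and> small u (Field k) \<and>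
       (\<forall>r :: 's rel. Card_order r \<and> infinite (Field r) \<and> small u (Field r) \<and> regularCard r \<and>
            (k, r) \<in> ordLeq \<longrightarrow>
          (\<forall>X x L i. trans_seq C r X x \<and> (\<forall>b c. is_succ r b c \<longrightarrow> (X b, X c, x b c) \<in> D) \<and>
               is_colimit C (ord_cat r) X (\<lambda>a b _. x a b) L i \<longrightarrow>
             (\<forall>g\<in>ar C W L. \<exists>a\<in>Field r. \<exists>h\<in>ar C W (X a). cmp C (i a) h = g) \<and>
             (\<forall>a\<in>Field r. \<forall>g\<in>ar C W (X a). \<forall>h\<in>ar C W (X a). cmp C (i a) g = cmp C (i a) h \<longrightarrow>
                (\<exists>b. (a, b) \<in> r \<and> cmp C (x a b) g = cmp C (x a b) h)))))"

definition cofibrantly_generated ::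
  "'s itself \<Rightarrow> ('o, 'a) cat \<Rightarrow> ('o \<times> 'o \<times> 'a) set \<Rightarrow> ('o \<times> 'o \<times> 'a) set \<Rightarrow> bool" where
  "cofibrantly_generated u C W Fi \<longleftrightarrow>
     (\<exists>I J. I \<subseteq> arrs C \<and> J \<subseteq> arrs C \<and> small u I \<and> small u J \<and>
        (\<forall>(A, B, i)\<in>I. small_object u C (rel_cells u C I) A) \<and>
        (\<forall>(A, B, i)\<in>J. small_object u C (rel_cells u C J) A) \<and>
        Fi = rlp C J \<and> Fi \<inter> W = rlp C I)"


section \<open>Simplicial sets\<close>

text \<open>\<open>Fc K n i\<close> and \<open>Dg K n i\<close> are the \<open>i\<close>-th face and degeneracy defined on \<open>n\<close>-simplices.\<close>

record 'x sset =
  Sx :: "nat \<Rightarrow> 'x set"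
  Fc :: "nat \<Rightarrow> nat \<Rightarrow> 'x \<Rightarrow> 'x"
  Dg :: "nat \<Rightarrow> nat \<Rightarrow> 'x \<Rightarrow> 'x"

definition is_sset :: "'x sset \<Rightarrow> bool" where
  "is_sset K \<longleftrightarrow>
     (\<forall>n. \<forall>x\<in>Sx K (Suc n). \<forall>i\<le>Suc n. Fc K (Suc n) i x \<in> Sx K n) \<and>
     (\<forall>n. \<forall>x\<in>Sx K n. \<forall>i\<le>n. Dg K n i x \<in> Sx K (Suc n)) \<and>
     (\<forall>n. \<forall>x\<in>Sx K (Suc (Suc n)). \<forall>i j. i < j \<and> j \<le> Suc (Suc n) \<longrightarrow>
        Fc K (Suc n) i (Fc K (Suc (Suc n)) j x) = Fc K (Suc n) (j - 1) (Fc K (Suc (Suc n)) i x)) \<and>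
     (\<forall>n. \<forall>x\<in>Sx K n. \<forall>j\<le>n. \<forall>i\<le>Suc n. Fc K (Suc n) i (Dg K n j x) =
        (if i < j then Dg K (n - 1) (j - 1) (Fc K n i x)
         else if i \<le> Suc j then x
         else Dg K (n - 1) j (Fc K n (i - 1) x))) \<and>
     (\<forall>n. \<forall>x\<in>Sx K n. \<forall>i j. i \<le> j \<and> j \<le> n \<longrightarrow>
        Dg K (Suc n) i (Dg K n j x) = Dg K (Suc n) (Suc j) (Dg K n i x))"

definition smap :: "'x sset \<Rightarrow> 'y sset \<Rightarrow> (nat \<Rightarrow> 'x \<Rightarrow> 'y) \<Rightarrow> bool" where
  "smap K L f \<longleftrightarrow>
     (\<forall>n. \<forall>x\<in>Sx K n. f n x \<in> Sx L n \<and>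
        (\<forall>i\<le>n. f (Suc n) (Dg K n i x) = Dg L n i (f n x)) \<and>
        (0 < n \<longrightarrow> (\<forall>i\<le>n. f (n - 1) (Fc K n i x) = Fc L n i (f n x))))"

definition smaps :: "'x sset \<Rightarrow> 'y sset \<Rightarrow> (nat \<Rightarrow> 'x \<Rightarrow> 'y) set" where
  "smaps K L = {f. smap K L f \<and> (\<forall>n x. x \<notin> Sx K n \<longrightarrow> f n x = undefined)}"

text \<open>The degenerate \<open>n\<close>-simplex on a vertex.\<close>

primrec cst :: "'x sset \<Rightarrow> nat \<Rightarrow> 'x \<Rightarrow> 'x" where
  "cst K 0 x = x"
| "cst K (Suc n) x = Dg K n 0 (cst K n x)"

definition sprod :: "'x sset \<Rightarrow> 'y sset \<Rightarrow> ('x \<times> 'y) sset" where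
  "sprod K L = \<lparr>Sx = (\<lambda>n. Sx K n \<times> Sx L n),
     Fc = (\<lambda>n i (x, y). (Fc K n i x, Fc L n i y)),
     Dg = (\<lambda>n i (x, y). (Dg K n i x, Dg L n i y))\<rparr>"

text \<open>\<open>squot K L\<close> is the quotient of \<open>K\<close> by a subcomplex \<open>L\<close>, with base point \<open>None\<close>.\<close>

definition squot :: "'x sset \<Rightarrow> (nat \<Rightarrow> 'x set) \<Rightarrow> 'x option sset" where
  "squot K L =
     (let c = (\<lambda>n x. if x \<in> L n then None else Some x)
      in \<lparr>Sx = (\<lambda>n. insert None (Some ` (Sx K n - L n))),
          Fc = (\<lambda>n i y. Option.bind y (\<lambda>x. c (n - 1) (Fc K n i x))),
          Dg = (\<lambda>n i y. Option.bind y (\<lambda>x. c (Suc n) (Dg K n i x)))\<rparr>)"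

text \<open>The \<open>k\<close>-simplices of \<open>Delta n\<close> are the monotone maps \<open>{0..k} \<rightarrow> {0..n}\<close>, as lists of values.\<close>

definition Delta :: "nat \<Rightarrow> nat list sset" where
  "Delta n = \<lparr>Sx = (\<lambda>k. {xs. length xs = Suc k \<and> sorted xs \<and> set xs \<subseteq> {0..n}}),
     Fc = (\<lambda>k i xs. take i xs @ drop (Suc i) xs),
     Dg = (\<lambda>k i xs. take (Suc i) xs @ drop i xs)\<rparr>"

definition sphere :: "nat \<Rightarrow> nat list option sset" where
  "sphere n = squot (Delta n) (\<lambda>k. {xs \<in> Sx (Delta n) k. \<not> {0..n} \<subseteq> set xs})"

definition nondegenerate :: "'x sset \<Rightarrow> nat \<Rightarrow> 'x \<Rightarrow> bool" where
  "nondegenerate K n x \<longleftrightarrow>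
     x \<in> Sx K n \<and> (\<nexists>m i y. n = Suc m \<and> i \<le> m \<and> y \<in> Sx K m \<and> x = Dg K m i y)"

inductive spanned :: "'x sset \<Rightarrow> (nat \<Rightarrow> 'x set) \<Rightarrow> nat \<Rightarrow> 'x \<Rightarrow> bool" for K S where
  "x \<in> S n \<Longrightarrow> spanned K S n x"
| "spanned K S (Suc n) x \<Longrightarrow> i \<le> Suc n \<Longrightarrow> spanned K S n (Fc K (Suc n) i x)"
| "spanned K S n x \<Longrightarrow> i \<le> n \<Longrightarrow> spanned K S (Suc n) (Dg K n i x)"

text \<open>Kan fibrations and trivial Kan fibrations: extension of horns, resp. boundaries, given by their faces.\<close>

definition kan_fibration :: "'x sset \<Rightarrow> 'y sset \<Rightarrow> (nat \<Rightarrow> 'x \<Rightarrow> 'y) \<Rightarrow> bool" where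
  "kan_fibration K L f \<longleftrightarrow>
     (\<forall>n k x y. k \<le> Suc n \<and> (\<forall>i\<le>Suc n. i \<noteq> k \<longrightarrow> x i \<in> Sx K n) \<and>
        (\<forall>i j. 0 < n \<and> i < j \<and> j \<le> Suc n \<and> i \<noteq> k \<and> j \<noteq> k \<longrightarrow>
           Fc K n i (x j) = Fc K n (j - 1) (x i)) \<and>
        y \<in> Sx L (Suc n) \<and> (\<forall>i\<le>Suc n. i \<noteq> k \<longrightarrow> Fc L (Suc n) i y = f n (x i)) \<longrightarrow>
        (\<exists>z\<in>Sx K (Suc n). f (Suc n) z = y \<and> (\<forall>i\<le>Suc n. i \<noteq> k \<longrightarrow> Fc K (Suc n) i z = x i)))"

definition trivial_kan_fibration :: "'x sset \<Rightarrow> 'y sset \<Rightarrow> (nat \<Rightarrow> 'x \<Rightarrow> 'y) \<Rightarrow> bool" where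
  "trivial_kan_fibration K L f \<longleftrightarrow>
     (\<forall>y\<in>Sx L 0. \<exists>z\<in>Sx K 0. f 0 z = y) \<and>
     (\<forall>n x y. (\<forall>i\<le>Suc n. x i \<in> Sx K n) \<and>
        (\<forall>i j. 0 < n \<and> i < j \<and> j \<le> Suc n \<longrightarrow> Fc K n i (x j) = Fc K n (j - 1) (x i)) \<and>
        y \<in> Sx L (Suc n) \<and> (\<forall>i\<le>Suc n. Fc L (Suc n) i y = f n (x i)) \<longrightarrow>
        (\<exists>z\<in>Sx K (Suc n). f (Suc n) z = y \<and> (\<forall>i\<le>Suc n. Fc K (Suc n) i z = x i)))"

text \<open>
  Homotopy groups of a pointed Kan complex, with \<open>d_0\<close>, \<open>d_1\<close> as the two ends of a homotopy.  They
  are only used for (underlying pointed simplicial sets of) simplicial groups, where a weak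
  equivalence is a map inducing bijections on all homotopy groups at the unit.
\<close>

definition pi_cycles :: "'x sset \<Rightarrow> 'x \<Rightarrow> nat \<Rightarrow> 'x set" where
  "pi_cycles K b m = {x \<in> Sx K m. 0 < m \<longrightarrow> (\<forall>i\<le>m. Fc K m i x = cst K (m - 1) b)}"

definition pi_rel :: "'x sset \<Rightarrow> 'x \<Rightarrow> nat \<Rightarrow> 'x \<Rightarrow> 'x \<Rightarrow> bool" where
  "pi_rel K b m x y \<longleftrightarrow> (\<exists>w\<in>Sx K (Suc m). Fc K (Suc m) 0 w = x \<and> Fc K (Suc m) 1 w = y \<and>
     (\<forall>i. 2 \<le> i \<and> i \<le> Suc m \<longrightarrow> Fc K (Suc m) i w = cst K m b))"

definition pi_equivalence ::
  "'x sset \<Rightarrow> 'x \<Rightarrow> 'y sset \<Rightarrow> 'y \<Rightarrow> (nat \<Rightarrow> 'x \<Rightarrow> 'y) \<Rightarrow> bool" where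
  "pi_equivalence K k L l f \<longleftrightarrow>
     (\<forall>m. (\<forall>x\<in>pi_cycles K k m. \<forall>y\<in>pi_cycles K k m.
             pi_rel L l m (f m x) (f m y) \<longrightarrow> pi_rel K k m x y) \<and>
          (\<forall>y\<in>pi_cycles L l m. \<exists>x\<in>pi_cycles K k m. pi_rel L l m (f m x) y))"


section \<open>Simplicial model categories\<close>

text \<open>\<open>mapc M X Y\<close> is the mapping complex, \<open>scmp M n\<close> composition of its \<open>n\<close>-simplices; maps of the
  underlying category are vertices.\<close>

record ('o, 'a) smc =
  sob :: "'o set"
  mapc :: "'o \<Rightarrow> 'o \<Rightarrow> 'a sset"
  sid :: "'o \<Rightarrow> 'a"
  scmp :: "nat \<Rightarrow> 'a \<Rightarrow> 'a \<Rightarrow> 'a"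
  weq :: "('o \<times> 'o \<times> 'a) set"
  cof :: "('o \<times> 'o \<times> 'a) set"
  fib :: "('o \<times> 'o \<times> 'a) set"

definition uc :: "('o, 'a) smc \<Rightarrow> ('o, 'a) cat" where
  "uc M = \<lparr>ob = sob M, ar = (\<lambda>X Y. Sx (mapc M X Y) 0), idt = sid M, cmp = scmp M 0\<rparr>"

definition simplicial_category :: "('o, 'a) smc \<Rightarrow> bool" where
  "simplicial_category M \<longleftrightarrow>
     (\<forall>X\<in>sob M. \<forall>Y\<in>sob M. is_sset (mapc M X Y)) \<and>
     (\<forall>X\<in>sob M. sid M X \<in> Sx (mapc M X X) 0) \<and>
     (\<forall>X\<in>sob M. \<forall>Y\<in>sob M. \<forall>Z\<in>sob M.
        smap (sprod (mapc M Y Z) (mapc M X Y)) (mapc M X Z) (\<lambda>n (g, f). scmp M n g f)) \<and>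
     (\<forall>X\<in>sob M. \<forall>Y\<in>sob M. \<forall>n. \<forall>f\<in>Sx (mapc M X Y) n.
        scmp M n f (cst (mapc M X X) n (sid M X)) = f \<and>
        scmp M n (cst (mapc M Y Y) n (sid M Y)) f = f) \<and>
     (\<forall>X\<in>sob M. \<forall>Y\<in>sob M. \<forall>Z\<in>sob M. \<forall>W\<in>sob M. \<forall>n.
        \<forall>f\<in>Sx (mapc M X Y) n. \<forall>g\<in>Sx (mapc M Y Z) n. \<forall>h\<in>Sx (mapc M Z W) n.
        scmp M n h (scmp M n g f) = scmp M n (scmp M n h g) f)"

text \<open>Post- and precomposition of an \<open>n\<close>-simplex with a map \<open>g : Y \<rightarrow> Z\<close>, resp. \<open>f : X \<rightarrow> Y\<close>.\<close>

definition postc :: "('o, 'a) smc \<Rightarrow> 'o \<Rightarrow> 'o \<Rightarrow> nat \<Rightarrow> 'a \<Rightarrow> 'a \<Rightarrow> 'a" where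
  "postc M Y Z n g x = scmp M n (cst (mapc M Y Z) n g) x"

definition prec :: "('o, 'a) smc \<Rightarrow> 'o \<Rightarrow> 'o \<Rightarrow> nat \<Rightarrow> 'a \<Rightarrow> 'a \<Rightarrow> 'a" where
  "prec M X Y n f x = scmp M n x (cst (mapc M X Y) n f)"

definition zsimp :: "('o, 'a) smc \<Rightarrow> 'o \<Rightarrow> 'o \<Rightarrow> nat \<Rightarrow> 'a" where
  "zsimp M X Y n = cst (mapc M X Y) n (zarr (uc M) X Y)"

text \<open>
  The tensor \<open>X \<otimes> K\<close>, the cotensor \<open>Y^K\<close> and, for \<open>K\<close> with base vertex \<open>k\<close>, the half-smash
  \<open>X \<and> K = (X \<otimes> K) / (X \<otimes> k)\<close>, each with its universal simplicial map.  The universal property says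
  that \<open>n\<close>-simplices of \<open>map(T, Y)\<close> (i.e. simplicial maps \<open>Delta n \<rightarrow> map(T, Y)\<close>) correspond to
  \<open>n\<close>-simplices of the (pointed) mapping complex from \<open>K\<close> to \<open>map(X, Y)\<close>.
\<close>

definition is_tensor ::
  "('o, 'a) smc \<Rightarrow> 'o \<Rightarrow> 'x sset \<Rightarrow> 'o \<Rightarrow> (nat \<Rightarrow> 'x \<Rightarrow> 'a) \<Rightarrow> bool" where
  "is_tensor M X K T al \<longleftrightarrow> T \<in> sob M \<and> al \<in> smaps K (mapc M X T) \<and>
     (\<forall>Y\<in>sob M. \<forall>n. \<forall>g\<in>smaps (sprod (Delta n) K) (mapc M X Y).
        \<exists>!b. b \<in> smaps (Delta n) (mapc M T Y) \<and>
          (\<forall>m. \<forall>s\<in>Sx (Delta n) m. \<forall>x\<in>Sx K m. g m (s, x) = scmp M m (b m s) (al m x)))"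

definition is_cotensor ::
  "('o, 'a) smc \<Rightarrow> 'o \<Rightarrow> 'x sset \<Rightarrow> 'o \<Rightarrow> (nat \<Rightarrow> 'x \<Rightarrow> 'a) \<Rightarrow> bool" where
  "is_cotensor M Y K T al \<longleftrightarrow> T \<in> sob M \<and> al \<in> smaps K (mapc M T Y) \<and>
     (\<forall>X\<in>sob M. \<forall>n. \<forall>g\<in>smaps (sprod (Delta n) K) (mapc M X Y).
        \<exists>!b. b \<in> smaps (Delta n) (mapc M X T) \<and>
          (\<forall>m. \<forall>s\<in>Sx (Delta n) m. \<forall>x\<in>Sx K m. g m (s, x) = scmp M m (al m x) (b m s)))"

definition is_smash ::
  "('o, 'a) smc \<Rightarrow> 'o \<Rightarrow> 'x sset \<Rightarrow> 'x \<Rightarrow> 'o \<Rightarrow> (nat \<Rightarrow> 'x \<Rightarrow> 'a) \<Rightarrow> bool" where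
  "is_smash M X K k T al \<longleftrightarrow> T \<in> sob M \<and> al \<in> smaps K (mapc M X T) \<and>
     (\<forall>m. al m (cst K m k) = zsimp M X T m) \<and>
     (\<forall>Y\<in>sob M. \<forall>n. \<forall>g\<in>smaps (sprod (Delta n) K) (mapc M X Y).
        (\<forall>m. \<forall>s\<in>Sx (Delta n) m. g m (s, cst K m k) = zsimp M X Y m) \<longrightarrow>
        (\<exists>!b. b \<in> smaps (Delta n) (mapc M T Y) \<and>
          (\<forall>m. \<forall>s\<in>Sx (Delta n) m. \<forall>x\<in>Sx K m. g m (s, x) = scmp M m (b m s) (al m x))))"

definition pullback_corner ::
  "('o, 'a) smc \<Rightarrow> 'o \<times> 'o \<times> 'a \<Rightarrow> 'o \<times> 'o \<times> 'a \<Rightarrow> ('a \<times> 'a) sset" where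
  "pullback_corner M = (\<lambda>(A, B, i) (X, Y, p).
     (sprod (mapc M A X) (mapc M B Y))
       \<lparr>Sx := (\<lambda>n. {(u, v) \<in> Sx (mapc M A X) n \<times> Sx (mapc M B Y) n.
          postc M X Y n p u = prec M A B n i v})\<rparr>)"

definition SM7 :: "('o, 'a) smc \<Rightarrow> bool" where
  "SM7 M \<longleftrightarrow>
     (\<forall>A B i X Y p. (A, B, i) \<in> cof M \<and> (X, Y, p) \<in> fib M \<longrightarrow>
        (let K = mapc M B X;
             L = pullback_corner M (A, B, i) (X, Y, p);
             f = (\<lambda>n h. (prec M A B n i h, postc M X Y n p h))
         in kan_fibration K L f \<and>
            ((A, B, i) \<in> weq M \<or> (X, Y, p) \<in> weq M \<longrightarrow> trivial_kan_fibration K L f)))"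

definition pointed_simplicial_model_category :: "'s itself \<Rightarrow> ('o, 'a) smc \<Rightarrow> bool" where
  "pointed_simplicial_model_category u M \<longleftrightarrow>
     simplicial_category M \<and>
     (\<forall>X\<in>sob M. \<forall>Y\<in>sob M. \<forall>n. small u (Sx (mapc M X Y) n)) \<and>
     complete u (uc M) \<and> complete u (opp (uc M)) \<and>
     (\<exists>Z. is_zero (uc M) Z) \<and>
     model_structure (uc M) (weq M) (cof M) (fib M) \<and>
     (\<forall>X\<in>sob M. \<forall>K :: 's sset. is_sset K \<and> (\<forall>n. small u (Sx K n)) \<longrightarrow>
        (\<exists>T al. is_tensor M X K T al) \<and> (\<exists>T al. is_cotensor M X K T al)) \<and>
     SM7 M"

definition cofibrant :: "('o, 'a) smc \<Rightarrow> 'o \<Rightarrow> bool" where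
  "cofibrant M X \<longleftrightarrow> (\<exists>Z f. is_zero (uc M) Z \<and> (Z, X, f) \<in> cof M)"

definition fibrant :: "('o, 'a) smc \<Rightarrow> 'o \<Rightarrow> bool" where
  "fibrant M X \<longleftrightarrow> (\<exists>Z f. is_zero (uc M) Z \<and> (X, Z, f) \<in> fib M)"

subsection \<open>The homotopy category\<close>

text \<open>
  As in Dwyer--Spalinski: every \<open>X\<close> has a cofibrant replacement \<open>QX \<rightarrow> X\<close> (a trivial fibration, the
  identity if \<open>X\<close> is cofibrant) and \<open>QX\<close> a fibrant replacement \<open>QX \<rightarrow> RQX\<close> (a trivial cofibration, the
  identity if \<open>QX\<close> is fibrant); maps \<open>X \<rightarrow> Y\<close> in the homotopy category are homotopy classes of
  maps \<open>RQX \<rightarrow> RQY\<close>.  A map in the homotopy category is tagged with its source and target.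
\<close>

definition crep :: "('o, 'a) smc \<Rightarrow> 'o \<Rightarrow> 'o \<times> 'a" where
  "crep M X = (if cofibrant M X then (X, sid M X)
     else (SOME (C, q). cofibrant M C \<and> (C, X, q) \<in> weq M \<inter> fib M))"

abbreviation Qob :: "('o, 'a) smc \<Rightarrow> 'o \<Rightarrow> 'o" where "Qob M X \<equiv> fst (crep M X)"

definition brep :: "('o, 'a) smc \<Rightarrow> 'o \<Rightarrow> 'o \<times> 'a" where
  "brep M X = (if fibrant M (Qob M X) then (Qob M X, sid M (Qob M X))
     else (SOME (R, r). fibrant M R \<and> (Qob M X, R, r) \<in> weq M \<inter> cof M))"

abbreviation RQob :: "('o, 'a) smc \<Rightarrow> 'o \<Rightarrow> 'o" where "RQob M X \<equiv> fst (brep M X)"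

definition htp :: "('o, 'a) smc \<Rightarrow> 'o \<Rightarrow> 'o \<Rightarrow> 'a \<Rightarrow> 'a \<Rightarrow> bool" where
  "htp M X Y = equivclp (\<lambda>f g. \<exists>h\<in>Sx (mapc M X Y) 1.
     Fc (mapc M X Y) 1 1 h = f \<and> Fc (mapc M X Y) 1 0 h = g)"

type_synonym ('o, 'a) harr = "'o \<times> 'o \<times> 'a set"

definition hocat :: "('o, 'a) smc \<Rightarrow> ('o, ('o, 'a) harr) cat" where
  "hocat M = \<lparr>ob = sob M,
     ar = (\<lambda>X Y. {(X, Y, Collect (htp M (RQob M X) (RQob M Y) f)) | f.
             f \<in> Sx (mapc M (RQob M X) (RQob M Y)) 0}),
     idt = (\<lambda>X. (X, X, Collect (htp M (RQob M X) (RQob M X) (sid M (RQob M X))))),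
     cmp = (\<lambda>(Y, Z, b) (X, _, a).
             (X, Z, {h. \<exists>f\<in>a. \<exists>g\<in>b. htp M (RQob M X) (RQob M Z) (scmp M 0 g f) h}))\<rparr>"

text \<open>The localization functor on a map \<open>f : X \<rightarrow> Y\<close>.\<close>

definition loc :: "('o, 'a) smc \<Rightarrow> 'o \<Rightarrow> 'o \<Rightarrow> 'a \<Rightarrow> ('o, 'a) harr" where
  "loc M X Y f = (X, Y, {b \<in> Sx (mapc M (RQob M X) (RQob M Y)) 0.
     \<exists>c\<in>Sx (mapc M (Qob M X) (Qob M Y)) 0.
       scmp M 0 (snd (crep M Y)) c = scmp M 0 f (snd (crep M X)) \<and>
       htp M (Qob M X) (RQob M Y) (scmp M 0 b (snd (brep M X))) (scmp M 0 (snd (brep M Y)) c)})"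

abbreviation hcmp :: "('o, 'a) smc \<Rightarrow> ('o, 'a) harr \<Rightarrow> ('o, 'a) harr \<Rightarrow> ('o, 'a) harr" where
  "hcmp M \<equiv> cmp (hocat M)"

definition smash :: "('o, 'a) smc \<Rightarrow> 'o \<Rightarrow> 'x sset \<Rightarrow> 'x \<Rightarrow> 'o \<times> (nat \<Rightarrow> 'x \<Rightarrow> 'a)" where
  "smash M X K k = (SOME (T, al). is_smash M X K k T al)"

text \<open>Suspensions and (in the definition of \<open>MA\<close>) coproducts are formed on cofibrant replacements,
  so that they are homotopy invariant; nothing is changed on cofibrant objects.\<close>

definition susp :: "('o, 'a) smc \<Rightarrow> nat \<Rightarrow> 'o \<Rightarrow> 'o" where
  "susp M i X = fst (smash M (Qob M X) (sphere i) None)"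

inductive_set MA :: "'s itself \<Rightarrow> ('o, 'a) smc \<Rightarrow> 'o set \<Rightarrow> 'o set"
  for u :: "'s itself" and M :: "('o, 'a) smc" and \<A> :: "'o set" where
  "A \<in> \<A> \<Longrightarrow> A \<in> MA u M \<A>"
| "X \<in> MA u M \<A> \<Longrightarrow> susp M 1 X \<in> MA u M \<A>"
| "small u (I :: 's set) \<Longrightarrow> (\<forall>i\<in>I. X i \<in> MA u M \<A>) \<Longrightarrow>
     is_coprod (uc M) I (\<lambda>i. Qob M (X i)) P inc \<Longrightarrow> P \<in> MA u M \<A>"
| "X \<in> MA u M \<A> \<Longrightarrow> (X, Y, f) \<in> weq M \<Longrightarrow> Y \<in> MA u M \<A>"
| "Y \<in> MA u M \<A> \<Longrightarrow> (X, Y, f) \<in> weq M \<Longrightarrow> X \<in> MA u M \<A>"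


section \<open>Algebras\<close>

definition Pi_cat :: "('o, 'a) smc \<Rightarrow> 'o set \<Rightarrow> ('o, ('o, 'a) harr) cat" where
  "Pi_cat M \<A> = (hocat M)\<lparr>ob := {B \<in> sob M. \<exists>(I :: nat set) A k inc. finite I \<and> (\<forall>j\<in>I. A j \<in> \<A>) \<and>
     is_coprod (hocat M) I (\<lambda>j. susp M (k j) (A j)) B inc}\<rparr>"

text \<open>Functors from \<open>P\<^sup>o\<^sup>p\<close> to pointed sets: \<open>act L B B' h : L{B'} \<rightarrow> L{B}\<close> for \<open>h : B \<rightarrow> B'\<close>.\<close>

record ('o, 'h, 'v) palg =
  val :: "'o \<Rightarrow> 'v set"
  bpt :: "'o \<Rightarrow> 'v"
  act :: "'o \<Rightarrow> 'o \<Rightarrow> 'h \<Rightarrow> 'v \<Rightarrow> 'v"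

definition is_palg :: "('o, 'h) cat \<Rightarrow> ('o, 'h, 's) palg \<Rightarrow> bool" where
  "is_palg P L \<longleftrightarrow>
     (\<forall>B\<in>ob P. small TYPE('s) (val L B) \<and> bpt L B \<in> val L B) \<and>
     (\<forall>B\<in>ob P. \<forall>B'\<in>ob P. \<forall>h\<in>ar P B B'. act L B B' h (bpt L B') = bpt L B \<and>
        (\<forall>x\<in>val L B'. act L B B' h x \<in> val L B)) \<and>
     (\<forall>B\<in>ob P. \<forall>x\<in>val L B. act L B B (idt P B) x = x) \<and>
     (\<forall>B\<in>ob P. \<forall>B'\<in>ob P. \<forall>B''\<in>ob P. \<forall>h\<in>ar P B B'. \<forall>k\<in>ar P B' B''. \<forall>x\<in>val L B''.
        act L B B'' (cmp P k h) x = act L B B' h (act L B' B'' k x)) \<and>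
     (\<forall>(I :: nat set) F B inc. finite I \<and> (\<forall>j\<in>I. F j \<in> ob P) \<and> is_coprod P I F B inc \<longrightarrow>
        bij_betw (\<lambda>x. \<lambda>j\<in>I. act L (F j) B (inc j) x) (val L B) (\<Pi>\<^sub>E j\<in>I. val L (F j)))"

definition palg_map ::
  "('o, 'h) cat \<Rightarrow> ('o, 'h, 'v) palg \<Rightarrow> ('o, 'h, 'w) palg \<Rightarrow> ('o \<Rightarrow> 'v \<Rightarrow> 'w) \<Rightarrow> bool" where
  "palg_map P L L' f \<longleftrightarrow>
     (\<forall>B\<in>ob P. f B (bpt L B) = bpt L' B \<and> (\<forall>x\<in>val L B. f B x \<in> val L' B)) \<and>
     (\<forall>B\<in>ob P. \<forall>B'\<in>ob P. \<forall>h\<in>ar P B B'. \<forall>x\<in>val L B'.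
        f B (act L B B' h x) = act L' B B' h (f B' x))"

definition palg_iso ::
  "('o, 'h) cat \<Rightarrow> ('o, 'h, 'v) palg \<Rightarrow> ('o, 'h, 'w) palg \<Rightarrow> ('o \<Rightarrow> 'v \<Rightarrow> 'w) \<Rightarrow> bool" where
  "palg_iso P L L' f \<longleftrightarrow> palg_map P L L' f \<and> (\<forall>B\<in>ob P. bij_betw (f B) (val L B) (val L' B))"

type_synonym ('o, 'a, 's) alg = "('o, ('o, 'a) harr, 's) palg"
type_synonym ('o, 'a, 's) algarr = "('o, 'a, 's) alg \<times> ('o, 'a, 's) alg \<times> ('o \<Rightarrow> 's \<Rightarrow> 's)"

definition pext :: "('o, 'h) cat \<Rightarrow> ('o, 'h, 'v) palg \<Rightarrow> ('o \<Rightarrow> 'v \<Rightarrow> 'w) \<Rightarrow> 'o \<Rightarrow> 'v \<Rightarrow> 'w" where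
  "pext P L f = (\<lambda>B x. if B \<in> ob P \<and> x \<in> val L B then f B x else undefined)"

definition Alg :: "('o, 'a) smc \<Rightarrow> 'o set \<Rightarrow> (('o, 'a, 's) alg, ('o, 'a, 's) algarr) cat" where
  "Alg M \<A> = \<lparr>ob = {L. is_palg (Pi_cat M \<A>) L},
     ar = (\<lambda>L L'. {(L, L', pext (Pi_cat M \<A>) L f) | f. palg_map (Pi_cat M \<A>) L L' f}),
     idt = (\<lambda>L. (L, L, pext (Pi_cat M \<A>) L (\<lambda>_ x. x))),
     cmp = (\<lambda>(_, L'', g) (L, _, f). (L, L'', pext (Pi_cat M \<A>) L (\<lambda>B x. g B (f B x))))\<rparr>"

abbreviation app :: "('o, 'a, 's) algarr \<Rightarrow> 'o \<Rightarrow> 's \<Rightarrow> 's" where "app h \<equiv> snd (snd h)"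

text \<open>\<open>\<pi>\<^sub>A Y\<close>, with values in classes of maps rather than in \<open>'s\<close>.\<close>

definition piA :: "('o, 'a) smc \<Rightarrow> 'o \<Rightarrow> ('o, 'a, ('o, 'a) harr) alg" where
  "piA M Y = \<lparr>val = (\<lambda>B. ar (hocat M) B Y), bpt = (\<lambda>B. zarr (hocat M) B Y),
     act = (\<lambda>B B' h x. hcmp M x h)\<rparr>"

definition free_alg :: "('o, 'a) smc \<Rightarrow> 'o set \<Rightarrow> ('o, 'a, 's) alg \<Rightarrow> bool" where
  "free_alg M \<A> F \<longleftrightarrow>
     (\<exists>(I :: 's set) R inc. small TYPE('s) I \<and> is_coprod (Alg M \<A>) I R F inc \<and>
        (\<forall>i\<in>I. R i \<in> ob (Alg M \<A>) \<and>
           (\<exists>A\<in>\<A>. \<exists>k be. palg_iso (Pi_cat M \<A>) (piA M (susp M k A)) (R i) be)))"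


section \<open>Simplicial objects\<close>

text \<open>\<open>fce X n i : X\<^sub>n \<rightarrow> X\<^sub>n\<^sub>-\<^sub>1\<close> and \<open>dgn X n i : X\<^sub>n \<rightarrow> X\<^sub>n\<^sub>+\<^sub>1\<close>.  A \<open>k\<close>-truncated simplicial object is
  only constrained in degrees at most \<open>k\<close>; \<open>k = \<infinity>\<close> gives simplicial objects.\<close>

record ('o, 'a) sobj =
  lev :: "nat \<Rightarrow> 'o"
  fce :: "nat \<Rightarrow> nat \<Rightarrow> 'a"
  dgn :: "nat \<Rightarrow> nat \<Rightarrow> 'a"

definition simp_obj :: "('o, 'a) cat \<Rightarrow> enat \<Rightarrow> ('o, 'a) sobj \<Rightarrow> bool" where
  "simp_obj C k X \<longleftrightarrow>
     (\<forall>m. enat m \<le> k \<longrightarrow> lev X m \<in> ob C) \<and>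
     (\<forall>m i. enat (Suc m) \<le> k \<and> i \<le> Suc m \<longrightarrow> fce X (Suc m) i \<in> ar C (lev X (Suc m)) (lev X m)) \<and>
     (\<forall>m i. enat (Suc m) \<le> k \<and> i \<le> m \<longrightarrow> dgn X m i \<in> ar C (lev X m) (lev X (Suc m))) \<and>
     (\<forall>m i j. enat (Suc (Suc m)) \<le> k \<and> i < j \<and> j \<le> Suc (Suc m) \<longrightarrow>
        cmp C (fce X (Suc m) i) (fce X (Suc (Suc m)) j) =
        cmp C (fce X (Suc m) (j - 1)) (fce X (Suc (Suc m)) i)) \<and>
     (\<forall>m i j. enat (Suc m) \<le> k \<and> j \<le> m \<and> i \<le> Suc m \<longrightarrow>
        cmp C (fce X (Suc m) i) (dgn X m j) =
        (if i < j then cmp C (dgn X (m - 1) (j - 1)) (fce X m i)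
         else if i \<le> Suc j then idt C (lev X m)
         else cmp C (dgn X (m - 1) j) (fce X m (i - 1)))) \<and>
     (\<forall>m i j. enat (Suc (Suc m)) \<le> k \<and> i \<le> j \<and> j \<le> m \<longrightarrow>
        cmp C (dgn X (Suc m) i) (dgn X m j) = cmp C (dgn X (Suc m) (Suc j)) (dgn X m i))"

definition simp_map ::
  "('o, 'a) cat \<Rightarrow> enat \<Rightarrow> ('o, 'a) sobj \<Rightarrow> ('o, 'a) sobj \<Rightarrow> (nat \<Rightarrow> 'a) \<Rightarrow> bool" where
  "simp_map C k X Y f \<longleftrightarrow>
     (\<forall>m. enat m \<le> k \<longrightarrow> f m \<in> ar C (lev X m) (lev Y m)) \<and>
     (\<forall>m i. enat (Suc m) \<le> k \<and> i \<le> Suc m \<longrightarrow>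
        cmp C (f m) (fce X (Suc m) i) = cmp C (fce Y (Suc m) i) (f (Suc m))) \<and>
     (\<forall>m i. enat (Suc m) \<le> k \<and> i \<le> m \<longrightarrow>
        cmp C (f (Suc m)) (dgn X m i) = cmp C (dgn Y m i) (f m))"

definition sconst :: "('o, 'a) cat \<Rightarrow> 'o \<Rightarrow> ('o, 'a) sobj" where
  "sconst C X = \<lparr>lev = (\<lambda>_. X), fce = (\<lambda>_ _. idt C X), dgn = (\<lambda>_ _. idt C X)\<rparr>"

primrec sdeg :: "('o, 'a) cat \<Rightarrow> ('o, 'a) sobj \<Rightarrow> nat \<Rightarrow> 'a" where
  "sdeg C X 0 = idt C (lev X 0)"
| "sdeg C X (Suc n) = cmp C (dgn X n 0) (sdeg C X n)"

text \<open>Matching and latching objects; in degree \<open>0\<close> these are a terminal and an initial object.\<close>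

definition match_cone :: "('o, 'a) cat \<Rightarrow> ('o, 'a) sobj \<Rightarrow> nat \<Rightarrow> 'o \<Rightarrow> (nat \<Rightarrow> 'a) \<Rightarrow> bool" where
  "match_cone C X m E p \<longleftrightarrow> E \<in> ob C \<and>
     (0 < m \<longrightarrow> (\<forall>i\<le>m. p i \<in> ar C E (lev X (m - 1)))) \<and>
     (1 < m \<longrightarrow> (\<forall>i j. i < j \<and> j \<le> m \<longrightarrow>
        cmp C (fce X (m - 1) i) (p j) = cmp C (fce X (m - 1) (j - 1)) (p i)))"

definition is_matching :: "('o, 'a) cat \<Rightarrow> ('o, 'a) sobj \<Rightarrow> nat \<Rightarrow> 'o \<Rightarrow> (nat \<Rightarrow> 'a) \<Rightarrow> bool" where
  "is_matching C X m E p \<longleftrightarrow> match_cone C X m E p \<and>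
     (\<forall>T t. match_cone C X m T t \<longrightarrow>
        (\<exists>!h. h \<in> ar C T E \<and> (0 < m \<longrightarrow> (\<forall>i\<le>m. cmp C (p i) h = t i))))"

definition latch_cocone :: "('o, 'a) cat \<Rightarrow> ('o, 'a) sobj \<Rightarrow> nat \<Rightarrow> 'o \<Rightarrow> (nat \<Rightarrow> 'a) \<Rightarrow> bool" where
  "latch_cocone C X m E p \<longleftrightarrow> E \<in> ob C \<and>
     (\<forall>i<m. p i \<in> ar C (lev X (m - 1)) E) \<and>
     (\<forall>i j. i \<le> j \<and> Suc j < m \<longrightarrow>
        cmp C (p i) (dgn X (m - 2) j) = cmp C (p (Suc j)) (dgn X (m - 2) i))"

definition is_latching :: "('o, 'a) cat \<Rightarrow> ('o, 'a) sobj \<Rightarrow> nat \<Rightarrow> 'o \<Rightarrow> (nat \<Rightarrow> 'a) \<Rightarrow> bool" where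
  "is_latching C X m E p \<longleftrightarrow> latch_cocone C X m E p \<and>
     (\<forall>T t. latch_cocone C X m T t \<longrightarrow>
        (\<exists>!h. h \<in> ar C E T \<and> (\<forall>i<m. cmp C h (p i) = t i)))"

text \<open>The intersection of the kernels of the faces \<open>d\<^sub>i\<close>, \<open>i \<in> S\<close>, on \<open>X\<^sub>m\<close>.\<close>

definition is_kers ::
  "('o, 'a) cat \<Rightarrow> ('o, 'a) sobj \<Rightarrow> nat \<Rightarrow> nat set \<Rightarrow> 'o \<Rightarrow> 'a \<Rightarrow> bool" where
  "is_kers C X m S E j \<longleftrightarrow> E \<in> ob C \<and> j \<in> ar C E (lev X m) \<and>
     (\<forall>i\<in>S. cmp C (fce X m i) j = zarr C E (lev X (m - 1))) \<and>
     (\<forall>T\<in>ob C. \<forall>t\<in>ar C T (lev X m). (\<forall>i\<in>S. cmp C (fce X m i) t = zarr C T (lev X (m - 1))) \<longrightarrow>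
        (\<exists>!h. h \<in> ar C T E \<and> cmp C j h = t))"

definition is_chains :: "('o, 'a) cat \<Rightarrow> ('o, 'a) sobj \<Rightarrow> nat \<Rightarrow> 'o \<Rightarrow> 'a \<Rightarrow> bool" where
  "is_chains C X m E j \<longleftrightarrow> is_kers C X m {1..m} E j"

definition is_cycles :: "('o, 'a) cat \<Rightarrow> ('o, 'a) sobj \<Rightarrow> nat \<Rightarrow> 'o \<Rightarrow> 'a \<Rightarrow> bool" where
  "is_cycles C X m E j \<longleftrightarrow> is_kers C X m (if m = 0 then {} else {0..m}) E j"

text \<open>CW objects with basis \<open>Bs\<close> included by \<open>b m : Bs m \<rightarrow> X\<^sub>m\<close>.\<close>

definition cw_object ::
  "('o, 'a) cat \<Rightarrow> enat \<Rightarrow> ('o, 'a) sobj \<Rightarrow> (nat \<Rightarrow> 'o) \<Rightarrow> (nat \<Rightarrow> 'a) \<Rightarrow> bool" where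
  "cw_object C k X Bs b \<longleftrightarrow> simp_obj C k X \<and>
     (\<forall>m. enat m \<le> k \<longrightarrow> Bs m \<in> ob C \<and> b m \<in> ar C (Bs m) (lev X m) \<and>
        (\<forall>i. 1 \<le> i \<and> i \<le> m \<longrightarrow> cmp C (fce X m i) (b m) = zarr C (Bs m) (lev X (m - 1))) \<and>
        (\<exists>L p l. is_latching C X m L p \<and> l \<in> ar C L (lev X m) \<and>
           (\<forall>i<m. cmp C l (p i) = dgn X (m - 1) i) \<and>
           is_coprod C {0, 1 :: nat} (\<lambda>i. if i = 0 then Bs m else L) (lev X m)
             (\<lambda>i. if i = 0 then b m else l)))"

definition reedy_fibrant :: "('o, 'a) smc \<Rightarrow> enat \<Rightarrow> ('o, 'a) sobj \<Rightarrow> bool" where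
  "reedy_fibrant M k X \<longleftrightarrow> simp_obj (uc M) k X \<and>
     (\<forall>m. enat m \<le> k \<longrightarrow> (\<exists>E p v. is_matching (uc M) X m E p \<and> (lev X m, E, v) \<in> fib M \<and>
        (0 < m \<longrightarrow> (\<forall>i\<le>m. cmp (uc M) (p i) v = fce X m i))))"

definition reedy_fibration ::
  "('o, 'a) smc \<Rightarrow> ('o, 'a) sobj \<Rightarrow> ('o, 'a) sobj \<Rightarrow> (nat \<Rightarrow> 'a) \<Rightarrow> bool" where
  "reedy_fibration M X Y f \<longleftrightarrow>
     (\<forall>m. \<exists>E p v E' p' v' g P a c h.
        is_matching (uc M) X m E p \<and> v \<in> ar (uc M) (lev X m) E \<and>
        is_matching (uc M) Y m E' p' \<and> v' \<in> ar (uc M) (lev Y m) E' \<and> g \<in> ar (uc M) E E' \<and>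
        (0 < m \<longrightarrow> (\<forall>i\<le>m. cmp (uc M) (p i) v = fce X m i \<and> cmp (uc M) (p' i) v' = fce Y m i \<and>
           cmp (uc M) (p' i) g = cmp (uc M) (f (m - 1)) (p i))) \<and>
        is_pullback (uc M) (lev Y m) E E' v' g P a c \<and>
        cmp (uc M) a h = f m \<and> cmp (uc M) c h = v \<and> (lev X m, P, h) \<in> fib M)"

text \<open>The category of simplicial objects over \<open>M\<close> and the resolution model structure.\<close>

definition sM :: "('o, 'a) smc \<Rightarrow> (('o, 'a) sobj, nat \<Rightarrow> 'a) cat" where
  "sM M = \<lparr>ob = {X. simp_obj (uc M) \<infinity> X}, ar = (\<lambda>X Y. {f. simp_map (uc M) \<infinity> X Y f}),
     idt = (\<lambda>X m. sid M (lev X m)), cmp = (\<lambda>g f m. scmp M 0 (g m) (f m))\<rparr>"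

definition sMf :: "('o, 'a) smc \<Rightarrow> (('o, 'a) sobj, nat \<Rightarrow> 'a) cat" where
  "sMf M = (sM M)\<lparr>ob := {X. reedy_fibrant M \<infinity> X}\<rparr>"

text \<open>The simplicial set underlying the simplicial group \<open>[B, X\<^sub>\<bullet>]\<close>.\<close>

definition hset :: "('o, 'a) smc \<Rightarrow> 'o \<Rightarrow> ('o, 'a) sobj \<Rightarrow> ('o, 'a) harr sset" where
  "hset M B X = \<lparr>Sx = (\<lambda>n. ar (hocat M) B (lev X n)),
     Fc = (\<lambda>n i x. hcmp M (loc M (lev X n) (lev X (n - 1)) (fce X n i)) x),
     Dg = (\<lambda>n i x. hcmp M (loc M (lev X n) (lev X (Suc n)) (dgn X n i)) x)\<rparr>"

definition hmap ::
  "('o, 'a) smc \<Rightarrow> ('o, 'a) sobj \<Rightarrow> ('o, 'a) sobj \<Rightarrow> (nat \<Rightarrow> 'a) \<Rightarrow>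
    nat \<Rightarrow> ('o, 'a) harr \<Rightarrow> ('o, 'a) harr" where
  "hmap M X Y f n x = hcmp M (loc M (lev X n) (lev Y n) (f n)) x"

definition res_weq ::
  "('o, 'a) smc \<Rightarrow> 'o set \<Rightarrow> (('o, 'a) sobj \<times> ('o, 'a) sobj \<times> (nat \<Rightarrow> 'a)) set" where
  "res_weq M \<A> = {(X, Y, f) \<in> arrs (sM M). \<forall>A\<in>\<A>. \<forall>i. let B = susp M i A in
     pi_equivalence (hset M B X) (zarr (hocat M) B (lev X 0))
       (hset M B Y) (zarr (hocat M) B (lev Y 0)) (hmap M X Y f)}"

definition res_fib ::
  "('o, 'a) smc \<Rightarrow> 'o set \<Rightarrow> (('o, 'a) sobj \<times> ('o, 'a) sobj \<times> (nat \<Rightarrow> 'a)) set" where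
  "res_fib M \<A> = {(X, Y, f) \<in> arrs (sM M). reedy_fibration M X Y f \<and>
     (\<forall>A\<in>\<A>. \<forall>i. let B = susp M i A in kan_fibration (hset M B X) (hset M B Y) (hmap M X Y f))}"

definition res_cof ::
  "('o, 'a) smc \<Rightarrow> 'o set \<Rightarrow> (('o, 'a) sobj \<times> ('o, 'a) sobj \<times> (nat \<Rightarrow> 'a)) set" where
  "res_cof M \<A> = llp (sM M) (res_fib M \<A> \<inter> res_weq M \<A>)"


section \<open>Natural homotopy groups and \<open>E\<^sup>2\<close>-model categories\<close>

text \<open>\<open>(N, p)\<close> is \<open>\<pi>\<^sup>\<natural>\<^sub>m X\<close>, i.e. a cokernel of \<open>(d\<^sub>0)\<^sub>* : \<pi>\<^sub>A C\<^sub>m\<^sub>+\<^sub>1 X \<rightarrow> \<pi>\<^sub>A Z\<^sub>m X\<close>,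
  where \<open>z : Z \<rightarrow> X\<^sub>m\<close> is \<open>Z\<^sub>m X\<close>.\<close>

definition is_pinat ::
  "('o, 'a) smc \<Rightarrow> 'o set \<Rightarrow> ('o, 'a) sobj \<Rightarrow> nat \<Rightarrow> 'o \<Rightarrow> 'a \<Rightarrow>
    ('o, 'a, 's) alg \<Rightarrow> ('o \<Rightarrow> ('o, 'a) harr \<Rightarrow> 's) \<Rightarrow> bool" where
  "is_pinat M \<A> X m Z z N p \<longleftrightarrow> is_cycles (uc M) X m Z z \<and> N \<in> ob (Alg M \<A>) \<and>
     palg_map (Pi_cat M \<A>) (piA M Z) N p \<and>
     (\<exists>C j d. is_chains (uc M) X (Suc m) C j \<and> d \<in> ar (uc M) C Z \<and>
        cmp (uc M) z d = cmp (uc M) (fce X (Suc m) 0) j \<and>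
        (\<forall>B\<in>ob (Pi_cat M \<A>). \<forall>x\<in>ar (hocat M) B C. p B (hcmp M (loc M C Z d) x) = bpt N B) \<and>
        (\<forall>T\<in>ob (Alg M \<A>). \<forall>t. palg_map (Pi_cat M \<A>) (piA M Z) T t \<and>
             (\<forall>B\<in>ob (Pi_cat M \<A>). \<forall>x\<in>ar (hocat M) B C. t B (hcmp M (loc M C Z d) x) = bpt T B) \<longrightarrow>
           (\<exists>!h. h \<in> ar (Alg M \<A>) N T \<and>
              (\<forall>B\<in>ob (Pi_cat M \<A>). \<forall>x\<in>ar (hocat M) B Z. app h B (p B x) = t B x))))"

definition pinat_trivial :: "'s itself \<Rightarrow> ('o, 'a) smc \<Rightarrow> 'o set \<Rightarrow> ('o, 'a) sobj \<Rightarrow> nat \<Rightarrow> bool" where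
  "pinat_trivial u M \<A> X m \<longleftrightarrow>
     (\<exists>Z z (N :: ('o, 'a, 's) alg) p. is_pinat M \<A> X m Z z N p \<and>
        (\<forall>B\<in>ob (Pi_cat M \<A>). val N B = {bpt N B}))"

definition pinat_iso ::
  "'s itself \<Rightarrow> ('o, 'a) smc \<Rightarrow> 'o set \<Rightarrow> ('o, 'a) sobj \<Rightarrow> ('o, 'a) sobj \<Rightarrow> (nat \<Rightarrow> 'a) \<Rightarrow> nat \<Rightarrow> bool" where
  "pinat_iso u M \<A> X Y f m \<longleftrightarrow>
     (\<exists>Z z (N :: ('o, 'a, 's) alg) p Z' z' (N' :: ('o, 'a, 's) alg) p' g h.
        is_pinat M \<A> X m Z z N p \<and> is_pinat M \<A> Y m Z' z' N' p' \<and>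
        g \<in> ar (uc M) Z Z' \<and> cmp (uc M) z' g = cmp (uc M) (f m) z \<and>
        palg_iso (Pi_cat M \<A>) N N' h \<and>
        (\<forall>B\<in>ob (Pi_cat M \<A>). \<forall>x\<in>ar (hocat M) B Z. h B (p B x) = p' B (hcmp M (loc M Z Z' g) x)))"

text \<open>\<open>r : X \<rightarrow> Y\<close> exhibits \<open>Y\<close> as the \<open>k\<close>-coskeleton of \<open>X\<close>.\<close>

definition is_csk ::
  "('o, 'a) smc \<Rightarrow> nat \<Rightarrow> ('o, 'a) sobj \<Rightarrow> ('o, 'a) sobj \<Rightarrow> (nat \<Rightarrow> 'a) \<Rightarrow> bool" where
  "is_csk M k X Y r \<longleftrightarrow> Y \<in> ob (sM M) \<and> r \<in> ar (sM M) X Y \<and>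
     (\<forall>m\<le>k. is_iso (uc M) (lev X m) (lev Y m) (r m)) \<and>
     (\<forall>T\<in>ob (sM M). \<forall>g. simp_map (uc M) (enat k) T X g \<longrightarrow>
        (\<exists>!h. h \<in> ar (sM M) T Y \<and> (\<forall>m\<le>k. h m = scmp M 0 (r m) (g m))))"

definition postnikov_sections ::
  "'s itself \<Rightarrow> ('o, 'a) smc \<Rightarrow> 'o set \<Rightarrow> (nat \<Rightarrow> ('o, 'a) sobj \<Rightarrow> ('o, 'a) sobj) \<Rightarrow>
    (nat \<Rightarrow> ('o, 'a) sobj \<Rightarrow> ('o, 'a) sobj \<Rightarrow> (nat \<Rightarrow> 'a) \<Rightarrow> nat \<Rightarrow> 'a) \<Rightarrow>
    (nat \<Rightarrow> ('o, 'a) sobj \<Rightarrow> nat \<Rightarrow> 'a) \<Rightarrow> (nat \<Rightarrow> ('o, 'a) sobj \<Rightarrow> nat \<Rightarrow> 'a) \<Rightarrow> bool" where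
  "postnikov_sections u M \<A> Po Pa r t \<longleftrightarrow>
     (\<forall>m. is_functor (sMf M) (sMf M) (Po m) (Pa m) \<and>
        nat_tr (sMf M) (sMf M) (\<lambda>X. X) (\<lambda>_ _ f. f) (Po m) (Pa m) (r m) \<and>
        nat_tr (sMf M) (sMf M) (Po (Suc m)) (Pa (Suc m)) (Po m) (Pa m) (t m) \<and>
        (\<forall>X\<in>ob (sMf M). cmp (sM M) (t m X) (r (Suc m) X) = r m X \<and>
           is_csk M (Suc m) X (Po m X) (r m X) \<and>
           (\<forall>k\<le>m. pinat_iso u M \<A> X (Po m X) (r m X) k) \<and>
           (\<forall>k>m. pinat_trivial u M \<A> (Po m X) k)))"

text \<open>\<open>Y\<close> is a classifying object \<open>B\<Lambda>\<close>, with \<open>\<eta>\<close> exhibiting \<open>\<Lambda>\<close> as \<open>\<pi>\<^sup>\<natural>\<^sub>0 Y\<close>.\<close>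

definition classifying ::
  "('o, 'a) smc \<Rightarrow> 'o set \<Rightarrow> ('o, 'a, 's) alg \<Rightarrow> ('o, 'a) sobj \<Rightarrow>
    ('o \<Rightarrow> ('o, 'a) harr \<Rightarrow> 's) \<Rightarrow> bool" where
  "classifying M \<A> L Y eta \<longleftrightarrow> reedy_fibrant M \<infinity> Y \<and>
     is_pinat M \<A> Y 0 (lev Y 0) (sid M (lev Y 0)) L eta \<and>
     (\<forall>k\<ge>1. pinat_trivial TYPE('s) M \<A> Y k)"

text \<open>A module over \<open>\<Lambda>\<close>: an abelian group object \<open>pr : K \<rightarrow> \<Lambda>\<close>, with zero section \<open>zr\<close> and fibrewise
  addition \<open>ad\<close>, in the category of algebras over \<open>\<Lambda>\<close>.  The module proper is the kernel of \<open>pr\<close>.\<close>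

definition is_module ::
  "('o, 'a) smc \<Rightarrow> 'o set \<Rightarrow> ('o, 'a, 's) alg \<Rightarrow> ('o, 'a, 's) alg \<Rightarrow> ('o, 'a, 's) algarr \<Rightarrow>
    ('o, 'a, 's) algarr \<Rightarrow> ('o \<Rightarrow> 's \<Rightarrow> 's \<Rightarrow> 's) \<Rightarrow> bool" where
  "is_module M \<A> L K pr zr ad \<longleftrightarrow> L \<in> ob (Alg M \<A>) \<and> K \<in> ob (Alg M \<A>) \<and>
     pr \<in> ar (Alg M \<A>) K L \<and> zr \<in> ar (Alg M \<A>) L K \<and> cmp (Alg M \<A>) pr zr = idt (Alg M \<A>) L \<and>
     (\<forall>B\<in>ob (Pi_cat M \<A>). \<forall>l\<in>val L B.
        comm_group \<lparr>carrier = {x \<in> val K B. app pr B x = l}, mult = ad B, one = app zr B l\<rparr>) \<and>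
     (\<forall>B\<in>ob (Pi_cat M \<A>). \<forall>B'\<in>ob (Pi_cat M \<A>). \<forall>h\<in>ar (hocat M) B B'. \<forall>x\<in>val K B'. \<forall>y\<in>val K B'.
        app pr B' x = app pr B' y \<longrightarrow>
        act K B B' h (ad B' x y) = ad B (act K B B' h x) (act K B B' h y))"

text \<open>The degree-zero object \<open>(X^K)\<^sub>0\<close> of maps from a simplicial set \<open>K\<close> into a simplicial object \<open>X\<close>.\<close>

definition map_cone ::
  "('o, 'a) cat \<Rightarrow> ('o, 'a) sobj \<Rightarrow> 'x sset \<Rightarrow> 'o \<Rightarrow> (nat \<Rightarrow> 'x \<Rightarrow> 'a) \<Rightarrow> bool" where
  "map_cone C X K E e \<longleftrightarrow> E \<in> ob C \<and>
     (\<forall>n. \<forall>x\<in>Sx K n. e n x \<in> ar C E (lev X n) \<and>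
        (\<forall>i\<le>n. e (Suc n) (Dg K n i x) = cmp C (dgn X n i) (e n x)) \<and>
        (0 < n \<longrightarrow> (\<forall>i\<le>n. e (n - 1) (Fc K n i x) = cmp C (fce X n i) (e n x))))"

definition is_map_object ::
  "('o, 'a) cat \<Rightarrow> ('o, 'a) sobj \<Rightarrow> 'x sset \<Rightarrow> 'o \<Rightarrow> (nat \<Rightarrow> 'x \<Rightarrow> 'a) \<Rightarrow> bool" where
  "is_map_object C X K E e \<longleftrightarrow> map_cone C X K E e \<and>
     (\<forall>T t. map_cone C X K T t \<longrightarrow>
        (\<exists>!h. h \<in> ar C T E \<and> (\<forall>n. \<forall>x\<in>Sx K n. cmp C (e n x) h = t n x)))"

text \<open>
  \<open>\<pi>\<^sup>\<natural>\<^sub>m X\<close> as a module over \<open>\<pi>\<^sup>\<natural>\<^sub>0 X\<close> is the abelian group object \<open>\<pi>\<^sup>\<natural>\<^sub>0 (X^{S^m}) \<rightarrow> \<pi>\<^sup>\<natural>\<^sub>0 X\<close>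
  (evaluation at the base point, with the constant maps as zero section), where
  \<open>\<pi>\<^sup>\<natural>\<^sub>0 (X^{S^m})\<close> is the coequalizer of \<open>\<pi>\<^sub>A\<close> of the objects of maps from \<open>S^m \<times> Delta 1\<close> and
  \<open>S^m\<close>.  A group structure with given unit is unique here, so addition need not be compared.
\<close>

definition pinat_module ::
  "('o, 'a) smc \<Rightarrow> 'o set \<Rightarrow> ('o, 'a) sobj \<Rightarrow> nat \<Rightarrow> ('o, 'a, 's) alg \<Rightarrow>
    ('o \<Rightarrow> ('o, 'a) harr \<Rightarrow> 's) \<Rightarrow> ('o, 'a, 's) alg \<Rightarrow>
    ('o, 'a, 's) algarr \<Rightarrow> ('o, 'a, 's) algarr \<Rightarrow> bool" where
  "pinat_module M \<A> X m L eta K pr zr \<longleftrightarrow>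
     is_pinat M \<A> X 0 (lev X 0) (sid M (lev X 0)) L eta \<and>
     (\<exists>U e W w v0 v1 c q.
        is_map_object (uc M) X (sphere m) U e \<and>
        is_map_object (uc M) X (sprod (sphere m) (Delta 1)) W w \<and>
        v0 \<in> ar (uc M) W U \<and> v1 \<in> ar (uc M) W U \<and> c \<in> ar (uc M) (lev X 0) U \<and>
        (\<forall>n. \<forall>x\<in>Sx (sphere m) n.
           cmp (uc M) (e n x) v0 = w n (x, replicate (Suc n) 0) \<and>
           cmp (uc M) (e n x) v1 = w n (x, replicate (Suc n) 1) \<and>
           cmp (uc M) (e n x) c = sdeg (uc M) X n) \<and>
        palg_map (Pi_cat M \<A>) (piA M U) K q \<and>
        (\<forall>B\<in>ob (Pi_cat M \<A>). \<forall>y\<in>ar (hocat M) B W.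
           q B (hcmp M (loc M W U v0) y) = q B (hcmp M (loc M W U v1) y)) \<and>
        (\<forall>T\<in>ob (Alg M \<A>). \<forall>t. palg_map (Pi_cat M \<A>) (piA M U) T t \<and>
             (\<forall>B\<in>ob (Pi_cat M \<A>). \<forall>y\<in>ar (hocat M) B W.
                t B (hcmp M (loc M W U v0) y) = t B (hcmp M (loc M W U v1) y)) \<longrightarrow>
           (\<exists>!h. h \<in> ar (Alg M \<A>) K T \<and>
              (\<forall>B\<in>ob (Pi_cat M \<A>). \<forall>x\<in>ar (hocat M) B U. app h B (q B x) = t B x))) \<and>
        (\<forall>B\<in>ob (Pi_cat M \<A>).
           (\<forall>x\<in>ar (hocat M) B U.
              app pr B (q B x) = eta B (hcmp M (loc M U (lev X 0) (e 0 None)) x)) \<and>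
           (\<forall>y\<in>ar (hocat M) B (lev X 0).
              app zr B (eta B y) = q B (hcmp M (loc M (lev X 0) U c) y))))"

text \<open>\<open>E\<close>, with \<open>p : E \<rightarrow> Y\<close>, is an Eilenberg--Mac Lane object \<open>E\<^sub>\<Lambda>(K, m)\<close> over \<open>Y = B\<Lambda>\<close>.\<close>

definition em_object ::
  "('o, 'a) smc \<Rightarrow> 'o set \<Rightarrow> ('o, 'a, 's) alg \<Rightarrow> ('o, 'a, 's) alg \<Rightarrow> ('o, 'a, 's) algarr \<Rightarrow>
    ('o, 'a, 's) algarr \<Rightarrow> nat \<Rightarrow> ('o, 'a) sobj \<Rightarrow> (nat \<Rightarrow> 'a) \<Rightarrow> ('o, 'a) sobj \<Rightarrow> bool" where
  "em_object M \<A> L K pr zr m E p Y \<longleftrightarrow> reedy_fibrant M \<infinity> E \<and> p \<in> ar (sM M) E Y \<and>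
     (\<exists>eta. classifying M \<A> L Y eta \<and>
        pinat_module M \<A> E m L (\<lambda>B x. eta B (hmap M E Y p 0 x)) K pr zr) \<and>
     (\<forall>k. k \<noteq> 0 \<and> k \<noteq> m \<longrightarrow> pinat_trivial TYPE('s) M \<A> E k)"

text \<open>Functorial \<open>k\<close>-invariants: a natural homotopy pullback square with corners
  \<open>P\<^sub>m\<^sub>+\<^sub>1 X\<close>, \<open>P\<^sub>m X\<close>, \<open>B\<Lambda>\<close> and \<open>E\<^sub>\<Lambda>(\<pi>\<^sup>\<natural>\<^sub>m\<^sub>+\<^sub>1 X, m + 2)\<close>, for \<open>\<Lambda> = \<pi>\<^sup>\<natural>\<^sub>0 X\<close>, where
  \<open>B\<Lambda>\<close> maps to the Eilenberg--Mac Lane object by a section up to weak equivalence.\<close>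

definition k_invariants ::
  "'s itself \<Rightarrow> ('o, 'a) smc \<Rightarrow> 'o set \<Rightarrow> (nat \<Rightarrow> ('o, 'a) sobj \<Rightarrow> ('o, 'a) sobj) \<Rightarrow>
    (nat \<Rightarrow> ('o, 'a) sobj \<Rightarrow> ('o, 'a) sobj \<Rightarrow> (nat \<Rightarrow> 'a) \<Rightarrow> nat \<Rightarrow> 'a) \<Rightarrow>
    (nat \<Rightarrow> ('o, 'a) sobj \<Rightarrow> nat \<Rightarrow> 'a) \<Rightarrow> nat \<Rightarrow> bool" where
  "k_invariants u M \<A> Po Pa t m \<longleftrightarrow>
     (\<exists>Bo Ba Eo Ea ka ze be.
        is_functor (sMf M) (sMf M) Bo Ba \<and> is_functor (sMf M) (sMf M) Eo Ea \<and>
        nat_tr (sMf M) (sMf M) (Po m) (Pa m) Eo Ea ka \<and>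
        nat_tr (sMf M) (sMf M) Bo Ba Eo Ea ze \<and>
        nat_tr (sMf M) (sMf M) (Po (Suc m)) (Pa (Suc m)) Bo Ba be \<and>
        (\<forall>X\<in>ob (sMf M).
           (\<exists>(L :: ('o, 'a, 's) alg) K pr zr ad Y p eta eta'.
              is_module M \<A> L K pr zr ad \<and> pinat_module M \<A> X (Suc m) L eta K pr zr \<and>
              classifying M \<A> L (Bo X) eta' \<and> em_object M \<A> L K pr zr (m + 2) (Eo X) p Y \<and>
              (Bo X, Y, cmp (sM M) p (ze X)) \<in> res_weq M \<A>) \<and>
           is_hopullback (sM M) (res_weq M \<A>) (res_fib M \<A>) (Po m X) (Bo X) (Eo X) (ka X) (ze X)
             (Po (Suc m) X) (t m X) (be X)))"

text \<open>A map from the (\<open>k\<close>-truncated) simplicial algebra \<open>\<pi>\<^sub>A X\<close> to \<open>H\<close>.\<close>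

definition piA_map ::
  "('o, 'a) smc \<Rightarrow> 'o set \<Rightarrow> enat \<Rightarrow> ('o, 'a) sobj \<Rightarrow> (('o, 'a, 's) alg, ('o, 'a, 's) algarr) sobj \<Rightarrow>
    (nat \<Rightarrow> 'o \<Rightarrow> ('o, 'a) harr \<Rightarrow> 's) \<Rightarrow> bool" where
  "piA_map M \<A> k X H th \<longleftrightarrow>
     (\<forall>m. enat m \<le> k \<longrightarrow> palg_map (Pi_cat M \<A>) (piA M (lev X m)) (lev H m) (th m)) \<and>
     (\<forall>B\<in>ob (Pi_cat M \<A>). \<forall>m. enat (Suc m) \<le> k \<longrightarrow>
        (\<forall>x\<in>ar (hocat M) B (lev X (Suc m)). \<forall>i\<le>Suc m.
           th m B (Fc (hset M B X) (Suc m) i x) = app (fce H (Suc m) i) B (th (Suc m) B x)) \<and>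
        (\<forall>x\<in>ar (hocat M) B (lev X m). \<forall>i\<le>m.
           th (Suc m) B (Dg (hset M B X) m i x) = app (dgn H m i) B (th m B x)))"

text \<open>The simplicial set underlying \<open>H{B}\<close>.\<close>

definition evset :: "(('o, 'a, 's) alg, ('o, 'a, 's) algarr) sobj \<Rightarrow> 'o \<Rightarrow> 's sset" where
  "evset H B = \<lparr>Sx = (\<lambda>n. val (lev H n) B), Fc = (\<lambda>n i. app (fce H n i) B),
     Dg = (\<lambda>n i. app (dgn H n i) B)\<rparr>"

definition E2_model_category :: "'s itself \<Rightarrow> ('o, 'a) smc \<Rightarrow> 'o set \<Rightarrow> bool" where
  "E2_model_category u M \<A> \<longleftrightarrow>
     model_structure (sM M) (res_weq M \<A>) (res_cof M \<A>) (res_fib M \<A>) \<and>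
     (\<exists>Po Pa r t. postnikov_sections u M \<A> Po Pa r t \<and> (\<forall>m. k_invariants u M \<A> Po Pa t m)) \<and>
     (\<forall>L :: ('o, 'a, 's) alg. L \<in> ob (Alg M \<A>) \<longrightarrow> (\<exists>Y eta. classifying M \<A> L Y eta)) \<and>
     (\<forall>(L :: ('o, 'a, 's) alg) K pr zr ad m. is_module M \<A> L K pr zr ad \<and> 1 \<le> m \<longrightarrow>
        (\<exists>E p Y. em_object M \<A> L K pr zr m E p Y)) \<and>
     (\<exists>Jo Ja. is_functor (sM M) (uc M) Jo Ja \<and>
        (\<forall>X Z z. is_zero (sM M) Z \<and> (Z, X, z) \<in> res_cof M \<A> \<longrightarrow>
           (\<forall>(L :: ('o, 'a, 's) alg) ep. L \<in> ob (Alg M \<A>) \<and>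
                piA_map M \<A> \<infinity> X (sconst (Alg M \<A>) L) ep \<and>
                (\<forall>A\<in>\<A>. \<forall>i. let B = susp M i A in
                   pi_equivalence (hset M B X) (zarr (hocat M) B (lev X 0))
                     (evset (sconst (Alg M \<A>) L) B) (bpt L B) (\<lambda>m. ep m B)) \<longrightarrow>
              (\<forall>A\<in>\<A>. \<exists>f. bij_betw f (ar (hocat M) A (Jo X)) (val L A) \<and>
                 f (zarr (hocat M) A (Jo X)) = bpt L A)))) \<and>
     (\<forall>k X m C j. reedy_fibrant M k X \<and> enat m \<le> k \<and> is_chains (uc M) X m C j \<longrightarrow>
        (\<forall>B\<in>ob (Pi_cat M \<A>).
           bij_betw (\<lambda>x. hcmp M (loc M C (lev X m) j) x) (ar (hocat M) B C)
             {x \<in> ar (hocat M) B (lev X m). \<forall>i. 1 \<le> i \<and> i \<le> m \<longrightarrow>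
                Fc (hset M B X) m i x = zarr (hocat M) B (lev X (m - 1))}))"


section \<open>Resolutions and realizations\<close>

definition free_resolution ::
  "('o, 'a) smc \<Rightarrow> 'o set \<Rightarrow> ('o, 'a, 's) alg \<Rightarrow> (('o, 'a, 's) alg, ('o, 'a, 's) algarr) sobj \<Rightarrow>
    (nat \<Rightarrow> ('o, 'a, 's) alg) \<Rightarrow> (nat \<Rightarrow> ('o, 'a, 's) algarr) \<Rightarrow> (nat \<Rightarrow> ('o, 'a, 's) algarr) \<Rightarrow> bool" where
  "free_resolution M \<A> L G Gb gb ep \<longleftrightarrow>
     cw_object (Alg M \<A>) \<infinity> G Gb gb \<and> (\<forall>m. free_alg M \<A> (Gb m)) \<and>
     simp_map (Alg M \<A>) \<infinity> G (sconst (Alg M \<A>) L) ep \<and>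
     (\<forall>A\<in>\<A>. \<forall>i. let B = susp M i A in
        pi_equivalence (evset G B) (bpt (lev G 0) B)
          (evset (sconst (Alg M \<A>) L) B) (bpt L B) (\<lambda>m. app (ep m) B))"

text \<open>\<open>V\<close> is a \<open>k\<close>-truncated realization of \<open>G\<close>; \<open>th\<close> is the isomorphism \<open>\<tau>\<^sub>k \<pi>\<^sub>A V \<cong> \<tau>\<^sub>k G\<close>.\<close>

definition truncated_realization ::
  "('o, 'a) smc \<Rightarrow> 'o set \<Rightarrow> (('o, 'a, 's) alg, ('o, 'a, 's) algarr) sobj \<Rightarrow>
    (nat \<Rightarrow> ('o, 'a, 's) alg) \<Rightarrow> nat \<Rightarrow> ('o, 'a) sobj \<Rightarrow> (nat \<Rightarrow> 'o) \<Rightarrow> (nat \<Rightarrow> 'a) \<Rightarrow>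
    (nat \<Rightarrow> 'o \<Rightarrow> ('o, 'a) harr \<Rightarrow> 's) \<Rightarrow> bool" where
  "truncated_realization M \<A> G Gb k V Vb vb th \<longleftrightarrow>
     reedy_fibrant M (enat k) V \<and> cw_object (uc M) (enat k) V Vb vb \<and>
     (\<forall>i\<le>k. Vb i \<in> MA TYPE('s) M \<A> \<and> (\<exists>be. palg_iso (Pi_cat M \<A>) (piA M (Vb i)) (Gb i) be)) \<and>
     piA_map M \<A> (enat k) V G th \<and>
     (\<forall>m\<le>k. palg_iso (Pi_cat M \<A>) (piA M (lev V m)) (lev G m) (th m))"


section \<open>Flag complexes\<close>

text \<open>\<open>norm w\<close> is the increasing word equal to the word \<open>d\<^sub>w\<^sub>1 d\<^sub>w\<^sub>2 \<cdots>\<close> by the simplicial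
  identities, read as \<open>d\<^sub>i d\<^sub>j = d\<^sub>j d\<^sub>i\<^sub>+\<^sub>1\<close> for \<open>j \<le> i\<close>; \<open>ins i w\<close> composes an increasing word with
  \<open>d\<^sub>i\<close> on the left.\<close>

fun ins :: "nat \<Rightarrow> nat list \<Rightarrow> nat list" where
  "ins i [] = [i]"
| "ins i (j # w) = (if i < j then i # j # w else j # ins (Suc i) w)"

definition norm_word :: "nat list \<Rightarrow> nat list" where
  "norm_word w = foldr ins w []"

definition is_flag :: "nat \<Rightarrow> nat list \<Rightarrow> bool" where
  "is_flag N \<phi> \<longleftrightarrow> sorted_wrt (<) \<phi> \<and> (\<forall>i\<in>set \<phi>. i \<le> N + 1)"

text \<open>The simplex \<open>d\<^sub>I\<^sub>0 | d\<^sub>I\<^sub>1 | \<cdots> | d\<^sub>I\<^sub>j\<^sub>+\<^sub>1\<close> is the list of the words \<open>I\<^sub>0, \<dots>, I\<^sub>j\<^sub>+\<^sub>1\<close>.\<close>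

definition flag_complex :: "nat list \<Rightarrow> nat list list sset" where
  "flag_complex \<phi> = \<lparr>
     Sx = (\<lambda>j. {s. length s = j + 2 \<and> (\<forall>w\<in>set s. sorted_wrt (<) w) \<and> norm_word (concat s) = \<phi>}),
     Fc = (\<lambda>j i s. take i s @ [norm_word (s ! i @ s ! Suc i)] @ drop (i + 2) s),
     Dg = (\<lambda>j i s. take (Suc i) s @ [[]] @ drop (Suc i) s)\<rparr>"

definition bd_zero :: "nat list \<Rightarrow> nat \<Rightarrow> nat list list set" where
  "bd_zero \<phi> n = Collect (spanned (flag_complex \<phi>)
     (\<lambda>m. {Fc (flag_complex \<phi>) (Suc m) 0 s | s.
        Suc m = length \<phi> \<and> nondegenerate (flag_complex \<phi>) (Suc m) s}) n)"

definition bd_tilde :: "nat list \<Rightarrow> nat \<Rightarrow> nat list list set" where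
  "bd_tilde \<phi> n = Collect (spanned (flag_complex \<phi>)
     (\<lambda>m. {Fc (flag_complex \<phi>) (Suc m) (Suc m) s | s.
        Suc m = length \<phi> \<and> nondegenerate (flag_complex \<phi>) (Suc m) s}) n)"

definition flag_boundary :: "nat list \<Rightarrow> nat list list sset" where
  "flag_boundary \<phi> = (flag_complex \<phi>)\<lparr>Sx := (\<lambda>n. bd_zero \<phi> n \<union> bd_tilde \<phi> n)\<rparr>"

text \<open>\<open>left_comp c s\<close> is \<open>d\<^sub>c \<circ> s\<close>; \<open>omit p \<phi>\<close> omits the entry at (zero-based) position \<open>p\<close>, so that
  \<open>d\<^sub>\<phi> = d\<^sub>c d\<^sub>o\<^sub>m\<^sub>i\<^sub>t\<close> for \<open>c = \<phi> ! p - p\<close>.\<close>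

definition left_comp :: "nat \<Rightarrow> nat list list \<Rightarrow> nat list list" where
  "left_comp c s = norm_word (c # hd s) # tl s"

definition omit :: "nat \<Rightarrow> nat list \<Rightarrow> nat list" where
  "omit p \<phi> = take p \<phi> @ drop (Suc p) \<phi>"


section \<open>The last higher homotopy operation\<close>

definition level_lift ::
  "('o, 'a) smc \<Rightarrow> ('o, 'a) sobj \<Rightarrow> 'o \<Rightarrow> nat \<Rightarrow> 'a \<Rightarrow> nat \<Rightarrow>
    (nat list \<Rightarrow> nat \<Rightarrow> nat list list \<Rightarrow> 'a) \<Rightarrow> bool" where
  "level_lift M V B N a k h \<longleftrightarrow>
     (\<forall>\<phi>. is_flag N \<phi> \<and> length \<phi> \<le> k \<longrightarrow>
        smap (flag_complex \<phi>) (mapc M B (lev V (N + 1 - length \<phi>))) (h \<phi>) \<and>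
        (\<phi> = [] \<longrightarrow> (\<forall>j. \<forall>s\<in>Sx (flag_complex []) j. h [] j s = cst (mapc M B (lev V (N + 1))) j a)) \<and>
        (\<phi> \<noteq> [] \<longrightarrow>
           (\<forall>j. \<forall>s\<in>bd_tilde \<phi> j. h \<phi> j s = zsimp M B (lev V (N + 1 - length \<phi>)) j)) \<and>
        (\<forall>p<length \<phi>. \<forall>j. \<forall>s\<in>Sx (flag_complex (omit p \<phi>)) j.
           h \<phi> j (left_comp (\<phi> ! p - p) s) =
           postc M (lev V (N + 2 - length \<phi>)) (lev V (N + 1 - length \<phi>)) j
             (fce V (N + 2 - length \<phi>) (\<phi> ! p - p)) (h (omit p \<phi>) j s)))"

definition Psi :: "nat \<Rightarrow> nat list set" where
  "Psi N = {\<phi>. is_flag N \<phi> \<and> length \<phi> = N + 1}"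

text \<open>\<open>f\<close> is the map \<open>f\<^sub>\<phi> : \<partial>K\<^sub>\<phi> \<rightarrow> map(B, V\<^sub>0)\<close> determined by a level-\<open>N\<close> lift \<open>h\<close>.\<close>

definition boundary_map ::
  "('o, 'a) smc \<Rightarrow> ('o, 'a) sobj \<Rightarrow> 'o \<Rightarrow> (nat list \<Rightarrow> nat \<Rightarrow> nat list list \<Rightarrow> 'a) \<Rightarrow>
    nat list \<Rightarrow> (nat \<Rightarrow> nat list list \<Rightarrow> 'a) \<Rightarrow> bool" where
  "boundary_map M V B h \<phi> f \<longleftrightarrow>
     smap (flag_boundary \<phi>) (mapc M B (lev V 0)) f \<and>
     (\<forall>j. \<forall>s\<in>bd_tilde \<phi> j. f j s = zsimp M B (lev V 0) j) \<and>
     (\<forall>p<length \<phi>. \<forall>j. \<forall>s\<in>Sx (flag_complex (omit p \<phi>)) j.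
        f j (left_comp (\<phi> ! p - p) s) =
        postc M (lev V 1) (lev V 0) j (fce V 1 (\<phi> ! p - p)) (h (omit p \<phi>) j s))"

text \<open>\<open>B \<and> (\<partial>K\<^sub>\<phi> / \<partial>\<tilde>K\<^sub>\<phi>)\<close>, a model of the \<open>N\<close>-fold suspension of a cofibrant \<open>B\<close>.\<close>

definition flag_smash :: "('o, 'a) smc \<Rightarrow> 'o \<Rightarrow> nat list \<Rightarrow> 'o \<times> (nat \<Rightarrow> nat list list option \<Rightarrow> 'a)" where
  "flag_smash M B \<phi> = smash M B (squot (flag_boundary \<phi>) (bd_tilde \<phi>)) None"

text \<open>The map \<open>B \<and> (\<partial>K\<^sub>\<phi> / \<partial>\<tilde>K\<^sub>\<phi>) \<rightarrow> V\<^sub>0\<close> adjoint to the factorization of \<open>f : \<partial>K\<^sub>\<phi> \<rightarrow> map(B, V\<^sub>0)\<close>.\<close>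

definition is_adjoint ::
  "('o, 'a) smc \<Rightarrow> ('o, 'a) sobj \<Rightarrow> 'o \<Rightarrow> nat list \<Rightarrow> (nat \<Rightarrow> nat list list \<Rightarrow> 'a) \<Rightarrow> 'a \<Rightarrow> bool" where
  "is_adjoint M V B \<phi> f g \<longleftrightarrow> g \<in> ar (uc M) (fst (flag_smash M B \<phi>)) (lev V 0) \<and>
     (\<forall>j. \<forall>s\<in>Sx (flag_boundary \<phi>) j - bd_tilde \<phi> j.
        postc M (fst (flag_smash M B \<phi>)) (lev V 0) j g (snd (flag_smash M B \<phi>) j (Some s)) = f j s)"

definition wedge :: "('o, 'a) smc \<Rightarrow> 'i set \<Rightarrow> ('i \<Rightarrow> 'o) \<Rightarrow> 'o \<times> ('i \<Rightarrow> 'a)" where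
  "wedge M I X = (SOME (P, inc). is_coprod (uc M) I X P inc)"

definition susp_wedge :: "('o, 'a) smc \<Rightarrow> 'o \<Rightarrow> nat \<Rightarrow> 'o \<times> (nat list \<Rightarrow> 'a)" where
  "susp_wedge M B N = wedge M (Psi N) (\<lambda>_. susp M N B)"

text \<open>
  The isomorphisms \<open>e \<phi> : \<Sigma>^N B \<rightarrow> B \<and> (\<partial>K\<^sub>\<phi> / \<partial>\<tilde>K\<^sub>\<phi>)\<close> in the homotopy category stand for the
  identifications \<open>S^N \<simeq> \<partial>K\<^sub>\<phi> / \<partial>\<tilde>K\<^sub>\<phi>\<close>.  \<open>hho_value M V B N e h w\<close> says that \<open>w\<close> is the class of
  the map out of the wedge whose component \<open>ft \<phi> : \<Sigma>^N B \<rightarrow> V\<^sub>0\<close> is obtained from \<open>f\<^sub>\<phi>\<close>.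
\<close>

definition hho_value ::
  "('o, 'a) smc \<Rightarrow> ('o, 'a) sobj \<Rightarrow> 'o \<Rightarrow> nat \<Rightarrow> (nat list \<Rightarrow> ('o, 'a) harr) \<Rightarrow>
    (nat list \<Rightarrow> nat \<Rightarrow> nat list list \<Rightarrow> 'a) \<Rightarrow> ('o, 'a) harr \<Rightarrow> bool" where
  "hho_value M V B N e h w \<longleftrightarrow>
     (\<exists>f g ft t.
        (\<forall>\<phi>\<in>Psi N. boundary_map M V B h \<phi> (f \<phi>) \<and> is_adjoint M V B \<phi> (f \<phi>) (g \<phi>) \<and>
           ft \<phi> \<in> ar (uc M) (susp M N B) (lev V 0) \<and>
           loc M (susp M N B) (lev V 0) (ft \<phi>) =
             hcmp M (loc M (fst (flag_smash M B \<phi>)) (lev V 0) (g \<phi>)) (e \<phi>)) \<and>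
        t \<in> ar (uc M) (fst (susp_wedge M B N)) (lev V 0) \<and>
        (\<forall>\<phi>\<in>Psi N. cmp (uc M) t (snd (susp_wedge M B N) \<phi>) = ft \<phi>) \<and>
        w = loc M (fst (susp_wedge M B N)) (lev V 0) t)"

definition hho ::
  "('o, 'a) smc \<Rightarrow> ('o, 'a) sobj \<Rightarrow> 'o \<Rightarrow> nat \<Rightarrow> 'a \<Rightarrow> (nat list \<Rightarrow> ('o, 'a) harr) \<Rightarrow>
    ('o, 'a) harr set" where
  "hho M V B N a e = {w. \<exists>h. level_lift M V B N a N h \<and> hho_value M V B N e h w}"

definition hho_zero :: "('o, 'a) smc \<Rightarrow> ('o, 'a) sobj \<Rightarrow> 'o \<Rightarrow> nat \<Rightarrow> ('o, 'a) harr" where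
  "hho_zero M V B N = zarr (hocat M) (fst (susp_wedge M B N)) (lev V 0)"

definition hho_vanishes ::
  "('o, 'a) smc \<Rightarrow> ('o, 'a) sobj \<Rightarrow> 'o \<Rightarrow> nat \<Rightarrow> 'a \<Rightarrow> (nat list \<Rightarrow> ('o, 'a) harr) \<Rightarrow> bool" where
  "hho_vanishes M V B N a e \<longleftrightarrow> hho_zero M V B N \<in> hho M V B N a e"

text \<open>\<open>[[]] @ replicate k [0] @ [[]]\<close> is the simplex \<open>|d\<^sub>0|d\<^sub>0|\<cdots>|d\<^sub>0|\<close>; the component for \<open>\<phi>\<close> is
  constant iff \<open>f\<^sub>\<phi>\<close> is the zero map.\<close>

definition minimal_lift ::
  "('o, 'a) smc \<Rightarrow> ('o, 'a) sobj \<Rightarrow> 'o \<Rightarrow> nat \<Rightarrow> (nat list \<Rightarrow> nat \<Rightarrow> nat list list \<Rightarrow> 'a) \<Rightarrow> bool" where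
  "minimal_lift M V B N h \<longleftrightarrow>
     (\<forall>\<phi>\<in>Psi N. \<phi> \<noteq> [0..<N + 1] \<longrightarrow> boundary_map M V B h \<phi> (\<lambda>j _. zsimp M B (lev V 0) j)) \<and>
     (\<forall>k \<phi> s. 1 \<le> k \<and> k \<le> N \<and> is_flag N \<phi> \<and> length \<phi> = k \<and> nondegenerate (flag_complex \<phi>) k s \<and>
        s \<noteq> [[]] @ replicate k [0] @ [[]] \<longrightarrow> h \<phi> k s = zsimp M B (lev V (N + 1 - k)) k)"

definition minimal_values ::
  "('o, 'a) smc \<Rightarrow> ('o, 'a) sobj \<Rightarrow> 'o \<Rightarrow> nat \<Rightarrow> 'a \<Rightarrow> (nat list \<Rightarrow> ('o, 'a) harr) \<Rightarrow>
    ('o, 'a) harr set" where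
  "minimal_values M V B N a e =
     {w. \<exists>h. level_lift M V B N a N h \<and> minimal_lift M V B N h \<and> hho_value M V B N e h w}"

end

theory Submission
 imports Defs "HOL-Library.Countable"
begin

text \<open>
 The operation has a minimal value because the nullhomotopies that enter it can all be chosen in the
 chains objects \<open>C\<^sub>m\<close> of \<open>V\<close>, where only \<open>d\<^sub>0\<close> is left.  Let \<open>\<delta> : C\<^sub>m\<^sub>+\<^sub>1 \<rightarrow> C\<^sub>m\<close> be the map induced by
 \<open>d\<^sub>0\<close>, so that \<open>\<delta>\<delta> = 0\<close>, and let \<open>H\<^sub>0 : B \<rightarrow> C\<^sub>n\<^sub>+\<^sub>1\<close> be the given map.  The heart of the proof is a tower:
 for \<open>1 \<le> k \<le> n\<close> a \<open>k\<close>-simplex \<open>H\<^sub>k\<close> of \<open>map(B, C\<^sub>n\<^sub>+\<^sub>1\<^sub>-\<^sub>k)\<close> with zeroth face \<open>\<delta>H\<^sub>k\<^sub>-\<^sub>1\<close> and with all other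
 faces zero (\<open>tower_ex\<close>, \<open>V_tower\<close>).

 The tower is built by induction.  \<open>H\<^sub>1\<close> is a nullhomotopy of \<open>\<delta>H\<^sub>0\<close> (\<open>attaching_null\<close>).  Given \<open>H\<^sub>k\<close>, the
 simplex \<open>\<delta>H\<^sub>k\<close> is a cycle, and \<open>\<delta>\<close> maps it to zero.  Since \<open>C\<^sub>m\<^sub>+\<^sub>1 \<rightarrow> C\<^sub>m \<rightarrow> C\<^sub>m\<^sub>-\<^sub>1\<close> is exact on the homotopy
 groups of mapping spaces out of \<open>B\<close> (\<open>chains_exact_B\<close>), \<open>\<delta>H\<^sub>k\<close> is homotopic to \<open>\<delta>v\<close> for a cycle \<open>v\<close>.
 Subtracting \<open>v\<close> from \<open>H\<^sub>k\<close> does not change the faces of \<open>H\<^sub>k\<close> and makes \<open>\<delta>H\<^sub>k\<close> null (\<open>subtract_cycle\<close>);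
 a nullhomotopy is \<open>H\<^sub>k\<^sub>+\<^sub>1\<close>.

 Exactness for \<open>A\<close> in \<open>\<A>\<close> is the acyclicity of the resolution: \<open>k\<close>-cycles of \<open>map(A, C\<^sub>m)\<close> are maps
 \<open>\<Sigma>\<^sup>kA \<rightarrow> C\<^sub>m\<close>, and \<open>[\<Sigma>\<^sup>kA, C\<^sub>m]\<close> consists of the Moore chains of \<open>[\<Sigma>\<^sup>kA, V]\<close>, which agrees with \<open>G{\<Sigma>\<^sup>kA}\<close>
 (\<open>chains_exact\<close>).  The objects for which exactness holds are closed under weak equivalences,
 coproducts and suspensions, the last because the cone on \<open>X\<close> gives a fibration with contractible
 total space that shifts homotopy groups by one degree (\<open>hom_exact_MA\<close>); thus \<open>B\<close> is among them.
 For \<open>H\<^sub>1\<close>, the attaching map of \<open>G\<close> followed by \<open>d\<^sub>0\<close> is trivial because \<open>d\<^sub>0d\<^sub>0 = d\<^sub>0d\<^sub>1\<close>, so \<open>\<delta>H\<^sub>0\<close> is trivial on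
 maps out of the objects of \<open>\<Pi>\<^sub>\<A>\<close>; that such a map out of \<open>B\<close> is nullhomotopic is once more an exactness
 statement, for the homotopy fibre of \<open>\<delta>H\<^sub>0\<close> (\<open>trivial_on_homotopy\<close>).

 A lift is obtained from the tower as follows.  On a simplex of a flag complex it vanishes unless the last
 word is empty and all other words are empty or \<open>d\<^sub>0\<close>.  If \<open>r\<close> of the words between the bars are
 \<open>d\<^sub>0\<close>, counting them defines a monotone map, and the lift takes the value of the corresponding operator on
 \<open>H\<^sub>r\<close>, followed by \<open>d\<^sub>0\<close> if the first word is \<open>d\<^sub>0\<close>.  Removing the first bar from \<open>|d\<^sub>0|\<cdots>\<close> produces
 \<open>d\<^sub>0H\<^sub>r\<^sub>-\<^sub>1\<close>, which is the zeroth face of \<open>H\<^sub>r\<close>; removing any other bar next to two words \<open>d\<^sub>0\<close>, or the last bar after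
 \<open>d\<^sub>0\<close>, produces a simplex on which the lift vanishes, as do the other faces of \<open>H\<^sub>r\<close>
 (\<open>hv_face\<close>).  Since \<open>d\<^sub>0\<cdots>d\<^sub>0 = d\<^sub>0d\<^sub>1\<cdots>d\<^sub>n\<close>, the only flag of length \<open>n + 1\<close> whose component is not constant is
 \<open>0 < 1 < \<cdots> < n\<close> (\<open>hv_minimal\<close>).
\<close>

section \<open>Simplicial sets\<close>

lemma sset_face: "is_sset K ==> x : Sx K (Suc n) ==> i <= Suc n ==> Fc K (Suc n) i x : Sx K n"
 and sset_degen: "is_sset K ==> x : Sx K n ==> i <= n ==> Dg K n i x : Sx K (Suc n)"
 and sset_face_face: "is_sset K ==> x : Sx K (Suc (Suc n)) ==> i < j ==> j <= Suc (Suc n) ==>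
  Fc K (Suc n) i (Fc K (Suc (Suc n)) j x) = Fc K (Suc n) (j - 1) (Fc K (Suc (Suc n)) i x)"
 and sset_face_degen: "is_sset K ==> x : Sx K n ==> j <= n ==> i <= Suc n ==>
  Fc K (Suc n) i (Dg K n j x) =
    (if i < j then Dg K (n - 1) (j - 1) (Fc K n i x)
         else if i <= Suc j then x
         else Dg K (n - 1) j (Fc K n (i - 1) x))"
 and sset_degen_degen: "is_sset K ==> x : Sx K n ==> i <= j ==> j <= n ==>
  Dg K (Suc n) i (Dg K n j x) = Dg K (Suc n) (Suc j) (Dg K n i x)"
 unfolding is_sset_def by simp_all

lemma smap_in: "smap K L f ==> x : Sx K n ==> f n x : Sx L n"
 and smap_degen: "smap K L f ==> x : Sx K n ==> i <= n ==> f (Suc n) (Dg K n i x) = Dg L n i (f n x)"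
 and smap_face: "smap K L f ==> x : Sx K (Suc n) ==> i <= Suc n ==>
  f n (Fc K (Suc n) i x) = Fc L (Suc n) i (f (Suc n) x)"
 unfolding smap_def by (blast, blast, force)

lemma smap_comp: "smap K L f ==> smap L P g ==> smap K P (%n x. g n (f n x))"
 unfolding smap_def by simp

lemma cst_in: "is_sset K ==> b : Sx K 0 ==> cst K n b : Sx K n"
 by (induction n) (auto intro: sset_degen)

lemma cst_degen: "is_sset K ==> b : Sx K 0 ==> i <= n ==> Dg K n i (cst K n b) = cst K (Suc n) b"
proof (induction n arbitrary: i)
 case (Suc n)
 show ?case
 proof (cases i)
  case (Suc j)
  thus ?thesis
   using Suc.IH[of j] Suc.prems sset_degen_degen[OF Suc.prems(1) cst_in[OF Suc.prems(1,2)], of 0 j n] by simp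
 qed simp
qed simp

lemma cst_face: "is_sset K ==> b : Sx K 0 ==> i <= Suc n ==> Fc K (Suc n) i (cst K (Suc n) b) = cst K n b"
proof (induction n arbitrary: i)
 case 0
 thus ?case using sset_face_degen[OF 0(1,2), of 0 i] by auto
next
 case (Suc n)
 have c: "cst K (Suc n) b : Sx K (Suc n)" by (rule cst_in[OF Suc.prems(1,2)])
 have "Fc K (Suc (Suc n)) i (Dg K (Suc n) 0 (cst K (Suc n) b)) = cst K (Suc n) b"
 proof (cases "i <= 1")
  case True
  thus ?thesis using sset_face_degen[OF Suc.prems(1) c, of 0 i] Suc.prems by auto
 next
  case False
  hence "Fc K (Suc (Suc n)) i (Dg K (Suc n) 0 (cst K (Suc n) b)) =
    Dg K n 0 (Fc K (Suc n) (i - 1) (cst K (Suc n) b))"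
   using sset_face_degen[OF Suc.prems(1) c, of 0 i] Suc.prems by auto
  also have "\<dots> = cst K (Suc n) b" using Suc.IH[of "i - 1"] Suc.prems by simp
  finally show ?thesis .
 qed
 thus ?case by simp
qed

declare cst.simps(2) [simp del] cst.simps(2) [symmetric, simp]

lemma smap_cst: "smap K L f ==> is_sset K ==> b : Sx K 0 ==> f n (cst K n b) = cst L n (f 0 b)"
proof (induction n)
 case (Suc n)
 thus ?case using smap_degen[OF Suc.prems(1) cst_in[OF Suc.prems(2,3)], of 0 n] by simp
qed simp

section \<open>Pointed Kan complexes\<close>

text \<open>The zero simplices of a pointed simplicial set \<open>(K, b)\<close> are the \<open>cst K n b\<close>.  Cycles are
 homotopic if they are, up to the order of the faces, the only two nonzero faces of a simplex; the
 variant below leaves the zeroth face zero, so that it can be used next to a zeroth face that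
 is still to be filled in.\<close>

definition rel12 :: "'x sset => 'x => nat => 'x => 'x => bool" where
 "rel12 K b k x y \<longleftrightarrow> (EX w:Sx K (Suc k). Fc K (Suc k) 0 w = cst K k b & Fc K (Suc k) 1 w = x &
     Fc K (Suc k) 2 w = y & (ALL i. 3 <= i & i <= Suc k --> Fc K (Suc k) i w = cst K k b))"

abbreviation null :: "'x sset => 'x => nat => 'x => bool" where
 "null K b k x == pi_rel K b k x (cst K k b)"

lemma null_alt: "null K b k x \<longleftrightarrow> (EX w:Sx K (Suc k). Fc K (Suc k) 0 w = x &
  (ALL i. 1 <= i & i <= Suc k --> Fc K (Suc k) i w = cst K k b))"
proof -
 have "(ALL i. 1 <= i & i <= Suc k --> P i) \<longleftrightarrow> P 1 & (ALL i. 2 <= i & i <= Suc k --> P i)" for P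
 proof -
  have "1 <= i \<longleftrightarrow> i = 1 | 2 <= i" for i :: nat by auto
  thus ?thesis by auto
 qed
 thus ?thesis unfolding pi_rel_def by auto
qed

text \<open>All horns and spheres below have at most four nonzero faces, at the beginning.\<close>

definition faces4 :: "'x sset => 'x => nat => 'x => 'x => 'x => 'x => nat => 'x" where
 "faces4 K b n a0 a1 a2 a3 i =
     (if i = 0 then a0 else if i = 1 then a1 else if i = 2 then a2 else if i = 3 then a3 else cst K n b)"

lemma faces4_simps [simp]:
 "faces4 K b n a0 a1 a2 a3 0 = a0" "faces4 K b n a0 a1 a2 a3 (Suc 0) = a1"
 "faces4 K b n a0 a1 a2 a3 2 = a2" "faces4 K b n a0 a1 a2 a3 3 = a3"
 "4 <= i ==> faces4 K b n a0 a1 a2 a3 i = cst K n b"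
 by (auto simp: faces4_def)

text \<open>The simplices \<open>a1\<close>, \<open>a2\<close>, \<open>a3\<close> fit together as the faces of a simplex without its zeroth face.\<close>

definition compat3 :: "'x sset => 'x => nat => 'x => 'x => 'x => bool" where
 "compat3 K b n a1 a2 a3 \<longleftrightarrow> a1 : Sx K n & a2 : Sx K n & a3 : Sx K n &
     (1 <= n --> Fc K n 1 a2 = Fc K n 1 a1) &
     (2 <= n --> Fc K n 1 a3 = Fc K n 2 a1 & Fc K n 2 a3 = Fc K n 2 a2) &
     (ALL l. 3 <= l & l <= n --> Fc K n l a1 = cst K (n - 1) b & Fc K n l a2 = cst K (n - 1) b &
    Fc K n l a3 = cst K (n - 1) b)"

definition compat4 :: "'x sset => 'x => nat => 'x => 'x => 'x => 'x => bool" where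
 "compat4 K b n a0 a1 a2 a3 \<longleftrightarrow> compat3 K b n a1 a2 a3 & a0 : Sx K n &
     (1 <= n --> Fc K n 0 a1 = Fc K n 0 a0 & Fc K n 0 a2 = Fc K n 1 a0) &
     (2 <= n --> Fc K n 0 a3 = Fc K n 2 a0) &
     (ALL l. 3 <= l & l <= n --> Fc K n l a0 = cst K (n - 1) b)"

lemma faces4_in:
 assumes "is_sset K" "b : Sx K 0" "compat3 K b n a1 a2 a3" "0 < i | a0 : Sx K n"
 shows "faces4 K b n a0 a1 a2 a3 i : Sx K n"
 using assms cst_in[OF assms(1,2)] by (auto simp: faces4_def compat3_def)

lemma faces4_compat3:
 assumes K: "is_sset K" "b : Sx K 0" and c: "compat3 K b n a1 a2 a3"
  and ij: "0 < n" "0 < i" "i < j" "j <= Suc n"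
 shows "Fc K n i (faces4 K b n a0 a1 a2 a3 j) = Fc K n (j - 1) (faces4 K b n a0 a1 a2 a3 i)"
proof -
 obtain m where m: "n = Suc m" using ij by (cases n) auto
 have z: "Fc K n l (cst K n b) = cst K (n - 1) b" if "l <= n" for l
  using cst_face[OF K, of l m] that m by simp
 consider "j = 2" "i = 1" | "j = 3" "i = 1" | "j = 3" "i = 2" | "4 <= j" "i = 1 | i = 2 | i = 3" | "4 <= j" "4 <= i"
  using ij by linarith
 thus ?thesis
 proof cases
  case 4
  hence "3 <= j - 1" "j - 1 <= n" "i <= n" using ij by auto
  hence "Fc K n (j - 1) a1 = cst K (n - 1) b" "Fc K n (j - 1) a2 = cst K (n - 1) b"
    "Fc K n (j - 1) a3 = cst K (n - 1) b"
   using c unfolding compat3_def by blast+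
  thus ?thesis using 4 z[OF \<open>i <= n\<close>] by (auto simp: faces4_def)
 next
  case 5
  thus ?thesis using ij z[of i] z[of "j - 1"] by (simp add: faces4_def)
 next
  case 1
  have "Fc K n 1 a2 = Fc K n 1 a1" using c ij(1) by (simp add: compat3_def)
  thus ?thesis using 1 by simp
 next
  case 2
  hence "Fc K n 1 a3 = Fc K n 2 a1" using c ij by (simp add: compat3_def)
  thus ?thesis using 2 by simp
 next
  case 3
  hence "Fc K n 2 a3 = Fc K n 2 a2" using c ij by (simp add: compat3_def)
  thus ?thesis using 3 by simp
 qed
qed

lemma faces4_compat4:
 assumes K: "is_sset K" "b : Sx K 0" and c: "compat4 K b n a0 a1 a2 a3"
  and ij: "0 < n" "i < j" "j <= Suc n"
 shows "Fc K n i (faces4 K b n a0 a1 a2 a3 j) = Fc K n (j - 1) (faces4 K b n a0 a1 a2 a3 i)"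
proof (cases "i = 0")
 case False
 thus ?thesis using faces4_compat3[OF K, of n a1 a2 a3 i j] c ij by (auto simp: compat4_def)
next
 case True
 obtain m where m: "n = Suc m" using ij by (cases n) auto
 have z: "Fc K n l (cst K n b) = cst K (n - 1) b" if "l <= n" for l
  using cst_face[OF K, of l m] that m by simp
 consider "j = 1" | "j = 2" | "j = 3" | "4 <= j" using True ij by linarith
 thus ?thesis
 proof cases
  case 4
  hence "3 <= j - 1" "j - 1 <= n" using ij by auto
  hence "Fc K n (j - 1) a0 = cst K (n - 1) b"
   using c unfolding compat4_def by blast
  thus ?thesis using 4 True z[of 0] by (auto simp: faces4_def)
 next
  case 1
  hence "Fc K n 0 a1 = Fc K n 0 a0" using c ij by (simp add: compat4_def)
  thus ?thesis using 1 True by simp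
 next
  case 2
  hence "Fc K n 0 a2 = Fc K n 1 a0" using c ij by (simp add: compat4_def)
  thus ?thesis using 2 True by simp
 next
  case 3
  hence "Fc K n 0 a3 = Fc K n 2 a0" using c ij by (simp add: compat4_def)
  thus ?thesis using 3 True by simp
 qed
qed

lemma kan_lift3:
 assumes f: "kan_fibration K L f" and K: "is_sset K" "b : Sx K 0" and c: "compat3 K b n a1 a2 a3"
  and y: "y : Sx L (Suc n)" "Fc L (Suc n) 1 y = f n a1" "1 <= n ==> Fc L (Suc n) 2 y = f n a2"
   "2 <= n ==> Fc L (Suc n) 3 y = f n a3"
   "!!i. 4 <= i ==> i <= Suc n ==> Fc L (Suc n) i y = f n (cst K n b)"
 obtains z where "z : Sx K (Suc n)" "f (Suc n) z = y" "Fc K (Suc n) 1 z = a1"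
  "1 <= n ==> Fc K (Suc n) 2 z = a2" "2 <= n ==> Fc K (Suc n) 3 z = a3"
  "!!i. 4 <= i ==> i <= Suc n ==> Fc K (Suc n) i z = cst K n b"
proof -
 let ?x = "faces4 K b n a1 a1 a2 a3"
 have y': "Fc L (Suc n) i y = f n (?x i)" if "i <= Suc n" "i ~= 0" for i
 proof -
  have "i = 1 | i = 2 | i = 3 | 4 <= i" using that by linarith
  thus ?thesis using y that by (elim disjE) (auto simp: faces4_def)
 qed
 have "EX z:Sx K (Suc n). f (Suc n) z = y & (ALL i<=Suc n. i ~= 0 --> Fc K (Suc n) i z = ?x i)"
  using f[unfolded kan_fibration_def, rule_format, of 0 n ?x y] y(1) y'
   faces4_in[OF K c] faces4_compat3[OF K c] by auto
 then obtain z where z: "z : Sx K (Suc n)" "f (Suc n) z = y"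
   "!!i. i <= Suc n ==> i ~= 0 ==> Fc K (Suc n) i z = ?x i" by blast
 show thesis
  by (rule that[OF z(1,2)]) (use z(3) in \<open>auto simp: faces4_def\<close>)
qed

lemma trivial_kan_lift4:
 assumes f: "trivial_kan_fibration K L f" and K: "is_sset K" "b : Sx K 0"
  and c: "compat4 K b n a0 a1 a2 a3"
  and y: "y : Sx L (Suc n)" "Fc L (Suc n) 0 y = f n a0" "Fc L (Suc n) 1 y = f n a1"
   "1 <= n ==> Fc L (Suc n) 2 y = f n a2" "2 <= n ==> Fc L (Suc n) 3 y = f n a3"
   "!!i. 4 <= i ==> i <= Suc n ==> Fc L (Suc n) i y = f n (cst K n b)"
 obtains z where "z : Sx K (Suc n)" "f (Suc n) z = y" "Fc K (Suc n) 0 z = a0" "Fc K (Suc n) 1 z = a1"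
  "1 <= n ==> Fc K (Suc n) 2 z = a2" "2 <= n ==> Fc K (Suc n) 3 z = a3"
  "!!i. 4 <= i ==> i <= Suc n ==> Fc K (Suc n) i z = cst K n b"
proof -
 let ?x = "faces4 K b n a0 a1 a2 a3"
 have y': "Fc L (Suc n) i y = f n (?x i)" if "i <= Suc n" for i
 proof -
  consider "i = 0" | "i = 1" | "i = 2" | "i = 3" | "4 <= i" using that by linarith
  thus ?thesis using y that by cases (auto simp: faces4_def)
 qed
 have "ALL i<=Suc n. ?x i : Sx K n"
  using faces4_in[OF K, of n a1 a2 a3] c by (auto simp: compat4_def)
 hence "EX z:Sx K (Suc n). f (Suc n) z = y & (ALL i<=Suc n. Fc K (Suc n) i z = ?x i)"
  using f[unfolded trivial_kan_fibration_def, THEN conjunct2, rule_format, of n ?x y] y(1) y'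
   faces4_compat4[OF K c] by auto
 then obtain z where z: "z : Sx K (Suc n)" "f (Suc n) z = y"
   "!!i. i <= Suc n ==> Fc K (Suc n) i z = ?x i" by blast
 show thesis
  by (rule that[OF z(1,2)]) (use z(3) in \<open>auto simp: faces4_def\<close>)
qed

text \<open>The same horns as in the notion of a fibration, so that statements on fibrations apply with a point as
 base.\<close>

definition kan :: "'x sset => bool" where
 "kan K \<longleftrightarrow> (ALL n k x. k <= Suc n & (ALL i<=Suc n. i ~= k --> x i : Sx K n) &
    (ALL i j. 0 < n & i < j & j <= Suc n & i ~= k & j ~= k -->
           Fc K n i (x j) = Fc K n (j - 1) (x i)) -->
    (EX z:Sx K (Suc n). ALL i<=Suc n. i ~= k --> Fc K (Suc n) i z = x i))"

definition point :: "unit sset" where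
 "point = \<lparr>Sx = (%_. UNIV), Fc = (%_ _ _. ()), Dg = (%_ _ _. ())\<rparr>"

lemma kan_point: "kan K ==> kan_fibration K point (%_ _. ())"
 unfolding kan_def kan_fibration_def by (simp add: point_def)

lemma kan_fill3:
 assumes f: "kan K" and K: "is_sset K" "b : Sx K 0" and c: "compat3 K b n a1 a2 a3"
 obtains z where "z : Sx K (Suc n)" "Fc K (Suc n) 1 z = a1"
  "1 <= n ==> Fc K (Suc n) 2 z = a2" "2 <= n ==> Fc K (Suc n) 3 z = a3"
  "!!i. 4 <= i ==> i <= Suc n ==> Fc K (Suc n) i z = cst K n b"
proof -
 have "() : Sx point (Suc n)" by (simp add: point_def)
 from kan_lift3[OF kan_point[OF f] K c this] show thesis using that by (auto simp: point_def)
qed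

text \<open>The new face of the simplex that fills such a horn is used as a simplex in its own right, so its
 boundary has to be known.\<close>

lemma face0_faces:
 assumes K: "is_sset K" "b : Sx K 0" and z: "z : Sx K (Suc n)" "1 <= n" "Fc K (Suc n) 1 z = a1" "Fc K (Suc n) 2 z = a2"
  "2 <= n ==> Fc K (Suc n) 3 z = a3"
  "!!i. 4 <= i ==> i <= Suc n ==> Fc K (Suc n) i z = cst K n b"
 shows "Fc K (Suc n) 0 z : Sx K n" "Fc K n 0 (Fc K (Suc n) 0 z) = Fc K n 0 a1"
  "Fc K n 1 (Fc K (Suc n) 0 z) = Fc K n 0 a2" "2 <= n ==> Fc K n 2 (Fc K (Suc n) 0 z) = Fc K n 0 a3"
  "!!i. 3 <= i ==> i <= n ==> Fc K n i (Fc K (Suc n) 0 z) = cst K (n - 1) b"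
proof -
 obtain m where m: "n = Suc m" using z(2) by (cases n) auto
 have e: "Fc K n i (Fc K (Suc n) 0 z) = Fc K n 0 (Fc K (Suc n) (Suc i) z)" if "i <= n" for i
  using sset_face_face[OF K(1), of z m 0 "Suc i"] z(1) that m by simp
 show "Fc K (Suc n) 0 z : Sx K n" using sset_face[OF K(1) z(1)] by simp
 show "Fc K n 0 (Fc K (Suc n) 0 z) = Fc K n 0 a1" using e[of 0] z(3) by simp
 show "Fc K n 1 (Fc K (Suc n) 0 z) = Fc K n 0 a2" using e[of 1] z(2,4) by (simp add: numeral_2_eq_2)
 show "Fc K n 2 (Fc K (Suc n) 0 z) = Fc K n 0 a3" if "2 <= n"
  using e[of 2] z(5) that by (simp add: numeral_3_eq_3 numeral_2_eq_2)
 show "Fc K n i (Fc K (Suc n) 0 z) = cst K (n - 1) b" if i: "3 <= i" "i <= n" for i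
 proof -
  have "Fc K (Suc n) (Suc i) z = cst K n b" using z(6)[of "Suc i"] i by linarith
  moreover have "Fc K n 0 (cst K n b) = cst K (n - 1) b" using cst_face[OF K, of 0 m] unfolding m by simp
  ultimately show ?thesis using e[OF i(2)] by simp
 qed
qed

lemma cycle_in: "x : pi_cycles K b k ==> x : Sx K k"
 and cycle_face: "x : pi_cycles K b k ==> 0 < k ==> i <= k ==> Fc K k i x = cst K (k - 1) b"
 by (auto simp: pi_cycles_def)

lemma cst_cycle: "is_sset K ==> b : Sx K 0 ==> cst K k b : pi_cycles K b k"
 using cst_face[of K b _ "k - 1"] by (cases k) (auto simp: pi_cycles_def cst_in)

lemma smap_cycle:
 assumes "smap K L f" "is_sset K" "b : Sx K 0" "f 0 b = c" "x : pi_cycles K b k"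
 shows "f k x : pi_cycles L c k"
proof (cases k)
 case 0
 thus ?thesis using assms smap_in[OF assms(1)] by (auto simp: pi_cycles_def)
next
 case (Suc m)
 show ?thesis unfolding pi_cycles_def
 proof (intro CollectI conjI impI allI)
  show "f k x : Sx L k" using smap_in[OF assms(1) cycle_in[OF assms(5)]] .
  fix i assume "i <= k"
  thus "Fc L k i (f k x) = cst L (k - 1) c"
   using smap_face[OF assms(1), of x m i] cycle_in[OF assms(5)] cycle_face[OF assms(5), of i] Suc
    smap_cst[OF assms(1-3), of m] assms(4) by simp
 qed
qed

lemma smap_null:
 assumes "smap K L f" "is_sset K" "b : Sx K 0" "f 0 b = c" "null K b k x"
 shows "null L c k (f k x)"
proof -
 obtain w where w: "w : Sx K (Suc k)" "Fc K (Suc k) 0 w = x"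
   "!!i. 1 <= i ==> i <= Suc k ==> Fc K (Suc k) i w = cst K k b"
  using assms(5) unfolding null_alt by blast
 show ?thesis unfolding null_alt
 proof (intro bexI conjI allI impI)
  show "f (Suc k) w : Sx L (Suc k)" by (rule smap_in[OF assms(1) w(1)])
  show "Fc L (Suc k) 0 (f (Suc k) w) = f k x" using smap_face[OF assms(1) w(1), of 0] w(2) by simp
  fix i assume "1 <= i & i <= Suc k"
  thus "Fc L (Suc k) i (f (Suc k) w) = cst L k c"
   using smap_face[OF assms(1) w(1), of i] w(3)[of i] smap_cst[OF assms(1-3), of k] assms(4) by simp
 qed
qed

lemma cst_null: "is_sset K ==> b : Sx K 0 ==> null K b k (cst K k b)"
 unfolding null_alt by (rule bexI[of _ "cst K (Suc k) b"]) (simp_all add: cst_in cst_face)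

text \<open>Symmetry moves the homotopy through a horn with one degenerate face.\<close>

lemma pi_rel_sym:
 assumes f: "kan K" and K: "is_sset K" "b : Sx K 0"
  and x: "x : pi_cycles K b k" and y: "y : pi_cycles K b k" and r: "pi_rel K b k x y"
 shows "pi_rel K b k y x"
proof -
 obtain t where t: "t : Sx K (Suc k)" "Fc K (Suc k) 0 t = x" "Fc K (Suc k) 1 t = y"
   "!!i. 2 <= i ==> i <= Suc k ==> Fc K (Suc k) i t = cst K k b"
  using r unfolding pi_rel_def by blast
 define s where "s = Dg K k 0 y"
 have s: "s : Sx K (Suc k)" "Fc K (Suc k) 0 s = y" "Fc K (Suc k) 1 s = y"
  unfolding s_def using cycle_in[OF y] sset_degen[OF K(1)] sset_face_degen[OF K(1), of y k 0] by auto
 have s2: "Fc K (Suc k) i s = cst K k b" if i: "2 <= i" "i <= Suc k" for i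
 proof -
  obtain m where m: "k = Suc m" using i by (cases k) auto
  have "Fc K (Suc k) i s = Dg K (k - 1) 0 (Fc K k (i - 1) y)"
   unfolding s_def using sset_face_degen[OF K(1) cycle_in[OF y], of 0 i] that by auto
  also have "\<dots> = cst K k b" using cycle_face[OF y, of "i - 1"] that m by simp
  finally show ?thesis .
 qed
 have "compat3 K b (Suc k) s t (cst K (Suc k) b)"
  unfolding compat3_def using s s2 t cst_in[OF K] cst_face[OF K] by auto
 from kan_fill3[OF f K this] obtain z where z: "z : Sx K (Suc (Suc k))" "Fc K (Suc (Suc k)) 1 z = s"
  "Fc K (Suc (Suc k)) 2 z = t" "2 <= Suc k ==> Fc K (Suc (Suc k)) 3 z = cst K (Suc k) b"
  "!!i. 4 <= i ==> i <= Suc (Suc k) ==> Fc K (Suc (Suc k)) i z = cst K (Suc k) b"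
  by (metis le_add1 plus_1_eq_Suc)
 note n = face0_faces[OF K z(1) _ z(2-5), simplified]
 show ?thesis unfolding pi_rel_def
 proof (intro bexI[OF _ n(1)] conjI allI impI)
  fix i assume "2 <= i & i <= Suc k"
  then consider "i = 2" "1 <= k" | "3 <= i" "i <= Suc k" by linarith
  thus "Fc K (Suc k) i (Fc K (Suc (Suc k)) 0 z) = cst K k b"
   using n cst_face[OF K, of 0 k] by cases auto
 qed (use n s t in auto)
qed

text \<open>A further horn filling frees the zeroth face, at the price of a shift of the two ends.\<close>

lemma pi_rel_imp_rel12:
 assumes f: "kan K" and K: "is_sset K" "b : Sx K 0" and k: "1 <= k"
  and x: "x : pi_cycles K b k" and y: "y : pi_cycles K b k" and r: "pi_rel K b k y x"
 shows "rel12 K b k x y"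
proof -
 obtain m where m: "k = Suc m" using k by (cases k) auto
 obtain t where t: "t : Sx K (Suc k)" "Fc K (Suc k) 0 t = y" "Fc K (Suc k) 1 t = x"
   "!!i. 2 <= i ==> i <= Suc k ==> Fc K (Suc k) i t = cst K k b"
  using r unfolding pi_rel_def by blast
 have xf: "Fc K k i x = cst K m b" if "i <= k" for i using cycle_face[OF x, of i] that m by simp
 define s0 where "s0 = Dg K k 0 x"
 define s1 where "s1 = Dg K k 1 x"
 have s0: "s0 : Sx K (Suc k)" "Fc K (Suc k) 0 s0 = x" "Fc K (Suc k) 1 s0 = x"
  "!!i. 2 <= i ==> i <= Suc k ==> Fc K (Suc k) i s0 = cst K k b"
  unfolding s0_def using cycle_in[OF x] sset_degen[OF K(1)] sset_face_degen[OF K(1), of x k 0] xf m by auto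
 have s1: "s1 : Sx K (Suc k)" "Fc K (Suc k) 0 s1 = cst K k b" "Fc K (Suc k) 1 s1 = x" "Fc K (Suc k) 2 s1 = x"
  "!!i. 3 <= i ==> i <= Suc k ==> Fc K (Suc k) i s1 = cst K k b"
  unfolding s1_def using cycle_in[OF x] sset_degen[OF K(1)] sset_face_degen[OF K(1), of x k 1] xf m
   cst_degen[OF K] k by auto
 have "compat3 K b (Suc k) s1 s0 t"
  unfolding compat3_def using s0 s1 t k by auto
 from kan_fill3[OF f K this] obtain z where z: "z : Sx K (Suc (Suc k))" "Fc K (Suc (Suc k)) 1 z = s1"
  "Fc K (Suc (Suc k)) 2 z = s0" "2 <= Suc k ==> Fc K (Suc (Suc k)) 3 z = t"
  "!!i. 4 <= i ==> i <= Suc (Suc k) ==> Fc K (Suc (Suc k)) i z = cst K (Suc k) b"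
  by (metis le_add1 plus_1_eq_Suc)
 note n = face0_faces[OF K z(1) _ z(2-5), simplified]
 show ?thesis unfolding rel12_def
  by (rule bexI[OF _ n(1)]) (use n s0 s1 t k in auto)
qed

text \<open>Changing a simplex \<open>h\<close> by a cycle \<open>v\<close> without changing its boundary.  If a map \<open>f\<close> identifies
 \<open>v\<close> with \<open>h\<close> up to homotopy, then the image of the difference is null.\<close>

lemma subtract_cycle:
 assumes kK: "kan K" and K: "is_sset K" "b : Sx K 0"
  and kL: "kan L" and L: "is_sset L" and f: "smap K L f" "f 0 b = c" and k: "1 <= k"
  and h: "h : Sx K k" "!!i. 1 <= i ==> i <= k ==> Fc K k i h = cst K (k - 1) b"
  and v: "v : pi_cycles K b k"
  and fh: "f k h : pi_cycles L c k" and r: "rel12 L c k (f k h) (f k v)"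
 obtains h' where "h' : Sx K k" "Fc K k 0 h' = Fc K k 0 h"
  "!!i. 1 <= i ==> i <= k ==> Fc K k i h' = cst K (k - 1) b" "null L c k (f k h')"
proof -
 obtain m where m: "k = Suc m" using k by (cases k) auto
 have L2: "c : Sx L 0" using smap_in[OF f(1) K(2)] f(2) by simp
 have vf: "Fc K k i v = cst K (k - 1) b" if "i <= k" for i using cycle_face[OF v, of i] that m by simp
 have "compat3 K b k h v (cst K k b)"
  unfolding compat3_def using h vf cycle_in[OF v] cst_in[OF K] cst_face[OF K] k m by auto
 from kan_fill3[OF kK K this] obtain z where z: "z : Sx K (Suc k)" "Fc K (Suc k) 1 z = h"
  "Fc K (Suc k) 2 z = v" "2 <= k ==> Fc K (Suc k) 3 z = cst K k b"
  "!!i. 4 <= i ==> i <= Suc k ==> Fc K (Suc k) i z = cst K k b"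
  using k by metis
 note n = face0_faces[OF K z(1) k z(2-5)]
 define h' where "h' = Fc K (Suc k) 0 z"
 have h'1: "Fc K k i h' = cst K (k - 1) b" if i: "1 <= i" "i <= k" for i
 proof -
  consider "i = 1" | "i = 2" "2 <= k" | "3 <= i" "i <= k" using i by linarith
  thus ?thesis using n(3-5) vf[of 0] cst_face[OF K, of 0 m] m unfolding h'_def by cases auto
 qed
 obtain w where w: "w : Sx L (Suc k)" "Fc L (Suc k) 0 w = cst L k c" "Fc L (Suc k) 1 w = f k h"
   "Fc L (Suc k) 2 w = f k v" "!!i. 3 <= i ==> i <= Suc k ==> Fc L (Suc k) i w = cst L k c"
  using r unfolding rel12_def by blast
 define fz where "fz = f (Suc k) z"
 have fz: "fz : Sx L (Suc k)" "!!i. i <= Suc k ==> Fc L (Suc k) i fz = f k (Fc K (Suc k) i z)"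
  unfolding fz_def using smap_in[OF f(1) z(1)] smap_face[OF f(1) z(1)] by auto
 have fc: "f k (cst K k b) = cst L k c" using smap_cst[OF f(1) K] f(2) by simp
 have fz3: "Fc L (Suc k) i fz = cst L k c" if i: "3 <= i" "i <= Suc k" for i
 proof -
  consider "i = 3" "2 <= k" | "4 <= i" "i <= Suc k" using i by linarith
  thus ?thesis using fz(2)[OF i(2)] z(4,5) fc by cases auto
 qed
 have vv: "f k v : pi_cycles L c k" using smap_cycle[OF f(1) K f(2) v] .
 have vf: "Fc L k i (f k v) = cst L m c" if "i <= k" for i using cycle_face[OF vv, of i] that m by simp
 define s where "s = Dg L k 1 (f k v)"
 have s: "s : Sx L (Suc k)" "Fc L (Suc k) 0 s = cst L k c" "Fc L (Suc k) 1 s = f k v" "Fc L (Suc k) 2 s = f k v"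
  "!!i. 3 <= i ==> i <= Suc k ==> Fc L (Suc k) i s = cst L k c"
  unfolding s_def using cycle_in[OF vv] sset_degen[OF L] sset_face_degen[OF L, of "f k v" k 1] vf m
   cst_degen[OF L L2] k by auto
 have "compat3 L c (Suc k) fz w s"
  unfolding compat3_def using fz fz3 s w z k by auto
 from kan_fill3[OF kL L L2 this] obtain y where y: "y : Sx L (Suc (Suc k))" "Fc L (Suc (Suc k)) 1 y = fz"
  "Fc L (Suc (Suc k)) 2 y = w" "2 <= Suc k ==> Fc L (Suc (Suc k)) 3 y = s"
  "!!i. 4 <= i ==> i <= Suc (Suc k) ==> Fc L (Suc (Suc k)) i y = cst L (Suc k) c"
  by (metis le_add1 plus_1_eq_Suc)
 note l = face0_faces[OF L L2 y(1) _ y(2-5), simplified]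
 have "null L c k (f k h')" unfolding null_alt
 proof (intro bexI[OF _ l(1)] conjI allI impI)
  show "Fc L (Suc k) 0 (Fc L (Suc (Suc k)) 0 y) = f k h'" using l(2) fz(2)[of 0] h'_def by simp
  fix i assume "1 <= i & i <= Suc k"
  then consider "i = 1" | "i = 2" | "3 <= i" "i <= Suc k" by linarith
  thus "Fc L (Suc k) i (Fc L (Suc (Suc k)) 0 y) = cst L k c"
   using l w s k by cases auto
 qed
 thus thesis using that[of h'] n(1,2) h'1 unfolding h'_def by blast
qed

lemma cst_face': "is_sset K ==> b : Sx K 0 ==> 0 < n ==> i <= n ==> Fc K n i (cst K n b) = cst K (n - 1) b"
 using cst_face[of K b i "n - 1"] by simp

section \<open>The Yoneda lemma for simplices\<close>

text \<open>A monotone map \<open>[k] \<rightarrow> [r]\<close> is given by the list of the cardinalities of its fibres.  Reading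
 this list from the left, \<open>mono_act\<close> applies the corresponding face and degeneracy operators: the first
 \<open>p\<close> vertices of the current simplex are final, and vertex \<open>p\<close> is the next one to be dropped, kept
 or repeated.\<close>

fun mono_act :: "'x sset => nat list => nat => 'x => 'x" where
 "mono_act K [] p x = x"
| "mono_act K (0 # cs) p x = mono_act K cs p (Fc K (p + length cs) p x)"
| "mono_act K (Suc 0 # cs) p x = mono_act K cs (Suc p) x"
| "mono_act K (Suc (Suc c) # cs) p x = mono_act K (Suc c # cs) (Suc p) (Dg K (p + length cs) p x)"

fun count_dec :: "nat list => nat => nat list" where
 "count_dec [] i = []"
| "count_dec (c # cs) i = (if i < c then (c - 1) # cs else c # count_dec cs (i - c))"

fun count_inc :: "nat list => nat => nat list" where
 "count_inc [] i = []"
| "count_inc (c # cs) i = (if i < c then Suc c # cs else c # count_inc cs (i - c))"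

fun expand :: "nat => nat list => nat list" where
 "expand v [] = []"
| "expand v (c # cs) = replicate c v @ expand (Suc v) cs"

lemma length_dec [simp]: "length (count_dec cs i) = length cs"
 by (induction cs i rule: count_dec.induct) auto

lemma length_inc [simp]: "length (count_inc cs i) = length cs"
 by (induction cs i rule: count_inc.induct) auto

lemma length_expand [simp]: "length (expand v cs) = sum_list cs"
 by (induction v cs rule: expand.induct) auto

lemma mono_act_in:
 "is_sset K ==> Suc m = p + length cs ==> Suc k = p + sum_list cs ==> x : Sx K m ==>
  mono_act K cs p x : Sx K k"
proof (induction K cs p x arbitrary: m rule: mono_act.induct)
 case (2 K cs p x)
 obtain l where l: "m = Suc l" using "2.prems" by (cases m) auto
 have "p + length cs = Suc l" using "2.prems"(2) l by simp
 moreover have "Fc K (Suc l) p x : Sx K l" using "2.prems" l by (intro sset_face) auto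
 ultimately show ?case using "2.IH"[of l] "2.prems"(1-3) by simp
next
 case (3 K cs p x)
 show ?case using "3.IH"[of m] "3.prems" by simp
next
 case (4 K c cs p x)
 have "p + length cs = m" using "4.prems"(2) by simp
 moreover have "Dg K m p x : Sx K (Suc m)" using "4.prems" by (intro sset_degen) auto
 ultimately show ?case using "4.IH"[of "Suc m"] "4.prems"(1,3) by simp
qed auto

lemma mono_act_face_early:
 "is_sset K ==> 1 <= q + sum_list cs ==> x : Sx K (q + length cs) ==> i <= q ==> p = Suc q ==>
  Fc K (q + sum_list cs) i (mono_act K cs p x) = mono_act K cs q (Fc K (q + length cs) i x)"
proof (induction K cs p x arbitrary: q rule: mono_act.induct)
 case (2 K cs p x)
 obtain l where l: "q + length cs = Suc l" using "2.prems" by (cases "q + length cs") auto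
 have x: "x : Sx K (Suc (Suc l))" using "2.prems"(3) l by simp
 have f: "Fc K (Suc (Suc l)) (Suc q) x : Sx K (Suc l)" using "2.prems" l x by (intro sset_face) auto
 have "Fc K (Suc l) i (Fc K (Suc (Suc l)) (Suc q) x) = Fc K (Suc l) q (Fc K (Suc (Suc l)) i x)"
  using sset_face_face[OF "2.prems"(1) x, of i "Suc q"] "2.prems"(4) l by simp
 thus ?case using "2.IH"[of q] "2.prems" f l by simp
next
 case (3 K cs p x)
 show ?case using "3.IH"[of "Suc q"] "3.prems" by simp
next
 case (4 K c cs p x)
 define m where "m = Suc (q + length cs)"
 have x: "x : Sx K m" using "4.prems"(3) m_def by simp
 have d: "Dg K m (Suc q) x : Sx K (Suc m)" using "4.prems" x by (intro sset_degen) (auto simp: m_def)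
 have "Fc K (Suc m) i (Dg K m (Suc q) x) = Dg K (m - 1) q (Fc K m i x)"
  using sset_face_degen[OF "4.prems"(1) x, of "Suc q" i] "4.prems"(4) by (auto simp: m_def)
 thus ?case using "4.IH"[of "Suc q"] "4.prems" d by (simp add: m_def)
qed auto

lemma mono_act_face:
 "is_sset K ==> 2 <= p + sum_list cs ==> x : Sx K m ==> Suc m = p + length cs ==> i < sum_list cs ==>
  Fc K (p + sum_list cs - 1) (p + i) (mono_act K cs p x) = mono_act K (count_dec cs i) p x"
proof (induction K cs p x arbitrary: m i rule: mono_act.induct)
 case (2 K cs p x)
 obtain l where l: "m = Suc l" using "2.prems" by (cases m) auto
 have e: "p + length cs = Suc l" using "2.prems"(4) l by simp
 have f: "Fc K (p + length cs) p x : Sx K l" unfolding e using "2.prems" l by (intro sset_face) auto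
 show ?case using "2.IH"[OF "2.prems"(1) _ f e[symmetric], of i] "2.prems"(2,5) by simp
next
 case (3 K cs p x)
 show ?case
 proof (cases i)
  case 0
  thus ?thesis using mono_act_face_early[of K p cs x p "Suc p"] "3.prems"(1-5) by simp
 next
  case (Suc j)
  thus ?thesis using "3.IH"[of m j] "3.prems"(1-5) by simp
 qed
next
 case (4 K c cs p x)
 have m: "p + length cs = m" using "4.prems"(4) by simp
 have d: "Dg K m p x : Sx K (Suc m)" using "4.prems" m by (intro sset_degen) auto
 show ?case
 proof (cases i)
  case 0
  have "Fc K (Suc m) p (Dg K m p x) = x"
   using sset_face_degen[OF "4.prems"(1) "4.prems"(3), of p p] m by auto
  thus ?thesis using mono_act_face_early[of K p "Suc c # cs" "Dg K m p x" p "Suc p"] "4.prems"(1,2,5) 0 d m by simp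
 next
  case (Suc j)
  have IH: "Fc K (p + sum_list (Suc (Suc c) # cs) - 1) (p + i) (mono_act K (Suc (Suc c) # cs) p x) =
    mono_act K (count_dec (Suc c # cs) j) (Suc p) (Dg K m p x)"
   using "4.IH"[of "Suc m" j] "4.prems"(1,2,5) Suc d m by simp
  have "Fc K (Suc m) (Suc p) (Dg K m p x) = x"
   using sset_face_degen[OF "4.prems"(1) "4.prems"(3), of p "Suc p"] m by auto
  thus ?thesis unfolding IH using Suc m by (cases c) auto
 qed
qed auto

lemma mono_act_degen_early:
 "is_sset K ==> x : Sx K (q + length cs) ==> i <= q ==> p = Suc q ==>
  Dg K (q + sum_list cs) i (mono_act K cs p x) = mono_act K cs (Suc (Suc q)) (Dg K (q + length cs) i x)"
proof (induction K cs p x arbitrary: q rule: mono_act.induct)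
 case (2 K cs p x)
 define l where "l = q + length cs"
 have x: "x : Sx K (Suc l)" using "2.prems"(2) l_def by simp
 have f: "Fc K (Suc l) (Suc q) x : Sx K l" using "2.prems" l_def x by (intro sset_face) auto
 have "Fc K (Suc (Suc l)) (Suc (Suc q)) (Dg K (Suc l) i x) = Dg K l i (Fc K (Suc l) (Suc q) x)"
  using sset_face_degen[OF "2.prems"(1) x, of i "Suc (Suc q)"] "2.prems"(3) l_def by auto
 thus ?case using "2.IH"[of q] "2.prems" f by (simp add: l_def)
next
 case (3 K cs p x)
 show ?case using "3.IH"[of "Suc q"] "3.prems" by simp
next
 case (4 K c cs p x)
 define m where "m = Suc (q + length cs)"
 have x: "x : Sx K m" using "4.prems"(2) m_def by simp
 have d: "Dg K m (Suc q) x : Sx K (Suc m)" using "4.prems" x by (intro sset_degen) (auto simp: m_def)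
 have "Dg K (Suc m) i (Dg K m (Suc q) x) = Dg K (Suc m) (Suc (Suc q)) (Dg K m i x)"
  using sset_degen_degen[OF "4.prems"(1) x, of i "Suc q"] "4.prems"(3) by (auto simp: m_def)
 thus ?case using "4.IH"[of "Suc q"] "4.prems" d by (simp add: m_def)
qed auto

lemma mono_act_degen:
 "is_sset K ==> x : Sx K m ==> Suc m = p + length cs ==> i < sum_list cs ==>
  Dg K (p + sum_list cs - 1) (p + i) (mono_act K cs p x) = mono_act K (count_inc cs i) p x"
proof (induction K cs p x arbitrary: m i rule: mono_act.induct)
 case (2 K cs p x)
 have "cs ~= []" using "2.prems"(4) by auto
 then obtain l where l: "m = Suc l" using "2.prems"(3) by (cases m; cases cs) auto
 have e: "p + length cs = Suc l" using "2.prems"(3) l by simp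
 have f: "Fc K (p + length cs) p x : Sx K l" unfolding e using "2.prems" l by (intro sset_face) auto
 show ?case using "2.IH"[OF "2.prems"(1) f e[symmetric], of i] "2.prems"(4) by simp
next
 case (3 K cs p x)
 show ?case
 proof (cases i)
  case 0
  thus ?thesis using mono_act_degen_early[of K x p cs p "Suc p"] "3.prems"(1-4) by simp
 next
  case (Suc j)
  thus ?thesis using "3.IH"[of m j] "3.prems"(1-4) by simp
 qed
next
 case (4 K c cs p x)
 have m: "p + length cs = m" using "4.prems"(3) by simp
 have d: "Dg K m p x : Sx K (Suc m)" using "4.prems" m by (intro sset_degen) auto
 show ?case
 proof (cases i)
  case 0
  have "Dg K (Suc m) p (Dg K m p x) = Dg K (Suc m) (Suc p) (Dg K m p x)"
   using sset_degen_degen[OF "4.prems"(1) "4.prems"(2), of p p] m by auto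
  thus ?thesis using mono_act_degen_early[of K "Dg K m p x" p "Suc c # cs" p "Suc p"] "4.prems"(1,4) 0 d m by simp
 next
  case (Suc j)
  have IH: "Dg K (p + sum_list (Suc (Suc c) # cs) - 1) (p + i) (mono_act K (Suc (Suc c) # cs) p x) =
    mono_act K (count_inc (Suc c # cs) j) (Suc p) (Dg K m p x)"
   using "4.IH"[of "Suc m" j] "4.prems"(1,4) Suc d m by simp
  show ?thesis unfolding IH using Suc m by auto
 qed
qed auto

lemma smap_mono_act:
 "is_sset K ==> smap K L f ==> Suc m = p + length cs ==> Suc k = p + sum_list cs ==> x : Sx K m ==>
  f k (mono_act K cs p x) = mono_act L cs p (f m x)"
proof (induction K cs p x arbitrary: m rule: mono_act.induct)
 case (2 K cs p x)
 obtain l where l: "m = Suc l" using "2.prems" by (cases m) auto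
 have e: "p + length cs = Suc l" using "2.prems"(3) l by simp
 have "Fc K (Suc l) p x : Sx K l" using "2.prems" l by (intro sset_face) auto
 moreover have "f l (Fc K (Suc l) p x) = Fc L (Suc l) p (f (Suc l) x)"
  using smap_face[OF "2.prems"(2), of x l p] "2.prems"(5) l e by simp
 ultimately show ?case using "2.IH"[of l] "2.prems"(1,2,4) l e by simp
next
 case (3 K cs p x)
 show ?case using "3.IH"[of m] "3.prems" by simp
next
 case (4 K c cs p x)
 have e: "p + length cs = m" using "4.prems"(3) by simp
 have "Dg K m p x : Sx K (Suc m)" using "4.prems" by (intro sset_degen) auto
 moreover have "f (Suc m) (Dg K m p x) = Dg L m p (f m x)"
  using smap_degen[OF "4.prems"(2), of x m p] "4.prems"(5) e by simp
 ultimately show ?case using "4.IH"[of "Suc m"] "4.prems"(1,2,4) e by simp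
qed auto

lemma Delta_Sx: "xs : Sx (Delta r) k \<longleftrightarrow> length xs = Suc k & sorted xs & set xs \<subseteq> {0..r}"
 by (simp add: Delta_def)

lemma Delta_Fc: "Fc (Delta r) k i xs = take i xs @ drop (Suc i) xs"
 by (simp add: Delta_def)

lemma Delta_Dg: "Dg (Delta r) k i xs = take (Suc i) xs @ drop i xs"
 by (simp add: Delta_def)

lemma sorted_remove: "sorted xs ==> sorted (take i xs @ drop (Suc i) xs)"
proof -
 assume s: "sorted xs"
 have "take i xs @ drop (Suc i) xs = nths xs {j. j ~= i}"
 proof (induction xs arbitrary: i)
  case (Cons x xs)
  have "nths xs (UNIV :: nat set) = xs" by (simp add: nths_all)
  thus ?case using Cons[of "i - 1"] by (cases i) (auto simp: nths_Cons)
 qed simp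
 thus ?thesis using sorted_nths[OF s] by simp
qed

lemma sorted_repeat: "sorted xs ==> sorted (take (Suc i) xs @ drop i xs)"
proof (induction xs arbitrary: i)
 case (Cons x xs)
 show ?case
 proof (cases i)
  case (Suc j)
  have "set (take (Suc j) xs @ drop j xs) \<subseteq> set xs" using set_take_subset set_drop_subset by fastforce
  thus ?thesis using Cons Suc by fastforce
 qed (use Cons in auto)
qed simp

lemma split_list_at:
 assumes "i < length xs"
 obtains ys a zs where "xs = ys @ a # zs" "length ys = i"
 using id_take_nth_drop[OF assms] assms by (metis length_take min.absorb4)

lemma split_list_at2:
 assumes "i < j" "j < length xs"
 obtains ys a zs b ws where "xs = ys @ a # zs @ b # ws" "length ys = i" "j = Suc (i + length zs)"
proof -
 obtain ys a us where u: "xs = ys @ a # us" "length ys = i"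
  by (rule split_list_at[of i xs]) (use assms in auto)
 obtain zs b ws where "us = zs @ b # ws" "length zs = j - Suc i"
  by (rule split_list_at[of "j - Suc i" us]) (use assms u in auto)
 thus thesis using that u assms by simp
qed

lemma list_remove_remove:
 assumes "i < j" "j < length xs"
 shows "take i (take j xs @ drop (Suc j) xs) @ drop (Suc i) (take j xs @ drop (Suc j) xs) =
  take (j - 1) (take i xs @ drop (Suc i) xs) @ drop (Suc (j - 1)) (take i xs @ drop (Suc i) xs)"
 by (rule split_list_at2[OF assms]) auto

lemma list_repeat_repeat:
 assumes "i <= j" "j < length xs"
 shows "take (Suc i) (take (Suc j) xs @ drop j xs) @ drop i (take (Suc j) xs @ drop j xs) =
  take (Suc (Suc j)) (take (Suc i) xs @ drop i xs) @ drop (Suc j) (take (Suc i) xs @ drop i xs)"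
proof (cases "i = j")
 case True
 show ?thesis by (rule split_list_at[OF assms(2)]) (auto simp: True)
next
 case False
 hence "i < j" using assms by simp
 thus ?thesis by (rule split_list_at2[OF _ assms(2)]) (auto simp: eval_nat_numeral)
qed

lemma list_remove_repeat:
 assumes "j < length xs" "i <= length xs"
 shows "take i (take (Suc j) xs @ drop j xs) @ drop (Suc i) (take (Suc j) xs @ drop j xs) =
  (if i < j then take (Suc (j - 1)) (take i xs @ drop (Suc i) xs) @ drop (j - 1) (take i xs @ drop (Suc i) xs)
     else if i <= Suc j then xs
     else take (Suc j) (take (i - 1) xs @ drop (Suc (i - 1)) xs) @ drop j (take (i - 1) xs @ drop (Suc (i - 1)) xs))"
proof -
 consider "i < j" | "i = j" | "i = Suc j" | "Suc j < i" by linarith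
 thus ?thesis
 proof cases
  case 1
  thus ?thesis by (rule split_list_at2[OF _ assms(1)]) (auto simp: 1)
 next
  case 2
  show ?thesis by (rule split_list_at[OF assms(1)]) (auto simp: 2)
 next
  case 3
  show ?thesis by (rule split_list_at[OF assms(1)]) (auto simp: 3)
 next
  case 4
  then obtain l where l: "i = Suc l" by (cases i) auto
  have "j < l" "l < length xs" using 4 l assms by auto
  thus ?thesis by (rule split_list_at2) (auto simp: l eval_nat_numeral)
 qed
qed

lemma is_sset_Delta: "is_sset (Delta r)"
 unfolding is_sset_def Delta_Fc Delta_Dg
proof (intro conjI allI ballI impI, goal_cases)
 case (1 n xs i)
 thus ?case using set_take_subset[of i xs] set_drop_subset[of "Suc i" xs]
  by (auto simp: Delta_Sx sorted_remove)
next
 case (2 n xs i)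
 thus ?case using set_take_subset[of "Suc i" xs] set_drop_subset[of i xs]
  by (auto simp: Delta_Sx sorted_repeat)
next
 case (3 n xs i j)
 thus ?case by (intro list_remove_remove) (auto simp: Delta_Sx)
next
 case (4 n xs j i)
 thus ?case by (intro list_remove_repeat) (auto simp: Delta_Sx)
next
 case (5 n xs i j)
 thus ?case by (intro list_repeat_repeat) (auto simp: Delta_Sx)
qed

lemma expand_dec: "i < sum_list cs ==>
  expand v (count_dec cs i) = take i (expand v cs) @ drop (Suc i) (expand v cs)"
proof (induction v cs arbitrary: i rule: expand.induct)
 case (2 v c cs)
 show ?case
 proof (cases "i < c")
  case True
  then obtain d where c: "c = i + Suc d" using less_iff_Suc_add by auto
  have "replicate c v = replicate i v @ v # replicate d v" "replicate (c - 1) v = replicate i v @ replicate d v"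
   using replicate_add[of i "Suc d" v] replicate_add[of i d v] c by simp_all
  thus ?thesis using True by simp
 next
  case False
  thus ?thesis using 2 by (auto simp: Suc_diff_le)
 qed
qed simp

lemma expand_inc: "i < sum_list cs ==>
  expand v (count_inc cs i) = take (Suc i) (expand v cs) @ drop i (expand v cs)"
proof (induction v cs arbitrary: i rule: expand.induct)
 case (2 v c cs)
 show ?case
 proof (cases "i < c")
  case True
  then obtain d where c: "c = i + Suc d" using less_iff_Suc_add by auto
  have r: "replicate (Suc i) v = replicate i v @ [v]" by (simp add: replicate_append_same)
  have "replicate c v = replicate i v @ v # replicate d v" using replicate_add[of i "Suc d" v] c by simp
  moreover have "replicate (Suc c) v = replicate (Suc i) v @ v # replicate d v"
   using replicate_add[of "Suc i" "Suc d" v] c by simp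
  ultimately show ?thesis using True r by simp
 next
  case False
  thus ?thesis using 2 by (auto simp: Suc_diff_le)
 qed
qed simp

lemma set_expand: "set (expand v cs) \<subseteq> {v..<v + length cs}"
 by (induction v cs rule: expand.induct) (auto simp: subset_iff)

lemma count_expand: "map (count_list (expand v cs)) [v..<v + length cs] = cs"
proof (induction v cs rule: expand.induct)
 case (2 v c cs)
 have "v ~: set (expand (Suc v) cs)" using set_expand[of "Suc v" cs] by auto
 hence v: "count_list (expand (Suc v) cs) v = 0" by simp
 have r: "count_list (replicate c v) w = (if w = v then c else 0)" for w by (induction c) auto
 have A: "map (count_list (expand v (c # cs))) [Suc v..<Suc v + length cs] =
   map (count_list (expand (Suc v) cs)) [Suc v..<Suc v + length cs]"
  by (intro map_cong) (auto simp: r)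
 have B: "count_list (expand v (c # cs)) v = c" using v r by simp
 have C: "[v..<v + length (c # cs)] = v # [Suc v..<Suc v + length cs]" by (simp add: upt_conv_Cons del: upt_Suc)
 have "map (count_list (expand v (c # cs))) [v..<v + length (c # cs)] =
   c # map (count_list (expand (Suc v) cs)) [Suc v..<Suc v + length cs]"
  by (simp only: C list.map B A)
 thus ?case by (simp only: 2)
qed simp

lemma expand_count:
 "sorted xs ==> set xs \<subseteq> {v..<v + n} ==> expand v (map (count_list xs) [v..<v + n]) = xs"
proof (induction n arbitrary: v xs)
 case (Suc n)
 define ys where "ys = dropWhile (%x. x = v) xs"
 have tw: "takeWhile (%x. x = v) xs = replicate (length (takeWhile (%x. x = v) xs)) v"
  by (rule replicate_eqI[symmetric, OF refl, symmetric]) (auto dest: set_takeWhileD)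
 define c where "c = length (takeWhile (%x. x = v) xs)"
 have xs: "xs = replicate c v @ ys" using tw takeWhile_dropWhile_id[of "%x. x = v" xs] unfolding ys_def c_def by metis
 have s: "sorted ys" using Suc.prems(1) unfolding xs by (simp add: sorted_append)
 have ne: "v ~: set ys"
 proof (cases ys)
  case (Cons y zs)
  have "y ~= v" using hd_dropWhile[of "%x. x = v" xs] Cons unfolding ys_def by (cases "dropWhile (%x. x = v) xs") auto
  moreover have "v <= y" using Suc.prems(2) Cons xs by auto
  ultimately show ?thesis using s Cons by auto
 qed simp
 have ys: "set ys \<subseteq> {Suc v..<Suc v + n}" using Suc.prems(2) ne xs by (auto simp: Suc_le_eq order_le_less)
 have r: "count_list (replicate c v) w = (if w = v then c else 0)" for w by (induction c) auto
 have A: "map (count_list xs) [Suc v..<Suc v + n] = map (count_list ys) [Suc v..<Suc v + n]"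
  by (intro map_cong) (auto simp: r xs)
 have B: "count_list xs v = c" using ne by (simp add: xs r)
 have C: "[v..<v + Suc n] = v # [Suc v..<Suc v + n]" by (simp add: upt_conv_Cons del: upt_Suc)
 have "expand v (map (count_list xs) [v..<v + Suc n]) = replicate c v @ ys"
  by (simp only: C list.map A B expand.simps Suc.IH[OF s ys])
 thus ?case by (simp only: xs[symmetric])
qed simp

definition yoneda :: "'x sset => nat => 'x => nat => nat list => 'x" where
 "yoneda K r x k xs = (if xs : Sx (Delta r) k then mono_act K (map (count_list xs) [0..<Suc r]) 0 x else undefined)"

lemma counts_sum:
 assumes "xs : Sx (Delta r) k"
 shows "sum_list (map (count_list xs) [0..<Suc r]) = Suc k"
proof -
 have "expand 0 (map (count_list xs) [0..<0 + Suc r]) = xs"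
  using assms by (intro expand_count) (auto simp: Delta_Sx)
 from arg_cong[OF this, of length] show ?thesis using assms by (simp add: Delta_Sx del: upt_Suc)
qed

lemma yoneda_smap:
 assumes K: "is_sset K" and x: "x : Sx K r"
 shows "yoneda K r x : smaps (Delta r) K"
proof -
 have e: "expand 0 (map (count_list xs) [0..<Suc r]) = xs" if "xs : Sx (Delta r) k" for xs k
 proof -
  have "expand 0 (map (count_list xs) [0..<0 + Suc r]) = xs"
   using that by (intro expand_count) (auto simp: Delta_Sx)
  thus ?thesis by (simp del: upt_Suc)
 qed
 have c: "map (count_list (expand 0 cs)) [0..<Suc r] = cs" if "length cs = Suc r" for cs
  using count_expand[of 0 cs] that by (simp del: upt_Suc)
 show ?thesis unfolding smaps_def smap_def
 proof (intro CollectI conjI allI ballI impI)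
  fix k xs assume xs: "xs : Sx (Delta r) k"
  define cs where "cs = map (count_list xs) [0..<Suc r]"
  have cs: "length cs = Suc r" "sum_list cs = Suc k" "expand 0 cs = xs"
   using counts_sum[OF xs] e[OF xs] unfolding cs_def by auto
  have y: "yoneda K r x k xs = mono_act K cs 0 x" using xs by (simp add: yoneda_def cs_def)
  show "yoneda K r x k xs : Sx K k" unfolding y using mono_act_in[OF K, of r 0 cs k x] cs x by simp
  {
   fix i assume i: "i <= k"
   have d: "Dg (Delta r) k i xs : Sx (Delta r) (Suc k)" using sset_degen[OF is_sset_Delta xs i] .
   have "expand 0 (count_inc cs i) = Dg (Delta r) k i xs" using expand_inc[of i cs 0] cs i by (simp add: Delta_Dg)
   hence "yoneda K r x (Suc k) (Dg (Delta r) k i xs) = mono_act K (count_inc cs i) 0 x"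
    using d c[of "count_inc cs i"] cs by (simp add: yoneda_def del: upt_Suc)
   thus "yoneda K r x (Suc k) (Dg (Delta r) k i xs) = Dg K k i (yoneda K r x k xs)"
    unfolding y using mono_act_degen[OF K x, of 0 cs i] cs i by simp
  next
   fix i assume k: "0 < k" and i: "i <= k"
   then obtain l where l: "k = Suc l" by (cases k) auto
   have d: "Fc (Delta r) k i xs : Sx (Delta r) (k - 1)"
    using sset_face[OF is_sset_Delta, of xs r l i] xs i l by simp
   have "expand 0 (count_dec cs i) = Fc (Delta r) k i xs" using expand_dec[of i cs 0] cs i by (simp add: Delta_Fc)
   hence "yoneda K r x (k - 1) (Fc (Delta r) k i xs) = mono_act K (count_dec cs i) 0 x"
    using d c[of "count_dec cs i"] cs by (simp add: yoneda_def del: upt_Suc)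
   thus "yoneda K r x (k - 1) (Fc (Delta r) k i xs) = Fc K k i (yoneda K r x k xs)"
    unfolding y using mono_act_face[OF K, of 0 cs x r i] cs i l x by simp
  }
 next
  fix n xs assume "xs ~: Sx (Delta r) n"
  thus "yoneda K r x n xs = undefined" by (simp add: yoneda_def)
 qed
qed

lemma mono_act_Delta:
 "K = Delta r ==> p = length pre ==> x = pre @ [v..<v + length cs] ==> mono_act K cs p x = pre @ expand v cs"
proof (induction K cs p x arbitrary: pre v rule: mono_act.induct)
 case (2 K cs p x)
 have "Fc K (p + length cs) p x = pre @ [Suc v..<Suc v + length cs]"
  unfolding "2.prems" by (simp add: Delta_Fc upt_conv_Cons del: upt_Suc)
 from "2.IH"[OF "2.prems"(1,2) this] show ?case by simp
next
 case (3 K cs p x)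
 have "x = (pre @ [v]) @ [Suc v..<Suc v + length cs]" "Suc p = length (pre @ [v])"
  unfolding "3.prems" by (simp_all add: upt_conv_Cons del: upt_Suc)
 from "3.IH"[OF "3.prems"(1) this(2,1)] show ?case by simp
next
 case (4 K c cs p x)
 have "Dg K (p + length cs) p x = (pre @ [v]) @ [v..<v + length (Suc c # cs)]" "Suc p = length (pre @ [v])"
  unfolding "4.prems" by (simp_all add: Delta_Dg upt_conv_Cons del: upt_Suc)
 from "4.IH"[OF "4.prems"(1) this(2,1)] show ?case by simp
qed simp

lemma top_simplex_in: "[0..<Suc r] : Sx (Delta r) r"
 by (auto simp: Delta_Sx simp del: upt_Suc)

lemma smap_Delta_eq:
 assumes f: "smap (Delta r) K f" and xs: "xs : Sx (Delta r) k"
 shows "f k xs = mono_act K (map (count_list xs) [0..<Suc r]) 0 (f r [0..<Suc r])"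
proof -
 let ?cs = "map (count_list xs) [0..<Suc r]"
 have "expand 0 (map (count_list xs) [0..<0 + Suc r]) = xs"
  using xs by (intro expand_count) (auto simp: Delta_Sx)
 hence "mono_act (Delta r) ?cs 0 [0..<Suc r] = xs"
  using mono_act_Delta[OF refl, of 0 "[]" "[0..<Suc r]" 0 ?cs r] by (simp del: upt_Suc)
 moreover have "f k (mono_act (Delta r) ?cs 0 [0..<Suc r]) = mono_act K ?cs 0 (f r [0..<Suc r])"
  using counts_sum[OF xs] by (intro smap_mono_act[OF is_sset_Delta f _ _ top_simplex_in]) auto
 ultimately show ?thesis by simp
qed

text \<open>A simplicial map from a standard simplex is determined by the image of the top simplex, because every
 simplex arises from it by the operators of \<open>mono_act\<close>.\<close>

lemma yoneda_unique:
 assumes f: "smap (Delta r) K f" and xs: "xs : Sx (Delta r) k"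
 shows "f k xs = yoneda K r (f r [0..<Suc r]) k xs"
 using smap_Delta_eq[OF f xs] xs by (simp add: yoneda_def del: upt_Suc)

lemma yoneda_top: 
 assumes "is_sset K" "x : Sx K r"
 shows "yoneda K r x r [0..<Suc r] = x"
proof -
 have "expand v (replicate n 1) = [v..<v + n]" for v n
  by (induction n arbitrary: v) (simp_all add: upt_conv_Cons del: upt_Suc)
 hence c: "map (count_list [0..<Suc r]) [0..<Suc r] = replicate (Suc r) 1"
  using count_expand[of 0 "replicate (Suc r) 1"] by (simp del: upt_Suc replicate_Suc)
 have "mono_act K (replicate n 1) p x = x" for n p by (induction n arbitrary: p) auto
 thus ?thesis using top_simplex_in unfolding yoneda_def c by simp
qed

lemma finite_Delta: "finite (Sx (Delta r) k)"
proof (rule finite_subset)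
 show "Sx (Delta r) k \<subseteq> {xs. set xs \<subseteq> {0..r} & length xs = Suc k}" by (auto simp: Delta_Sx subset_eq)
qed (rule finite_lists_length_eq, simp)

section \<open>Quotients and spheres\<close>

definition subcomplex :: "'x sset => (nat => 'x set) => bool" where
 "subcomplex K L \<longleftrightarrow> (ALL n. L n \<subseteq> Sx K n) &
     (ALL n. ALL x:L (Suc n). ALL i<=Suc n. Fc K (Suc n) i x : L n) &
     (ALL n. ALL x:L n. ALL i<=n. Dg K n i x : L (Suc n))"

definition to_quot :: "(nat => 'x set) => nat => 'x => 'x option" where
 "to_quot L n x = (if x : L n then None else Some x)"

lemma squot_Sx: "Sx (squot K L) n = insert None (Some ` (Sx K n - L n))"
 and squot_None: "Fc (squot K L) n i None = None" "Dg (squot K L) n i None = None"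
 and squot_Some: "Fc (squot K L) n i (Some x) = to_quot L (n - 1) (Fc K n i x)"
  "Dg (squot K L) n i (Some x) = to_quot L (Suc n) (Dg K n i x)"
 by (simp_all add: squot_def to_quot_def)

lemma cst_squot: "cst (squot K L) n None = None"
 by (induction n) (simp_all add: squot_None cst.simps(2) del: cst.simps(2)[symmetric])

lemma squot_cases:
 assumes "y : Sx (squot K L) n"
 obtains "y = None" | x where "x : Sx K n" "x ~: L n" "y = Some x" "y = to_quot L n x"
 using assms by (auto simp: squot_Sx to_quot_def)

lemma to_quot_face:
 assumes "subcomplex K L" "x : Sx K (Suc n)" "i <= Suc n"
 shows "Fc (squot K L) (Suc n) i (to_quot L (Suc n) x) = to_quot L n (Fc K (Suc n) i x)"
 using assms by (auto simp: to_quot_def squot_None squot_Some subcomplex_def)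

lemma to_quot_degen:
 assumes "subcomplex K L" "x : Sx K n" "i <= n"
 shows "Dg (squot K L) n i (to_quot L n x) = to_quot L (Suc n) (Dg K n i x)"
 using assms by (auto simp: to_quot_def squot_None squot_Some subcomplex_def)

lemma to_quot_in: "x : Sx K n ==> to_quot L n x : Sx (squot K L) n"
 by (auto simp: to_quot_def squot_Sx)

lemma smap_to_quot: "is_sset K ==> subcomplex K L ==> smap K (squot K L) (to_quot L)"
 unfolding smap_def
proof (intro allI ballI conjI impI)
 fix n x i assume a: "is_sset K" "subcomplex K L" "x : Sx K n" "0 < n" "i <= n"
 then obtain m where "n = Suc m" by (cases n) auto
 thus "to_quot L (n - 1) (Fc K n i x) = Fc (squot K L) n i (to_quot L n x)" using a to_quot_face by fastforce
qed (auto simp: to_quot_degen to_quot_in)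

lemma is_sset_squot:
 assumes K: "is_sset K" and L: "subcomplex K L"
 shows "is_sset (squot K L)"
 unfolding is_sset_def
proof (intro conjI allI ballI impI, goal_cases)
 case (1 n y i)
 from 1(1) show ?case
 proof (cases rule: squot_cases)
  case (2 x)
  show ?thesis unfolding 2(4) using 2(1) 1(2) by (simp add: to_quot_face[OF L] to_quot_in sset_face[OF K])
 qed (simp add: squot_None squot_Sx)
next
 case (2 n y i)
 from 2(1) show ?case
 proof (cases rule: squot_cases)
  case (2 x)
  show ?thesis unfolding 2(4) using 2(1) \<open>i <= n\<close> by (simp add: to_quot_degen[OF L] to_quot_in sset_degen[OF K])
 qed (simp add: squot_None squot_Sx)
next
 case (3 n y i j)
 from 3(1) show ?case
 proof (cases rule: squot_cases)
  case (2 x)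
  have "i <= Suc (Suc n)" "j <= Suc (Suc n)" "i <= Suc n" "j - 1 <= Suc n" using 3(2) by auto
  thus ?thesis unfolding 2(4)
   using 3(2) 2(1) sset_face_face[OF K 2(1), of i j] sset_face[OF K 2(1)] by (simp add: to_quot_face[OF L])
 qed (simp add: squot_None)
next
 case (4 n y j i)
 from 4(1) show ?case
 proof (cases rule: squot_cases)
  case (2 x)
  have f: "Fc (squot K L) n l (to_quot L n x) = to_quot L (n - 1) (Fc K n l x)" "Fc K n l x : Sx K (n - 1)"
   if "0 < n" "l <= n" for l
   using that to_quot_face[OF L, of x "n - 1" l] sset_face[OF K, of x "n - 1" l] 2(1) by auto
  have d: "Dg (squot K L) (n - 1) l (to_quot L (n - 1) z) = to_quot L n (Dg K (n - 1) l z)"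
   if "0 < n" "l <= n - 1" "z : Sx K (n - 1)" for l z
   using that to_quot_degen[OF L that(3,2)] by simp
  have "Fc (squot K L) (Suc n) i (Dg (squot K L) n j y) = to_quot L n (Fc K (Suc n) i (Dg K n j x))"
   unfolding 2(4) using 4 2(1) to_quot_degen[OF L] to_quot_face[OF L] sset_degen[OF K] by simp
  also have "\<dots> = (if i < j then Dg (squot K L) (n - 1) (j - 1) (Fc (squot K L) n i y)
         else if i <= Suc j then y
         else Dg (squot K L) (n - 1) j (Fc (squot K L) n (i - 1) y))"
   unfolding sset_face_degen[OF K 2(1) 4(2,3)] using 4(2,3) f[of i] f[of "i - 1"] d[of "j - 1" "Fc K n i x"]
    d[of j "Fc K n (i - 1) x"] 2(4) by auto
  finally show ?thesis .
 qed (simp add: squot_None)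
next
 case (5 n y i j)
 from 5(1) show ?case
 proof (cases rule: squot_cases)
  case (2 x)
  show ?thesis unfolding 2(4)
   using 5(2) 2(1) sset_degen_degen[OF K 2(1), of i j] sset_degen[OF K 2(1)] by (simp add: to_quot_degen[OF L])
 qed (simp add: squot_None)
qed

definition from_quot :: "'y sset => 'y => (nat => 'x => 'y) => nat => 'x option => 'y" where
 "from_quot P b f n y = (case y of None => cst P n b | Some x => f n x)"

lemma smap_from_quot:
 assumes P: "is_sset P" "b : Sx P 0" and f: "smap K P f" and z: "!!n x. x : L n ==> f n x = cst P n b"
 shows "smap (squot K L) P (from_quot P b f)"
 unfolding smap_def
proof (intro allI ballI, goal_cases)
 case (1 n y)
 from 1 show ?case
 proof (cases rule: squot_cases)
  case 1
  have "Fc P n i (cst P n b) = cst P (n - 1) b" if "0 < n" "i <= n" for i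
   using cst_face[OF P, of i "n - 1"] that by simp
  thus ?thesis by (auto simp: 1 from_quot_def squot_None cst_in[OF P] cst_degen[OF P])
 next
  case (2 x)
  have q: "from_quot P b f m (to_quot L m w) = f m w" for m w
   using z by (auto simp: from_quot_def to_quot_def)
  have "from_quot P b f n y = f n x" by (simp add: 2 from_quot_def)
  moreover have "f (n - 1) (Fc K n i x) = Fc P n i (f n x)" if "0 < n" "i <= n" for i
   using smap_face[OF f, of x "n - 1" i] that 2(1) by simp
  ultimately show ?thesis unfolding 2(3)
   using smap_in[OF f 2(1)] smap_degen[OF f 2(1)] by (auto simp: squot_Some q)
 qed
qed

lemma subcomplex_sphere: "subcomplex (Delta n) (%k. {xs : Sx (Delta n) k. \<not> {0..n} \<subseteq> set xs})"
proof -
 have "set (Fc (Delta n) k i xs) \<subseteq> set xs" "set (Dg (Delta n) k i xs) \<subseteq> set xs" for k i xs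
  using set_take_subset[of i xs] set_drop_subset[of "Suc i" xs] set_take_subset[of "Suc i" xs] set_drop_subset[of i xs]
  unfolding Delta_Fc Delta_Dg set_append by blast+
 hence "\<not> {0..n} \<subseteq> set xs ==> \<not> {0..n} \<subseteq> set (Fc (Delta n) k i xs)"
  "\<not> {0..n} \<subseteq> set xs ==> \<not> {0..n} \<subseteq> set (Dg (Delta n) k i xs)" for k i xs by blast+
 thus ?thesis unfolding subcomplex_def
  using sset_face[OF is_sset_Delta] sset_degen[OF is_sset_Delta] by simp
qed

lemma is_sset_sphere: "is_sset (sphere k)"
 unfolding sphere_def by (rule is_sset_squot[OF is_sset_Delta subcomplex_sphere])

lemma finite_sphere: "finite (Sx (sphere k) m)"
 unfolding sphere_def squot_Sx by (simp add: finite_Delta)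

text \<open>A simplex of a standard simplex that is not surjective factors through a face.\<close>

lemma yoneda_cycle_zero:
 assumes K: "is_sset K" "b : Sx K 0" and z: "z : pi_cycles K b k"
  and xs: "xs : Sx (Delta k) m" "\<not> {0..k} \<subseteq> set xs"
 shows "yoneda K k z m xs = cst K m b"
proof -
 from xs(2) obtain v where "v : {0..k}" and v: "v ~: set xs" by blast
 hence v: "v <= k" "v ~: set xs" by auto
 have "k ~= 0"
 proof
  assume "k = 0"
  thus False using xs by (cases xs) (auto simp: Delta_Sx)
 qed
 then obtain r where k: "k = Suc r" by (cases k) auto
 define d where "d = (%j. if j < v then j else Suc j)"
 define s where "s = (%j. if j < v then j else j - 1)"
 have mono: "d i <= d j" "s i <= s j" if "i <= j" for i j using that by (auto simp: d_def s_def)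
 have srt: "sorted (map f ys)" if "sorted ys" "!!i j. i <= j ==> f i <= f j" for f :: "nat => nat" and ys
  using that by (induction ys) auto
 have D: "smap (Delta r) (Delta k) (%_. map d)"
  unfolding smap_def Delta_Fc Delta_Dg
 proof (intro allI ballI conjI impI)
  fix n ys assume "ys : Sx (Delta r) n"
  thus "map d ys : Sx (Delta k) n"
   using v k srt[of ys d] mono(1) by (auto simp: Delta_Sx subset_eq) (auto simp: d_def)
 qed (auto simp: take_map drop_map)
 have Y: "smap (Delta k) K (yoneda K k z)"
  using yoneda_smap[OF K(1) cycle_in[OF z]] by (simp add: smaps_def)
 have G: "smap (Delta r) K (%n ys. yoneda K k z n (map d ys))" by (rule smap_comp[OF D Y])
 have C: "smap (Delta r) K (%n ys. cst K n b)"
  unfolding smap_def using cst_in[OF K] cst_degen[OF K] cst_face'[OF K] by simp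
 have "map d [0..<Suc r] = Fc (Delta k) k v [0..<Suc k]"
  using v k by (intro nth_equalityI) (auto simp: d_def Delta_Fc nth_append simp del: upt_Suc)
 hence "yoneda K k z r (map d [0..<Suc r]) = cst K r b"
  using smap_face[OF Y[unfolded k] top_simplex_in, of v] cycle_face[OF z, of v] v k
   yoneda_top[OF K(1) cycle_in[OF z]] by simp
 hence *: "yoneda K k z n (map d ys) = cst K n b" if "ys : Sx (Delta r) n" for n ys
  using yoneda_unique[OF G that] yoneda_unique[OF C that] by simp
 have "map s xs : Sx (Delta r) m"
  using xs(1) v k srt[of xs s] mono(2) by (auto simp: Delta_Sx subset_eq) (auto simp: s_def)
 moreover have "d (s x) = x" if "x : set xs" for x
 proof -
  have "x ~= v" using v that by auto
  thus ?thesis by (auto simp: d_def s_def)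
 qed
 hence "map d (map s xs) = xs" by (simp add: map_idI)
 ultimately show ?thesis using *[of "map s xs" m] by simp
qed

text \<open>Pointed maps from a sphere are cycles, since all proper faces of the simplex are collapsed.\<close>

definition sphere_map :: "'x sset => 'x => nat => 'x => nat => nat list option => 'x" where
 "sphere_map K b k z = from_quot K b (yoneda K k z)"

lemma sphere_map_smap:
 assumes K: "is_sset K" "b : Sx K 0" and z: "z : pi_cycles K b k"
 shows "smap (sphere k) K (sphere_map K b k z)"
 unfolding sphere_def sphere_map_def
proof (rule smap_from_quot[OF K])
 show "smap (Delta k) K (yoneda K k z)"
  using yoneda_smap[OF K(1) cycle_in[OF z]] by (simp add: smaps_def)
qed (use yoneda_cycle_zero[OF K z] in auto)

lemma sphere_top_in: "Some [0..<Suc k] : Sx (sphere k) k"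
 unfolding sphere_def squot_Sx using top_simplex_in by (auto simp del: upt_Suc)

lemma sphere_map_top: "is_sset K ==> z : Sx K k ==> sphere_map K b k z k (Some [0..<Suc k]) = z"
 unfolding sphere_map_def from_quot_def using yoneda_top by (simp del: upt_Suc)

lemma sphere_map_unique:
 assumes F: "smap (sphere k) K F" "!!m. F m None = cst K m b" and y: "y : Sx (sphere k) m"
 shows "F m y = sphere_map K b k (F k (Some [0..<Suc k])) m y"
proof -
 define L where "L = (%k'. {xs : Sx (Delta k) k'. \<not> {0..k} \<subseteq> set xs})"
 have S: "sphere k = squot (Delta k) L" by (simp add: sphere_def L_def)
 have "smap (Delta k) (sphere k) (to_quot L)"
  unfolding S using smap_to_quot[OF is_sset_Delta] subcomplex_sphere unfolding L_def .
 hence G: "smap (Delta k) K (%m xs. F m (to_quot L m xs))" by (rule smap_comp[OF _ F(1)])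
 have t: "to_quot L k [0..<Suc k] = Some [0..<Suc k]" by (auto simp: to_quot_def L_def simp del: upt_Suc)
 from y show ?thesis unfolding S
 proof (cases rule: squot_cases)
  case 1
  thus ?thesis using F(2) by (simp add: sphere_map_def from_quot_def)
 next
  case (2 xs)
  hence "F m y = yoneda K k (F k (Some [0..<Suc k])) m xs" using yoneda_unique[OF G 2(1)] t by (simp del: upt_Suc)
  thus ?thesis using 2 by (simp add: sphere_map_def from_quot_def del: upt_Suc)
 qed
qed

lemma sphere_top_cycle:
 assumes "is_sset K" "b : Sx K 0" and F: "smap (sphere k) K F" "!!m. F m None = cst K m b"
 shows "F k (Some [0..<Suc k]) : pi_cycles K b k"
proof -
 have "Some [0..<Suc k] : pi_cycles (sphere k) None k"
  unfolding pi_cycles_def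
 proof (intro CollectI conjI impI allI)
  fix i assume "0 < k" "i <= k"
  hence "i ~: set (Fc (Delta k) k i [0..<Suc k])" "Fc (Delta k) k i [0..<Suc k] : Sx (Delta k) (k - 1)"
   using sset_face[OF is_sset_Delta, of "[0..<Suc k]" k "k - 1" i] top_simplex_in[of k]
   by (auto simp: Delta_Fc in_set_conv_nth simp del: upt_Suc)
  thus "Fc (sphere k) k i (Some [0..<Suc k]) = cst (sphere k) (k - 1) None"
   using \<open>i <= k\<close> unfolding sphere_def cst_squot squot_Some by (auto simp: to_quot_def simp del: upt_Suc)
 qed (rule sphere_top_in)
 thus ?thesis using smap_cycle[OF F(1) is_sset_sphere _ F(2)[of 0, simplified]]
  by (simp add: sphere_def squot_Sx del: upt_Suc)
qed

section \<open>Zero maps, kernels and coproducts\<close>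

lemma cat_id: "category C ==> X : ob C ==> idt C X : ar C X X"
 and cat_comp: "category C ==> X : ob C ==> Y : ob C ==> Z : ob C ==> f : ar C X Y ==> g : ar C Y Z ==>
  cmp C g f : ar C X Z"
 and cat_id_right: "category C ==> X : ob C ==> Y : ob C ==> f : ar C X Y ==> cmp C f (idt C X) = f"
 and cat_id_left: "category C ==> X : ob C ==> Y : ob C ==> f : ar C X Y ==> cmp C (idt C Y) f = f"
 and cat_assoc: "category C ==> X : ob C ==> Y : ob C ==> Z : ob C ==> W : ob C ==> f : ar C X Y ==> g : ar C Y Z ==>
  h : ar C Z W ==> cmp C h (cmp C g f) = cmp C (cmp C h g) f"
 unfolding category_def by simp_all

lemma zero_ob: "is_zero C Z ==> Z : ob C"
 by (simp add: is_zero_def)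

lemma zero_eq_to: "is_zero C Z ==> X : ob C ==> f : ar C X Z ==> g : ar C X Z ==> f = g"
 and zero_eq_from: "is_zero C Z ==> X : ob C ==> f : ar C Z X ==> g : ar C Z X ==> f = g"
 by (auto simp: is_zero_def)

lemma zarr_eq:
 assumes C: "category C" and Z: "is_zero C Z" and X: "X : ob C" "Y : ob C"
  and f: "f : ar C X Z" "g : ar C Z Y"
 shows "zarr C X Y = cmp C g f"
 unfolding zarr_def
proof (rule the_equality)
 show "EX Z' g' h. is_zero C Z' & g' : ar C X Z' & h : ar C Z' Y & cmp C g f = cmp C h g'" using assms by blast
 fix w assume "EX Z' g' h. is_zero C Z' & g' : ar C X Z' & h : ar C Z' Y & w = cmp C h g'"
 then obtain Z' g' h where w: "is_zero C Z'" "g' : ar C X Z'" "h : ar C Z' Y" "w = cmp C h g'" by blast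
 obtain k where k: "k : ar C Z Z'" using Z w(1) zero_ob unfolding is_zero_def by metis
 note o = zero_ob[OF Z] zero_ob[OF w(1)]
 have "cmp C k f = g'" using zero_eq_to[OF w(1) X(1)] cat_comp[OF C X(1) o f(1) k] w(2) by blast
 moreover have "cmp C h k = g" using zero_eq_from[OF Z X(2)] cat_comp[OF C o X(2) k w(3)] f(2) by blast
 ultimately show "w = cmp C g f" using cat_assoc[OF C X(1) o X(2) f(1) k w(3)] w(4) by simp
qed

lemma zarr_in:
 assumes C: "category C" and Z: "is_zero C Z" and X: "X : ob C" "Y : ob C"
 shows "zarr C X Y : ar C X Y"
proof -
 obtain f g where f: "f : ar C X Z" "g : ar C Z Y" using Z X unfolding is_zero_def by metis
 show ?thesis using zarr_eq[OF assms f] cat_comp[OF C X(1) zero_ob[OF Z] X(2) f] by simp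
qed

lemma zarr_post:
 assumes C: "category C" and Z: "is_zero C Z" and X: "X : ob C" "Y : ob C" "W : ob C" and h: "h : ar C Y W"
 shows "cmp C h (zarr C X Y) = zarr C X W"
proof -
 obtain f g where f: "f : ar C X Z" "g : ar C Z Y" using Z X unfolding is_zero_def by metis
 have "cmp C h g : ar C Z W" using cat_comp[OF C zero_ob[OF Z] X(2,3) f(2) h] .
 from zarr_eq[OF C Z X(1,3) f(1) this] show ?thesis
  using zarr_eq[OF C Z X(1,2) f] cat_assoc[OF C X(1) zero_ob[OF Z] X(2,3) f h] by simp
qed

lemma zarr_pre:
 assumes C: "category C" and Z: "is_zero C Z" and X: "X : ob C" "Y : ob C" "W : ob C" and h: "h : ar C W X"
 shows "cmp C (zarr C X Y) h = zarr C W Y"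
proof -
 obtain f g where f: "f : ar C X Z" "g : ar C Z Y" using Z X unfolding is_zero_def by metis
 have "cmp C f h : ar C W Z" using cat_comp[OF C X(3,1) zero_ob[OF Z] h f(1)] .
 from zarr_eq[OF C Z X(3,2) this f(2)] show ?thesis
  using zarr_eq[OF C Z X(1,2) f] cat_assoc[OF C X(3,1) zero_ob[OF Z] X(2) h f] by simp
qed

lemma opp_simps [simp]: "ob (opp C) = ob C" "ar (opp C) X Y = ar C Y X" "idt (opp C) = idt C"
 "cmp (opp C) g f = cmp C f g"
 by (simp_all add: opp_def)

lemma category_opp: "category C ==> category (opp C)"
proof -
 assume C: "category C"
 have "cmp C (cmp C f g) h = cmp C f (cmp C g h)"
  if "X : ob C" "Y : ob C" "Z : ob C" "W : ob C" "f : ar C Y X" "g : ar C Z Y" "h : ar C W Z" for X Y Z W f g h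
  using cat_assoc[OF C that(4,3,2,1) that(7,6,5)] by simp
 thus ?thesis unfolding category_def opp_simps
  using cat_id[OF C] cat_comp[OF C] cat_id_left[OF C] cat_id_right[OF C] by simp
qed

lemma is_zero_opp: "is_zero C Z ==> is_zero (opp C) Z"
 by (auto simp: is_zero_def)

lemma zarr_opp: "category C ==> is_zero C Z ==> X : ob C ==> Y : ob C ==> zarr (opp C) X Y = zarr C Y X"
proof -
 assume a: "category C" "is_zero C Z" "X : ob C" "Y : ob C"
 then obtain f g where f: "f : ar C Y Z" "g : ar C Z X" unfolding is_zero_def by metis
 show ?thesis using zarr_eq[OF a(1,2,4,3) f] zarr_eq[OF category_opp[OF a(1)] is_zero_opp[OF a(2)], of X Y g f] a f by simp
qed

definition is_kernel :: "('o, 'a) cat => 'o => 'o => 'a => 'o => 'a => bool" where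
 "is_kernel C E Y q F j \<longleftrightarrow> F : ob C & j : ar C F E & cmp C q j = zarr C F Y &
     (ALL T:ob C. ALL t:ar C T E. cmp C q t = zarr C T Y --> (EX! h. h : ar C T F & cmp C j h = t))"

lemma small_finite: "infinite (UNIV :: 's set) ==> finite S ==> small (u :: 's itself) S"
 unfolding small_def by (meson finite_lesspoll_infinite)

text \<open>The kernel of \<open>q\<close> is the equalizer of \<open>q\<close> and the zero map, a limit over the category with two objects
 and two parallel arrows.\<close>

lemma kernel_exists:
 assumes C: "category C" and Z: "is_zero C Z" and c: "complete (u :: 's itself) C" and inf: "infinite (UNIV :: 's set)"
  and E: "E : ob C" "Y : ob C" and q: "q : ar C E Y"
 obtains F j where "is_kernel C E Y q F j"
proof -
 obtain a b :: 's where ab: "a ~= b"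
  using inf by (metis (full_types) ex_new_if_finite finite.emptyI finite.insertI insertI1)
 define D :: "('s, 's) cat" where "D = \<lparr>ob = {a, b},
  ar = (%x y. if x = y then {a} else if x = a & y = b then {a, b} else {}),
  idt = (%_. a), cmp = (%g h. if g = a then h else g)\<rparr>"
 define Fo where "Fo = (%x. if x = a then E else Y)"
 define Fa where "Fa = (%x y g. if x = y then idt C (Fo x) else if g = a then zarr C E Y else q)"
 have D: "category D" using ab unfolding category_def D_def by auto
 have z: "zarr C E Y : ar C E Y" by (rule zarr_in[OF C Z E])
 have F: "is_functor D C Fo Fa" using ab E q z unfolding is_functor_def D_def Fo_def Fa_def
  by (auto simp: cat_id[OF C] cat_id_left[OF C] cat_id_right[OF C])
 have "small u (ob D)" "ALL j:ob D. ALL k:ob D. small u (ar D j k)"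
  by (auto intro!: small_finite[OF inf] simp: D_def)
 then obtain L p where L: "is_limit C D Fo Fa L p"
  using c D F unfolding complete_def by blast
 have cone: "is_cone C D Fo Fa T t \<longleftrightarrow> T : ob C & t a : ar C T E & t b : ar C T Y & t b = zarr C T Y &
   cmp C q (t a) = zarr C T Y" for T t
 proof
  assume l: "is_cone C D Fo Fa T t"
  hence 1: "T : ob C" "t a : ar C T E" "t b : ar C T Y"
   using ab unfolding is_cone_def D_def Fo_def by auto
  have "cmp C (zarr C E Y) (t a) = t b" "cmp C q (t a) = t b"
   using l ab unfolding is_cone_def D_def Fo_def Fa_def by (auto split: if_splits)
  thus "T : ob C & t a : ar C T E & t b : ar C T Y & t b = zarr C T Y & cmp C q (t a) = zarr C T Y"
   using 1 zarr_pre[OF C Z E 1(1,2)] by simp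
 next
  assume l: "T : ob C & t a : ar C T E & t b : ar C T Y & t b = zarr C T Y & cmp C q (t a) = zarr C T Y"
  thus "is_cone C D Fo Fa T t"
   using ab E unfolding is_cone_def D_def Fo_def Fa_def
   by (auto simp: cat_id_left[OF C] zarr_pre[OF C Z E])
 qed
 have "is_kernel C E Y q L (p a)" unfolding is_kernel_def
 proof (intro conjI ballI impI)
  have Lc: "is_cone C D Fo Fa L p" using L by (simp add: is_limit_def)
  thus L0: "L : ob C" "p a : ar C L E" "cmp C q (p a) = zarr C L Y" unfolding cone by auto
  fix T t assume t: "T : ob C" "t : ar C T E" "cmp C q t = zarr C T Y"
  let ?t = "%x. if x = a then t else zarr C T Y"
  have "is_cone C D Fo Fa T ?t" unfolding cone using t ab zarr_in[OF C Z t(1) E(2)] by auto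
  hence "EX! h. h : ar C T L & (ALL j:ob D. cmp C (p j) h = ?t j)" using L by (simp add: is_limit_def)
  moreover have "(h : ar C T L & (ALL j:ob D. cmp C (p j) h = ?t j)) \<longleftrightarrow> h : ar C T L & cmp C (p a) h = t" for h
  proof -
   have "cmp C (p b) h = zarr C T Y" if "h : ar C T L"
   proof -
    have "p b = zarr C L Y" using Lc unfolding cone by simp
    thus ?thesis using zarr_pre[OF C Z L0(1) E(2) t(1) that] by simp
   qed
   thus ?thesis using ab by (auto simp: D_def)
  qed
  ultimately show "EX! h. h : ar C T L & cmp C (p a) h = t" by simp
 qed
 thus thesis by (rule that)
qed

lemma coproduct_exists:
 fixes I :: "'i::countable set"
 assumes C: "category C" and c: "complete (u :: 's itself) (opp C)" and inf: "infinite (UNIV :: 's set)"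
  and I: "finite I" "!!i. i : I ==> X i : ob C"
 obtains P inc where "is_coprod C I X P inc"
proof -
 obtain r :: "nat => 's" where r: "inj r" using infinite_countable_subset[OF inf] by blast
 define e where "e = (%i :: 'i. r (to_nat i))"
 have e: "inj e" using inj_compose[OF r inj_to_nat] unfolding e_def comp_def .
 define D :: "('s, 's) cat" where "D = \<lparr>ob = e ` I, ar = (%x y. if x = y then {x} else {}),
  idt = (%x. x), cmp = (%g f. g)\<rparr>"
 define Fo where "Fo = (%x. X (inv_into UNIV e x))"
 have inv: "inv_into UNIV e (e i) = i" for i using e by simp
 have D: "category D" unfolding category_def D_def by auto
 have F: "is_functor D (opp C) Fo (%x y g. idt C (Fo x))"
  using I unfolding is_functor_def D_def Fo_def
  by (auto simp: inv inj_eq[OF e] cat_id[OF C] cat_id_right[OF C _ _ cat_id[OF C]] split: if_splits)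
 have "small u (ob D)" "ALL j:ob D. ALL k:ob D. small u (ar D j k)"
  using I by (auto intro!: small_finite[OF inf] simp: D_def)
 then obtain L p where L: "is_limit (opp C) D Fo (%x y g. idt C (Fo x)) L p"
  using c D F unfolding complete_def by blast
 have cone: "is_cone (opp C) D Fo (%x y g. idt C (Fo x)) T t \<longleftrightarrow> T : ob C & (ALL i:I. t (e i) : ar C (X i) T)" for T t
  using I unfolding is_cone_def D_def Fo_def by (auto simp: inv inj_eq[OF e] cat_id_right[OF C] split: if_splits)
 have "is_coprod C I X L (%i. p (e i))" unfolding is_coprod_def
 proof (intro conjI ballI impI allI)
  have Lc: "is_cone (opp C) D Fo (%x y g. idt C (Fo x)) L p" using L by (simp add: is_limit_def)
  thus "L : ob C" "!!i. i : I ==> p (e i) : ar C (X i) L" unfolding cone by auto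
  fix T t assume t: "T : ob C" "ALL j:I. t j : ar C (X j) T"
  have "is_cone (opp C) D Fo (%x y g. idt C (Fo x)) T (%x. t (inv_into UNIV e x))" unfolding cone using t by (simp add: inv)
  hence "EX! h. h : ar (opp C) T L & (ALL j:ob D. cmp (opp C) (p j) h = t (inv_into UNIV e j))" using L unfolding is_limit_def by blast
  thus "EX! h. h : ar C L T & (ALL j:I. cmp C h (p (e j)) = t j)" by (simp add: D_def inv)
 qed
 thus thesis by (rule that)
qed

section \<open>Lifting properties\<close>

lemma ms_arrs: "model_structure C W Co Fi ==> W \<subseteq> arrs C" "model_structure C W Co Fi ==> Co \<subseteq> arrs C"
  "model_structure C W Co Fi ==> Fi \<subseteq> arrs C"
 and ms_two_of_three: "model_structure C W Co Fi ==> ALL X Y Z f g. (X, Y, f) : arrs C & (Y, Z, g) : arrs C -->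
    ((X, Y, f) : W & (Y, Z, g) : W --> (X, Z, cmp C g f) : W) &
    ((X, Y, f) : W & (X, Z, cmp C g f) : W --> (Y, Z, g) : W) &
    ((Y, Z, g) : W & (X, Z, cmp C g f) : W --> (X, Y, f) : W)"
 and ms_retract: "model_structure C W Co Fi ==> ALL K:{W, Co, Fi}. ALL g:K. ALL f:arrs C. retract_of C f g --> f : K"
 and ms_lift1: "model_structure C W Co Fi ==> ALL i:Co \<inter> W. ALL p:Fi. lifts C i p"
 and ms_lift2: "model_structure C W Co Fi ==> ALL i:Co. ALL p:Fi \<inter> W. lifts C i p"
 and ms_factor: "model_structure C W Co Fi ==> ALL X Y f. (X, Y, f) : arrs C -->
    (EX T i p. (X, T, i) : Co \<inter> W & (T, Y, p) : Fi & f = cmp C p i) &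
    (EX T i p. (X, T, i) : Co & (T, Y, p) : Fi \<inter> W & f = cmp C p i)"
 unfolding model_structure_def by (elim conjE, assumption)+

text \<open>The retract argument: a map with the lifting property is a retract of the first factor of its
 factorization.\<close>

lemma retract_lift_cof:
 assumes C: "category C" and ms: "model_structure C W Co Fi" and f: "(A, B, f) : arrs C"
 shows "(ALL p:Fi \<inter> W. lifts C (A, B, f) p) ==> (A, B, f) : Co"
  and "(ALL p:Fi. lifts C (A, B, f) p) ==> (A, B, f) : Co \<inter> W"
proof -
 have o: "A : ob C" "B : ob C" "f : ar C A B" using f by (auto simp: arrs_def)
 have r: "retract_of C (A, B, f) (A, T, i)"
  if l: "lifts C (A, B, f) (T, B, p)" "i : ar C A T" "p : ar C T B" "f = cmp C p i" "T : ob C" for T i p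
 proof -
  have "cmp C p i = cmp C (idt C B) f" using that o by (simp add: cat_id_left[OF C])
  then obtain h where h: "h : ar C B T" "cmp C h f = i" "cmp C p h = idt C B"
   using l(1,2) cat_id[OF C o(2)] unfolding lifts_def by blast
  show ?thesis unfolding retract_of_def prod.case
   by (rule bexI[of _ "idt C A"], rule bexI[of _ "idt C A"], rule bexI[of _ h], rule bexI[of _ p])
    (use h l o cat_id[OF C o(1)] cat_id_right[OF C o(1) o(1)] cat_id_right[OF C o(1)] in auto)
 qed
 note s = ms_arrs[OF ms]
 have rt: "g : Co ==> retract_of C (A, B, f) g ==> (A, B, f) : Co"
  "g : W ==> retract_of C (A, B, f) g ==> (A, B, f) : W" for g
  using ms_retract[OF ms] f by blast+
 have fac: "EX T i p. (A, T, i) : Co \<inter> W & (T, B, p) : Fi & f = cmp C p i"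
   "EX T i p. (A, T, i) : Co & (T, B, p) : Fi \<inter> W & f = cmp C p i"
  using ms_factor[OF ms, rule_format, OF f] by blast+
 show "(A, B, f) : Co" if l: "ALL p:Fi \<inter> W. lifts C (A, B, f) p"
 proof -
  obtain T i p where t: "(A, T, i) : Co" "(T, B, p) : Fi \<inter> W" "f = cmp C p i" using fac by blast
  have "i : ar C A T" "p : ar C T B" "T : ob C" using t s by (auto simp: arrs_def)
  thus ?thesis using rt(1)[OF t(1)] r l t by blast
 qed
 show "(A, B, f) : Co \<inter> W" if l: "ALL p:Fi. lifts C (A, B, f) p"
 proof -
  obtain T i p where t: "(A, T, i) : Co \<inter> W" "(T, B, p) : Fi" "f = cmp C p i" using fac by blast
  have "i : ar C A T" "p : ar C T B" "T : ob C" using t s by (auto simp: arrs_def)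
  hence "retract_of C (A, B, f) (A, T, i)" using r l t by blast
  thus ?thesis using rt t by blast
 qed
qed

lemma retract_lift_fib:
 assumes C: "category C" and ms: "model_structure C W Co Fi" and f: "(X, Y, f) : arrs C"
 shows "(ALL i:Co \<inter> W. lifts C i (X, Y, f)) ==> (X, Y, f) : Fi"
  and "(ALL i:Co. lifts C i (X, Y, f)) ==> (X, Y, f) : Fi \<inter> W"
proof -
 have o: "X : ob C" "Y : ob C" "f : ar C X Y" using f by (auto simp: arrs_def)
 have r: "retract_of C (X, Y, f) (T, Y, p)"
  if l: "lifts C (X, T, i) (X, Y, f)" "i : ar C X T" "p : ar C T Y" "f = cmp C p i" "T : ob C" for T i p
 proof -
  have "cmp C f (idt C X) = cmp C p i" using that o by (simp add: cat_id_right[OF C])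
  then obtain h where h: "h : ar C T X" "cmp C h i = idt C X" "cmp C f h = p"
   using l(1,3) cat_id[OF C o(1)] unfolding lifts_def by blast
  show ?thesis unfolding retract_of_def prod.case
   by (rule bexI[of _ i], rule bexI[of _ h], rule bexI[of _ "idt C Y"], rule bexI[of _ "idt C Y"])
    (use h l o cat_id[OF C o(2)] cat_id_left[OF C o(2) o(2)] cat_id_left[OF C _ o(2)] in auto)
 qed
 note s = ms_arrs[OF ms]
 have rt: "g : Fi ==> retract_of C (X, Y, f) g ==> (X, Y, f) : Fi"
  "g : W ==> retract_of C (X, Y, f) g ==> (X, Y, f) : W" for g
  using ms_retract[OF ms] f by blast+
 have fac: "EX T i p. (X, T, i) : Co \<inter> W & (T, Y, p) : Fi & f = cmp C p i"
   "EX T i p. (X, T, i) : Co & (T, Y, p) : Fi \<inter> W & f = cmp C p i"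
  using ms_factor[OF ms, rule_format, OF f] by blast+
 show "(X, Y, f) : Fi" if l: "ALL i:Co \<inter> W. lifts C i (X, Y, f)"
 proof -
  obtain T i p where t: "(X, T, i) : Co \<inter> W" "(T, Y, p) : Fi" "f = cmp C p i" using fac by blast
  have "i : ar C X T" "p : ar C T Y" "T : ob C" using t s by (auto simp: arrs_def)
  thus ?thesis using rt(1)[OF t(2)] r l t by blast
 qed
 show "(X, Y, f) : Fi \<inter> W" if l: "ALL i:Co. lifts C i (X, Y, f)"
 proof -
  obtain T i p where t: "(X, T, i) : Co" "(T, Y, p) : Fi \<inter> W" "f = cmp C p i" using fac by blast
  have "i : ar C X T" "p : ar C T Y" "T : ob C" using t s by (auto simp: arrs_def)
  hence "retract_of C (X, Y, f) (T, Y, p)" using r l t by blast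
  thus ?thesis using rt t by blast
 qed
qed

section \<open>Pointed simplicial model categories\<close>

locale pointed_smc =
 fixes M :: "('o, 'a) smc" and u :: "'s itself"
 assumes psmc: "pointed_simplicial_model_category u M" and inf_univ: "infinite (UNIV :: 's set)"
begin

abbreviation hom :: "'o => 'o => nat => 'a set" where "hom X Y n == Sx (mapc M X Y) n"
abbreviation comp0 :: "'a => 'a => 'a" (infixr "**" 70) where "g ** f == scmp M 0 g f"
abbreviation zmap :: "'o => 'o => 'a" where "zmap X Y == zarr (uc M) X Y"

abbreviation "mp == mapc M"
abbreviation "post == postc M"
abbreviation "pre == prec M"
abbreviation "fc X Y == Fc (mp X Y)"
abbreviation "cyc X Y == pi_cycles (mp X Y) (zmap X Y)"
abbreviation "nul X Y k x == null (mp X Y) (zmap X Y) k x"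
abbreviation "hrel X Y == rel12 (mp X Y) (zmap X Y)"
abbreviation "zcst X Y n == cst (mp X Y) n (zmap X Y)"

lemma sc: "simplicial_category M"
 and ms: "model_structure (uc M) (weq M) (cof M) (fib M)"
 and SM7: "SM7 M"
 and complete_uc: "complete u (uc M)" and cocomplete_uc: "complete u (opp (uc M))"
 using psmc unfolding pointed_simplicial_model_category_def by blast+

lemma uc_simps [simp]: "ob (uc M) = sob M" "ar (uc M) X Y = hom X Y 0" "idt (uc M) = sid M" "cmp (uc M) g f = g ** f"
 by (simp_all add: uc_def)

lemma sset: "X : sob M ==> Y : sob M ==> is_sset (mp X Y)"
 and sid_in: "X : sob M ==> sid M X : hom X X 0"
 and smap_scmp: "X : sob M ==> Y : sob M ==> Z : sob M ==>
  smap (sprod (mp Y Z) (mp X Y)) (mp X Z) (%n (g, f). scmp M n g f)"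
 and scmp_id: "X : sob M ==> Y : sob M ==> f : hom X Y n ==>
  scmp M n f (cst (mp X X) n (sid M X)) = f"
  "X : sob M ==> Y : sob M ==> f : hom X Y n ==> scmp M n (cst (mp Y Y) n (sid M Y)) f = f"
 and scmp_assoc: "X : sob M ==> Y : sob M ==> Z : sob M ==> W : sob M ==> f : hom X Y n ==>
  g : hom Y Z n ==> h : hom Z W n ==> scmp M n h (scmp M n g f) = scmp M n (scmp M n h g) f"
 using sc unfolding simplicial_category_def by simp_all

lemma scmp_in:
 "X : sob M ==> Y : sob M ==> Z : sob M ==> f : hom X Y n ==> g : hom Y Z n ==> scmp M n g f : hom X Z n"
 using smap_in[OF smap_scmp, of X Y Z "(g, f)" n] by (simp add: sprod_def)

lemma scmp_face:
 "X : sob M ==> Y : sob M ==> Z : sob M ==> f : hom X Y (Suc n) ==> g : hom Y Z (Suc n) ==> i <= Suc n ==>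
  fc X Z (Suc n) i (scmp M (Suc n) g f) =
  scmp M n (fc Y Z (Suc n) i g) (fc X Y (Suc n) i f)"
 using smap_face[OF smap_scmp, of X Y Z "(g, f)" n i] by (simp add: sprod_def)

lemma scmp_degen:
 "X : sob M ==> Y : sob M ==> Z : sob M ==> f : hom X Y n ==> g : hom Y Z n ==> i <= n ==>
  Dg (mp X Z) n i (scmp M n g f) = scmp M (Suc n) (Dg (mp Y Z) n i g) (Dg (mp X Y) n i f)"
 using smap_degen[OF smap_scmp, of X Y Z "(g, f)" n i] by (simp add: sprod_def)

lemma cst_hom: "X : sob M ==> Y : sob M ==> f : hom X Y 0 ==> cst (mp X Y) n f : hom X Y n"
 by (rule cst_in[OF sset])

lemma scmp_cst:
 assumes "X : sob M" "Y : sob M" "Z : sob M" "f : hom X Y 0" "g : hom Y Z 0"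
 shows "scmp M n (cst (mp Y Z) n g) (cst (mp X Y) n f) = cst (mp X Z) n (g ** f)"
proof (induction n)
 case (Suc n)
 thus ?case
  using scmp_degen[OF assms(1-3) cst_hom[OF assms(1,2,4)] cst_hom[OF assms(2,3,5)], of 0 n] by simp
qed simp

lemma category_uc: "category (uc M)"
 unfolding category_def uc_simps
 using scmp_in scmp_assoc sid_in scmp_id[where n = 0] by (auto 0 3)

lemma comp0_in: "X : sob M ==> Y : sob M ==> Z : sob M ==> f : hom X Y 0 ==> g : hom Y Z 0 ==> g ** f : hom X Z 0"
 by (rule scmp_in)

lemma zero_ex: obtains Z where "is_zero (uc M) Z" "Z : sob M"
 using psmc zero_ob[of "uc M"] unfolding pointed_simplicial_model_category_def by auto

lemma zmap_in: "X : sob M ==> Y : sob M ==> zmap X Y : hom X Y 0"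
 by (rule zero_ex) (use zarr_in[OF category_uc, of _ X Y] in simp)

lemma zmap_post: "X : sob M ==> Y : sob M ==> Z : sob M ==> g : hom Y Z 0 ==> g ** zmap X Y = zmap X Z"
 by (rule zero_ex) (use zarr_post[OF category_uc, of _ X Y Z g] in simp)

lemma zmap_pre: "X : sob M ==> Y : sob M ==> Z : sob M ==> f : hom X Y 0 ==> zmap Y Z ** f = zmap X Z"
 by (rule zero_ex) (use zarr_pre[OF category_uc, of _ Y Z X f] in simp)

lemma post_in: "X : sob M ==> Y : sob M ==> Z : sob M ==> g : hom Y Z 0 ==> x : hom X Y n ==>
  post Y Z n g x : hom X Z n"
 unfolding postc_def by (rule scmp_in) (auto intro: cst_hom)

lemma pre_in: "X : sob M ==> Y : sob M ==> Z : sob M ==> f : hom X Y 0 ==> x : hom Y Z n ==>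
  pre X Y n f x : hom X Z n"
 unfolding prec_def by (rule scmp_in[of X Y Z]) (auto intro: cst_hom)

lemma smap_post:
 assumes "X : sob M" "Y : sob M" "Z : sob M" "g : hom Y Z 0"
 shows "smap (mp X Y) (mp X Z) (%n. post Y Z n g)"
 unfolding smap_def
proof (intro allI ballI conjI impI)
 fix n x i assume x: "x : hom X Y n"
 show "post Y Z n g x : hom X Z n" using assms x by (rule post_in)
 note c = cst_hom[OF assms(2-4)]
 show "post Y Z (Suc n) g (Dg (mp X Y) n i x) = Dg (mp X Z) n i (post Y Z n g x)" if "i <= n"
  unfolding postc_def using scmp_degen[OF assms(1-3) x c that] cst_degen[OF sset[OF assms(2,3)] assms(4) that] by simp
 assume "0 < n" "i <= n"
 then obtain m where m: "n = Suc m" by (cases n) auto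
 show "post Y Z (n - 1) g (fc X Y n i x) = fc X Z n i (post Y Z n g x)"
  unfolding postc_def m
  using scmp_face[OF assms(1-3) x[unfolded m] c] cst_face[OF sset[OF assms(2,3)] assms(4), of i m] \<open>i <= n\<close> m by simp
qed

lemma smap_pre:
 assumes "X : sob M" "Y : sob M" "Z : sob M" "f : hom X Y 0"
 shows "smap (mp Y Z) (mp X Z) (%n. pre X Y n f)"
 unfolding smap_def
proof (intro allI ballI conjI impI)
 fix n x i assume x: "x : hom Y Z n"
 show "pre X Y n f x : hom X Z n" using assms x by (rule pre_in)
 note c = cst_hom[OF assms(1,2,4)]
 show "pre X Y (Suc n) f (Dg (mp Y Z) n i x) = Dg (mp X Z) n i (pre X Y n f x)" if "i <= n"
  unfolding prec_def using scmp_degen[OF assms(1-3) c x that] cst_degen[OF sset[OF assms(1,2)] assms(4) that] by simp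
 assume "0 < n" "i <= n"
 then obtain m where m: "n = Suc m" by (cases n) auto
 show "pre X Y (n - 1) f (fc Y Z n i x) = fc X Z n i (pre X Y n f x)"
  unfolding prec_def m
  using scmp_face[OF assms(1-3) c x[unfolded m]] cst_face[OF sset[OF assms(1,2)] assms(4), of i m] \<open>i <= n\<close> m by simp
qed

lemma post_post: "X : sob M ==> Y : sob M ==> Z : sob M ==> W : sob M ==> x : hom X Y n ==> g : hom Y Z 0 ==> h : hom Z W 0 ==>
  post Z W n h (post Y Z n g x) = post Y W n (h ** g) x"
 unfolding postc_def using scmp_assoc[of X Y Z W x n] scmp_cst[of Y Z W g h n] by (simp add: cst_hom)

lemma pre_pre: "X : sob M ==> Y : sob M ==> Z : sob M ==> W : sob M ==> x : hom Z W n ==> f : hom X Y 0 ==> g : hom Y Z 0 ==>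
  pre X Y n f (pre Y Z n g x) = pre X Z n (g ** f) x"
 unfolding prec_def using scmp_assoc[of X Y Z W "cst (mp X Y) n f" n "cst (mp Y Z) n g" x] scmp_cst[of X Y Z f g n] by (simp add: cst_hom)

lemma post_pre: "X : sob M ==> Y : sob M ==> Z : sob M ==> W : sob M ==> x : hom Y Z n ==> f : hom X Y 0 ==> g : hom Z W 0 ==>
  post Z W n g (pre X Y n f x) = pre X Y n f (post Z W n g x)"
 unfolding prec_def postc_def using scmp_assoc[of X Y Z W "cst (mp X Y) n f" n x "cst (mp Z W) n g"] by (simp add: cst_hom)

lemma post_id: "X : sob M ==> Y : sob M ==> x : hom X Y n ==> post Y Y n (sid M Y) x = x"
 unfolding postc_def by (rule scmp_id)

lemma post_0 [simp]: "post Y Z 0 g x = g ** x"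
 and pre_0 [simp]: "pre X Y 0 f x = x ** f"
 by (simp_all add: postc_def prec_def)

lemma comp0_assoc: "X : sob M ==> Y : sob M ==> Z : sob M ==> W : sob M ==> f : hom X Y 0 ==>
  g : hom Y Z 0 ==> h : hom Z W 0 ==> (h ** g) ** f = h ** (g ** f)"
 using scmp_assoc[of X Y Z W f 0 g h] by simp

lemma comp0_id: "X : sob M ==> Y : sob M ==> f : hom X Y 0 ==> f ** sid M X = f"
  "X : sob M ==> Y : sob M ==> f : hom X Y 0 ==> sid M Y ** f = f"
 using scmp_id[of X Y f 0] by simp_all

lemma post_cst: "X : sob M ==> Y : sob M ==> Z : sob M ==> f : hom X Y 0 ==> g : hom Y Z 0 ==>
  post Y Z n g (cst (mp X Y) n f) = cst (mp X Z) n (g ** f)"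
 unfolding postc_def by (rule scmp_cst)

lemma pre_cst: "X : sob M ==> Y : sob M ==> Z : sob M ==> f : hom X Y 0 ==> g : hom Y Z 0 ==>
  pre X Y n f (cst (mp Y Z) n g) = cst (mp X Z) n (g ** f)"
 unfolding prec_def by (rule scmp_cst)

lemma zsimp_in: "X : sob M ==> Y : sob M ==> zsimp M X Y n : hom X Y n"
 unfolding zsimp_def by (intro cst_hom zmap_in)

lemma post_zsimp: "X : sob M ==> Y : sob M ==> Z : sob M ==> g : hom Y Z 0 ==>
  post Y Z n g (zsimp M X Y n) = zsimp M X Z n"
 unfolding zsimp_def by (simp add: post_cst zmap_in zmap_post)

lemma pre_zsimp: "X : sob M ==> Y : sob M ==> Z : sob M ==> f : hom X Y 0 ==>
  pre X Y n f (zsimp M Y Z n) = zsimp M X Z n"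
 unfolding zsimp_def by (simp add: pre_cst zmap_in zmap_pre)

subsection \<open>Tensors and cotensors with finite simplicial sets\<close>

lemma vertex_map:
 assumes K: "is_sset K"
  and ex: "EX! b. b : smaps (Delta 0) K & (ALL m. ALL s:Sx (Delta 0) m. ALL x:A m. Q m (b m s) x)"
 shows "EX! h. h : Sx K 0 & (ALL m. ALL x:A m. Q m (cst K m h) x)"
proof -
 have D: "s : Sx (Delta 0) m \<longleftrightarrow> s = cst (Delta 0) m [0]" for m s
 proof -
  have "cst (Delta 0) m [0] = replicate (Suc m) 0"
  proof (induction m)
   case (Suc m)
   have "cst (Delta 0) (Suc m) [0] = Dg (Delta 0) m 0 (cst (Delta 0) m [0])" by simp
   also have "\<dots> = replicate (Suc (Suc m)) 0" unfolding Suc by (simp add: Delta_Dg)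
   finally show ?case .
  qed simp
  moreover have "s : Sx (Delta 0) m \<longleftrightarrow> s = replicate (Suc m) 0"
   by (auto simp: Delta_Sx replicate_length_same[symmetric] simp del: replicate.simps intro!: replicate_eqI)
  ultimately show ?thesis by simp
 qed
 have v: "b m s = cst K m (b 0 [0])" if "b : smaps (Delta 0) K" "s : Sx (Delta 0) m" for b m s
  using smap_cst[of "Delta 0" K b "[0]" m] that D[of s m] D[of "[0]" 0] is_sset_Delta by (simp add: smaps_def)
 define bb where "bb = (%h m s. if s : Sx (Delta 0) m then cst K m h else undefined)"
 have bb: "bb h : smaps (Delta 0) K" if "h : Sx K 0" for h
  unfolding smaps_def smap_def bb_def
  using sset_face[OF is_sset_Delta] sset_degen[OF is_sset_Delta] cst_in[OF K that] cst_degen[OF K that] cst_face'[OF K that]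
  by (auto simp: gr0_conv_Suc)
 obtain b where b: "b : smaps (Delta 0) K" "!!m s x. s : Sx (Delta 0) m ==> x : A m ==> Q m (b m s) x"
   and u: "!!b'. b' : smaps (Delta 0) K ==> (ALL m. ALL s:Sx (Delta 0) m. ALL x:A m. Q m (b' m s) x) ==> b' = b"
  using ex by blast
 have D0: "[0] : Sx (Delta 0) 0" using D[of "[0]" 0] by simp
 show ?thesis
 proof (rule ex1I[of _ "b 0 [0]"])
  have "b 0 [0] : Sx K 0" using b(1) D0 smap_in by (fastforce simp: smaps_def)
  moreover have "Q m (cst K m (b 0 [0])) x" if "x : A m" for m x
   using b(2)[of "cst (Delta 0) m [0]" m x] that v[OF b(1), of "cst (Delta 0) m [0]" m] D by simp
  ultimately show "b 0 [0] : Sx K 0 & (ALL m. ALL x:A m. Q m (cst K m (b 0 [0])) x)" by blast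
  fix h assume h: "h : Sx K 0 & (ALL m. ALL x:A m. Q m (cst K m h) x)"
  hence "bb h = b" by (intro u bb) (auto simp: bb_def)
  thus "h = b 0 [0]" using D0 by (metis (no_types, lifting) bb_def cst.simps(1))
 qed
qed

text \<open>Restricting a simplicial map to the simplices of its source, as the function spaces require.\<close>

lemma restrict_smaps:
 assumes f: "smap K L f" and c: "!!n x i. x : Sx K (Suc n) ==> i <= Suc n ==> Fc K (Suc n) i x : Sx K n"
  "!!n x i. x : Sx K n ==> i <= n ==> Dg K n i x : Sx K (Suc n)"
 shows "(%n x. if x : Sx K n then f n x else undefined) : smaps K L"
 unfolding smaps_def smap_def
proof (intro CollectI conjI allI ballI impI)
 fix n x i assume x: "x : Sx K n" "0 < n" "i <= n"
 then obtain m where m: "n = Suc m" by (cases n) auto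
 have "Fc K n i x : Sx K (n - 1)" using c(1)[of x m i] x m by simp
 moreover have "f (n - 1) (Fc K n i x) = Fc L n i (f n x)" using smap_face[OF f, of x m i] x m by simp
 ultimately show "(if Fc K n i x : Sx K (n - 1) then f (n - 1) (Fc K n i x) else undefined) =
   Fc L n i (if x : Sx K n then f n x else undefined)" using x by simp
qed (use f c(2) in \<open>auto simp: smap_in smap_degen\<close>)

lemma sprod_smaps:
 assumes A: "is_sset A" and K: "is_sset K" and f: "smap (sprod A K) L f"
 shows "(%n x. if x : Sx (sprod A K) n then f n x else undefined) : smaps (sprod A K) L"
 by (rule restrict_smaps[OF f]) (auto simp: sprod_def sset_face[OF A] sset_face[OF K] sset_degen[OF A] sset_degen[OF K])

lemma sprod_snd: "smap K L f ==> smap (sprod A K) L (%n x. f n (snd x))"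
 unfolding smap_def by (auto simp: sprod_def)

lemma smaps_outside: "f : smaps K L ==> x ~: Sx K n ==> f n x = undefined"
 and smaps_smap: "f : smaps K L ==> smap K L f"
 by (auto simp: smaps_def)

lemma tensor_rep:
 assumes K: "is_sset K" and X: "X : sob M" and T: "is_tensor M X K T al" and Y: "Y : sob M" and f: "smap K (mp X Y) f"
 shows "EX! h. h : hom T Y 0 & (ALL m. ALL x:Sx K m. post T Y m h (al m x) = f m x)"
proof -
 have T0: "T : sob M" using T by (simp add: is_tensor_def)
 define g where "g = (%n (x :: nat list \<times> _). if x : Sx (sprod (Delta 0) K) n then f n (snd x) else undefined)"
 have "g : smaps (sprod (Delta 0) K) (mp X Y)" unfolding g_def
  by (rule sprod_smaps[OF is_sset_Delta K sprod_snd[OF f]])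
 hence "EX! b. b : smaps (Delta 0) (mp T Y) &
   (ALL m. ALL s:Sx (Delta 0) m. ALL x:Sx K m. g m (s, x) = scmp M m (b m s) (al m x))"
  using T Y unfolding is_tensor_def by blast
 hence "EX! b. b : smaps (Delta 0) (mp T Y) &
   (ALL m. ALL s:Sx (Delta 0) m. ALL x:Sx K m. scmp M m (b m s) (al m x) = f m x)"
  by (simp add: g_def sprod_def eq_commute[of "f _ _"])
 from vertex_map[OF sset[OF T0 Y] this] show ?thesis by (simp add: postc_def)
qed

lemma cotensor_rep:
 assumes K: "is_sset K" and Y: "Y : sob M" and T: "is_cotensor M Y K T al" and X: "X : sob M" and f: "smap K (mp X Y) f"
 shows "EX! h. h : hom X T 0 & (ALL m. ALL x:Sx K m. pre X T m h (al m x) = f m x)"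
proof -
 have T0: "T : sob M" using T by (simp add: is_cotensor_def)
 define g where "g = (%n (x :: nat list \<times> _). if x : Sx (sprod (Delta 0) K) n then f n (snd x) else undefined)"
 have "g : smaps (sprod (Delta 0) K) (mp X Y)" unfolding g_def
  by (rule sprod_smaps[OF is_sset_Delta K sprod_snd[OF f]])
 hence "EX! b. b : smaps (Delta 0) (mp X T) &
   (ALL m. ALL s:Sx (Delta 0) m. ALL x:Sx K m. g m (s, x) = scmp M m (al m x) (b m s))"
  using T X unfolding is_cotensor_def by blast
 hence "EX! b. b : smaps (Delta 0) (mp X T) &
   (ALL m. ALL s:Sx (Delta 0) m. ALL x:Sx K m. scmp M m (al m x) (b m s) = f m x)"
  by (simp add: g_def sprod_def eq_commute[of "f _ _"])
 from vertex_map[OF sset[OF X T0] this] show ?thesis by (simp add: prec_def)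
qed

lemma smash_rep:
 assumes K: "is_sset K" and X: "X : sob M" and T: "is_smash M X K k T al" and Y: "Y : sob M"
  and f: "smap K (mp X Y) f" "!!m. f m (cst K m k) = zsimp M X Y m" and k: "k : Sx K 0"
 shows "EX! h. h : hom T Y 0 & (ALL m. ALL x:Sx K m. post T Y m h (al m x) = f m x)"
proof -
 have T0: "T : sob M" using T by (simp add: is_smash_def)
 define g where "g = (%n (x :: nat list \<times> _). if x : Sx (sprod (Delta 0) K) n then f n (snd x) else undefined)"
 have "g : smaps (sprod (Delta 0) K) (mp X Y)" unfolding g_def
  by (rule sprod_smaps[OF is_sset_Delta K sprod_snd[OF f(1)]])
 moreover have "ALL m. ALL s:Sx (Delta 0) m. g m (s, cst K m k) = zsimp M X Y m"
  using f(2) cst_in[OF K k] by (simp add: g_def sprod_def)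
 ultimately have "EX! b. b : smaps (Delta 0) (mp T Y) &
   (ALL m. ALL s:Sx (Delta 0) m. ALL x:Sx K m. g m (s, x) = scmp M m (b m s) (al m x))"
  using T Y unfolding is_smash_def by blast
 hence "EX! b. b : smaps (Delta 0) (mp T Y) &
   (ALL m. ALL s:Sx (Delta 0) m. ALL x:Sx K m. scmp M m (b m s) (al m x) = f m x)"
  by (simp add: g_def sprod_def eq_commute[of "f _ _"])
 from vertex_map[OF sset[OF T0 Y] this] show ?thesis by (simp add: postc_def)
qed

text \<open>Tensors are given for simplicial sets on the type of the universe; a levelwise finite
 simplicial set on a countable type is isomorphic to such a one.\<close>

definition image_sset :: "('x => 'y) => 'x sset => 'y sset" where
 "image_sset r K = \<lparr>Sx = (%n. r ` Sx K n), Fc = (%n i y. r (Fc K n i (inv_into UNIV r y))),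
     Dg = (%n i y. r (Dg K n i (inv_into UNIV r y)))\<rparr>"

lemma is_sset_image:
 assumes r: "inj r" and K: "is_sset K"
 shows "is_sset (image_sset r K)"
proof -
 have i: "inv_into UNIV r (r x) = x" for x using r by simp
 show ?thesis
  unfolding is_sset_def image_sset_def
  using sset_face[OF K] sset_degen[OF K] sset_face_face[OF K] sset_face_degen[OF K] sset_degen_degen[OF K]
  by (simp add: i)
qed

lemma smap_image:
 assumes r: "inj r"
 shows "smap (image_sset r K) L f \<longleftrightarrow> smap K L (%n x. f n (r x))"
proof -
 have i: "inv_into UNIV r (r x) = x" for x using r by simp
 show ?thesis unfolding smap_def image_sset_def by (simp add: i)
qed

end

context pointed_smc begin

lemma transport_smaps:
 assumes r: "inj r" and K: "is_sset K" and g: "smap (sprod (Delta n) K) L g"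
 shows "(%m p. if p : Sx (sprod (Delta n) (image_sset r K)) m then g m (fst p, inv_into UNIV r (snd p)) else undefined)
  : smaps (sprod (Delta n) (image_sset r K)) L"
proof (rule sprod_smaps[OF is_sset_Delta is_sset_image[OF r K]])
 have i: "inv_into UNIV r (r x) = x" for x using r by simp
 show "smap (sprod (Delta n) (image_sset r K)) L (%m p. g m (fst p, inv_into UNIV r (snd p)))"
  using g unfolding smap_def by (auto simp: sprod_def image_sset_def i)
qed

lemma transport_universal:
 assumes r: "inj r" and g: "g' = (%m p. if p : Sx (sprod (Delta n) (image_sset r K)) m then g m (fst p, inv_into UNIV r (snd p)) else undefined)"
  and al: "!!m x. x : Sx K m ==> al m x = al' m (r x)"
 shows "(ALL m. ALL s:Sx (Delta n) m. ALL x:Sx (image_sset r K) m. g' m (s, x) = c m (b m s) (al' m x)) \<longleftrightarrow>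
  (ALL m. ALL s:Sx (Delta n) m. ALL x:Sx K m. g m (s, x) = c m (b m s) (al m x))"
proof -
 have i: "inv_into UNIV r (r x) = x" for x using r by simp
 show ?thesis unfolding g using al by (simp add: sprod_def image_sset_def i)
qed

lemma tensor_exists:
 fixes K :: "'x::countable sset"
 assumes K: "is_sset K" "!!n. finite (Sx K n)" and X: "X : sob M"
 shows "(EX T al. is_tensor M X K T al) & (EX T al. is_cotensor M X K T al)"
proof -
 obtain r0 :: "nat => 's" where r0: "inj r0" using infinite_countable_subset[OF inf_univ] by blast
 define r where "r = (%x :: 'x. r0 (to_nat x))"
 have r: "inj r" using inj_compose[OF r0 inj_to_nat] unfolding r_def comp_def .
 have "is_sset (image_sset r K)" "ALL n. small u (Sx (image_sset r K) n)"
  using is_sset_image[OF r K(1)] K(2) by (auto simp: image_sset_def intro!: small_finite[OF inf_univ])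
 hence ex: "(EX T al. is_tensor M X (image_sset r K) T al) & (EX T al. is_cotensor M X (image_sset r K) T al)"
  using psmc X unfolding pointed_simplicial_model_category_def by blast
 then obtain T al T' al' where T: "is_tensor M X (image_sset r K) T al" and T': "is_cotensor M X (image_sset r K) T' al'" by blast
 define rs where "rs = (%(f :: nat => 's => 'a) n x. if x : Sx K n then f n (r x) else undefined)"
 have rs: "rs f : smaps K L" if "f : smaps (image_sset r K) L" for f L
  unfolding rs_def using that smap_image[OF r, of K L f]
  by (intro restrict_smaps) (auto simp: smaps_def sset_face[OF K(1)] sset_degen[OF K(1)])
 have rs_eq: "rs f m x = f m (r x)" if "x : Sx K m" for f m x using that by (simp add: rs_def)
 have "is_tensor M X K T (rs al)" unfolding is_tensor_def
 proof (intro conjI ballI allI)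
  show "T : sob M" "rs al : smaps K (mp X T)" using T rs by (auto simp: is_tensor_def)
  fix Y n g assume Y: "Y : sob M" and g: "g : smaps (sprod (Delta n) K) (mp X Y)"
  define g' where "g' = (%m p. if p : Sx (sprod (Delta n) (image_sset r K)) m then g m (fst p, inv_into UNIV r (snd p)) else undefined)"
  have A: "EX! b. b : smaps (Delta n) (mp T Y) &
     (ALL m. ALL s:Sx (Delta n) m. ALL x:Sx (image_sset r K) m. g' m (s, x) = scmp M m (b m s) (al m x))"
   using T Y transport_smaps[OF r K(1) smaps_smap[OF g]] unfolding g'_def[symmetric] is_tensor_def by blast
  have E: "(ALL m. ALL s:Sx (Delta n) m. ALL x:Sx (image_sset r K) m. g' m (s, x) = scmp M m (b m s) (al m x)) \<longleftrightarrow>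
    (ALL m. ALL s:Sx (Delta n) m. ALL x:Sx K m. g m (s, x) = scmp M m (b m s) (rs al m x))" for b
   by (rule transport_universal[OF r g'_def rs_eq, where c = "scmp M"])
  from A show "EX! b. b : smaps (Delta n) (mp T Y) &
     (ALL m. ALL s:Sx (Delta n) m. ALL x:Sx K m. g m (s, x) = scmp M m (b m s) (rs al m x))" unfolding E .
 qed
 moreover have "is_cotensor M X K T' (rs al')" unfolding is_cotensor_def
 proof (intro conjI ballI allI)
  show "T' : sob M" "rs al' : smaps K (mp T' X)" using T' rs by (auto simp: is_cotensor_def)
  fix Y n g assume Y: "Y : sob M" and g: "g : smaps (sprod (Delta n) K) (mp Y X)"
  define g' where "g' = (%m p. if p : Sx (sprod (Delta n) (image_sset r K)) m then g m (fst p, inv_into UNIV r (snd p)) else undefined)"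
  have A: "EX! b. b : smaps (Delta n) (mp Y T') &
     (ALL m. ALL s:Sx (Delta n) m. ALL x:Sx (image_sset r K) m. g' m (s, x) = scmp M m (al' m x) (b m s))"
   using T' Y transport_smaps[OF r K(1) smaps_smap[OF g]] unfolding g'_def[symmetric] is_cotensor_def by blast
  have E: "(ALL m. ALL s:Sx (Delta n) m. ALL x:Sx (image_sset r K) m. g' m (s, x) = scmp M m (al' m x) (b m s)) \<longleftrightarrow>
    (ALL m. ALL s:Sx (Delta n) m. ALL x:Sx K m. g m (s, x) = scmp M m (rs al' m x) (b m s))" for b
   by (rule transport_universal[OF r g'_def rs_eq, where c = "%m b a. scmp M m a b"])
  from A show "EX! b. b : smaps (Delta n) (mp Y T') &
     (ALL m. ALL s:Sx (Delta n) m. ALL x:Sx K m. g m (s, x) = scmp M m (rs al' m x) (b m s))" unfolding E .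
 qed
 ultimately show ?thesis by blast
qed

text \<open>Tensors and cotensors with a standard simplex represent the simplices of the mapping complexes,
 which turns universal properties for maps into universal properties for simplices.\<close>

lemma simplex_tensor:
 assumes X: "X : sob M"
 obtains T x where "T : sob M" "x : hom X T n"
  "!!Y y. Y : sob M ==> y : hom X Y n ==> EX! h. h : hom T Y 0 & post T Y n h x = y"
proof -
 obtain T al where T: "is_tensor M X (Delta n) T al"
  using tensor_exists[OF is_sset_Delta finite_Delta X] by blast
 have T0: "T : sob M" "smap (Delta n) (mp X T) al" using T by (auto simp: is_tensor_def smaps_def)
 show thesis
 proof (rule that[OF T0(1)])
  show "al n [0..<Suc n] : hom X T n" using smap_in[OF T0(2) top_simplex_in] .
  fix Y y assume Y: "Y : sob M" "y : hom X Y n"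
  have ss: "is_sset (mp X Y)" using sset X Y by blast
  have ym: "smap (Delta n) (mp X Y) (yoneda (mp X Y) n y)" using yoneda_smap[OF ss Y(2)] by (rule smaps_smap)
  have "(ALL m. ALL x:Sx (Delta n) m. post T Y m h (al m x) = yoneda (mp X Y) n y m x) \<longleftrightarrow>
    post T Y n h (al n [0..<Suc n]) = y" if h: "h : hom T Y 0" for h
  proof
   assume "ALL m. ALL x:Sx (Delta n) m. post T Y m h (al m x) = yoneda (mp X Y) n y m x"
   thus "post T Y n h (al n [0..<Suc n]) = y" using top_simplex_in yoneda_top[OF ss Y(2)] by simp
  next
   assume e: "post T Y n h (al n [0..<Suc n]) = y"
   have "smap (Delta n) (mp X Y) (%m x. post T Y m h (al m x))"
    by (rule smap_comp[OF T0(2) smap_post[OF X T0(1) Y(1) h]])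
   from yoneda_unique[OF this] show "ALL m. ALL x:Sx (Delta n) m. post T Y m h (al m x) = yoneda (mp X Y) n y m x"
    unfolding e by blast
  qed
  thus "EX! h. h : hom T Y 0 & post T Y n h (al n [0..<Suc n]) = y"
   using tensor_rep[OF is_sset_Delta X T Y(1) ym] by (metis (no_types, lifting))
 qed
qed

lemma simplex_cotensor:
 assumes Y: "Y : sob M"
 obtains P p where "P : sob M" "p : hom P Y n"
  "!!X x. X : sob M ==> x : hom X Y n ==> EX! h. h : hom X P 0 & pre X P n h p = x"
proof -
 obtain T al where T: "is_cotensor M Y (Delta n) T al"
  using tensor_exists[OF is_sset_Delta finite_Delta Y] by blast
 have T0: "T : sob M" "smap (Delta n) (mp T Y) al" using T by (auto simp: is_cotensor_def smaps_def)
 show thesis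
 proof (rule that[OF T0(1)])
  show "al n [0..<Suc n] : hom T Y n" using smap_in[OF T0(2) top_simplex_in] .
  fix X y assume X: "X : sob M" "y : hom X Y n"
  have ss: "is_sset (mp X Y)" using sset X Y by blast
  have ym: "smap (Delta n) (mp X Y) (yoneda (mp X Y) n y)" using yoneda_smap[OF ss X(2)] by (rule smaps_smap)
  have "(ALL m. ALL x:Sx (Delta n) m. pre X T m h (al m x) = yoneda (mp X Y) n y m x) \<longleftrightarrow>
    pre X T n h (al n [0..<Suc n]) = y" if h: "h : hom X T 0" for h
  proof
   assume "ALL m. ALL x:Sx (Delta n) m. pre X T m h (al m x) = yoneda (mp X Y) n y m x"
   thus "pre X T n h (al n [0..<Suc n]) = y" using top_simplex_in yoneda_top[OF ss X(2)] by simp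
  next
   assume e: "pre X T n h (al n [0..<Suc n]) = y"
   have "smap (Delta n) (mp X Y) (%m x. pre X T m h (al m x))"
    by (rule smap_comp[OF T0(2) smap_pre[OF X(1) T0(1) Y h]])
   from yoneda_unique[OF this] show "ALL m. ALL x:Sx (Delta n) m. pre X T m h (al m x) = yoneda (mp X Y) n y m x"
    unfolding e by blast
  qed
  thus "EX! h. h : hom X T 0 & pre X T n h (al n [0..<Suc n]) = y"
   using cotensor_rep[OF is_sset_Delta Y T X(1) ym] by (metis (no_types, lifting))
 qed
qed

lemma zero_simplex_to: "is_zero (uc M) Z ==> X : sob M ==> x : hom X Z n ==> x = zsimp M X Z n"
proof -
 assume Z: "is_zero (uc M) Z" and X: "X : sob M" and x: "x : hom X Z n"
 have Z0: "Z : sob M" using zero_ob[OF Z] by simp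
 obtain T t where T: "T : sob M" "t : hom X T n"
  "!!Y y. Y : sob M ==> y : hom X Y n ==> EX! h. h : hom T Y 0 & post T Y n h t = y"
  using simplex_tensor[OF X] by metis
 obtain h h' where "h : hom T Z 0" "post T Z n h t = x" "h' : hom T Z 0" "post T Z n h' t = zsimp M X Z n"
  using T(3)[OF Z0 x] T(3)[OF Z0 zsimp_in[OF X Z0]] by blast
 moreover from this have "h = h'" using zero_eq_to[OF Z, of T h h'] T(1) by simp
 ultimately show ?thesis by simp
qed

lemma zero_simplex_from: "is_zero (uc M) Z ==> Y : sob M ==> x : hom Z Y n ==> x = zsimp M Z Y n"
proof -
 assume Z: "is_zero (uc M) Z" and Y: "Y : sob M" and x: "x : hom Z Y n"
 have Z0: "Z : sob M" using zero_ob[OF Z] by simp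
 obtain P p where P: "P : sob M" "p : hom P Y n"
  "!!X x. X : sob M ==> x : hom X Y n ==> EX! h. h : hom X P 0 & pre X P n h p = x"
  using simplex_cotensor[OF Y] by metis
 obtain h h' where "h : hom Z P 0" "pre Z P n h p = x" "h' : hom Z P 0" "pre Z P n h' p = zsimp M Z Y n"
  using P(3)[OF Z0 x] P(3)[OF Z0 zsimp_in[OF Z0 Y]] by blast
 moreover from this have "h = h'" using zero_eq_from[OF Z, of P h h'] P(1) by simp
 ultimately show ?thesis by simp
qed

lemma post_zmap:
 assumes "X : sob M" "Y : sob M" "Z : sob M" "x : hom X Y n"
 shows "post Y Z n (zmap Y Z) x = zsimp M X Z n"
proof -
 obtain O' where O': "is_zero (uc M) O'" "O' : sob M" by (rule zero_ex)
 have z: "zmap Y O' : hom Y O' 0" "zmap O' Z : hom O' Z 0" using zmap_in assms O' by auto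
 have "zmap Y Z = zmap O' Z ** zmap Y O'" using zmap_post[OF assms(2) O'(2) assms(3) z(2)] by simp
 hence "post Y Z n (zmap Y Z) x = post O' Z n (zmap O' Z) (post Y O' n (zmap Y O') x)"
  using post_post[OF assms(1,2) O'(2) assms(3,4) z] by simp
 also have "post Y O' n (zmap Y O') x = zsimp M X O' n"
  using zero_simplex_to[OF O'(1) assms(1)] post_in[OF assms(1,2) O'(2) z(1) assms(4)] by blast
 finally show ?thesis using post_zsimp[OF assms(1) O'(2) assms(3) z(2)] by simp
qed

lemma pre_zmap:
 assumes "X : sob M" "Y : sob M" "Z : sob M" "x : hom Y Z n"
 shows "pre X Y n (zmap X Y) x = zsimp M X Z n"
proof -
 obtain O' where O': "is_zero (uc M) O'" "O' : sob M" by (rule zero_ex)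
 have z: "zmap X O' : hom X O' 0" "zmap O' Y : hom O' Y 0" using zmap_in assms O' by auto
 have "zmap X Y = zmap O' Y ** zmap X O'" using zmap_post[OF assms(1) O'(2) assms(2) z(2)] by simp
 hence "pre X Y n (zmap X Y) x = pre X O' n (zmap X O') (pre O' Y n (zmap O' Y) x)"
  using pre_pre[OF assms(1) O'(2) assms(2,3,4) z] by simp
 also have "pre O' Y n (zmap O' Y) x = zsimp M O' Z n"
  using zero_simplex_from[OF O'(1) assms(3)] pre_in[OF O'(2) assms(2,3) z(2) assms(4)] by blast
 finally show ?thesis using pre_zsimp[OF assms(1) O'(2) assms(3) z(1)] by simp
qed

lemma kernel_simplex:
 assumes k: "is_kernel (uc M) E Y q F j" and E: "E : sob M" "Y : sob M" "q : hom E Y 0"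
  and X: "X : sob M" and y: "y : hom X E n" "post E Y n q y = zsimp M X Y n"
 shows "EX! z. z : hom X F n & post F E n j z = y"
proof -
 have F: "F : sob M" "j : hom F E 0" "q ** j = zmap F Y"
  and Fu: "!!T t. T : sob M ==> t : hom T E 0 ==> q ** t = zmap T Y ==> EX! h. h : hom T F 0 & j ** h = t"
  using k by (auto simp: is_kernel_def)
 obtain T t where T: "T : sob M" "t : hom X T n"
  "!!Y y. Y : sob M ==> y : hom X Y n ==> EX! h. h : hom T Y 0 & post T Y n h t = y"
  using simplex_tensor[OF X] by metis
 have inj: "h = h'" if "Y' : sob M" "h : hom T Y' 0" "h' : hom T Y' 0" "post T Y' n h t = post T Y' n h' t" for Y' h h'
  using T(3)[OF that(1) post_in[OF X T(1) that(1,2) T(2)]] that by metis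
 obtain h where h: "h : hom T E 0" "post T E n h t = y" using T(3)[OF E(1) y(1)] by blast
 have "post T Y n (q ** h) t = post T Y n (zmap T Y) t"
  using post_post[OF X T(1) E(1,2) T(2) h(1) E(3)] h(2) y(2) post_zmap[OF X T(1) E(2) T(2)] by simp
 hence "q ** h = zmap T Y" using inj[OF E(2)] comp0_in[OF T(1) E(1,2) h(1) E(3)] zmap_in[OF T(1) E(2)] by blast
 then obtain h' where h': "h' : hom T F 0" "j ** h' = h" using Fu[OF T(1) h(1)] by blast
 show ?thesis
 proof (rule ex1I[of _ "post T F n h' t"])
  show "post T F n h' t : hom X F n & post F E n j (post T F n h' t) = y"
   using post_in[OF X T(1) F(1) h'(1) T(2)] post_post[OF X T(1) F(1) E(1) T(2) h'(1) F(2)] h'(2) h(2) by simp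
  fix z assume z: "z : hom X F n & post F E n j z = y"
  then obtain k where kk: "k : hom T F 0" "post T F n k t = z" using T(3)[OF F(1)] by blast
  have "post T E n (j ** k) t = post T E n h t"
   using post_post[OF X T(1) F(1) E(1) T(2) kk(1) F(2)] kk(2) z h(2) by simp
  hence "j ** k = h" using inj[OF E(1)] comp0_in[OF T(1) F(1) E(1) kk(1) F(2)] h(1) by blast
  hence "k = h'" using Fu[OF T(1) h(1) \<open>q ** h = zmap T Y\<close>] kk(1) h' by blast
  thus "z = post T F n h' t" using kk(2) by simp
 qed
qed

lemma kernel_ex:
 assumes "E : sob M" "Y : sob M" "q : hom E Y 0"
 obtains F j where "is_kernel (uc M) E Y q F j" "F : sob M" "j : hom F E 0" "q ** j = zmap F Y"
  "!!T t. T : sob M ==> t : hom T E 0 ==> q ** t = zmap T Y ==> EX! h. h : hom T F 0 & j ** h = t"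
proof -
 obtain Z where Z: "is_zero (uc M) Z" by (rule zero_ex)
 obtain F j where "is_kernel (uc M) E Y q F j"
  by (rule kernel_exists[OF category_uc Z complete_uc inf_univ]) (use assms in auto)
 note k = this
 show thesis by (rule that[OF k]) (use k in \<open>auto simp: is_kernel_def\<close>)
qed

definition is_cokernel :: "'o => 'o => 'a => 'o => 'a => bool" where
 "is_cokernel X E i S p \<longleftrightarrow> S : sob M & p : hom E S 0 & p ** i = zmap X S &
     (ALL Y:sob M. ALL f:hom E Y 0. f ** i = zmap X Y --> (EX! h. h : hom S Y 0 & h ** p = f))"

lemma cokernel_ex:
 assumes X: "X : sob M" "E : sob M" "i : hom X E 0"
 obtains S p where "is_cokernel X E i S p"
proof -
 obtain Z where Z: "is_zero (uc M) Z" by (rule zero_ex)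
 obtain S p where k: "is_kernel (opp (uc M)) E X i S p"
  by (rule kernel_exists[OF category_opp[OF category_uc] is_zero_opp[OF Z] cocomplete_uc inf_univ]) (use X in auto)
 have z: "T : sob M ==> zarr (opp (uc M)) T X = zmap X T" for T
  using zarr_opp[OF category_uc Z] X by simp
 have "is_cokernel X E i S p" using k z unfolding is_kernel_def is_cokernel_def by simp
 thus thesis by (rule that)
qed

lemma cokernel_simplex:
 assumes c: "is_cokernel X E i S p" and X: "X : sob M" "E : sob M" "i : hom X E 0"
  and Y: "Y : sob M" and y: "y : hom E Y n" "pre X E n i y = zsimp M X Y n"
 shows "EX! z. z : hom S Y n & pre E S n p z = y"
proof -
 have S: "S : sob M" "p : hom E S 0" "p ** i = zmap X S"
  and Su: "!!Y f. Y : sob M ==> f : hom E Y 0 ==> f ** i = zmap X Y ==> EX! h. h : hom S Y 0 & h ** p = f"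
  using c by (auto simp: is_cokernel_def)
 obtain P t where P: "P : sob M" "t : hom P Y n"
  "!!X x. X : sob M ==> x : hom X Y n ==> EX! h. h : hom X P 0 & pre X P n h t = x"
  using simplex_cotensor[OF Y] by metis
 have inj: "h = h'" if "X' : sob M" "h : hom X' P 0" "h' : hom X' P 0" "pre X' P n h t = pre X' P n h' t" for X' h h'
  using P(3)[OF that(1) pre_in[OF that(1) P(1) Y that(2) P(2)]] that by metis
 obtain h where h: "h : hom E P 0" "pre E P n h t = y" using P(3)[OF X(2) y(1)] by blast
 have "pre X P n (h ** i) t = pre X P n (zmap X P) t"
  using pre_pre[OF X(1,2) P(1) Y P(2) X(3) h(1)] h(2) y(2) pre_zmap[OF X(1) P(1) Y P(2)] by simp
 hence hz: "h ** i = zmap X P" using inj[OF X(1)] comp0_in[OF X(1,2) P(1) X(3) h(1)] zmap_in[OF X(1) P(1)] by blast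
 then obtain h' where h': "h' : hom S P 0" "h' ** p = h" using Su[OF P(1) h(1)] by blast
 show ?thesis
 proof (rule ex1I[of _ "pre S P n h' t"])
  show "pre S P n h' t : hom S Y n & pre E S n p (pre S P n h' t) = y"
   using pre_in[OF S(1) P(1) Y h'(1) P(2)] pre_pre[OF X(2) S(1) P(1) Y P(2) S(2) h'(1)] h'(2) h(2) by simp
  fix z assume z: "z : hom S Y n & pre E S n p z = y"
  then obtain k where kk: "k : hom S P 0" "pre S P n k t = z" using P(3)[OF S(1)] by blast
  have "pre E P n (k ** p) t = pre E P n h t"
   using pre_pre[OF X(2) S(1) P(1) Y P(2) S(2) kk(1)] kk(2) z h(2) by simp
  hence "k ** p = h" using inj[OF X(2)] comp0_in[OF X(2) S(1) P(1) S(2) kk(1)] h(1) by blast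
  hence "k = h'" using Su[OF P(1) h(1) hz] kk(1) h' by blast
  thus "z = pre S P n h' t" using kk(2) by simp
 qed
qed

lemma coproduct_simplex:
 assumes c: "is_coprod (uc M) I X P inc" and X: "!!i. i : I ==> X i : sob M"
  and Y: "Y : sob M" and y: "!!i. i : I ==> y i : hom (X i) Y n"
 shows "EX! z. z : hom P Y n & (ALL i:I. pre (X i) P n (inc i) z = y i)"
proof -
 have P: "P : sob M" "!!i. i : I ==> inc i : hom (X i) P 0"
  and Pu: "!!T t. T : sob M ==> (ALL j:I. t j : hom (X j) T 0) ==> EX! h. h : hom P T 0 & (ALL j:I. h ** inc j = t j)"
  using c by (auto simp: is_coprod_def)
 obtain Q t where Q: "Q : sob M" "t : hom Q Y n"
  "!!X x. X : sob M ==> x : hom X Y n ==> EX! h. h : hom X Q 0 & pre X Q n h t = x"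
  using simplex_cotensor[OF Y] by metis
 have inj: "h = h'" if "X' : sob M" "h : hom X' Q 0" "h' : hom X' Q 0" "pre X' Q n h t = pre X' Q n h' t" for X' h h'
  using Q(3)[OF that(1) pre_in[OF that(1) Q(1) Y that(2) Q(2)]] that by metis
 have "EX h. ALL i:I. h i : hom (X i) Q 0 & pre (X i) Q n (h i) t = y i"
  using Q(3)[OF X y] by (intro bchoice) blast
 then obtain h where h: "!!i. i : I ==> h i : hom (X i) Q 0" "!!i. i : I ==> pre (X i) Q n (h i) t = y i" by blast
 obtain h' where h': "h' : hom P Q 0" "!!i. i : I ==> h' ** inc i = h i" using Pu[OF Q(1), of h] h(1) by blast
 show ?thesis
 proof (rule ex1I[of _ "pre P Q n h' t"])
  show "pre P Q n h' t : hom P Y n & (ALL i:I. pre (X i) P n (inc i) (pre P Q n h' t) = y i)"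
   using pre_in[OF P(1) Q(1) Y h'(1) Q(2)] pre_pre[OF X P(1) Q(1) Y Q(2) P(2) h'(1)] h' h by simp
  fix z assume z: "z : hom P Y n & (ALL i:I. pre (X i) P n (inc i) z = y i)"
  then obtain k where kk: "k : hom P Q 0" "pre P Q n k t = z" using Q(3)[OF P(1)] by blast
  have "k ** inc i = h i" if i: "i : I" for i
  proof (rule inj[OF X[OF i] _ h(1)[OF i]])
   show "k ** inc i : hom (X i) Q 0" using comp0_in[OF X[OF i] P(1) Q(1) P(2)[OF i] kk(1)] .
   show "pre (X i) Q n (k ** inc i) t = pre (X i) Q n (h i) t"
    using pre_pre[OF X[OF i] P(1) Q(1) Y Q(2) P(2)[OF i] kk(1)] kk(2) z h(2)[OF i] i by simp
  qed
  hence "k = h'" using Pu[OF Q(1), of h] kk(1) h' h(1) by blast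
  thus "z = pre P Q n h' t" using kk(2) by simp
 qed
qed

subsection \<open>Half-smash products\<close>

lemma smash_exists:
 fixes K :: "'x::countable sset"
 assumes K: "is_sset K" "!!n. finite (Sx K n)" "k : Sx K 0" and X: "X : sob M"
 shows "is_smash M X K k (fst (smash M X K k)) (snd (smash M X K k))"
proof -
 obtain T al where T: "is_tensor M X K T al" using tensor_exists[OF K(1,2) X] by blast
 have T0: "T : sob M" "smap K (mp X T) al" using T by (auto simp: is_tensor_def smaps_def)
 define v where "v = al 0 k"
 have v: "v : hom X T 0" using smap_in[OF T0(2) K(3)] by (simp add: v_def)
 have vc: "al m (cst K m k) = cst (mp X T) m v" for m
  using smap_cst[OF T0(2) K(1,3)] by (simp add: v_def)
 obtain S c where c: "is_cokernel X T v S c" using cokernel_ex[OF X T0(1) v] by blast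
 have S: "S : sob M" "c : hom T S 0" "c ** v = zmap X S" using c by (auto simp: is_cokernel_def)
 define be where "be = (%m x. if x : Sx K m then post T S m c (al m x) else undefined)"
 have be: "be : smaps K (mp X S)" unfolding be_def
  by (rule restrict_smaps[OF smap_comp[OF T0(2) smap_post[OF X T0(1) S(1,2)]]])
   (auto simp: sset_face[OF K(1)] sset_degen[OF K(1)])
 have "is_smash M X K k S be" unfolding is_smash_def
 proof (intro conjI allI ballI impI)
  show "S : sob M" "be : smaps K (mp X S)" by fact+
  show "be m (cst K m k) = zsimp M X S m" for m
   using cst_in[OF K(1,3)] vc post_cst[OF X T0(1) S(1) v S(2)] S(3) by (simp add: be_def zsimp_def)
  fix Y n g assume Y: "Y : sob M" and g: "g : smaps (sprod (Delta n) K) (mp X Y)"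
   and gz: "ALL m. ALL s:Sx (Delta n) m. g m (s, cst K m k) = zsimp M X Y m"
  obtain b0 where b0: "b0 : smaps (Delta n) (mp T Y)"
    "!!m s x. s : Sx (Delta n) m ==> x : Sx K m ==> g m (s, x) = scmp M m (b0 m s) (al m x)"
   and b0u: "!!b. b : smaps (Delta n) (mp T Y) ==>
    (!!m s x. s : Sx (Delta n) m ==> x : Sx K m ==> g m (s, x) = scmp M m (b m s) (al m x)) ==> b = b0"
  proof -
   have A: "EX! b. b : smaps (Delta n) (mp T Y) &
     (ALL m. ALL s:Sx (Delta n) m. ALL x:Sx K m. g m (s, x) = scmp M m (b m s) (al m x))"
    using T Y g unfolding is_tensor_def by blast
   thus thesis using that by (metis (no_types, lifting))
  qed
  have b0in: "b0 m s : hom T Y m" if "s : Sx (Delta n) m" for m s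
   using smap_in[OF smaps_smap[OF b0(1)] that] .
  have ex: "EX! z. z : hom S Y m & pre T S m c z = b0 m s" if s: "s : Sx (Delta n) m" for m s
  proof (rule cokernel_simplex[OF c X T0(1) v Y b0in[OF s]])
   have "pre X T m v (b0 m s) = g m (s, cst K m k)"
    using b0(2)[OF s cst_in[OF K(1,3)]] vc by (simp add: prec_def)
   thus "pre X T m v (b0 m s) = zsimp M X Y m" using gz s by simp
  qed
  have al: "al m x : hom X T m" if "x : Sx K m" for m x using smap_in[OF T0(2) that] .
  have as: "scmp M m z (be m x) = scmp M m (pre T S m c z) (al m x)" if "z : hom S Y m" "x : Sx K m" for m z x
   using that scmp_assoc[OF X T0(1) S(1) Y al[OF that(2)] cst_hom[OF T0(1) S(1,2)] that(1)]
   by (simp add: be_def prec_def postc_def)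
  define b where "b = (%m s. if s : Sx (Delta n) m then (THE z. z : hom S Y m & pre T S m c z = b0 m s) else undefined)"
  have b: "b m s : hom S Y m" "pre T S m c (b m s) = b0 m s" if "s : Sx (Delta n) m" for m s
   using theI'[OF ex[OF that]] that by (auto simp: b_def)
  have eqb: "z = b m s" if "s : Sx (Delta n) m" "z : hom S Y m" "pre T S m c z = b0 m s" for m s z
   using ex[OF that(1)] that b[OF that(1)] by blast
  note pc = smap_pre[OF T0(1) S(1) Y S(2)]
  have sb: "smap (Delta n) (mp S Y) b" unfolding smap_def
  proof (intro allI ballI conjI impI)
   fix m s i assume s: "s : Sx (Delta n) m"
   show "b m s : hom S Y m" using b s by blast
   show "b (Suc m) (Dg (Delta n) m i s) = Dg (mp S Y) m i (b m s)" if i: "i <= m"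
   proof (rule eqb[symmetric])
    show "Dg (Delta n) m i s : Sx (Delta n) (Suc m)" using sset_degen[OF is_sset_Delta s i] .
    show "Dg (mp S Y) m i (b m s) : hom S Y (Suc m)" using sset_degen[OF sset[OF S(1) Y] b(1)[OF s] i] .
    show "pre T S (Suc m) c (Dg (mp S Y) m i (b m s)) = b0 (Suc m) (Dg (Delta n) m i s)"
     using smap_degen[OF pc b(1)[OF s] i] b(2)[OF s] smap_degen[OF smaps_smap[OF b0(1)] s i] by simp
   qed
   assume "0 < m" and i: "i <= m"
   then obtain l where l: "m = Suc l" by (cases m) auto
   note s' = s[unfolded l] and i' = i[unfolded l]
   have "fc S Y (Suc l) i (b (Suc l) s) = b l (Fc (Delta n) (Suc l) i s)"
   proof (rule eqb)
    show "Fc (Delta n) (Suc l) i s : Sx (Delta n) l" using sset_face[OF is_sset_Delta s' i'] .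
    show "fc S Y (Suc l) i (b (Suc l) s) : hom S Y l" using sset_face[OF sset[OF S(1) Y] b(1)[OF s'] i'] .
    show "pre T S l c (fc S Y (Suc l) i (b (Suc l) s)) = b0 l (Fc (Delta n) (Suc l) i s)"
     using smap_face[OF pc b(1)[OF s'] i'] b(2)[OF s'] smap_face[OF smaps_smap[OF b0(1)] s' i'] by simp
   qed
   thus "b (m - 1) (Fc (Delta n) m i s) = fc S Y m i (b m s)" using l by simp
  qed
  show "EX! b. b : smaps (Delta n) (mp S Y) &
     (ALL m. ALL s:Sx (Delta n) m. ALL x:Sx K m. g m (s, x) = scmp M m (b m s) (be m x))"
  proof (rule ex1I[of _ b])
   show "b : smaps (Delta n) (mp S Y) &
     (ALL m. ALL s:Sx (Delta n) m. ALL x:Sx K m. g m (s, x) = scmp M m (b m s) (be m x))"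
    using sb b0(2) b as by (auto simp: smaps_def b_def)
   fix b' assume b': "b' : smaps (Delta n) (mp S Y) &
     (ALL m. ALL s:Sx (Delta n) m. ALL x:Sx K m. g m (s, x) = scmp M m (b' m s) (be m x))"
   have b'in: "b' m s : hom S Y m" if "s : Sx (Delta n) m" for m s
    using smap_in[OF smaps_smap that] b' by blast
   have eq: "(%m s. if s : Sx (Delta n) m then pre T S m c (b' m s) else undefined) = b0"
   proof (rule b0u)
    show "(%m s. if s : Sx (Delta n) m then pre T S m c (b' m s) else undefined) : smaps (Delta n) (mp T Y)"
     using b' by (intro restrict_smaps[OF smap_comp[OF smaps_smap pc]])
      (auto simp: sset_face[OF is_sset_Delta] sset_degen[OF is_sset_Delta])
    show "g m (s, x) = scmp M m (if s : Sx (Delta n) m then pre T S m c (b' m s) else undefined) (al m x)"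
     if "s : Sx (Delta n) m" "x : Sx K m" for m s x
     using b' that as[OF b'in[OF that(1)] that(2)] by simp
   qed
   have e: "pre T S m c (b' m s) = b0 m s" if "s : Sx (Delta n) m" for m s
    using that fun_cong[OF fun_cong[OF eq, of m], of s] by simp
   show "b' = b"
   proof (intro ext)
    fix m s
    show "b' m s = b m s"
    proof (cases "s : Sx (Delta n) m")
     case True
     thus ?thesis using eqb b'in e by blast
    next
     case False
     thus ?thesis using b' smaps_outside by (metis (no_types, lifting) b_def)
    qed
   qed
  qed
 qed
 define P where "P = (%(T, al). is_smash M X K k T al)"
 have "P (S, be)" using \<open>is_smash M X K k S be\<close> by (simp add: P_def)
 hence "P (Eps P)" by (rule someI)
 moreover have "smash M X K k = Eps P" by (simp add: smash_def P_def)
 ultimately show ?thesis by (cases "Eps P") (simp add: P_def)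
qed

end

section \<open>Mapping complexes and fibrations\<close>

text \<open>If one component of a pullback corner carries no information, as happens when the corresponding map
 starts or ends in a zero object, the corner is the mapping complex that forms the other component.\<close>

lemma kan_fibration_transfer:
 assumes t: "!!n y. y : Sx L' n ==> t n y : Sx L n"
  and tf: "!!n y i. y : Sx L' (Suc n) ==> i <= Suc n ==> Fc L (Suc n) i (t (Suc n) y) = t n (Fc L' (Suc n) i y)"
  and fg: "!!n x. x : Sx K n ==> f n x = t n (g n x)"
  and inj: "!!n x y. x : Sx K n ==> y : Sx L' n ==> t n (g n x) = t n y ==> g n x = y"
 shows "kan_fibration K L f ==> kan_fibration K L' g"
  and "trivial_kan_fibration K L f ==> trivial_kan_fibration K L' g"
proof -
 assume k: "kan_fibration K L f"
 show "kan_fibration K L' g" unfolding kan_fibration_def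
 proof (intro allI impI, elim conjE)
  fix n k x y
  assume a: "k <= Suc n" "ALL i<=Suc n. i ~= k --> x i : Sx K n"
   "ALL i j. 0 < n & i < j & j <= Suc n & i ~= k & j ~= k --> Fc K n i (x j) = Fc K n (j - 1) (x i)"
   "y : Sx L' (Suc n)" "ALL i<=Suc n. i ~= k --> Fc L' (Suc n) i y = g n (x i)"
  have "ALL i<=Suc n. i ~= k --> Fc L (Suc n) i (t (Suc n) y) = f n (x i)"
   using a tf fg by simp
  hence "EX z:Sx K (Suc n). f (Suc n) z = t (Suc n) y & (ALL i<=Suc n. i ~= k --> Fc K (Suc n) i z = x i)"
   using k[unfolded kan_fibration_def, rule_format, of k n x "t (Suc n) y"] a t[OF a(4)] by blast
  then obtain z where z: "z : Sx K (Suc n)" "f (Suc n) z = t (Suc n) y" "ALL i<=Suc n. i ~= k --> Fc K (Suc n) i z = x i" by blast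
  have "g (Suc n) z = y" using inj[OF z(1) a(4)] fg[OF z(1)] z(2) by simp
  thus "EX z:Sx K (Suc n). g (Suc n) z = y & (ALL i<=Suc n. i ~= k --> Fc K (Suc n) i z = x i)" using z by blast
 qed
next
 assume k: "trivial_kan_fibration K L f"
 show "trivial_kan_fibration K L' g" unfolding trivial_kan_fibration_def
 proof (intro conjI ballI allI impI; (elim conjE)?)
  fix y assume y: "y : Sx L' 0"
  obtain z where z: "z : Sx K 0" "f 0 z = t 0 y" using k t[OF y] unfolding trivial_kan_fibration_def by blast
  hence "g 0 z = y" using inj[OF z(1) y] fg[OF z(1)] by simp
  thus "EX z:Sx K 0. g 0 z = y" using z by blast
 next
  fix n x y
  assume a: "ALL i<=Suc n. x i : Sx K n"
   "ALL i j. 0 < n & i < j & j <= Suc n --> Fc K n i (x j) = Fc K n (j - 1) (x i)"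
   "y : Sx L' (Suc n)" "ALL i<=Suc n. Fc L' (Suc n) i y = g n (x i)"
  have "ALL i<=Suc n. Fc L (Suc n) i (t (Suc n) y) = f n (x i)" using a tf fg by simp
  hence "EX z:Sx K (Suc n). f (Suc n) z = t (Suc n) y & (ALL i<=Suc n. Fc K (Suc n) i z = x i)"
   using k[unfolded trivial_kan_fibration_def, THEN conjunct2, rule_format, of n x "t (Suc n) y"] a t[OF a(3)] by blast
  then obtain z where z: "z : Sx K (Suc n)" "f (Suc n) z = t (Suc n) y" "ALL i<=Suc n. Fc K (Suc n) i z = x i" by blast
  have "g (Suc n) z = y" using inj[OF z(1) a(3)] fg[OF z(1)] z(2) by simp
  thus "EX z:Sx K (Suc n). g (Suc n) z = y & (ALL i<=Suc n. Fc K (Suc n) i z = x i)" using z by blast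
 qed
qed

definition contractible :: "'x sset => bool" where
 "contractible K \<longleftrightarrow> trivial_kan_fibration K point (%_ _. ())"

lemma contractible_fill4:
 assumes f: "contractible K" and K: "is_sset K" "b : Sx K 0" and c: "compat4 K b n a0 a1 a2 a3"
 obtains z where "z : Sx K (Suc n)" "Fc K (Suc n) 0 z = a0" "Fc K (Suc n) 1 z = a1"
  "1 <= n ==> Fc K (Suc n) 2 z = a2" "2 <= n ==> Fc K (Suc n) 3 z = a3"
  "!!i. 4 <= i ==> i <= Suc n ==> Fc K (Suc n) i z = cst K n b"
proof -
 have "() : Sx point (Suc n)" by (simp add: point_def)
 from trivial_kan_lift4[OF f[unfolded contractible_def] K c this] show thesis using that by (auto simp: point_def)
qed

context pointed_smc begin

abbreviation src :: "'o => 'o => 'a => 'a" where "src X Y e == fc X Y (Suc 0) (Suc 0) e"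
abbreviation tgt :: "'o => 'o => 'a => 'a" where "tgt X Y e == fc X Y (Suc 0) 0 e"

lemma cof_arr: "(A, B, i) : cof M ==> A : sob M & B : sob M & i : hom A B 0"
 and fib_arr: "(A, B, i) : fib M ==> A : sob M & B : sob M & i : hom A B 0"
 and weq_arr: "(A, B, i) : weq M ==> A : sob M & B : sob M & i : hom A B 0"
 using ms_arrs[OF ms] by (auto simp: arrs_def)

lemma cofibrant_ob: "cofibrant M X ==> X : sob M"
 and fibrant_ob: "fibrant M X ==> X : sob M"
 using cof_arr fib_arr by (auto simp: cofibrant_def fibrant_def)

lemma edge_faces:
 "X : sob M ==> Y : sob M ==> e : hom X Y (Suc 0) ==> src X Y e : hom X Y 0"
 "X : sob M ==> Y : sob M ==> e : hom X Y (Suc 0) ==> tgt X Y e : hom X Y 0"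
 using sset_face[OF sset, of X Y e 0] by auto

lemma post_edge:
 "X : sob M ==> Y : sob M ==> Z : sob M ==> g : hom Y Z 0 ==> e : hom X Y (Suc 0) ==>
  src X Z (post Y Z (Suc 0) g e) = g ** src X Y e"
 "X : sob M ==> Y : sob M ==> Z : sob M ==> g : hom Y Z 0 ==> e : hom X Y (Suc 0) ==>
  tgt X Z (post Y Z (Suc 0) g e) = g ** tgt X Y e"
 using smap_face[OF smap_post, of X Y Z g e 0 "Suc 0"] smap_face[OF smap_post, of X Y Z g e 0 0] by simp_all

lemma pre_edge:
 "X : sob M ==> Y : sob M ==> Z : sob M ==> f : hom X Y 0 ==> e : hom Y Z (Suc 0) ==>
  src X Z (pre X Y (Suc 0) f e) = src Y Z e ** f"
 "X : sob M ==> Y : sob M ==> Z : sob M ==> f : hom X Y 0 ==> e : hom Y Z (Suc 0) ==>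
  tgt X Z (pre X Y (Suc 0) f e) = tgt Y Z e ** f"
 using smap_face[OF smap_pre, of X Y Z f e 0 "Suc 0"] smap_face[OF smap_pre, of X Y Z f e 0 0] by simp_all

lemma corner_kan:
 assumes i: "(A, B, i) : cof M" and p: "(X, Y, p) : fib M"
 shows "kan_fibration (mp B X) (pullback_corner M (A, B, i) (X, Y, p)) (%n h. (pre A B n i h, post X Y n p h))"
  and "(A, B, i) : weq M | (X, Y, p) : weq M ==>
   trivial_kan_fibration (mp B X) (pullback_corner M (A, B, i) (X, Y, p)) (%n h. (pre A B n i h, post X Y n p h))"
 using SM7 i p unfolding SM7_def Let_def by blast+

lemma corner_Sx: "Sx (pullback_corner M (A, B, i) (X, Y, p)) n =
  {(v, w). v : hom A X n & w : hom B Y n & post X Y n p v = pre A B n i w}"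
 and corner_Fc: "Fc (pullback_corner M (A, B, i) (X, Y, p)) n k (v, w) = (fc A X n k v, fc B Y n k w)"
 by (auto simp: pullback_corner_def sprod_def)

lemma zsimp_face: "X : sob M ==> Y : sob M ==> i <= Suc n ==> fc X Y (Suc n) i (zsimp M X Y (Suc n)) = zsimp M X Y n"
 unfolding zsimp_def by (rule cst_face[OF sset zmap_in])

lemma cof_kan:
 assumes i: "(A, B, i) : cof M" and Y: "fibrant M Y"
 shows "kan_fibration (mp B Y) (mp A Y) (%n. pre A B n i)"
  and "(A, B, i) : weq M ==> trivial_kan_fibration (mp B Y) (mp A Y) (%n. pre A B n i)"
proof -
 obtain Z p where Z: "is_zero (uc M) Z" and p: "(Y, Z, p) : fib M" using Y by (auto simp: fibrant_def)
 note o = cof_arr[OF i] fib_arr[OF p]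
 have t: "(y, zsimp M B Z n) : Sx (pullback_corner M (A, B, i) (Y, Z, p)) n" if "y : hom A Y n" for n y
  using that o zsimp_in[of B Z n] zero_simplex_to[OF Z, of A "post Y Z n p y" n] post_in[of A Y Z p y n]
   pre_zsimp[of A B Z i n] by (simp add: corner_Sx)
 have fg: "(pre A B n i x, post Y Z n p x) = (pre A B n i x, zsimp M B Z n)" if "x : hom B Y n" for n x
  using that o zero_simplex_to[OF Z, of B "post Y Z n p x" n] post_in[of B Y Z p x n] by simp
 have tf: "Fc (pullback_corner M (A, B, i) (Y, Z, p)) (Suc n) k (y, zsimp M B Z (Suc n)) = (fc A Y (Suc n) k y, zsimp M B Z n)"
  if "k <= Suc n" for n k y using that o zsimp_face[of B Z k n] by (simp add: corner_Fc)
 show "kan_fibration (mp B Y) (mp A Y) (%n. pre A B n i)"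
  by (rule kan_fibration_transfer(1)[where t = "%n y. (y, zsimp M B Z n)", OF t tf fg _ corner_kan(1)[OF i p]]) auto
 show "trivial_kan_fibration (mp B Y) (mp A Y) (%n. pre A B n i)" if "(A, B, i) : weq M"
  by (rule kan_fibration_transfer(2)[where t = "%n y. (y, zsimp M B Z n)", OF t tf fg _ corner_kan(2)[OF i p]]) (use that in auto)
qed

lemma fib_kan:
 assumes X: "cofibrant M X" and p: "(E, D, p) : fib M"
 shows "kan_fibration (mp X E) (mp X D) (%n. post E D n p)"
  and "(E, D, p) : weq M ==> trivial_kan_fibration (mp X E) (mp X D) (%n. post E D n p)"
proof -
 obtain Z i where Z: "is_zero (uc M) Z" and i: "(Z, X, i) : cof M" using X by (auto simp: cofibrant_def)
 note o = cof_arr[OF i] fib_arr[OF p]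
 have t: "(zsimp M Z E n, y) : Sx (pullback_corner M (Z, X, i) (E, D, p)) n" if "y : hom X D n" for n y
  using that o zsimp_in[of Z E n] zero_simplex_from[OF Z, of D "pre Z X n i y" n] pre_in[of Z X D i y n]
   post_zsimp[of Z E D p n] by (simp add: corner_Sx)
 have fg: "(pre Z X n i x, post E D n p x) = (zsimp M Z E n, post E D n p x)" if "x : hom X E n" for n x
  using that o zero_simplex_from[OF Z, of E "pre Z X n i x" n] pre_in[of Z X E i x n] by simp
 have tf: "Fc (pullback_corner M (Z, X, i) (E, D, p)) (Suc n) k (zsimp M Z E (Suc n), y) = (zsimp M Z E n, fc X D (Suc n) k y)"
  if "k <= Suc n" for n k y using that o zsimp_face[of Z E k n] by (simp add: corner_Fc)
 show "kan_fibration (mp X E) (mp X D) (%n. post E D n p)"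
  by (rule kan_fibration_transfer(1)[where t = "%n y. (zsimp M Z E n, y)", OF t tf fg _ corner_kan(1)[OF i p]]) auto
 show "trivial_kan_fibration (mp X E) (mp X D) (%n. post E D n p)" if "(E, D, p) : weq M"
  by (rule kan_fibration_transfer(2)[where t = "%n y. (zsimp M Z E n, y)", OF t tf fg _ corner_kan(2)[OF i p]]) (use that in auto)
qed

text \<open>The mapping complex into a zero object has one simplex in each degree, so compatibility over it is no
 condition.\<close>

lemma to_point:
 assumes Z: "is_zero (uc M) Z" and X: "X : sob M"
 shows "kan_fibration K (mp X Z) f ==> (!!n x. x : Sx K n ==> f n x : hom X Z n) ==> kan K"
  and "trivial_kan_fibration K (mp X Z) f ==> (!!n x. x : Sx K n ==> f n x : hom X Z n) ==> contractible K"
proof -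
 have Z0: "Z : sob M" using zero_ob[OF Z] by simp
 have e: "f n x = zsimp M X Z n" if "!!n x. x : Sx K n ==> f n x : hom X Z n" "x : Sx K n" for n x
  using zero_simplex_to[OF Z X that(1)[OF that(2)]] .
 show "kan K" if k: "kan_fibration K (mp X Z) f" and m: "!!n x. x : Sx K n ==> f n x : hom X Z n"
  unfolding kan_def
 proof (intro allI impI, elim conjE)
  fix n k x
  assume a: "k <= Suc n" "ALL i<=Suc n. i ~= k --> x i : Sx K n"
   "ALL i j. 0 < n & i < j & j <= Suc n & i ~= k & j ~= k --> Fc K n i (x j) = Fc K n (j - 1) (x i)"
  have "ALL i<=Suc n. i ~= k --> fc X Z (Suc n) i (zsimp M X Z (Suc n)) = f n (x i)"
   using a(2) e[OF m] zsimp_face[OF X Z0] by simp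
  thus "EX z:Sx K (Suc n). ALL i<=Suc n. i ~= k --> Fc K (Suc n) i z = x i"
   using k[unfolded kan_fibration_def, rule_format, of k n x "zsimp M X Z (Suc n)"] a zsimp_in[OF X Z0] by blast
 qed
 show "contractible K" if k: "trivial_kan_fibration K (mp X Z) f" and m: "!!n x. x : Sx K n ==> f n x : hom X Z n"
  unfolding contractible_def trivial_kan_fibration_def
 proof (intro conjI ballI allI impI; (elim conjE)?)
  show "EX z:Sx K 0. () = y" for y :: unit
   using k zsimp_in[OF X Z0, of 0] unfolding trivial_kan_fibration_def by fastforce
  fix n x and y :: unit
  assume a: "ALL i<=Suc n. x i : Sx K n"
   "ALL i j. 0 < n & i < j & j <= Suc n --> Fc K n i (x j) = Fc K n (j - 1) (x i)"
  have "ALL i<=Suc n. fc X Z (Suc n) i (zsimp M X Z (Suc n)) = f n (x i)"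
   using a(1) e[OF m] zsimp_face[OF X Z0] by simp
  thus "EX z:Sx K (Suc n). () = y & (ALL i<=Suc n. Fc K (Suc n) i z = x i)"
   using k[unfolded trivial_kan_fibration_def, THEN conjunct2, rule_format, of n x "zsimp M X Z (Suc n)"] a zsimp_in[OF X Z0] by auto
 qed
qed

text \<open>The case of a map from and a map to a zero object.\<close>

lemma kan_hom:
 assumes X: "cofibrant M X" and Y: "fibrant M Y"
 shows "kan (mp X Y)"
proof -
 obtain Z p where Z: "is_zero (uc M) Z" and p: "(Y, Z, p) : fib M" using Y by (auto simp: fibrant_def)
 note o = cofibrant_ob[OF X] fib_arr[OF p]
 show ?thesis by (rule to_point(1)[OF Z o(1) fib_kan(1)[OF X p]]) (use o in \<open>auto intro: post_in\<close>)
qed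

lemma lift_cof:
 assumes "(A, B, i) : cof M" "(E, D, p) : fib M" "(A, B, i) : weq M | (E, D, p) : weq M"
  and "a : hom A E 0" "b : hom B D 0" "p ** a = b ** i"
 obtains h where "h : hom B E 0" "h ** i = a" "p ** h = b"
proof -
 have "lifts (uc M) (A, B, i) (E, D, p)" using ms_lift1[OF ms] ms_lift2[OF ms] assms(1-3) by blast
 thus thesis using assms(4-) that unfolding lifts_def by auto
qed

lemma extend_fibrant:
 assumes i: "(A, B, i) : cof M" "(A, B, i) : weq M" and Y: "fibrant M Y" and f: "f : hom A Y 0"
 obtains h where "h : hom B Y 0" "h ** i = f"
proof -
 obtain Z p where Z: "is_zero (uc M) Z" and p: "(Y, Z, p) : fib M" using Y by (auto simp: fibrant_def)
 note o = cof_arr[OF i(1)] fib_arr[OF p]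
 have "p ** f = zmap B Z ** i"
  using zero_eq_to[OF Z, of A] o comp0_in[of A Y Z f p] comp0_in[of A B Z i "zmap B Z"] zmap_in[of B Z] f by simp
 thus thesis using lift_cof[OF i(1) p _ f zmap_in[of B Z]] i o that by blast
qed

lemma fib_by_lifting:
 assumes "E : sob M" "D : sob M" "p : hom E D 0"
 shows "(!!A B i a b. (A, B, i) : cof M ==> (A, B, i) : weq M ==> a : hom A E 0 ==> b : hom B D 0 ==> p ** a = b ** i ==>
   EX h:hom B E 0. h ** i = a & p ** h = b) ==> (E, D, p) : fib M"
  and "(!!A B i a b. (A, B, i) : cof M ==> a : hom A E 0 ==> b : hom B D 0 ==> p ** a = b ** i ==>
   EX h:hom B E 0. h ** i = a & p ** h = b) ==> (E, D, p) : fib M \<inter> weq M"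
proof -
 have a: "(E, D, p) : arrs (uc M)" using assms by (simp add: arrs_def)
 show "(E, D, p) : fib M" if "!!A B i a b. (A, B, i) : cof M ==> (A, B, i) : weq M ==> a : hom A E 0 ==> b : hom B D 0 ==> p ** a = b ** i ==>
   EX h:hom B E 0. h ** i = a & p ** h = b"
  by (rule retract_lift_fib(1)[OF category_uc ms a]) (use that in \<open>auto simp: lifts_def\<close>)
 show "(E, D, p) : fib M \<inter> weq M" if "!!A B i a b. (A, B, i) : cof M ==> a : hom A E 0 ==> b : hom B D 0 ==> p ** a = b ** i ==>
   EX h:hom B E 0. h ** i = a & p ** h = b"
  by (rule retract_lift_fib(2)[OF category_uc ms a]) (use that in \<open>auto simp: lifts_def\<close>)
qed

lemma cof_by_lifting:
 assumes "A : sob M" "B : sob M" "i : hom A B 0"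
 shows "(!!E D p a b. (E, D, p) : fib M ==> (E, D, p) : weq M ==> a : hom A E 0 ==> b : hom B D 0 ==> p ** a = b ** i ==>
   EX h:hom B E 0. h ** i = a & p ** h = b) ==> (A, B, i) : cof M"
  and "(!!E D p a b. (E, D, p) : fib M ==> a : hom A E 0 ==> b : hom B D 0 ==> p ** a = b ** i ==>
   EX h:hom B E 0. h ** i = a & p ** h = b) ==> (A, B, i) : cof M \<inter> weq M"
proof -
 have a: "(A, B, i) : arrs (uc M)" using assms by (simp add: arrs_def)
 show "(A, B, i) : cof M" if "!!E D p a b. (E, D, p) : fib M ==> (E, D, p) : weq M ==> a : hom A E 0 ==> b : hom B D 0 ==> p ** a = b ** i ==>
   EX h:hom B E 0. h ** i = a & p ** h = b"
  by (rule retract_lift_cof(1)[OF category_uc ms a]) (use that in \<open>auto simp: lifts_def\<close>)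
 show "(A, B, i) : cof M \<inter> weq M" if "!!E D p a b. (E, D, p) : fib M ==> a : hom A E 0 ==> b : hom B D 0 ==> p ** a = b ** i ==>
   EX h:hom B E 0. h ** i = a & p ** h = b"
  by (rule retract_lift_cof(2)[OF category_uc ms a]) (use that in \<open>auto simp: lifts_def\<close>)
qed

text \<open>Into a zero object and out of it, lifting problems only have one nontrivial map.\<close>

lemma fibrant_by_lifting:
 assumes Y: "Y : sob M"
  and l: "!!A B i a. (A, B, i) : cof M ==> (A, B, i) : weq M ==> a : hom A Y 0 ==> EX h:hom B Y 0. h ** i = a"
 shows "fibrant M Y"
proof -
 obtain Z where Z: "is_zero (uc M) Z" "Z : sob M" by (rule zero_ex)
 have "(Y, Z, zmap Y Z) : fib M"
 proof (rule fib_by_lifting(1)[OF Y Z(2) zmap_in[OF Y Z(2)]])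
  fix A B i a b assume a: "(A, B, i) : cof M" "(A, B, i) : weq M" "a : hom A Y 0" "b : hom B Z 0"
  obtain h where h: "h : hom B Y 0" "h ** i = a" using l[OF a(1-3)] by blast
  have "zmap Y Z ** h = b"
   using zero_eq_to[OF Z(1), of B] cof_arr[OF a(1)] comp0_in[of B Y Z h "zmap Y Z"] Y Z zmap_in[OF Y Z(2)] h a by simp
  thus "EX h:hom B Y 0. h ** i = a & zmap Y Z ** h = b" using h by blast
 qed
 thus ?thesis using Z(1) by (auto simp: fibrant_def)
qed

lemma cofibrant_by_lifting:
 assumes X: "X : sob M"
  and l: "!!E D p b. (E, D, p) : fib M ==> (E, D, p) : weq M ==> b : hom X D 0 ==> EX h:hom X E 0. p ** h = b"
 shows "cofibrant M X"
proof -
 obtain Z where Z: "is_zero (uc M) Z" "Z : sob M" by (rule zero_ex)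
 have "(Z, X, zmap Z X) : cof M"
 proof (rule cof_by_lifting(1)[OF Z(2) X zmap_in[OF Z(2) X]])
  fix E D p a b assume a: "(E, D, p) : fib M" "(E, D, p) : weq M" "a : hom Z E 0" "b : hom X D 0"
  obtain h where h: "h : hom X E 0" "p ** h = b" using l[OF a(1,2,4)] by blast
  have "h ** zmap Z X = a"
   using zero_eq_from[OF Z(1), of E] fib_arr[OF a(1)] comp0_in[of Z X E "zmap Z X" h] X Z zmap_in[OF Z(2) X] h a by simp
  thus "EX h:hom X E 0. h ** zmap Z X = a & p ** h = b" using h by blast
 qed
 thus ?thesis using Z(1) by (auto simp: cofibrant_def)
qed

text \<open>A vertex and an edge are a horn of dimension one relative to a cofibration; if the cofibration is trivial,
 both ends may be prescribed.\<close>

lemma extend_edge: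
 assumes i: "(A, B, i) : cof M" and Y: "fibrant M Y" and e: "e : hom A Y (Suc 0)" and x: "x : hom B Y 0" "src A Y e = x ** i"
 obtains e' where "e' : hom B Y (Suc 0)" "pre A B (Suc 0) i e' = e" "src B Y e' = x"
proof -
 have "EX z:hom B Y (Suc 0). pre A B (Suc 0) i z = e & (ALL k<=Suc 0. k ~= 0 --> fc B Y (Suc 0) k z = x)"
  using cof_kan(1)[OF i Y, unfolded kan_fibration_def, rule_format, of 0 0 "%_. x" e] e x by (auto simp: le_Suc_eq)
 thus thesis using that by auto
qed

lemma extend_edge2:
 assumes i: "(A, B, i) : cof M" "(A, B, i) : weq M" and Y: "fibrant M Y" and e: "e : hom A Y (Suc 0)"
  and x: "x : hom B Y 0" "src A Y e = x ** i" and y: "y : hom B Y 0" "tgt A Y e = y ** i"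
 obtains e' where "e' : hom B Y (Suc 0)" "pre A B (Suc 0) i e' = e" "src B Y e' = x" "tgt B Y e' = y"
proof -
 have "EX z:hom B Y (Suc 0). pre A B (Suc 0) i z = e & (ALL k<=Suc 0. fc B Y (Suc 0) k z = (if k = 0 then y else x))"
  using cof_kan(2)[OF i(1) Y i(2), unfolded trivial_kan_fibration_def, THEN conjunct2, rule_format, of 0 "%k. if k = 0 then y else x" e] e x y
  by (auto simp: le_Suc_eq)
 thus thesis using that by auto
qed

lemma lift_edge:
 assumes X: "cofibrant M X" and p: "(E, D, p) : fib M" and e: "e : hom X D (Suc 0)" and x: "x : hom X E 0" "src X D e = p ** x"
 obtains e' where "e' : hom X E (Suc 0)" "post E D (Suc 0) p e' = e" "src X E e' = x"
proof -
 have "EX z:hom X E (Suc 0). post E D (Suc 0) p z = e & (ALL k<=Suc 0. k ~= 0 --> fc X E (Suc 0) k z = x)"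
  using fib_kan(1)[OF X p, unfolded kan_fibration_def, rule_format, of 0 0 "%_. x" e] e x by (auto simp: le_Suc_eq)
 thus thesis using that by auto
qed

lemma lift_edge2:
 assumes X: "cofibrant M X" and p: "(E, D, p) : fib M" "(E, D, p) : weq M" and e: "e : hom X D (Suc 0)"
  and x: "x : hom X E 0" "src X D e = p ** x" and y: "y : hom X E 0" "tgt X D e = p ** y"
 obtains e' where "e' : hom X E (Suc 0)" "post E D (Suc 0) p e' = e" "src X E e' = x" "tgt X E e' = y"
proof -
 have "EX z:hom X E (Suc 0). post E D (Suc 0) p z = e & (ALL k<=Suc 0. fc X E (Suc 0) k z = (if k = 0 then y else x))"
  using fib_kan(2)[OF X p, unfolded trivial_kan_fibration_def, THEN conjunct2, rule_format, of 0 "%k. if k = 0 then y else x" e] e x y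
  by (auto simp: le_Suc_eq)
 thus thesis using that by auto
qed

end

section \<open>Path objects, cones and suspensions\<close>

text \<open>A loop fibration: \<open>E\<close> is contractible and \<open>F\<close> is the fibre of \<open>q : E \<rightarrow> K\<close>.  A simplex of \<open>E\<close>
 whose only nonzero face is a cycle \<open>z\<close> of \<open>F\<close> is mapped by \<open>q\<close> to a cycle \<open>x\<close> of \<open>K\<close>; this relation
 realizes the boundary isomorphism between the homotopy groups of \<open>K\<close> and \<open>F\<close>.\<close>

locale loop_seq =
 fixes F :: "'x sset" and f and E :: "'y sset" and e and K :: "'z sset" and k and j and q
 assumes F: "is_sset F" "f : Sx F 0" and E: "is_sset E" "e : Sx E 0" and K: "is_sset K" "k : Sx K 0"
  and j: "smap F E j" "j 0 f = e" and q: "smap E K q" "q 0 e = k"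
  and kanK: "kan K" and fib: "kan_fibration E K q" and contr: "contractible E"
  and zero: "!!n z. z : Sx F n ==> q n (j n z) = cst K n k"
  and ker: "!!n y. y : Sx E n ==> q n y = cst K n k ==> EX! z. z : Sx F n & j n z = y"
begin

definition lrel :: "nat => 'x => 'z => bool" where
 "lrel n z x \<longleftrightarrow> z : pi_cycles F f n & (EX y:Sx E (Suc n). Fc E (Suc n) 0 y = j n z &
     (ALL i. 1 <= i & i <= Suc n --> Fc E (Suc n) i y = cst E n e) & q (Suc n) y = x)"

lemma j_inj: "z : Sx F n ==> z' : Sx F n ==> j n z = j n z' ==> z = z'"
 using ker[of "j n z" n] smap_in[OF j(1)] zero by metis

lemma j_cst: "j n (cst F n f) = cst E n e"
 using smap_cst[OF j(1) F] j(2) by simp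

lemma q_cst: "q n (cst E n e) = cst K n k"
 using smap_cst[OF q(1) E] q(2) by simp

lemma j_face: "z : Sx F (Suc n) ==> i <= Suc n ==> Fc E (Suc n) i (j (Suc n) z) = j n (Fc F (Suc n) i z)"
 using smap_face[OF j(1)] by simp

lemma q_face: "y : Sx E (Suc n) ==> i <= Suc n ==> Fc K (Suc n) i (q (Suc n) y) = q n (Fc E (Suc n) i y)"
 using smap_face[OF q(1)] by simp

lemma lrel_cycle_right: "lrel n z x ==> x : pi_cycles K k (Suc n)"
proof -
 assume "lrel n z x"
 then obtain y where y: "z : pi_cycles F f n" "y : Sx E (Suc n)" "Fc E (Suc n) 0 y = j n z"
   "!!i. 1 <= i ==> i <= Suc n ==> Fc E (Suc n) i y = cst E n e" "q (Suc n) y = x"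
  unfolding lrel_def by blast
 have "Fc K (Suc n) i x = cst K n k" if "i <= Suc n" for i
  using q_face[OF y(2) that] y(3) y(4)[of i] zero[OF cycle_in[OF y(1)]] q_cst that unfolding y(5) by (cases "i = 0") auto
 thus ?thesis using smap_in[OF q(1) y(2)] y(5) by (simp add: pi_cycles_def)
qed

lemma cyc_face: "z : pi_cycles F f n ==> 0 < n ==> i <= n ==> Fc E n i (j n z) = cst E (n - 1) e"
proof -
 assume z: "z : pi_cycles F f n" and n: "0 < n" "i <= n"
 then obtain m where m: "n = Suc m" by (cases n) auto
 show ?thesis using j_face[of z m i] cycle_in[OF z] cycle_face[OF z n] j_cst[of m] n m by simp
qed

lemma lrel_total_left: assumes z: "z : pi_cycles F f n" obtains x where "lrel n z x"
proof -
 have z0: "j n z : Sx E n" using smap_in[OF j(1) cycle_in[OF z]] .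
 have "compat4 E e n (j n z) (cst E n e) (cst E n e) (cst E n e)"
  unfolding compat4_def compat3_def using z0 cst_in[OF E] cst_face'[OF E] cyc_face[OF z] by auto
 from contractible_fill4[OF contr E this] obtain y where y: "y : Sx E (Suc n)" "Fc E (Suc n) 0 y = j n z"
  "Fc E (Suc n) 1 y = cst E n e" "1 <= n ==> Fc E (Suc n) 2 y = cst E n e" "2 <= n ==> Fc E (Suc n) 3 y = cst E n e"
  "!!i. 4 <= i ==> i <= Suc n ==> Fc E (Suc n) i y = cst E n e" by auto
 have "Fc E (Suc n) i y = cst E n e" if i: "1 <= i" "i <= Suc n" for i
 proof -
  have "i = 1 | i = 2 & 1 <= n | i = 3 & 2 <= n | 4 <= i" using i by linarith
  thus ?thesis using y(3-6) i by auto
 qed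
 hence "lrel n z (q (Suc n) y)" unfolding lrel_def using z y(1,2) by blast
 thus thesis by (rule that)
qed

lemma lrel_total_right: assumes x: "x : pi_cycles K k (Suc n)" obtains z where "lrel n z x"
proof -
 have xf: "Fc K (Suc n) i x = q n (cst E n e)" if "i <= Suc n" for i using cycle_face[OF x _ that] q_cst by simp
 have "compat3 E e n (cst E n e) (cst E n e) (cst E n e)"
  unfolding compat3_def using cst_in[OF E] cst_face'[OF E] by auto
 from kan_lift3[OF fib E this cycle_in[OF x] xf xf xf xf] obtain y where y: "y : Sx E (Suc n)" "q (Suc n) y = x"
  "Fc E (Suc n) 1 y = cst E n e" "1 <= n ==> Fc E (Suc n) 2 y = cst E n e" "2 <= n ==> Fc E (Suc n) 3 y = cst E n e"
  "!!i. 4 <= i ==> i <= Suc n ==> Fc E (Suc n) i y = cst E n e" by auto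
 have yf: "Fc E (Suc n) i y = cst E n e" if i: "1 <= i" "i <= Suc n" for i
 proof -
  have "i = 1 | i = 2 & 1 <= n | i = 3 & 2 <= n | 4 <= i" using i by linarith
  thus ?thesis using y(3-6) i by auto
 qed
 have y0: "Fc E (Suc n) 0 y : Sx E n" using sset_face[OF E(1) y(1)] by simp
 have "q n (Fc E (Suc n) 0 y) = cst K n k" using q_face[OF y(1), of 0] y(2) xf[of 0] q_cst by simp
 then obtain z where z: "z : Sx F n" "j n z = Fc E (Suc n) 0 y" using ker[OF y0] by blast
 have "Fc F n i z = cst F (n - 1) f" if i: "0 < n" "i <= n" for i
 proof -
  obtain m where m: "n = Suc m" using i by (cases n) auto
  have "j m (Fc F n i z) = Fc E n i (Fc E (Suc n) 0 y)" using j_face[of z m i] z i m by simp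
  also have "\<dots> = Fc E n 0 (Fc E (Suc n) (Suc i) y)"
   using sset_face_face[OF E(1), of y m 0 "Suc i"] y(1) i m by simp
  also have "\<dots> = cst E m e" using yf[of "Suc i"] i m cst_face[OF E, of 0 m] by simp
  finally have "j m (Fc F n i z) = j m (cst F m f)" using j_cst by simp
  thus ?thesis using j_inj[of "Fc F n i z" m "cst F m f"] sset_face[OF F(1), of z m i] z i m cst_in[OF F] by simp
 qed
 hence "z : pi_cycles F f n" using z by (simp add: pi_cycles_def)
 hence "lrel n z x" unfolding lrel_def using y(1,2) z(2) yf by metis
 thus thesis by (rule that)
qed

lemma lrel_null: assumes r: "lrel n z x" and z: "null F f n z" shows "null K k (Suc n) x"
proof -
 obtain y where y: "z : pi_cycles F f n" "y : Sx E (Suc n)" "Fc E (Suc n) 0 y = j n z"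
   "!!i. 1 <= i ==> i <= Suc n ==> Fc E (Suc n) i y = cst E n e" "q (Suc n) y = x"
  using r unfolding lrel_def by blast
 obtain w where w: "w : Sx F (Suc n)" "Fc F (Suc n) 0 w = z" "!!i. 1 <= i ==> i <= Suc n ==> Fc F (Suc n) i w = cst F n f"
  using z unfolding null_alt by blast
 define jw where "jw = j (Suc n) w"
 have jw: "jw : Sx E (Suc n)" "Fc E (Suc n) 0 jw = j n z" "!!i. 1 <= i ==> i <= Suc n ==> Fc E (Suc n) i jw = cst E n e"
  unfolding jw_def using smap_in[OF j(1) w(1)] j_face[OF w(1)] w(2,3) j_cst by auto
 have "compat4 E e (Suc n) y jw (cst E (Suc n) e) (cst E (Suc n) e)"
  unfolding compat4_def compat3_def using y jw cst_in[OF E] cst_face[OF E] by auto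
 from contractible_fill4[OF contr E this] obtain v where v: "v : Sx E (Suc (Suc n))" "Fc E (Suc (Suc n)) 0 v = y"
  "Fc E (Suc (Suc n)) 1 v = jw" "Fc E (Suc (Suc n)) 2 v = cst E (Suc n) e" "2 <= Suc n ==> Fc E (Suc (Suc n)) 3 v = cst E (Suc n) e"
  "!!i. 4 <= i ==> i <= Suc (Suc n) ==> Fc E (Suc (Suc n)) i v = cst E (Suc n) e" by auto
 show ?thesis unfolding null_alt
 proof (intro bexI[of _ "q (Suc (Suc n)) v"] conjI allI impI)
  show "q (Suc (Suc n)) v : Sx K (Suc (Suc n))" using smap_in[OF q(1) v(1)] .
  show "Fc K (Suc (Suc n)) 0 (q (Suc (Suc n)) v) = x" using q_face[OF v(1), of 0] v(2) y(5) by simp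
  fix i assume i: "1 <= i & i <= Suc (Suc n)"
  hence "i = 1 | i = 2 | i = 3 & 2 <= Suc n | 4 <= i" by linarith
  thus "Fc K (Suc (Suc n)) i (q (Suc (Suc n)) v) = cst K (Suc n) k"
   using q_face[OF v(1), of i] v(3-6) i q_cst[of "Suc n"] zero[OF w(1)] jw_def by auto
 qed
qed

lemma lrel_rel12: assumes r: "lrel n z x" "lrel n z' x'" and x: "rel12 K k (Suc n) x x'" shows "pi_rel F f n z z'"
proof -
 obtain y where y: "z : pi_cycles F f n" "y : Sx E (Suc n)" "Fc E (Suc n) 0 y = j n z"
   "!!i. 1 <= i ==> i <= Suc n ==> Fc E (Suc n) i y = cst E n e" "q (Suc n) y = x"
  using r(1) unfolding lrel_def by blast
 obtain y' where y': "z' : pi_cycles F f n" "y' : Sx E (Suc n)" "Fc E (Suc n) 0 y' = j n z'"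
   "!!i. 1 <= i ==> i <= Suc n ==> Fc E (Suc n) i y' = cst E n e" "q (Suc n) y' = x'"
  using r(2) unfolding lrel_def by blast
 obtain w where w: "w : Sx K (Suc (Suc n))" "Fc K (Suc (Suc n)) 0 w = cst K (Suc n) k" "Fc K (Suc (Suc n)) 1 w = x"
   "Fc K (Suc (Suc n)) 2 w = x'" "!!i. 3 <= i ==> i <= Suc (Suc n) ==> Fc K (Suc (Suc n)) i w = cst K (Suc n) k"
  using x unfolding rel12_def by blast
 have "compat3 E e (Suc n) y y' (cst E (Suc n) e)"
  unfolding compat3_def using y y' cst_in[OF E] cst_face[OF E] by auto
 from kan_lift3[OF fib E this w(1), simplified y(5) y'(5) q_cst, OF w(3) w(4) w(5) w(5)]
 obtain v where v: "v : Sx E (Suc (Suc n))" "q (Suc (Suc n)) v = w" "Fc E (Suc (Suc n)) 1 v = y"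
  "Fc E (Suc (Suc n)) 2 v = y'" "2 <= Suc n ==> Fc E (Suc (Suc n)) 3 v = cst E (Suc n) e"
  "!!i. 4 <= i ==> i <= Suc (Suc n) ==> Fc E (Suc (Suc n)) i v = cst E (Suc n) e" by auto
 note l = face0_faces[OF E v(1) _ v(3-6), simplified]
 define t where "t = Fc E (Suc (Suc n)) 0 v"
 have t: "t : Sx E (Suc n)" "Fc E (Suc n) 0 t = j n z" "Fc E (Suc n) 1 t = j n z'"
  using l(1-3) y(3) y'(3) unfolding t_def by auto
 have t2: "Fc E (Suc n) i t = cst E n e" if i: "2 <= i" "i <= Suc n" for i
 proof -
  have "i = 2 & 1 <= n | 3 <= i" using i by linarith
  thus ?thesis using l(4,5) cst_face[OF E, of 0 n] i unfolding t_def by auto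
 qed
 have "q (Suc n) t = cst K (Suc n) k" unfolding t_def using q_face[OF v(1), of 0] v(2) w(2) by simp
 then obtain s where s: "s : Sx F (Suc n)" "j (Suc n) s = t" using ker[OF t(1)] by blast
 have sf: "Fc F (Suc n) i s = a" if "i <= Suc n" "a : Sx F n" "Fc E (Suc n) i t = j n a" for i a
  using j_inj[OF sset_face[OF F(1) s(1) that(1)] that(2)] j_face[OF s(1) that(1)] s(2) that(3) by simp
 show ?thesis unfolding pi_rel_def
  by (rule bexI[OF _ s(1)])
   (use sf[OF _ cycle_in[OF y(1)]] sf[OF _ cycle_in[OF y'(1)]] sf[OF _ cst_in[OF F]] t(2,3) t2 j_cst[of n] in auto)
qed

end

lemma unique_eqI: "EX! x. P x ==> P a ==> P b ==> a = b"
 by blast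

context pointed_smc begin

definition is_path :: "'o => 'o => 'a => bool" where
 "is_path Y P p \<longleftrightarrow> P : sob M & p : hom P Y (Suc 0) &
     (ALL X:sob M. ALL e:hom X Y (Suc 0). EX! h. h : hom X P 0 & pre X P (Suc 0) h p = e)"

definition is_based :: "'o => 'o => 'a => bool" where
 "is_based Y P p \<longleftrightarrow> P : sob M & p : hom P Y (Suc 0) & src P Y p = zmap P Y &
     (ALL X:sob M. ALL e:hom X Y (Suc 0). src X Y e = zmap X Y --> (EX! h. h : hom X P 0 & pre X P (Suc 0) h p = e))"

definition is_cone_ob :: "'o => 'o => 'a => bool" where
 "is_cone_ob X C c \<longleftrightarrow> C : sob M & c : hom X C (Suc 0) & src X C c = zmap X C &
     (ALL Y:sob M. ALL e:hom X Y (Suc 0). src X Y e = zmap X Y --> (EX! h. h : hom C Y 0 & post C Y (Suc 0) h c = e))"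

definition is_susp :: "'o => 'o => 'a => bool" where
 "is_susp X S c \<longleftrightarrow> S : sob M & c : hom X S (Suc 0) & src X S c = zmap X S & tgt X S c = zmap X S &
     (ALL Y:sob M. ALL e:hom X Y (Suc 0). src X Y e = zmap X Y & tgt X Y e = zmap X Y -->
    (EX! h. h : hom S Y 0 & post S Y (Suc 0) h c = e))"

lemma path_ex: assumes "Y : sob M" obtains P p where "is_path Y P p"
 using simplex_cotensor[OF assms, of "Suc 0"] unfolding is_path_def by metis

text \<open>A lift against the source map of the path object is an extension of an edge with given source.\<close>

lemma path_fib:
 assumes P: "is_path Y P p" and Y: "fibrant M Y"
 shows "(P, Y, src P Y p) : fib M \<inter> weq M"
proof -
 note Y0 = fibrant_ob[OF Y]
 have P0: "P : sob M" "p : hom P Y (Suc 0)"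
  and u: "!!X e. X : sob M ==> e : hom X Y (Suc 0) ==> EX! h. h : hom X P 0 & pre X P (Suc 0) h p = e"
  using P by (auto simp: is_path_def)
 show ?thesis
 proof (rule fib_by_lifting(2)[OF P0(1) Y0 edge_faces(1)[OF P0(1) Y0 P0(2)]])
  fix A B i a b assume a: "(A, B, i) : cof M" "a : hom A P 0" "b : hom B Y 0" "src P Y p ** a = b ** i"
  note o = cof_arr[OF a(1)]
  have pa: "pre A P (Suc 0) a p : hom A Y (Suc 0)" "src A Y (pre A P (Suc 0) a p) = b ** i"
   using pre_in[OF _ P0(1) Y0 a(2) P0(2)] pre_edge(1)[OF _ P0(1) Y0 a(2) P0(2)] a(4) o by auto
  obtain e where e: "e : hom B Y (Suc 0)" "pre A B (Suc 0) i e = pre A P (Suc 0) a p" "src B Y e = b"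
   using extend_edge[OF a(1) Y pa(1) a(3) pa(2)] by blast
  obtain h where h: "h : hom B P 0" "pre B P (Suc 0) h p = e" using u[of B e] o e by blast
  have "pre A P (Suc 0) (h ** i) p = pre A P (Suc 0) a p"
   using pre_pre[of A B P Y p "Suc 0" i h] o P0 Y0 h e by simp
  hence "h ** i = a" using u[OF _ pa(1)] o comp0_in[of A B P i h] P0 h a(2) by blast
  moreover have "src P Y p ** h = b" using pre_edge(1)[of B P Y h p] o P0 Y0 h e by simp
  ultimately show "EX h:hom B P 0. h ** i = a & src P Y p ** h = b" using h by blast
 qed
qed

lemma based_ex: assumes Y: "Y : sob M" obtains P p where "is_based Y P p"
proof -
 obtain Q r where "is_path Y Q r" by (rule path_ex[OF Y])
 hence Q: "Q : sob M" "r : hom Q Y (Suc 0)"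
  and u: "!!X e. X : sob M ==> e : hom X Y (Suc 0) ==> EX! h. h : hom X Q 0 & pre X Q (Suc 0) h r = e"
  by (auto simp: is_path_def)
 note s = edge_faces(1)[OF Q(1) Y Q(2)]
 obtain P j where "is_kernel (uc M) Q Y (src Q Y r) P j" and P: "P : sob M" "j : hom P Q 0" "src Q Y r ** j = zmap P Y"
  and pu: "!!T t. T : sob M ==> t : hom T Q 0 ==> src Q Y r ** t = zmap T Y ==> EX! h. h : hom T P 0 & j ** h = t"
  by (rule kernel_ex[OF Q(1) Y s]) (rule that)
 have "is_based Y P (pre P Q (Suc 0) j r)" unfolding is_based_def
 proof (intro conjI ballI impI)
  show "P : sob M" "pre P Q (Suc 0) j r : hom P Y (Suc 0)" "src P Y (pre P Q (Suc 0) j r) = zmap P Y"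
   using P(1) pre_in[OF P(1) Q(1) Y P(2) Q(2)] pre_edge(1)[OF P(1) Q(1) Y P(2) Q(2)] P(3) by simp_all
  fix X e assume X: "X : sob M" "e : hom X Y (Suc 0)" "src X Y e = zmap X Y"
  obtain g where g: "g : hom X Q 0" "pre X Q (Suc 0) g r = e" using u[OF X(1,2)] by blast
  have gz: "src Q Y r ** g = zmap X Y" using pre_edge(1)[OF X(1) Q(1) Y g(1) Q(2)] g(2) X(3) by simp
  obtain h where h: "h : hom X P 0" "j ** h = g" using pu[OF X(1) g(1) gz] by blast
  show "EX! h. h : hom X P 0 & pre X P (Suc 0) h (pre P Q (Suc 0) j r) = e"
  proof (rule ex1I[of _ h])
   show "h : hom X P 0 & pre X P (Suc 0) h (pre P Q (Suc 0) j r) = e"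
    using h g pre_pre[OF X(1) P(1) Q(1) Y Q(2) h(1) P(2)] by simp
   fix h' assume h': "h' : hom X P 0 & pre X P (Suc 0) h' (pre P Q (Suc 0) j r) = e"
   hence "pre X Q (Suc 0) (j ** h') r = e" using pre_pre[OF X(1) P(1) Q(1) Y Q(2) _ P(2), of h'] by simp
   hence "j ** h' = g" using u[OF X(1,2)] g comp0_in[OF X(1) P(1) Q(1) _ P(2), of h'] h' by blast
   thus "h' = h" using pu[OF X(1) g(1) gz] h h' by blast
  qed
 qed
 thus thesis by (rule that)
qed

text \<open>Lifts to the object of based paths are extensions of edges that start at zero.\<close>

lemma based_fib:
 assumes b: "is_based Y P p" and Y: "fibrant M Y"
 shows "(P, Y, tgt P Y p) : fib M" and "fibrant M P" and "cofibrant M X ==> contractible (mp X P)"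
proof -
 note Y0 = fibrant_ob[OF Y]
 have P0: "P : sob M" "p : hom P Y (Suc 0)" "src P Y p = zmap P Y"
  and u: "!!X e. X : sob M ==> e : hom X Y (Suc 0) ==> src X Y e = zmap X Y ==> EX! h. h : hom X P 0 & pre X P (Suc 0) h p = e"
  using b by (auto simp: is_based_def)
 have pa: "pre A P (Suc 0) a p : hom A Y (Suc 0)" "src A Y (pre A P (Suc 0) a p) = zmap A Y"
   "tgt A Y (pre A P (Suc 0) a p) = tgt P Y p ** a" if "A : sob M" "a : hom A P 0" for A a
  using that pre_in[OF that(1) P0(1) Y0 that(2) P0(2)] pre_edge[OF that(1) P0(1) Y0 that(2) P0(2)]
   zmap_pre[OF that(1) P0(1) Y0 that(2)] P0(3) by auto
 have ext: "EX h:hom B P 0. h ** i = a & pre B P (Suc 0) h p = e"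
  if l: "A : sob M" "B : sob M" "i : hom A B 0" "a : hom A P 0" "e : hom B Y (Suc 0)" "src B Y e = zmap B Y"
   "pre A B (Suc 0) i e = pre A P (Suc 0) a p" for A B i a e
 proof -
  obtain h where h: "h : hom B P 0" "pre B P (Suc 0) h p = e" using u[OF l(2,5,6)] by blast
  have "pre A P (Suc 0) (h ** i) p = pre A P (Suc 0) a p"
   using pre_pre[of A B P Y p "Suc 0" i h] l P0 Y0 h by simp
  hence "h ** i = a" using u[OF l(1) pa(1,2)[OF l(1,4)]] comp0_in[OF l(1,2) P0(1) l(3) h(1)] l(4) by blast
  thus ?thesis using h by blast
 qed
 show "(P, Y, tgt P Y p) : fib M"
 proof (rule fib_by_lifting(1)[OF P0(1) Y0 edge_faces(2)[OF P0(1) Y0 P0(2)]])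
  fix A B i a b assume a: "(A, B, i) : cof M" "(A, B, i) : weq M" "a : hom A P 0" "b : hom B Y 0" "tgt P Y p ** a = b ** i"
  have o: "A : sob M" "B : sob M" "i : hom A B 0" using cof_arr[OF a(1)] by auto
  have z: "zmap B Y ** i = zmap A Y" using zmap_pre[OF o(1,2) Y0 o(3)] .
  obtain e where e: "e : hom B Y (Suc 0)" "pre A B (Suc 0) i e = pre A P (Suc 0) a p" "src B Y e = zmap B Y" "tgt B Y e = b"
   by (rule extend_edge2[OF a(1,2) Y pa(1)[OF o(1) a(3)] zmap_in[OF o(2) Y0] _ a(4)]) (use z pa[OF o(1) a(3)] a(5) in auto)
  obtain h where h: "h : hom B P 0" "h ** i = a" "pre B P (Suc 0) h p = e" using ext[OF o a(3) e(1,3,2)] by blast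
  have "tgt P Y p ** h = b" using pa(3)[OF o(2) h(1)] h(3) e(4) by simp
  thus "EX h:hom B P 0. h ** i = a & tgt P Y p ** h = b" using h by blast
 qed
 have l: "EX h:hom B P 0. h ** i = a" if a: "(A, B, i) : cof M" "a : hom A P 0" for A B i a
 proof -
  have o: "A : sob M" "B : sob M" "i : hom A B 0" using cof_arr[OF a(1)] by auto
  have z: "zmap B Y ** i = zmap A Y" using zmap_pre[OF o(1,2) Y0 o(3)] .
  obtain e where e: "e : hom B Y (Suc 0)" "pre A B (Suc 0) i e = pre A P (Suc 0) a p" "src B Y e = zmap B Y"
   by (rule extend_edge[OF a(1) Y pa(1)[OF o(1) a(2)] zmap_in[OF o(2) Y0]]) (use z pa[OF o(1) a(2)] in auto)
  thus ?thesis using ext[OF o a(2) e(1,3,2)] by blast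
 qed
 show "fibrant M P" by (rule fibrant_by_lifting[OF P0(1)]) (use l in blast)
 obtain Z where Z: "is_zero (uc M) Z" "Z : sob M" by (rule zero_ex)
 have "(P, Z, zmap P Z) : fib M \<inter> weq M"
 proof (rule fib_by_lifting(2)[OF P0(1) Z(2) zmap_in[OF P0(1) Z(2)]])
  fix A B i a b assume a: "(A, B, i) : cof M" "a : hom A P 0" "b : hom B Z 0"
  obtain h where h: "h : hom B P 0" "h ** i = a" using l[OF a(1,2)] by blast
  have "zmap P Z ** h = b"
   using zero_eq_to[OF Z(1), of B] cof_arr[OF a(1)] comp0_in[of B P Z h "zmap P Z"] P0 Z zmap_in[OF P0(1) Z(2)] h a by simp
  thus "EX h:hom B P 0. h ** i = a & zmap P Z ** h = b" using h by blast
 qed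
 thus "contractible (mp X P)" if X: "cofibrant M X"
  using to_point(2)[OF Z(1) cofibrant_ob[OF X] fib_kan(2)[OF X, of P Z "zmap P Z"]] cofibrant_ob[OF X] P0 Z zmap_in[OF P0(1) Z(2)]
  by (auto intro: post_in)
qed

lemma cone_ex: assumes X: "X : sob M" obtains C c where "is_cone_ob X C c"
proof -
 obtain T t where T: "T : sob M" "t : hom X T (Suc 0)"
  and u: "!!Y y. Y : sob M ==> y : hom X Y (Suc 0) ==> EX! h. h : hom T Y 0 & post T Y (Suc 0) h t = y"
  using simplex_tensor[OF X, of "Suc 0"] by metis
 note s = edge_faces(1)[OF X T]
 obtain C p where ck: "is_cokernel X T (src X T t) C p" by (rule cokernel_ex[OF X T(1) s])
 hence C: "C : sob M" "p : hom T C 0" "p ** src X T t = zmap X C"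
  and cu: "!!Y f. Y : sob M ==> f : hom T Y 0 ==> f ** src X T t = zmap X Y ==> EX! h. h : hom C Y 0 & h ** p = f"
  by (auto simp: is_cokernel_def)
 have "is_cone_ob X C (post T C (Suc 0) p t)" unfolding is_cone_ob_def
 proof (intro conjI ballI impI)
  show "C : sob M" "post T C (Suc 0) p t : hom X C (Suc 0)" "src X C (post T C (Suc 0) p t) = zmap X C"
   using C(1) post_in[OF X T(1) C(1,2) T(2)] post_edge(1)[OF X T(1) C(1,2) T(2)] C(3) by simp_all
  fix Y e assume Y: "Y : sob M" "e : hom X Y (Suc 0)" "src X Y e = zmap X Y"
  obtain g where g: "g : hom T Y 0" "post T Y (Suc 0) g t = e" using u[OF Y(1,2)] by blast
  have gz: "g ** src X T t = zmap X Y" using post_edge(1)[OF X T(1) Y(1) g(1) T(2)] g(2) Y(3) by simp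
  obtain h where h: "h : hom C Y 0" "h ** p = g" using cu[OF Y(1) g(1) gz] by blast
  show "EX! h. h : hom C Y 0 & post C Y (Suc 0) h (post T C (Suc 0) p t) = e"
  proof (rule ex1I[of _ h])
   show "h : hom C Y 0 & post C Y (Suc 0) h (post T C (Suc 0) p t) = e"
    using h g post_post[OF X T(1) C(1) Y(1) T(2) C(2) h(1)] by simp
   fix h' assume h': "h' : hom C Y 0 & post C Y (Suc 0) h' (post T C (Suc 0) p t) = e"
   hence "post T Y (Suc 0) (h' ** p) t = e" using post_post[OF X T(1) C(1) Y(1) T(2) C(2), of h'] by simp
   hence "h' ** p = g" using u[OF Y(1,2)] g comp0_in[OF T(1) C(1) Y(1) C(2), of h'] h' by blast
   thus "h' = h" using cu[OF Y(1) g(1) gz] h h' by blast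
  qed
 qed
 thus thesis by (rule that)
qed

text \<open>Dually, extensions of maps to the cone are lifts of edges that start at zero.\<close>

lemma cone_cof:
 assumes X: "cofibrant M X" and C: "is_cone_ob X C c"
 shows "(X, C, tgt X C c) : cof M" and "fibrant M Y ==> contractible (mp C Y)"
proof -
 note X0 = cofibrant_ob[OF X]
 have C0: "C : sob M" "c : hom X C (Suc 0)" "src X C c = zmap X C"
  and u: "!!Y e. Y : sob M ==> e : hom X Y (Suc 0) ==> src X Y e = zmap X Y ==> EX! h. h : hom C Y 0 & post C Y (Suc 0) h c = e"
  using C by (auto simp: is_cone_ob_def)
 have pb: "post C D (Suc 0) b c : hom X D (Suc 0)" "src X D (post C D (Suc 0) b c) = zmap X D"
   "tgt X D (post C D (Suc 0) b c) = b ** tgt X C c" if "D : sob M" "b : hom C D 0" for D b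
  using post_in[OF X0 C0(1) that C0(2)] post_edge[OF X0 C0(1) that C0(2)] zmap_post[OF X0 C0(1) that] C0(3) by auto
 have ext: "EX h:hom C E 0. p ** h = b & post C E (Suc 0) h c = e"
  if l: "E : sob M" "D : sob M" "p : hom E D 0" "b : hom C D 0" "e : hom X E (Suc 0)" "src X E e = zmap X E"
   "post E D (Suc 0) p e = post C D (Suc 0) b c" for E D p b e
 proof -
  obtain h where h: "h : hom C E 0" "post C E (Suc 0) h c = e" using u[OF l(1,5,6)] by blast
  have "post C D (Suc 0) (p ** h) c = post C D (Suc 0) b c"
   using post_post[OF X0 C0(1) l(1,2) C0(2) h(1) l(3)] h l by simp
  hence "p ** h = b" using u[OF l(2) pb(1,2)[OF l(2,4)]] comp0_in[OF C0(1) l(1,2) h(1) l(3)] l(4) by blast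
  thus ?thesis using h by blast
 qed
 show "(X, C, tgt X C c) : cof M"
 proof (rule cof_by_lifting(1)[OF X0 C0(1) edge_faces(2)[OF X0 C0(1,2)]])
  fix E D p a b assume a: "(E, D, p) : fib M" "(E, D, p) : weq M" "a : hom X E 0" "b : hom C D 0" "p ** a = b ** tgt X C c"
  have o: "E : sob M" "D : sob M" "p : hom E D 0" using fib_arr[OF a(1)] by auto
  have z: "p ** zmap X E = zmap X D" using zmap_post[OF X0 o] .
  obtain e where e: "e : hom X E (Suc 0)" "post E D (Suc 0) p e = post C D (Suc 0) b c" "src X E e = zmap X E" "tgt X E e = a"
   by (rule lift_edge2[OF X a(1,2) pb(1)[OF o(2) a(4)] zmap_in[OF X0 o(1)] _ a(3)]) (use z pb[OF o(2) a(4)] a(5) in auto)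
  obtain h where h: "h : hom C E 0" "p ** h = b" "post C E (Suc 0) h c = e" using ext[OF o a(4) e(1,3,2)] by blast
  have "h ** tgt X C c = a" using pb(3)[OF o(1) h(1)] h(3) e(4) by simp
  thus "EX h:hom C E 0. h ** tgt X C c = a & p ** h = b" using h by blast
 qed
 obtain Z where Z: "is_zero (uc M) Z" "Z : sob M" by (rule zero_ex)
 have zc: "(Z, C, zmap Z C) : cof M \<inter> weq M"
 proof (rule cof_by_lifting(2)[OF Z(2) C0(1) zmap_in[OF Z(2) C0(1)]])
  fix E D p a b assume a: "(E, D, p) : fib M" "a : hom Z E 0" "b : hom C D 0"
  have o: "E : sob M" "D : sob M" "p : hom E D 0" using fib_arr[OF a(1)] by auto
  have z: "p ** zmap X E = zmap X D" using zmap_post[OF X0 o] .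
  obtain e where e: "e : hom X E (Suc 0)" "post E D (Suc 0) p e = post C D (Suc 0) b c" "src X E e = zmap X E"
   by (rule lift_edge[OF X a(1) pb(1)[OF o(2) a(3)] zmap_in[OF X0 o(1)]]) (use z pb[OF o(2) a(3)] in auto)
  obtain h where h: "h : hom C E 0" "p ** h = b" using ext[OF o a(3) e(1,3,2)] by blast
  have "h ** zmap Z C = a"
   using zero_eq_from[OF Z(1), of E] comp0_in[of Z C E "zmap Z C" h] C0 Z o zmap_in[OF Z(2) C0(1)] h a by simp
  thus "EX h:hom C E 0. h ** zmap Z C = a & p ** h = b" using h by blast
 qed
 show "contractible (mp C Y)" if Y: "fibrant M Y"
 proof -
  note Y0 = fibrant_ob[OF Y]
  have t: "trivial_kan_fibration (mp C Y) (mp Z Y) (%n. pre Z C n (zmap Z C))" using cof_kan(2)[OF _ Y] zc by blast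
  show ?thesis unfolding contractible_def trivial_kan_fibration_def
  proof (intro conjI ballI allI impI; (elim conjE)?)
   show "EX z:hom C Y 0. () = y" for y :: unit using zmap_in[OF C0(1) Y0] by auto
   fix n x and y :: unit
   assume a: "ALL i<=Suc n. x i : hom C Y n"
    "ALL i j. 0 < n & i < j & j <= Suc n --> fc C Y n i (x j) = fc C Y n (j - 1) (x i)"
   have "ALL i<=Suc n. fc Z Y (Suc n) i (zsimp M Z Y (Suc n)) = pre Z C n (zmap Z C) (x i)"
    using a(1) zsimp_face[OF Z(2) Y0] pre_zmap[OF Z(2) C0(1) Y0] by simp
   thus "EX z:hom C Y (Suc n). () = y & (ALL i<=Suc n. fc C Y (Suc n) i z = x i)"
    using t[unfolded trivial_kan_fibration_def, THEN conjunct2, rule_format, of n x "zsimp M Z Y (Suc n)"] a zsimp_in[OF Z(2) Y0] by auto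
  qed
 qed
qed

text \<open>Maps out of the cone restrict to its base \<open>X\<close>, and those that are zero on \<open>X\<close> factor through the
 suspension.  The cofibrancy of \<open>X \<rightarrow> CX\<close> makes the restriction a fibration.\<close>

lemma loop_seq_susp:
 assumes X: "cofibrant M X" and C: "is_cone_ob X C c" and S: "is_susp X S s"
 obtains p where "p : hom C S 0" "!!Y. fibrant M Y ==> loop_seq (mp S Y) (zmap S Y) (mp C Y) (zmap C Y) (mp X Y) (zmap X Y)
  (%n. pre C S n p) (%n. pre X C n (tgt X C c))"
proof -
 note X0 = cofibrant_ob[OF X]
 have C0: "C : sob M" "c : hom X C (Suc 0)" "src X C c = zmap X C"
  and u: "!!Y e. Y : sob M ==> e : hom X Y (Suc 0) ==> src X Y e = zmap X Y ==> EX! h. h : hom C Y 0 & post C Y (Suc 0) h c = e"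
  using C by (auto simp: is_cone_ob_def)
 have S0: "S : sob M" "s : hom X S (Suc 0)" "src X S s = zmap X S" "tgt X S s = zmap X S"
  and su: "!!Y e. Y : sob M ==> e : hom X Y (Suc 0) ==> src X Y e = zmap X Y ==> tgt X Y e = zmap X Y ==>
   EX! h. h : hom S Y 0 & post S Y (Suc 0) h s = e"
  using S by (auto simp: is_susp_def)
 note t = edge_faces(2)[OF X0 C0(1,2)]
 obtain p where p: "p : hom C S 0" "post C S (Suc 0) p c = s" using u[OF S0(1-3)] by blast
 have k: "is_cokernel X C (tgt X C c) S p" unfolding is_cokernel_def
 proof (intro conjI ballI impI)
  show "S : sob M" "p : hom C S 0" "p ** tgt X C c = zmap X S"
   using S0 p post_edge(2)[OF X0 C0(1) S0(1) p(1) C0(2)] by auto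
  fix Y f assume Y: "Y : sob M" and f: "f : hom C Y 0" "f ** tgt X C c = zmap X Y"
  define e where "e = post C Y (Suc 0) f c"
  have e: "e : hom X Y (Suc 0)" "src X Y e = zmap X Y" "tgt X Y e = zmap X Y"
   unfolding e_def using post_in[OF X0 C0(1) Y f(1) C0(2)] post_edge[OF X0 C0(1) Y f(1) C0(2)] zmap_post[OF X0 C0(1) Y f(1)] C0(3) f(2) by auto
  have eq: "h ** p = f \<longleftrightarrow> post S Y (Suc 0) h s = e" if "h : hom S Y 0" for h
  proof -
   have "post C Y (Suc 0) (h ** p) c = post S Y (Suc 0) h s" using post_post[OF X0 C0(1) S0(1) Y C0(2) p(1) that] p(2) by simp
   thus ?thesis using u[OF Y e(1,2)] comp0_in[OF C0(1) S0(1) Y p(1) that] f(1) e_def by metis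
  qed
  show "EX! h. h : hom S Y 0 & h ** p = f" using su[OF Y e] eq by metis
 qed
 show thesis
 proof (rule that[OF p(1)])
  fix Y assume Y: "fibrant M Y"
  note Y0 = fibrant_ob[OF Y]
  show "loop_seq (mp S Y) (zmap S Y) (mp C Y) (zmap C Y) (mp X Y) (zmap X Y)
   (%n. pre C S n p) (%n. pre X C n (tgt X C c))"
  proof
   show "contractible (mp C Y)" by (rule cone_cof(2)[OF X C Y])
   show "kan_fibration (mp C Y) (mp X Y) (%n. pre X C n (tgt X C c))" by (rule cof_kan(1)[OF cone_cof(1)[OF X C] Y])
   show "kan (mp X Y)" by (rule kan_hom[OF X Y])
   fix n
   show "pre X C n (tgt X C c) (pre C S n p z) = zcst X Y n" if "z : hom S Y n" for z
    using pre_pre[OF X0 C0(1) S0(1) Y0 that t p(1)] k pre_zmap[OF X0 S0(1) Y0 that] by (simp add: zsimp_def is_cokernel_def)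
   show "EX! z. z : hom S Y n & pre C S n p z = y"
    if "y : hom C Y n" "pre X C n (tgt X C c) y = zcst X Y n" for y
    by (rule cokernel_simplex[OF k X0 C0(1) t Y0 that(1)]) (use that in \<open>simp add: zsimp_def\<close>)
  qed (use X0 Y0 C0 S0 t p in \<open>auto simp: zmap_pre intro: sset zmap_in smap_pre\<close>)
 qed
qed

end

section \<open>The homotopy category\<close>

context pointed_smc begin

lemma cofibrant_cof:
 assumes X: "cofibrant M X" and i: "(X, B, i) : cof M"
 shows "cofibrant M B"
proof -
 note o = cof_arr[OF i]
 show ?thesis
 proof (rule cofibrant_by_lifting)
  fix E D p b assume p: "(E, D, p) : fib M" "(E, D, p) : weq M" and b: "b : hom B D 0"
  have bi: "b ** i : hom X D 0" using comp0_in[of X B D i b] o b fib_arr[OF p(1)] by simp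
  obtain g where g: "g : hom X E 0" "p ** g = b ** i"
   using fib_kan(2)[OF X p] bi unfolding trivial_kan_fibration_def by auto
  thus "EX h:hom B E 0. p ** h = b" using lift_cof[OF i p(1) _ g(1) b g(2)] p(2) by blast
 qed (use o in simp)
qed

lemma fibrant_fib:
 assumes Y: "fibrant M Y" and p: "(E, Y, p) : fib M"
 shows "fibrant M E"
proof -
 note o = fib_arr[OF p]
 show ?thesis
 proof (rule fibrant_by_lifting)
  fix A B i a assume i: "(A, B, i) : cof M" "(A, B, i) : weq M" and a: "a : hom A E 0"
  have "p ** a : hom A Y 0" using comp0_in[of A E Y a p] o a cof_arr[OF i(1)] by simp
  then obtain b where b: "b : hom B Y 0" "b ** i = p ** a" using extend_fibrant[OF i Y] by blast
  thus "EX h:hom B E 0. h ** i = a" using lift_cof[OF i(1) p _ a b(1)] i(2) by metis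
 qed (use o in simp)
qed

lemma id_classes:
 assumes X: "X : sob M"
 shows "(X, X, sid M X) : weq M \<inter> fib M" and "(X, X, sid M X) : weq M \<inter> cof M"
proof -
 note i = sid_in[OF X]
 show "(X, X, sid M X) : weq M \<inter> fib M"
 proof -
  have "(X, X, sid M X) : fib M \<inter> weq M"
  proof (rule fib_by_lifting(2)[OF X X i])
   fix A B j a b assume a: "(A, B, j) : cof M" "a : hom A X 0" "b : hom B X 0" "sid M X ** a = b ** j"
   thus "EX h:hom B X 0. h ** j = a & sid M X ** h = b"
    using comp0_id(2)[of A X a] comp0_id(2)[of B X b] X cof_arr[OF a(1)] by auto
  qed
  thus ?thesis by blast
 qed
 show "(X, X, sid M X) : weq M \<inter> cof M"
 proof -
  have "(X, X, sid M X) : cof M \<inter> weq M"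
  proof (rule cof_by_lifting(2)[OF X X i])
   fix E D p a b assume a: "(E, D, p) : fib M" "a : hom X E 0" "b : hom X D 0" "p ** a = b ** sid M X"
   thus "EX h:hom X E 0. h ** sid M X = a & p ** h = b"
    using comp0_id(1)[of X E a] comp0_id(1)[of X D b] X fib_arr[OF a(1)] by auto
  qed
  thus ?thesis by blast
 qed
qed

lemma Qob:
 assumes X: "X : sob M"
 shows "cofibrant M (Qob M X)" and "(Qob M X, X, snd (crep M X)) : weq M \<inter> fib M"
proof -
 have "cofibrant M (fst (crep M X)) & (fst (crep M X), X, snd (crep M X)) : weq M \<inter> fib M"
 proof (cases "cofibrant M X")
  case True
  thus ?thesis using id_classes[OF X] by (simp add: crep_def)
 next
  case False
  obtain Z where Z: "is_zero (uc M) Z" "Z : sob M" by (rule zero_ex)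
  have "(Z, X, zmap Z X) : arrs (uc M)" using Z X zmap_in[OF Z(2) X] by (simp add: arrs_def)
  then obtain T i p where t: "(Z, T, i) : cof M" "(T, X, p) : fib M \<inter> weq M" using ms_factor[OF ms] by blast
  define P where "P = (%(C, q). cofibrant M C & (C, X, q) : weq M \<inter> fib M)"
  have "cofibrant M T" using t(1) Z(1) by (auto simp: cofibrant_def)
  hence "P (T, p)" using t by (simp add: P_def)
  hence "P (Eps P)" by (rule someI)
  moreover have "crep M X = Eps P" using False by (simp add: crep_def P_def)
  ultimately show ?thesis by (cases "Eps P") (simp add: P_def)
 qed
 thus "cofibrant M (Qob M X)" "(Qob M X, X, snd (crep M X)) : weq M \<inter> fib M" by auto
qed

lemma RQob:
 assumes X: "X : sob M"
 shows "fibrant M (RQob M X)" and "(Qob M X, RQob M X, snd (brep M X)) : weq M \<inter> cof M" and "cofibrant M (RQob M X)"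
proof -
 note Q = Qob[OF X]
 have Q0: "Qob M X : sob M" by (rule cofibrant_ob[OF Q(1)])
 have *: "fibrant M (fst (brep M X)) & (Qob M X, fst (brep M X), snd (brep M X)) : weq M \<inter> cof M"
 proof (cases "fibrant M (Qob M X)")
  case True
  thus ?thesis using id_classes[OF Q0] by (simp add: brep_def)
 next
  case False
  obtain Z where Z: "is_zero (uc M) Z" "Z : sob M" by (rule zero_ex)
  have "(Qob M X, Z, zmap (Qob M X) Z) : arrs (uc M)" using Z Q0 zmap_in[OF Q0 Z(2)] by (simp add: arrs_def)
  then obtain T i p where t: "(Qob M X, T, i) : cof M \<inter> weq M" "(T, Z, p) : fib M" using ms_factor[OF ms] by blast
  define P where "P = (%(R, r). fibrant M R & (Qob M X, R, r) : weq M \<inter> cof M)"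
  have "fibrant M T" using t(2) Z(1) by (auto simp: fibrant_def)
  hence "P (T, i)" using t by (simp add: P_def)
  hence "P (Eps P)" by (rule someI)
  moreover have "brep M X = Eps P" using False by (simp add: brep_def P_def)
  ultimately show ?thesis by (cases "Eps P") (simp add: P_def)
 qed
 thus "fibrant M (RQob M X)" "(Qob M X, RQob M X, snd (brep M X)) : weq M \<inter> cof M" by auto
 thus "cofibrant M (RQob M X)" using cofibrant_cof[OF Q(1)] by blast
qed

lemma Qob_cofibrant: "cofibrant M X ==> crep M X = (X, sid M X)"
 by (simp add: crep_def)

lemma RQob_fibrant: "fibrant M Y ==> brep M Y = (Qob M Y, sid M (Qob M Y))"
 using fibrant_fib[of Y "Qob M Y" "snd (crep M Y)"] Qob(2)[OF fibrant_ob, of Y] by (simp add: brep_def)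

lemma QR_maps:
 assumes X: "X : sob M"
 shows "Qob M X : sob M" "RQob M X : sob M" "snd (crep M X) : hom (Qob M X) X 0"
  "snd (brep M X) : hom (Qob M X) (RQob M X) 0"
 using Qob[OF X] RQob[OF X] fib_arr cof_arr cofibrant_ob by blast+

definition edge_rel :: "'o => 'o => 'a => 'a => bool" where
 "edge_rel X Y f g \<longleftrightarrow> (EX h:hom X Y (Suc 0). src X Y h = f & tgt X Y h = g)"

lemma htp_edge_rel: "htp M X Y = equivclp (edge_rel X Y)"
 unfolding htp_def edge_rel_def[abs_def] by simp

lemma htp_refl: "htp M X Y f f"
 and htp_sym: "htp M X Y f g ==> htp M X Y g f"
 and htp_trans: "htp M X Y f g ==> htp M X Y g h ==> htp M X Y f h"
 and edge_htp: "edge_rel X Y f g ==> htp M X Y f g"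
 unfolding htp_edge_rel using equivclp_sym equivclp_trans r_into_equivclp by (auto intro: equivclp_refl)

lemma htp_map:
 assumes "!!f g. edge_rel X Y f g ==> edge_rel X' Y' (F f) (F g)" and "htp M X Y f g"
 shows "htp M X' Y' (F f) (F g)"
 using assms(2) unfolding htp_edge_rel
proof (induction rule: equivclp_induct)
 case base
 show ?case by simp
next
 case (step y z)
 thus ?case using assms(1) equivclp_trans r_into_equivclp equivclp_sym by metis
qed

lemma htp_hom:
 assumes X: "X : sob M" "Y : sob M" and "htp M X Y f g" and f: "f : hom X Y 0"
 shows "g : hom X Y 0"
 using assms(3) unfolding htp_edge_rel
proof (induction rule: equivclp_induct)
 case base
 show ?case by (rule f)
next
 case (step y z)
 thus ?case using edge_faces[OF X] unfolding edge_rel_def by blast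
qed

lemma htp_post:
 assumes "X : sob M" "Y : sob M" "Z : sob M" "g : hom Y Z 0" "htp M X Y f f'"
 shows "htp M X Z (g ** f) (g ** f')"
proof (rule htp_map[OF _ assms(5)])
 fix a b assume "edge_rel X Y a b"
 then obtain h where h: "h : hom X Y (Suc 0)" "src X Y h = a" "tgt X Y h = b" by (auto simp: edge_rel_def)
 show "edge_rel X Z (g ** a) (g ** b)" unfolding edge_rel_def
  by (rule bexI[OF _ post_in[OF assms(1-4) h(1)]]) (use post_edge[OF assms(1-4) h(1)] h(2,3) in simp)
qed

lemma htp_pre:
 assumes "X : sob M" "Y : sob M" "Z : sob M" "f : hom X Y 0" "htp M Y Z g g'"
 shows "htp M X Z (g ** f) (g' ** f)"
proof (rule htp_map[where F = "%g. g ** f", OF _ assms(5)])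
 fix a b assume "edge_rel Y Z a b"
 then obtain h where h: "h : hom Y Z (Suc 0)" "src Y Z h = a" "tgt Y Z h = b" by (auto simp: edge_rel_def)
 show "edge_rel X Z (a ** f) (b ** f)" unfolding edge_rel_def
  by (rule bexI[OF _ pre_in[OF assms(1-4) h(1)]]) (use pre_edge[OF assms(1-4) h(1)] h(2,3) in simp)
qed

lemma edge_refl: "X : sob M ==> Y : sob M ==> f : hom X Y 0 ==> edge_rel X Y f f"
 unfolding edge_rel_def using cst_in[OF sset, of X Y f "Suc 0"] cst_face[OF sset, of X Y f _ 0]
 by (intro bexI[of _ "cst (mp X Y) (Suc 0) f"]) auto

text \<open>For a fibrant target, edges are reversed and composed by filling horns.\<close>

lemma edge_sym_trans:
 assumes X: "cofibrant M X" and Y: "fibrant M Y"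
 shows "edge_rel X Y f g ==> edge_rel X Y g f" and "edge_rel X Y f g ==> edge_rel X Y g h ==> edge_rel X Y f h"
proof -
 note o = cofibrant_ob[OF X] fibrant_ob[OF Y]
 note ss = sset[OF o]
 have k: "kan (mp X Y)" by (rule kan_hom[OF X Y])
 have two: "i <= Suc (Suc 0) \<longleftrightarrow> i = 0 | i = Suc 0 | i = Suc (Suc 0)" for i by auto
 let ?K = "mp X Y"
 have ff: "Fc ?K (Suc 0) i (Fc ?K (Suc (Suc 0)) j z) = Fc ?K (Suc 0) (j - 1) (Fc ?K (Suc (Suc 0)) i z)"
  if "z : hom X Y (Suc (Suc 0))" "i < j" "j <= Suc (Suc 0)" for z i j
  using sset_face_face[OF ss that] .
 show "edge_rel X Y g f" if fg: "edge_rel X Y f g"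
 proof -
  obtain e where e: "e : hom X Y (Suc 0)" "src X Y e = f" "tgt X Y e = g" using fg by (auto simp: edge_rel_def)
  obtain c where c: "c : hom X Y (Suc 0)" "src X Y c = f" "tgt X Y c = f"
   using edge_refl[OF o, of f] edge_faces(1)[OF o e(1)] e(2) by (auto simp: edge_rel_def)
  let ?x = "%i. if i = Suc 0 then c else e"
  have "Fc ?K (Suc 0) i (?x j) = Fc ?K (Suc 0) (j - 1) (?x i)" if "i < j" "j <= Suc (Suc 0)" "i ~= 0" for i j
  proof -
   have "i = Suc 0" "j = Suc (Suc 0)" using that by auto
   thus ?thesis using c e by simp
  qed
  then obtain z where z: "z : hom X Y (Suc (Suc 0))" "ALL i<=Suc (Suc 0). i ~= 0 --> Fc ?K (Suc (Suc 0)) i z = ?x i"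
   using k[unfolded kan_def, rule_format, of 0 "Suc 0" ?x] c(1) e(1) by force
  have "src X Y (Fc ?K (Suc (Suc 0)) 0 z) = g" using ff[OF z(1), of 0 "Suc (Suc 0)"] z(2) e by simp
  moreover have "tgt X Y (Fc ?K (Suc (Suc 0)) 0 z) = f" using ff[OF z(1), of 0 "Suc 0"] z(2) c by simp
  ultimately show ?thesis unfolding edge_rel_def using sset_face[OF ss z(1), of 0] by blast
 qed
 show "edge_rel X Y f h" if fg: "edge_rel X Y f g" "edge_rel X Y g h"
 proof -
  obtain e where e: "e : hom X Y (Suc 0)" "src X Y e = f" "tgt X Y e = g" using fg(1) by (auto simp: edge_rel_def)
  obtain c where c: "c : hom X Y (Suc 0)" "src X Y c = g" "tgt X Y c = h" using fg(2) by (auto simp: edge_rel_def)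
  let ?x = "%i. if i = 0 then c else e"
  have "Fc ?K (Suc 0) i (?x j) = Fc ?K (Suc 0) (j - 1) (?x i)" if "i < j" "j <= Suc (Suc 0)" "i ~= Suc 0" "j ~= Suc 0" for i j
  proof -
   have "i = 0" "j = Suc (Suc 0)" using that by auto
   thus ?thesis using c e by simp
  qed
  then obtain z where z: "z : hom X Y (Suc (Suc 0))" "ALL i<=Suc (Suc 0). i ~= Suc 0 --> Fc ?K (Suc (Suc 0)) i z = ?x i"
   using k[unfolded kan_def, rule_format, of "Suc 0" "Suc 0" ?x] c(1) e(1) by force
  have "src X Y (Fc ?K (Suc (Suc 0)) (Suc 0) z) = f" using ff[OF z(1), of "Suc 0" "Suc (Suc 0)"] z(2) e by simp
  moreover have "tgt X Y (Fc ?K (Suc (Suc 0)) (Suc 0) z) = h" using ff[OF z(1), of 0 "Suc 0"] z(2) c by simp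
  ultimately show ?thesis unfolding edge_rel_def using sset_face[OF ss z(1), of "Suc 0"] by blast
 qed
qed

lemma htp_edge:
 assumes X: "cofibrant M X" and Y: "fibrant M Y" and f: "f : hom X Y 0" and h: "htp M X Y f g"
 shows "edge_rel X Y f g"
 using h unfolding htp_edge_rel
proof (induction rule: equivclp_induct)
 case base
 show ?case using edge_refl cofibrant_ob[OF X] fibrant_ob[OF Y] f by blast
next
 case (step y z)
 thus ?case using edge_sym_trans[OF X Y] by blast
qed

lemma htp_extend:
 assumes i: "(A, B, i) : cof M" "(A, B, i) : weq M" and A: "cofibrant M A" and Y: "fibrant M Y"
  and f: "f : hom B Y 0" "g : hom B Y 0" and h: "htp M A Y (f ** i) (g ** i)"
 shows "htp M B Y f g"
proof -
 note o = cof_arr[OF i(1)] fibrant_ob[OF Y]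
 have fi: "f ** i : hom A Y 0" using comp0_in[of A B Y i f] o f by simp
 obtain e where e: "e : hom A Y (Suc 0)" "src A Y e = f ** i" "tgt A Y e = g ** i"
  using htp_edge[OF A Y fi h] by (auto simp: edge_rel_def)
 obtain e' where "e' : hom B Y (Suc 0)" "src B Y e' = f" "tgt B Y e' = g"
  by (rule extend_edge2[OF i Y e(1) f(1) e(2) f(2) e(3)])
 thus ?thesis by (intro edge_htp) (auto simp: edge_rel_def)
qed

lemma htp_lift:
 assumes X: "cofibrant M X" and p: "(E, D, p) : fib M" "(E, D, p) : weq M"
  and f: "f : hom X E 0" "g : hom X E 0" "p ** f = p ** g"
 shows "htp M X E f g"
proof -
 note o = fib_arr[OF p(1)] cofibrant_ob[OF X]
 have "p ** f : hom X D 0" using comp0_in[of X E D f p] o f by simp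
 then obtain e where e: "e : hom X D (Suc 0)" "src X D e = p ** f" "tgt X D e = p ** g"
  using edge_refl[of X D "p ** f"] o f(3) by (auto simp: edge_rel_def)
 obtain e' where "e' : hom X E (Suc 0)" "src X E e' = f" "tgt X E e' = g"
  by (rule lift_edge2[OF X p e(1) f(1) e(2) f(2) e(3)])
 thus ?thesis by (intro edge_htp) (auto simp: edge_rel_def)
qed

definition hcls :: "'o => 'o => 'a => ('o, 'a) harr" where
 "hcls X Y f = (X, Y, Collect (htp M (RQob M X) (RQob M Y) f))"

lemma hcls_eq: "hcls X Y f = hcls X Y g \<longleftrightarrow> htp M (RQob M X) (RQob M Y) f g"
proof
 assume "hcls X Y f = hcls X Y g"
 hence "Collect (htp M (RQob M X) (RQob M Y) f) = Collect (htp M (RQob M X) (RQob M Y) g)" by (simp add: hcls_def)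
 thus "htp M (RQob M X) (RQob M Y) f g" using htp_refl by blast
next
 assume "htp M (RQob M X) (RQob M Y) f g"
 thus "hcls X Y f = hcls X Y g" unfolding hcls_def using htp_sym htp_trans by blast
qed

lemma hocat_simps: "ob (hocat M) = sob M" "ar (hocat M) X Y = hcls X Y ` hom (RQob M X) (RQob M Y) 0"
 "idt (hocat M) X = hcls X X (sid M (RQob M X))"
 by (auto simp: hocat_def hcls_def)

lemma hcmp_hcls:
 assumes X: "X : sob M" "Y : sob M" "Z : sob M" and f: "f : hom (RQob M X) (RQob M Y) 0" "g : hom (RQob M Y) (RQob M Z) 0"
 shows "hcmp M (hcls Y Z g) (hcls X Y f) = hcls X Z (g ** f)"
proof -
 note o = QR_maps(2)[OF X(1)] QR_maps(2)[OF X(2)] QR_maps(2)[OF X(3)]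
 have "htp M (RQob M X) (RQob M Z) (g ** f) (g' ** f')"
  if "htp M (RQob M X) (RQob M Y) f f'" "htp M (RQob M Y) (RQob M Z) g g'" for f' g'
  using htp_trans[OF htp_post[OF o f(2) that(1)] htp_pre[OF o htp_hom[OF o(1,2) that(1) f(1)] that(2)]] .
 hence "{h. EX f':Collect (htp M (RQob M X) (RQob M Y) f). EX g':Collect (htp M (RQob M Y) (RQob M Z) g).
   htp M (RQob M X) (RQob M Z) (g' ** f') h} = Collect (htp M (RQob M X) (RQob M Z) (g ** f))"
  using htp_trans htp_refl by blast
 thus ?thesis by (simp add: hocat_def hcls_def)
qed

lemma category_hocat: "category (hocat M)"
 unfolding category_def hocat_simps
proof (intro conjI ballI)
 show "hcls X X (sid M (RQob M X)) : hcls X X ` hom (RQob M X) (RQob M X) 0" if "X : sob M" for X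
  using sid_in[OF QR_maps(2)[OF that]] by blast
next
 fix X Y Z f g assume o: "X : sob M" "Y : sob M" "Z : sob M" and f: "f : hcls X Y ` hom (RQob M X) (RQob M Y) 0"
  and g: "g : hcls Y Z ` hom (RQob M Y) (RQob M Z) 0"
 thus "hcmp M g f : hcls X Z ` hom (RQob M X) (RQob M Z) 0"
  using hcmp_hcls[OF o] comp0_in[OF QR_maps(2) QR_maps(2) QR_maps(2), OF o] by auto
next
 fix X Y f assume o: "X : sob M" "Y : sob M" and f: "f : hcls X Y ` hom (RQob M X) (RQob M Y) 0"
 note R = QR_maps(2)[OF o(1)] QR_maps(2)[OF o(2)]
 show "hcmp M f (hcls X X (sid M (RQob M X))) = f" "hcmp M (hcls Y Y (sid M (RQob M Y))) f = f"
  using f hcmp_hcls[OF o(1,1,2) sid_in[OF R(1)]] hcmp_hcls[OF o(1,2,2) _ sid_in[OF R(2)]] comp0_id[OF R] by auto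
next
 fix X Y Z W f g h assume o: "X : sob M" "Y : sob M" "Z : sob M" "W : sob M"
  and f: "f : hcls X Y ` hom (RQob M X) (RQob M Y) 0"
  and g: "g : hcls Y Z ` hom (RQob M Y) (RQob M Z) 0" and h: "h : hcls Z W ` hom (RQob M Z) (RQob M W) 0"
 note R = QR_maps(2)[OF o(1)] QR_maps(2)[OF o(2)] QR_maps(2)[OF o(3)] QR_maps(2)[OF o(4)]
 obtain f' g' h' where e: "f = hcls X Y f'" "g = hcls Y Z g'" "h = hcls Z W h'"
   "f' : hom (RQob M X) (RQob M Y) 0" "g' : hom (RQob M Y) (RQob M Z) 0" "h' : hom (RQob M Z) (RQob M W) 0"
  using f g h by blast
 show "hcmp M h (hcmp M g f) = hcmp M (hcmp M h g) f"
  unfolding e(1-3) using hcmp_hcls[OF o(1-3) e(4,5)] hcmp_hcls[OF o(2-4) e(5,6)]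
   hcmp_hcls[OF o(1,3,4) comp0_in[OF R(1-3) e(4,5)] e(6)] hcmp_hcls[OF o(1,2,4) e(4) comp0_in[OF R(2-4) e(5,6)]]
   comp0_assoc[OF R e(4-6)] by simp
qed

lemma zero_hocat:
 assumes Z: "is_zero (uc M) Z"
 shows "is_zero (hocat M) Z" and "RQob M Z = Z"
proof -
 have Z0: "Z : sob M" using zero_ob[OF Z] by simp
 have c: "cofibrant M Z" using Z id_classes[OF Z0] by (auto simp: cofibrant_def)
 have f: "fibrant M Z" using Z id_classes[OF Z0] by (auto simp: fibrant_def)
 show r: "RQob M Z = Z" using RQob_fibrant[OF f] Qob_cofibrant[OF c] by simp
 have "(EX! f. f : hcls X Z ` hom (RQob M X) Z 0) & (EX! f. f : hcls Z X ` hom Z (RQob M X) 0)" if X: "X : sob M" for X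
 proof -
  note R = QR_maps(2)[OF X]
  have "hom (RQob M X) Z 0 = {zmap (RQob M X) Z}" "hom Z (RQob M X) 0 = {zmap Z (RQob M X)}"
   using zmap_in[OF R Z0] zmap_in[OF Z0 R] zero_eq_to[OF Z, of "RQob M X"] zero_eq_from[OF Z, of "RQob M X"] R by auto
  thus ?thesis by simp
 qed
 thus "is_zero (hocat M) Z" using Z0 by (simp add: is_zero_def hocat_simps r)
qed

lemma zarr_hocat: assumes X: "X : sob M" "Y : sob M" shows "zarr (hocat M) X Y = hcls X Y (zmap (RQob M X) (RQob M Y))"
proof -
 obtain Z where Z: "is_zero (uc M) Z" "Z : sob M" by (rule zero_ex)
 note z = zero_hocat[OF Z(1)] and R = QR_maps(2)[OF X(1)] QR_maps(2)[OF X(2)]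
 have a: "zmap (RQob M X) (RQob M Z) : hom (RQob M X) (RQob M Z) 0" "zmap (RQob M Z) (RQob M Y) : hom (RQob M Z) (RQob M Y) 0"
  using zmap_in R Z z(2) by auto
 have "zarr (hocat M) X Y = hcmp M (hcls Z Y (zmap (RQob M Z) (RQob M Y))) (hcls X Z (zmap (RQob M X) (RQob M Z)))"
  by (rule zarr_eq[OF category_hocat z(1)]) (use X a in \<open>auto simp: hocat_simps\<close>)
 also have "\<dots> = hcls X Y (zmap (RQob M X) (RQob M Y))"
  using hcmp_hcls[OF X(1) Z(2) X(2) a] zmap_post[OF R(1) _ R(2) a(2)] Z z(2) by simp
 finally show ?thesis .
qed

lemma loc_eq:
 assumes X: "X : sob M" "Y : sob M" and f: "f : hom X Y 0" and c: "c : hom (Qob M X) (Qob M Y) 0"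
   "snd (crep M Y) ** c = f ** snd (crep M X)"
  and b: "b : hom (RQob M X) (RQob M Y) 0" "htp M (Qob M X) (RQob M Y) (b ** snd (brep M X)) (snd (brep M Y) ** c)"
 shows "loc M X Y f = hcls X Y b"
proof -
 note x = QR_maps[OF X(1)] and y = QR_maps[OF X(2)]
 note Q = Qob[OF X(1)] Qob[OF X(2)] and R = RQob[OF X(1)] RQob[OF X(2)]
 have "{b' : hom (RQob M X) (RQob M Y) 0. EX c':hom (Qob M X) (Qob M Y) 0. snd (crep M Y) ** c' = f ** snd (crep M X) &
       htp M (Qob M X) (RQob M Y) (b' ** snd (brep M X)) (snd (brep M Y) ** c')} = Collect (htp M (RQob M X) (RQob M Y) b)"
  (is "?S = _")
 proof (intro Set.set_eqI iffI)
  fix b' assume "b' : ?S"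
  then obtain c' where b': "b' : hom (RQob M X) (RQob M Y) 0" and c': "c' : hom (Qob M X) (Qob M Y) 0"
   "snd (crep M Y) ** c' = f ** snd (crep M X)" "htp M (Qob M X) (RQob M Y) (b' ** snd (brep M X)) (snd (brep M Y) ** c')" by blast
  have "htp M (Qob M X) (Qob M Y) c c'" using htp_lift[OF Q(1) _ _ c(1) c'(1), of Y "snd (crep M Y)"] Q(4) c(2) c'(2) by auto
  hence "htp M (Qob M X) (RQob M Y) (snd (brep M Y) ** c) (snd (brep M Y) ** c')" by (rule htp_post[OF x(1) y(1,2,4)])
  hence "htp M (Qob M X) (RQob M Y) (b ** snd (brep M X)) (b' ** snd (brep M X))" using b(2) c'(3) htp_trans htp_sym by meson
  thus "b' : Collect (htp M (RQob M X) (RQob M Y) b)" using htp_extend[OF _ _ Q(1) R(4) b(1) b'] R(2) by blast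
 next
  fix b' assume "b' : Collect (htp M (RQob M X) (RQob M Y) b)"
  hence h: "htp M (RQob M X) (RQob M Y) b b'" by simp
  hence b': "b' : hom (RQob M X) (RQob M Y) 0" using htp_hom[OF x(2) y(2)] b(1) by blast
  have "htp M (Qob M X) (RQob M Y) (b ** snd (brep M X)) (b' ** snd (brep M X))" by (rule htp_pre[OF x(1,2) y(2) x(4) h])
  thus "b' : ?S" using b' c b(2) htp_trans htp_sym by blast
 qed
 thus ?thesis by (simp add: loc_def hcls_def)
qed

lemma loc_ex:
 assumes X: "X : sob M" "Y : sob M" and f: "f : hom X Y 0"
 obtains c b where "c : hom (Qob M X) (Qob M Y) 0" "snd (crep M Y) ** c = f ** snd (crep M X)"
  "b : hom (RQob M X) (RQob M Y) 0" "b ** snd (brep M X) = snd (brep M Y) ** c" "loc M X Y f = hcls X Y b"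
proof -
 note x = QR_maps[OF X(1)] and y = QR_maps[OF X(2)]
 note Q = Qob[OF X(1)] Qob[OF X(2)] and R = RQob[OF X(1)] RQob[OF X(2)]
 have "f ** snd (crep M X) : hom (Qob M X) Y 0" by (rule comp0_in[OF x(1) X x(3) f])
 then obtain c where c: "c : hom (Qob M X) (Qob M Y) 0" "snd (crep M Y) ** c = f ** snd (crep M X)"
  using fib_kan(2)[OF Q(1), of "Qob M Y" Y "snd (crep M Y)"] Q(4) unfolding trivial_kan_fibration_def by auto
 have "snd (brep M Y) ** c : hom (Qob M X) (RQob M Y) 0" by (rule comp0_in[OF x(1) y(1,2) c(1) y(4)])
 then obtain b where b: "b : hom (RQob M X) (RQob M Y) 0" "b ** snd (brep M X) = snd (brep M Y) ** c"
  using extend_fibrant[OF _ _ R(4), of "Qob M X" "RQob M X" "snd (brep M X)"] R(2) by blast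
 show thesis using that[OF c b loc_eq[OF X f c b(1)]] b(2) htp_refl by simp
qed

lemma loc_in: "X : sob M ==> Y : sob M ==> f : hom X Y 0 ==> loc M X Y f : ar (hocat M) X Y"
 by (erule (2) loc_ex) (auto simp: hocat_simps)

lemma loc_comp:
 assumes X: "X : sob M" "Y : sob M" "Z : sob M" and f: "f : hom X Y 0" "g : hom Y Z 0"
 shows "hcmp M (loc M Y Z g) (loc M X Y f) = loc M X Z (g ** f)"
proof -
 note x = QR_maps[OF X(1)] and y = QR_maps[OF X(2)] and z = QR_maps[OF X(3)]
 obtain c b where c: "c : hom (Qob M X) (Qob M Y) 0" "snd (crep M Y) ** c = f ** snd (crep M X)"
  "b : hom (RQob M X) (RQob M Y) 0" "b ** snd (brep M X) = snd (brep M Y) ** c" "loc M X Y f = hcls X Y b"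
  by (rule loc_ex[OF X(1,2) f(1)])
 obtain c' b' where c': "c' : hom (Qob M Y) (Qob M Z) 0" "snd (crep M Z) ** c' = g ** snd (crep M Y)"
  "b' : hom (RQob M Y) (RQob M Z) 0" "b' ** snd (brep M Y) = snd (brep M Z) ** c'" "loc M Y Z g = hcls Y Z b'"
  by (rule loc_ex[OF X(2,3) f(2)])
 have "snd (crep M Z) ** (c' ** c) = (g ** f) ** snd (crep M X)"
  using comp0_assoc[OF x(1) y(1) z(1) X(3) c(1) c'(1) z(3)] comp0_assoc[OF x(1) y(1) X(2,3) c(1) y(3) f(2)]
   comp0_assoc[OF x(1) X x(3) f] c(2) c'(2) by simp
 moreover have "(b' ** b) ** snd (brep M X) = snd (brep M Z) ** (c' ** c)"
  using comp0_assoc[OF x(1,2) y(2) z(2) x(4) c(3) c'(3)] comp0_assoc[OF x(1) y(1,2) z(2) c(1) y(4) c'(3)]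
   comp0_assoc[OF x(1) y(1) z(1,2) c(1) c'(1) z(4)] c(4) c'(4) by simp
 ultimately have "loc M X Z (g ** f) = hcls X Z (b' ** b)"
  using loc_eq[OF X(1,3) comp0_in[OF X f] comp0_in[OF x(1) y(1) z(1) c(1) c'(1)] _ comp0_in[OF x(2) y(2) z(2) c(3) c'(3)]] htp_refl by simp
 thus ?thesis using hcmp_hcls[OF X c(3) c'(3)] c(5) c'(5) by simp
qed

lemma loc_zero: assumes X: "X : sob M" "Y : sob M" shows "loc M X Y (zmap X Y) = zarr (hocat M) X Y"
proof -
 note x = QR_maps[OF X(1)] and y = QR_maps[OF X(2)]
 have "loc M X Y (zmap X Y) = hcls X Y (zmap (RQob M X) (RQob M Y))"
  by (rule loc_eq[OF X zmap_in[OF X] zmap_in[OF x(1) y(1)] _ zmap_in[OF x(2) y(2)]])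
   (simp_all add: zmap_pre[OF x(1) X x(3)] zmap_post[OF x(1) y(1) X(2) y(3)] zmap_pre[OF x(1,2) y(2) x(4)]
    zmap_post[OF x(1) y(1,2,4)] htp_refl)
 thus ?thesis using zarr_hocat[OF X] by simp
qed

text \<open>For cofibrant \<open>X\<close> and fibrant \<open>Y\<close> the replacement maps induce bijections on homotopy classes, so maps of
 the homotopy category can be compared by homotopies between maps from \<open>X\<close> to \<open>Y\<close>.\<close>

lemma loc_cof_fib:
 assumes X: "cofibrant M X" and Y: "fibrant M Y" and f: "f : hom X Y 0" and b: "b : hom (RQob M X) (RQob M Y) 0"
 shows "loc M X Y f = hcls X Y b \<longleftrightarrow> htp M X Y (snd (crep M Y) ** (b ** snd (brep M X))) f"
  and "snd (crep M Y) ** (b ** snd (brep M X)) : hom X Y 0"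
proof -
 note X0 = cofibrant_ob[OF X] and Y0 = fibrant_ob[OF Y]
 note x = QR_maps[OF X0] and y = QR_maps[OF Y0] and Q = Qob[OF Y0]
 have cx: "Qob M X = X" "snd (crep M X) = sid M X" using Qob_cofibrant[OF X] by auto
 have ry: "RQob M Y = Qob M Y" "snd (brep M Y) = sid M (Qob M Y)" using RQob_fibrant[OF Y] by auto
 have br: "b ** snd (brep M X) : hom X (Qob M Y) 0"
  using comp0_in[OF x(1,2) y(2) x(4) b] cx ry by simp
 show qb: "snd (crep M Y) ** (b ** snd (brep M X)) : hom X Y 0" by (rule comp0_in[OF X0 y(1) Y0 br y(3)])
 obtain c b' where c: "c : hom (Qob M X) (Qob M Y) 0" "snd (crep M Y) ** c = f ** snd (crep M X)"
  "b' : hom (RQob M X) (RQob M Y) 0" "b' ** snd (brep M X) = snd (brep M Y) ** c" "loc M X Y f = hcls X Y b'"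
  by (rule loc_ex[OF X0 Y0 f])
 have c1: "c : hom X (Qob M Y) 0" "snd (crep M Y) ** c = f" "b' ** snd (brep M X) = c"
  using c(1,2,4) cx ry comp0_id(1)[OF X0 Y0 f] comp0_id(2)[OF X0 y(1), of c] by auto
 have fq: "fibrant M (Qob M Y)" using fibrant_fib[OF Y] Q(2) by blast
 show "loc M X Y f = hcls X Y b \<longleftrightarrow> htp M X Y (snd (crep M Y) ** (b ** snd (brep M X))) f"
 proof
  assume "loc M X Y f = hcls X Y b"
  hence "htp M (RQob M X) (Qob M Y) b b'" using c(5) hcls_eq htp_sym ry(1) by metis
  hence "htp M X (Qob M Y) (b ** snd (brep M X)) (b' ** snd (brep M X))"
   using htp_pre[OF x(1,2) y(1) x(4)] cx by simp
  thus "htp M X Y (snd (crep M Y) ** (b ** snd (brep M X))) f"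
   using htp_post[OF X0 y(1) Y0 y(3)] c1 by metis
 next
  assume h: "htp M X Y (snd (crep M Y) ** (b ** snd (brep M X))) f"
  obtain e where e: "e : hom X Y (Suc 0)" "src X Y e = snd (crep M Y) ** (b ** snd (brep M X))" "tgt X Y e = snd (crep M Y) ** c"
   using htp_edge[OF X Y qb h] c1(2) by (auto simp: edge_rel_def)
  have q: "(Qob M Y, Y, snd (crep M Y)) : fib M" "(Qob M Y, Y, snd (crep M Y)) : weq M" using Q(2) by auto
  obtain e' where "e' : hom X (Qob M Y) (Suc 0)" "src X (Qob M Y) e' = b ** snd (brep M X)" "tgt X (Qob M Y) e' = c"
   by (rule lift_edge2[OF X q e(1) br e(2) c1(1) e(3)])
  hence "htp M X (Qob M Y) (b ** snd (brep M X)) (b' ** snd (brep M X))"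
   unfolding c1(3) by (intro edge_htp) (auto simp: edge_rel_def)
  hence "htp M (RQob M X) (Qob M Y) b b'"
   using htp_extend[of "Qob M X" "RQob M X" "snd (brep M X)" "Qob M Y" b b'] RQob(2)[OF X0] Qob(1)[OF X0] fq b c(3) cx(1) ry(1) by auto
  thus "loc M X Y f = hcls X Y b" using c(5) hcls_eq htp_sym ry(1) by metis
 qed
qed

lemma loc_surj:
 assumes X: "cofibrant M X" and Y: "fibrant M Y" and x: "x : ar (hocat M) X Y"
 obtains f where "f : hom X Y 0" "loc M X Y f = x"
proof -
 obtain b where b: "b : hom (RQob M X) (RQob M Y) 0" "x = hcls X Y b" using x by (auto simp: hocat_simps)
 note q = loc_cof_fib(2)[OF X Y zmap_in[OF cofibrant_ob[OF X] fibrant_ob[OF Y]] b(1)]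
 show thesis by (rule that[OF q]) (use loc_cof_fib(1)[OF X Y q b(1)] b(2) htp_refl in simp)
qed

lemma loc_inj:
 assumes X: "cofibrant M X" and Y: "fibrant M Y" and f: "f : hom X Y 0" "g : hom X Y 0"
 shows "loc M X Y f = loc M X Y g \<longleftrightarrow> htp M X Y f g"
proof -
 obtain b where b: "b : hom (RQob M X) (RQob M Y) 0" "loc M X Y f = hcls X Y b"
  using loc_in[OF cofibrant_ob[OF X] fibrant_ob[OF Y] f(1)] by (auto simp: hocat_simps)
 have "htp M X Y (snd (crep M Y) ** (b ** snd (brep M X))) f" using loc_cof_fib(1)[OF X Y f(1) b(1)] b(2) by simp
 moreover have "loc M X Y g = loc M X Y f \<longleftrightarrow> htp M X Y (snd (crep M Y) ** (b ** snd (brep M X))) g"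
  unfolding b(2) by (rule loc_cof_fib(1)[OF X Y f(2) b(1)])
 ultimately show ?thesis using htp_sym htp_trans by metis
qed

text \<open>Each suspension is an object of \<open>\<Pi>\<^sub>\<A>\<close>, as a coproduct with one summand.\<close>

lemma hocat_trivial_coprod:
 assumes T: "T : sob M"
 shows "is_coprod (hocat M) {0 :: nat} (%_. T) T (%_. idt (hocat M) T)"
 unfolding is_coprod_def
proof (intro conjI ballI allI impI)
 show "T : ob (hocat M)" using T by (simp add: hocat_simps)
 thus "idt (hocat M) T : ar (hocat M) T T" by (rule cat_id[OF category_hocat])
 fix Y and t :: "nat => ('o, 'a) harr" assume Y: "Y : ob (hocat M)" "ALL j:{0}. t j : ar (hocat M) T Y"
 have r: "hcmp M h (idt (hocat M) T) = h" if "h : ar (hocat M) T Y" for h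
  by (rule cat_id_right[OF category_hocat _ Y(1) that]) (use T in \<open>simp add: hocat_simps\<close>)
 show "EX! h. h : ar (hocat M) T Y & (ALL j:{0}. hcmp M h (idt (hocat M) T) = t j)"
  by (rule ex1I[of _ "t 0"]) (use Y(2) r in auto)
qed

end

section \<open>Exactness on homotopy groups\<close>

text \<open>Exactness of \<open>K2 \<rightarrow> K1 \<rightarrow> K0\<close> on homotopy groups in degrees \<open>k \<ge> \<kappa>\<close>.  The chains objects are exact only
 for \<open>\<kappa> = 1\<close>, while \<open>\<kappa> = 0\<close> yields statements about homotopy classes of maps.\<close>

definition sexact :: "nat => 'x sset => 'x => 'y sset => 'y => 'z sset => 'z => (nat => 'x => 'y) => (nat => 'y => 'z) => bool" where
 "sexact \<kappa> K2 b2 K1 b1 K0 b0 p q \<longleftrightarrow> (ALL k>=\<kappa>. ALL x:pi_cycles K1 b1 k. null K0 b0 k (q k x) -->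
     (EX v:pi_cycles K2 b2 k. pi_rel K1 b1 k (p k v) x))"

lemma trivial_cycle_fill:
 assumes t: "trivial_kan_fibration K L f" and K: "is_sset K" "b : Sx K 0" and f: "smap K L f" "f 0 b = c"
  and x: "x0 : pi_cycles K b k" "x1 : pi_cycles K b k" "x2 : pi_cycles K b k"
  and w: "w : Sx L (Suc k)" "Fc L (Suc k) 0 w = f k x0" "Fc L (Suc k) 1 w = f k x1" "1 <= k ==> Fc L (Suc k) 2 w = f k x2"
   "!!i. 3 <= i ==> i <= Suc k ==> Fc L (Suc k) i w = cst L k c"
 obtains y where "y : Sx K (Suc k)" "f (Suc k) y = w" "Fc K (Suc k) 0 y = x0" "Fc K (Suc k) 1 y = x1"
  "1 <= k ==> Fc K (Suc k) 2 y = x2" "!!i. 3 <= i ==> i <= Suc k ==> Fc K (Suc k) i y = cst K k b"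
proof -
 have fc: "f k (cst K k b) = cst L k c" using smap_cst[OF f(1) K] f(2) by simp
 have c: "compat4 K b k x0 x1 x2 (cst K k b)"
  unfolding compat4_def compat3_def using cst_in[OF K] cst_face'[OF K] cycle_in[OF x(1)] cycle_face[OF x(1)]
   cycle_in[OF x(2)] cycle_face[OF x(2)] cycle_in[OF x(3)] cycle_face[OF x(3)] by auto
 have w3: "2 <= k ==> Fc L (Suc k) 3 w = f k (cst K k b)" using w(5)[of 3] fc by simp
 have w4: "4 <= i ==> i <= Suc k ==> Fc L (Suc k) i w = f k (cst K k b)" for i using w(5)[of i] fc by simp
 show thesis
 proof (rule trivial_kan_lift4[OF t K c w(1-3)])
  fix z assume z: "z : Sx K (Suc k)" "f (Suc k) z = w" "Fc K (Suc k) 0 z = x0" "Fc K (Suc k) 1 z = x1"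
   "1 <= k ==> Fc K (Suc k) 2 z = x2" and z3: "2 <= k ==> Fc K (Suc k) 3 z = cst K k b"
   and z4: "!!i. 4 <= i ==> i <= Suc k ==> Fc K (Suc k) i z = cst K k b"
  have z5: "Fc K (Suc k) i z = cst K k b" if "3 <= i" "i <= Suc k" for i
   using z3 z4[of i] that by (cases "i = 3") auto
  show thesis by (rule that[OF z z5])
 qed (use w(4) w3 w4 in simp_all)
qed

text \<open>Trivial fibrations are bijective on homotopy groups: cycles lift, and so do homotopies between images
 of cycles.\<close>

lemma trivial_cycle_lift:
 assumes t: "trivial_kan_fibration K L f" and K: "is_sset K" "b : Sx K 0" and f: "smap K L f" "f 0 b = c"
  and z: "z : pi_cycles L c k"
 obtains y where "y : pi_cycles K b k" "f k y = z"
proof (cases k)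
 case 0
 have "z : Sx L 0" using cycle_in[OF z] 0 by simp
 then obtain y where "y : Sx K 0" "f 0 y = z"
  using bspec[OF t[unfolded trivial_kan_fibration_def, THEN conjunct1]] by blast
 thus thesis using that 0 by (simp add: pi_cycles_def)
next
 case (Suc m)
 have fc: "f m (cst K m b) = cst L m c" using smap_cst[OF f(1) K] f(2) by simp
 have zf: "Fc L (Suc m) i z = cst L m c" if "i <= Suc m" for i using cycle_face[OF z, of i] Suc that by simp
 have z0: "z : Sx L (Suc m)" using cycle_in[OF z] Suc by simp
 note cc = cst_cycle[OF K, of m]
 show thesis
 proof (rule trivial_cycle_fill[OF t K f cc cc cc z0])
  fix y assume y: "y : Sx K (Suc m)" "f (Suc m) y = z" "Fc K (Suc m) 0 y = cst K m b" "Fc K (Suc m) 1 y = cst K m b"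
   and y2: "1 <= m ==> Fc K (Suc m) 2 y = cst K m b" and y3: "!!i. 3 <= i ==> i <= Suc m ==> Fc K (Suc m) i y = cst K m b"
  have "Fc K (Suc m) i y = cst K m b" if i: "i <= Suc m" for i
  proof -
   consider "i = 0" | "i = 1" | "i = 2" | "3 <= i" by linarith
   thus ?thesis using y(3,4) y2 y3[of i] i by cases auto
  qed
  thus thesis using that[of y] y(1,2) Suc by (simp add: pi_cycles_def)
 qed (use zf fc in simp_all)
qed

lemma trivial_null:
 assumes t: "trivial_kan_fibration K L f" and K: "is_sset K" "b : Sx K 0" and f: "smap K L f" "f 0 b = c"
  and y: "y : pi_cycles K b k" and n: "null L c k (f k y)"
 shows "null K b k y"
proof -
 obtain w where w: "w : Sx L (Suc k)" "Fc L (Suc k) 0 w = f k y" and wf: "!!i. 1 <= i ==> i <= Suc k ==> Fc L (Suc k) i w = cst L k c"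
  using n unfolding null_alt by blast
 have fc: "f k (cst K k b) = cst L k c" using smap_cst[OF f(1) K] f(2) by simp
 note cc = cst_cycle[OF K, of k]
 show ?thesis
 proof (rule trivial_cycle_fill[OF t K f y cc cc w])
  fix z assume z: "z : Sx K (Suc k)" "Fc K (Suc k) 0 z = y" and z1: "Fc K (Suc k) 1 z = cst K k b"
   and z2: "1 <= k ==> Fc K (Suc k) 2 z = cst K k b" and z3: "!!i. 3 <= i ==> i <= Suc k ==> Fc K (Suc k) i z = cst K k b"
  have "Fc K (Suc k) i z = cst K k b" if i: "1 <= i" "i <= Suc k" for i
  proof -
   consider "i = 1" | "i = 2" | "3 <= i" using i by linarith
   thus ?thesis using z1 z2 z3[of i] i by cases auto
  qed
  thus ?thesis unfolding null_alt using z by blast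
 qed (use wf[of 1] wf[of 2] wf fc in simp_all)
qed

lemma trivial_pi_rel:
 assumes t: "trivial_kan_fibration K L f" and K: "is_sset K" "b : Sx K 0" and f: "smap K L f" "f 0 b = c"
  and y: "y : pi_cycles K b k" "y' : pi_cycles K b k" and n: "pi_rel L c k (f k y) (f k y')"
 shows "pi_rel K b k y y'"
proof -
 obtain w where w: "w : Sx L (Suc k)" "Fc L (Suc k) 0 w = f k y" "Fc L (Suc k) 1 w = f k y'"
  and w2: "!!i. 2 <= i ==> i <= Suc k ==> Fc L (Suc k) i w = cst L k c"
  using n unfolding pi_rel_def by blast
 have fc: "f k (cst K k b) = cst L k c" using smap_cst[OF f(1) K] f(2) by simp
 show ?thesis
 proof (rule trivial_cycle_fill[OF t K f y cst_cycle[OF K, of k] w])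
  fix z assume z: "z : Sx K (Suc k)" "Fc K (Suc k) 0 z = y" "Fc K (Suc k) 1 z = y'"
   and z2: "1 <= k ==> Fc K (Suc k) 2 z = cst K k b" and z3: "!!i. 3 <= i ==> i <= Suc k ==> Fc K (Suc k) i z = cst K k b"
  have "Fc K (Suc k) i z = cst K k b" if "2 <= i" "i <= Suc k" for i using z2 z3[of i] that by (cases "i = 2") auto
  thus ?thesis unfolding pi_rel_def using z by blast
 qed (use w2[of 2] w2 fc in simp_all)
qed

lemma smap_pi_rel:
 assumes f: "smap K L f" and K: "is_sset K" "b : Sx K 0" "f 0 b = c" and r: "pi_rel K b k x y"
 shows "pi_rel L c k (f k x) (f k y)"
proof -
 obtain w where w: "w : Sx K (Suc k)" "Fc K (Suc k) 0 w = x" "Fc K (Suc k) 1 w = y"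
  and w2: "!!i. 2 <= i ==> i <= Suc k ==> Fc K (Suc k) i w = cst K k b"
  using r unfolding pi_rel_def by blast
 have s: "i <= Suc k ==> Fc L (Suc k) i (f (Suc k) w) = f k (Fc K (Suc k) i w)" for i using smap_face[OF f w(1), of i] by simp
 show ?thesis unfolding pi_rel_def
  using smap_in[OF f w(1)] s w w2 smap_cst[OF f K(1,2), of k] K(3) by (intro bexI[of _ "f (Suc k) w"]) simp_all
qed

definition pmap :: "'x sset => 'x => 'y sset => 'y => (nat => 'x => 'y) => bool" where
 "pmap K b L c f \<longleftrightarrow> is_sset K & b : Sx K 0 & smap K L f & f 0 b = c"

lemma pmapD: "pmap K b L c f ==> is_sset K" "pmap K b L c f ==> b : Sx K 0" "pmap K b L c f ==> smap K L f"
 "pmap K b L c f ==> f 0 b = c"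
 by (auto simp: pmap_def)

lemma pmap_cycle: "pmap K b L c f ==> x : pi_cycles K b k ==> f k x : pi_cycles L c k"
 using smap_cycle[of K L f b c x k] by (simp add: pmap_def)

lemma sexact_trivial:
 assumes t2: "trivial_kan_fibration K2' K2 t2" "pmap K2' b2' K2 b2 t2" and t1: "trivial_kan_fibration K1' K1 t1" "pmap K1' b1' K1 b1 t1"
  and t0: "trivial_kan_fibration K0' K0 t0" "pmap K0' b0' K0 b0 t0"
  and p: "pmap K2' b2' K1' b1' p'" and q: "pmap K1' b1' K0' b0' q'"
  and cp: "!!k x. x : Sx K2' k ==> t1 k (p' k x) = p k (t2 k x)" and cq: "!!k x. x : Sx K1' k ==> t0 k (q' k x) = q k (t1 k x)"
 shows "sexact \<kappa> K2' b2' K1' b1' K0' b0' p' q' \<longleftrightarrow> sexact \<kappa> K2 b2 K1 b1 K0 b0 p q"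
proof
 assume e: "sexact \<kappa> K2' b2' K1' b1' K0' b0' p' q'"
 show "sexact \<kappa> K2 b2 K1 b1 K0 b0 p q" unfolding sexact_def
 proof (intro allI impI ballI)
  fix k x assume k: "\<kappa> <= k" and x: "x : pi_cycles K1 b1 k" and n: "null K0 b0 k (q k x)"
  obtain x' where x': "x' : pi_cycles K1' b1' k" "t1 k x' = x"
   by (rule trivial_cycle_lift[OF t1(1) pmapD[OF t1(2)] x])
  have "t0 k (q' k x') = q k x" using cq[OF cycle_in[OF x'(1)]] x'(2) by simp
  hence "null K0' b0' k (q' k x')"
   using trivial_null[OF t0(1) pmapD[OF t0(2)] pmap_cycle[OF q x'(1)]] n by simp
  then obtain v where v: "v : pi_cycles K2' b2' k" "pi_rel K1' b1' k (p' k v) x'"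
   using e k x'(1) unfolding sexact_def by blast
  have "pi_rel K1 b1 k (t1 k (p' k v)) (t1 k x')" by (rule smap_pi_rel[OF pmapD(3,1,2,4)[OF t1(2)] v(2)])
  hence "pi_rel K1 b1 k (p k (t2 k v)) x" using cp[OF cycle_in[OF v(1)]] x'(2) by simp
  thus "EX v:pi_cycles K2 b2 k. pi_rel K1 b1 k (p k v) x" using pmap_cycle[OF t2(2) v(1)] by blast
 qed
next
 assume e: "sexact \<kappa> K2 b2 K1 b1 K0 b0 p q"
 show "sexact \<kappa> K2' b2' K1' b1' K0' b0' p' q'" unfolding sexact_def
 proof (intro allI impI ballI)
  fix k x assume k: "\<kappa> <= k" and x: "x : pi_cycles K1' b1' k" and n: "null K0' b0' k (q' k x)"
  have "null K0 b0 k (q k (t1 k x))"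
   using smap_null[OF pmapD(3,1,2,4)[OF t0(2)] n] cq[OF cycle_in[OF x]] by simp
  then obtain v where v: "v : pi_cycles K2 b2 k" "pi_rel K1 b1 k (p k v) (t1 k x)"
   using e k pmap_cycle[OF t1(2) x] unfolding sexact_def by blast
  obtain v' where v': "v' : pi_cycles K2' b2' k" "t2 k v' = v"
   by (rule trivial_cycle_lift[OF t2(1) pmapD[OF t2(2)] v(1)])
  have "pi_rel K1 b1 k (t1 k (p' k v')) (t1 k x)" using v(2) cp[OF cycle_in[OF v'(1)]] v'(2) by simp
  hence "pi_rel K1' b1' k (p' k v') x"
   by (rule trivial_pi_rel[OF t1(1) pmapD[OF t1(2)] pmap_cycle[OF p v'(1)] x])
  thus "EX v:pi_cycles K2' b2' k. pi_rel K1' b1' k (p' k v) x" using v'(1) by blast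
 qed
qed

lemma lrel_nat:
 assumes A: "loop_seq F f E e K k j q" and B: "loop_seq F' f' E' e' K' k' j' q'"
  and pF: "pmap F f F' f' pF" and pE: "pmap E e E' e' pE"
  and cj: "!!n z. z : Sx F n ==> pE n (j n z) = j' n (pF n z)" and cq: "!!n y. y : Sx E n ==> q' n (pE n y) = pK n (q n y)"
  and r: "loop_seq.lrel F f E e j q n z x"
 shows "loop_seq.lrel F' f' E' e' j' q' n (pF n z) (pK (Suc n) x)"
proof -
 obtain y where y: "z : pi_cycles F f n" "y : Sx E (Suc n)" "Fc E (Suc n) 0 y = j n z"
   "!!i. 1 <= i ==> i <= Suc n ==> Fc E (Suc n) i y = cst E n e" "q (Suc n) y = x"
  using r unfolding loop_seq.lrel_def[OF A] by blast
 have "pE n (cst E n e) = cst E' n e'" using smap_cst[OF pmapD(3,1,2)[OF pE]] pmapD(4)[OF pE] by simp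
 hence "pE n (Fc E (Suc n) i y) = cst E' n e'" if "1 <= i" "i <= Suc n" for i using y(4)[OF that] by simp
 hence f: "1 <= i ==> i <= Suc n ==> Fc E' (Suc n) i (pE (Suc n) y) = cst E' n e'" for i
  using smap_face[OF pmapD(3)[OF pE] y(2), of i] by simp
 have f0: "Fc E' (Suc n) 0 (pE (Suc n) y) = j' n (pF n z)"
  using smap_face[OF pmapD(3)[OF pE] y(2), of 0] y(3) cj[OF cycle_in[OF y(1)]] by simp
 have "q' (Suc n) (pE (Suc n) y) = pK (Suc n) x" using cq[OF y(2)] y(5) by simp
 thus ?thesis unfolding loop_seq.lrel_def[OF B]
  using pmap_cycle[OF pF y(1)] smap_in[OF pmapD(3)[OF pE] y(2)] f f0 by blast
qed

text \<open>A loop fibration identifies cycles of \<open>F\<close> in degree \<open>k\<close> with cycles of \<open>K\<close> in degree \<open>k + 1\<close>, up to homotopy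
 and naturally, so exactness passes from the bases to the fibres.\<close>

lemma sexact_loop:
 assumes L2: "loop_seq F2 f2 E2 e2 K2 k2 j2 q2" and L1: "loop_seq F1 f1 E1 e1 K1 k1 j1 q1" and L0: "loop_seq F0 f0 E0 e0 K0 k0 j0 q0"
  and kan: "kan F1"
  and aF: "pmap F2 f2 F1 f1 aF" and aE: "pmap E2 e2 E1 e1 aE"
  and aj: "!!n z. z : Sx F2 n ==> aE n (j2 n z) = j1 n (aF n z)" and aq: "!!n y. y : Sx E2 n ==> q1 n (aE n y) = aK n (q2 n y)"
  and bF: "pmap F1 f1 F0 f0 bF" and bE: "pmap E1 e1 E0 e0 bE"
  and bj: "!!n z. z : Sx F1 n ==> bE n (j1 n z) = j0 n (bF n z)" and bq: "!!n y. y : Sx E1 n ==> q0 n (bE n y) = bK n (q1 n y)"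
  and ex: "sexact \<kappa> K2 k2 K1 k1 K0 k0 aK bK"
 shows "sexact \<kappa> F2 f2 F1 f1 F0 f0 aF bF"
 unfolding sexact_def
proof (intro allI impI ballI)
 fix k z assume k: "\<kappa> <= k" and z: "z : pi_cycles F1 f1 k" and n: "null F0 f0 k (bF k z)"
 obtain x where x: "loop_seq.lrel F1 f1 E1 e1 j1 q1 k z x" by (rule loop_seq.lrel_total_left[OF L1 z])
 have "null K0 k0 (Suc k) (bK (Suc k) x)" by (rule loop_seq.lrel_null[OF L0 lrel_nat[OF L1 L0 bF bE bj bq x] n])
 then obtain v where v: "v : pi_cycles K2 k2 (Suc k)" "pi_rel K1 k1 (Suc k) (aK (Suc k) v) x"
  using ex[unfolded sexact_def, rule_format, OF _ loop_seq.lrel_cycle_right[OF L1 x]] k by auto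
 obtain z' where z': "loop_seq.lrel F2 f2 E2 e2 j2 q2 k z' v" by (rule loop_seq.lrel_total_right[OF L2 v(1)])
 have z'c: "z' : pi_cycles F2 f2 k" using z' unfolding loop_seq.lrel_def[OF L2] by blast
 note F = pmapD(1,2)[OF bF]
 have l: "loop_seq.lrel F1 f1 E1 e1 j1 q1 k (aF k z') (aK (Suc k) v)" by (rule lrel_nat[OF L2 L1 aF aE aj aq z'])
 have "rel12 K1 k1 (Suc k) x (aK (Suc k) v)"
  by (rule pi_rel_imp_rel12[OF loop_seq.kanK[OF L1] loop_seq.K[OF L1] _ loop_seq.lrel_cycle_right[OF L1 x] loop_seq.lrel_cycle_right[OF L1 l] v(2)]) simp
 from loop_seq.lrel_rel12[OF L1 x l this] have "pi_rel F1 f1 k (aF k z') z" by (rule pi_rel_sym[OF kan F z pmap_cycle[OF aF z'c]])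
 thus "EX v:pi_cycles F2 f2 k. pi_rel F1 f1 k (aF k v) z" using z'c by blast
qed

context pointed_smc begin

lemma cof_comp: assumes "(A, B, i) : cof M" "(B, C, j) : cof M" shows "(A, C, j ** i) : cof M"
proof -
 have o: "A : sob M" "B : sob M" "C : sob M" "i : hom A B 0" "j : hom B C 0" using cof_arr assms by auto
 show ?thesis
 proof (rule cof_by_lifting(1)[OF o(1,3) comp0_in[OF o]])
  fix E D p a b assume p: "(E, D, p) : fib M" "(E, D, p) : weq M" and a: "a : hom A E 0" "b : hom C D 0" "p ** a = b ** (j ** i)"
  have d: "E : sob M" "D : sob M" "p : hom E D 0" using fib_arr[OF p(1)] by auto
  obtain h where h: "h : hom B E 0" "h ** i = a" "p ** h = b ** j"
   using lift_cof[OF assms(1) p(1) _ a(1) comp0_in[OF o(2,3) d(2) o(5) a(2)]] p(2) a(3) comp0_assoc[OF o(1-3) d(2) o(4,5) a(2)] by auto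
  obtain h' where h': "h' : hom C E 0" "h' ** j = h" "p ** h' = b"
   using lift_cof[OF assms(2) p(1) _ h(1) a(2) h(3)] p(2) by auto
  have "h' ** (j ** i) = a" using comp0_assoc[OF o(1-3) d(1) o(4,5) h'(1)] h'(2) h(2) by simp
  thus "EX h:hom C E 0. h ** (j ** i) = a & p ** h = b" using h' by blast
 qed
qed

lemma coprod_eq:
 assumes c: "is_coprod (uc M) I X P inc" and X: "!!i. i : I ==> X i : sob M" and Y: "Y : sob M"
  and y: "y : hom P Y n" "y' : hom P Y n" "!!i. i : I ==> pre (X i) P n (inc i) y = pre (X i) P n (inc i) y'"
 shows "y = y'"
proof -
 have P: "P : sob M" "!!i. i : I ==> inc i : hom (X i) P 0" using c by (auto simp: is_coprod_def)
 have "EX! z. z : hom P Y n & (ALL i:I. pre (X i) P n (inc i) z = pre (X i) P n (inc i) y')"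
  by (rule coproduct_simplex[OF c X Y]) (use pre_in[OF X P(1) Y P(2) y(2)] in auto)
 thus ?thesis using y by blast
qed

lemma lift_vertex:
 assumes X: "cofibrant M X" and p: "(E, D, p) : fib M" "(E, D, p) : weq M" and b: "b : hom X D 0"
 obtains h where "h : hom X E 0" "p ** h = b"
 using bspec[OF fib_kan(2)[OF X p, unfolded trivial_kan_fibration_def, THEN conjunct1] b] by auto

lemma coprod_cofibrant:
 assumes c: "is_coprod (uc M) I X P inc" and X: "!!i. i : I ==> cofibrant M (X i)"
 shows "cofibrant M P"
proof -
 have P: "P : sob M" "!!i. i : I ==> inc i : hom (X i) P 0" using c by (auto simp: is_coprod_def)
 note X0 = cofibrant_ob[OF X]
 show ?thesis
 proof (rule cofibrant_by_lifting[OF P(1)])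
  fix E D p b assume p: "(E, D, p) : fib M" "(E, D, p) : weq M" and b: "b : hom P D 0"
  have d: "E : sob M" "D : sob M" "p : hom E D 0" using fib_arr[OF p(1)] by auto
  have "ALL i:I. EX h. h : hom (X i) E 0 & p ** h = b ** inc i"
  proof
   fix i assume i: "i : I"
   show "EX h. h : hom (X i) E 0 & p ** h = b ** inc i"
    by (rule lift_vertex[OF X[OF i] p comp0_in[OF X0[OF i] P(1) d(2) P(2)[OF i] b]]) blast
  qed
  then obtain h where h: "!!i. i : I ==> h i : hom (X i) E 0 & p ** h i = b ** inc i" by metis
  have "EX! z. z : hom P E 0 & (ALL i:I. pre (X i) P 0 (inc i) z = h i)"
   by (rule coproduct_simplex[OF c X0 d(1)]) (use h in auto)
  then obtain g where g: "g : hom P E 0" "!!i. i : I ==> g ** inc i = h i" by auto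
  have "p ** g = b"
  proof (rule coprod_eq[OF c X0 d(2) comp0_in[OF P(1) d(1,2) g(1) d(3)] b])
   fix i assume i: "i : I"
   show "pre (X i) P 0 (inc i) (p ** g) = pre (X i) P 0 (inc i) b"
    using comp0_assoc[OF X0[OF i] P(1) d(1,2) P(2)[OF i] g(1) d(3)] g(2)[OF i] h[OF i] by simp
  qed
  thus "EX h:hom P E 0. p ** h = b" using g by blast
 qed
qed

text \<open>Ken Brown's lemma: what is invariant under trivial cofibrations between cofibrant objects is
 invariant under weak equivalences between them, since the mapping cylinder of \<open>f\<close> receives trivial
 cofibrations from both ends.\<close>

lemma weq_invariant:
 assumes inv: "!!X Z j. cofibrant M X ==> cofibrant M Z ==> (X, Z, j) : cof M ==> (X, Z, j) : weq M ==> Q X = Q Z"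
  and X: "cofibrant M X" and Y: "cofibrant M Y" and f: "(X, Y, f) : weq M"
 shows "Q X = Q Y"
proof -
 note X0 = cofibrant_ob[OF X] and Y0 = cofibrant_ob[OF Y]
 have f0: "f : hom X Y 0" using weq_arr[OF f] by simp
 define XY where "XY = (%i :: nat. if i = 0 then X else Y)"
 obtain P ic where P: "is_coprod (uc M) {0, 1} XY P ic"
  by (rule coproduct_exists[OF category_uc cocomplete_uc inf_univ, of "{0, 1}" XY]) (auto simp: XY_def X0 Y0)
 have XYc: "cofibrant M (XY i)" for i using X Y by (simp add: XY_def)
 have P0: "P : sob M" "ic 0 : hom X P 0" "ic 1 : hom Y P 0" using P by (auto simp: is_coprod_def XY_def)
 have u: "EX h. h : hom P T 0 & h ** ic 0 = a & h ** ic 1 = b" if "T : sob M" "a : hom X T 0" "b : hom Y T 0" for T a b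
 proof -
  have "EX! h. h : hom P T 0 & (ALL i:{0, 1}. pre (XY i) P 0 (ic i) h = (if i = 0 then a else b))"
   by (rule coproduct_simplex[OF P _ that(1)]) (use that X0 Y0 in \<open>auto simp: XY_def\<close>)
  thus ?thesis by auto
 qed
 have ue: "h = h'" if "T : sob M" "h : hom P T 0" "h' : hom P T 0" "h ** ic 0 = h' ** ic 0" "h ** ic 1 = h' ** ic 1" for T h h'
  by (rule coprod_eq[OF P _ that(1-3)]) (use that X0 Y0 in \<open>auto simp: XY_def\<close>)
 have ci: "(X, P, ic 0) : cof M"
 proof (rule cof_by_lifting(1)[OF X0 P0(1,2)])
  fix E D p a b assume p: "(E, D, p) : fib M" "(E, D, p) : weq M" and a: "a : hom X E 0" "b : hom P D 0" "p ** a = b ** ic 0"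
  have d: "E : sob M" "D : sob M" "p : hom E D 0" using fib_arr[OF p(1)] by auto
  obtain c where c: "c : hom Y E 0" "p ** c = b ** ic 1"
   by (rule lift_vertex[OF Y p comp0_in[OF Y0 P0(1) d(2) P0(3) a(2)]])
  obtain h where h: "h : hom P E 0" "h ** ic 0 = a" "h ** ic 1 = c" using u[OF d(1) a(1) c(1)] by blast
  have "p ** h = b" using ue[OF d(2) comp0_in[OF P0(1) d(1,2) h(1) d(3)] a(2)]
    comp0_assoc[OF X0 P0(1) d(1,2) P0(2) h(1) d(3)] comp0_assoc[OF Y0 P0(1) d(1,2) P0(3) h(1) d(3)] h(2,3) a(3) c(2) by simp
  thus "EX h:hom P E 0. h ** ic 0 = a & p ** h = b" using h by blast
 qed
 have cj: "(Y, P, ic 1) : cof M"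
 proof (rule cof_by_lifting(1)[OF Y0 P0(1,3)])
  fix E D p a b assume p: "(E, D, p) : fib M" "(E, D, p) : weq M" and a: "a : hom Y E 0" "b : hom P D 0" "p ** a = b ** ic 1"
  have d: "E : sob M" "D : sob M" "p : hom E D 0" using fib_arr[OF p(1)] by auto
  obtain c where c: "c : hom X E 0" "p ** c = b ** ic 0"
   by (rule lift_vertex[OF X p comp0_in[OF X0 P0(1) d(2) P0(2) a(2)]])
  obtain h where h: "h : hom P E 0" "h ** ic 0 = c" "h ** ic 1 = a" using u[OF d(1) c(1) a(1)] by blast
  have "p ** h = b" using ue[OF d(2) comp0_in[OF P0(1) d(1,2) h(1) d(3)] a(2)]
    comp0_assoc[OF X0 P0(1) d(1,2) P0(2) h(1) d(3)] comp0_assoc[OF Y0 P0(1) d(1,2) P0(3) h(1) d(3)] h(2,3) a(3) c(2) by simp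
  thus "EX h:hom P E 0. h ** ic 1 = a & p ** h = b" using h by blast
 qed
 obtain g where g: "g : hom P Y 0" "g ** ic 0 = f" "g ** ic 1 = sid M Y" using u[OF Y0 f0 sid_in[OF Y0]] by blast
 have "(P, Y, g) : arrs (uc M)" using P0 Y0 g by (simp add: arrs_def)
 then obtain Z i q where z: "(P, Z, i) : cof M" "(Z, Y, q) : fib M \<inter> weq M" "g = scmp M 0 q i"
  using ms_factor[OF ms] uc_simps(4) by metis
 have Z0: "Z : sob M" "i : hom P Z 0" "q : hom Z Y 0" using cof_arr[OF z(1)] fib_arr[of Z Y q] z(2) by auto
 have 0: "(X, Z, i ** ic 0) : cof M" "(Y, Z, i ** ic 1) : cof M" using cof_comp ci cj z(1) by auto
 have q: "q ** (i ** ic 0) = f" "q ** (i ** ic 1) = sid M Y"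
  using comp0_assoc[OF X0 P0(1) Z0(1) Y0 P0(2) Z0(2,3)] comp0_assoc[OF Y0 P0(1) Z0(1) Y0 P0(3) Z0(2,3)] g z(3) by auto
 have tw: "(A, Z, h) : weq M" if "(A, Z, h) : cof M" "(A, Y, q ** h) : weq M" for A h
 proof -
  have "(A, Z, h) : arrs (uc M)" "(Z, Y, q) : arrs (uc M)" using cof_arr[OF that(1)] Z0 Y0 by (auto simp: arrs_def)
  thus ?thesis using ms_two_of_three[OF ms, rule_format, of A Z h Y q] that(2) z(2) by simp
 qed
 have w: "(X, Z, i ** ic 0) : weq M" "(Y, Z, i ** ic 1) : weq M"
  using tw[OF 0(1)] tw[OF 0(2)] q f id_classes(1)[OF Y0] by auto
 have Zc: "cofibrant M Z" using cofibrant_cof[OF X 0(1)] .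
 show ?thesis using inv[OF X Zc 0(1) w(1)] inv[OF Y Zc 0(2) w(2)] by simp
qed

text \<open>Spheres: maps out of \<open>X \<and> S^k\<close> are \<open>k\<close>-cycles of mapping complexes out of \<open>X\<close>.\<close>

definition sph :: "nat => 'o => 'o" where
 "sph k X = fst (smash M X (sphere k) None)"

definition sph_cycle :: "nat => 'o => 'a" where
 "sph_cycle k X = snd (smash M X (sphere k) None) k (Some [0..<Suc k])"

lemma sph_rep:
 assumes X: "X : sob M"
 shows "sph k X : sob M" and "sph_cycle k X : cyc X (sph k X) k"
  and "!!Y z. Y : sob M ==> z : cyc X Y k ==>
   EX! h. h : hom (sph k X) Y 0 & post (sph k X) Y k h (sph_cycle k X) = z"
proof -
 have none: "None : Sx (sphere k) 0" "!!m. cst (sphere k) m None = None"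
  by (auto simp: sphere_def squot_Sx cst_squot)
 define T al where "T = sph k X" and "al = snd (smash M X (sphere k) None)"
 have sm: "is_smash M X (sphere k) None T al"
  using smash_exists[OF is_sset_sphere finite_sphere none(1) X] by (simp add: T_def al_def sph_def)
 have T: "T : sob M" "smap (sphere k) (mp X T) al" "!!m. al m None = zcst X T m"
  using sm none(2) by (auto simp: is_smash_def smaps_def zsimp_def)
 have xi: "sph_cycle k X = al k (Some [0..<Suc k])" by (simp add: sph_cycle_def al_def)
 show "sph k X : sob M" using T(1) by (simp add: T_def)
 have ss: "is_sset (mp X T)" "zmap X T : hom X T 0" using sset[OF X T(1)] zmap_in[OF X T(1)] by auto
 show "sph_cycle k X : cyc X (sph k X) k"
  using sphere_top_cycle[OF ss T(2,3)] unfolding xi T_def[symmetric] .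
 fix Y z assume Y: "Y : sob M" and z: "z : cyc X Y k"
 have sY: "is_sset (mp X Y)" "zmap X Y : hom X Y 0" using sset[OF X Y] zmap_in[OF X Y] by auto
 have ex: "EX! h. h : hom T Y 0 & (ALL m. ALL x:Sx (sphere k) m. post T Y m h (al m x) = sphere_map (mp X Y) (zmap X Y) k z m x)"
  by (rule smash_rep[OF is_sset_sphere X sm Y sphere_map_smap[OF sY z] _ none(1)])
   (simp add: none(2) sphere_map_def from_quot_def zsimp_def)
 have eq: "(ALL m. ALL x:Sx (sphere k) m. post T Y m h (al m x) = sphere_map (mp X Y) (zmap X Y) k z m x) \<longleftrightarrow>
   post T Y k h (al k (Some [0..<Suc k])) = z" if h: "h : hom T Y 0" for h
 proof
  assume "ALL m. ALL x:Sx (sphere k) m. post T Y m h (al m x) = sphere_map (mp X Y) (zmap X Y) k z m x"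
  thus "post T Y k h (al k (Some [0..<Suc k])) = z"
   using sphere_top_in sphere_map_top[OF sY(1) cycle_in[OF z]] by metis
 next
  assume e: "post T Y k h (al k (Some [0..<Suc k])) = z"
  have "smap (sphere k) (mp X Y) (%m x. post T Y m h (al m x))"
   by (rule smap_comp[OF T(2) smap_post[OF X T(1) Y h]])
  moreover have "post T Y m h (al m None) = zcst X Y m" for m
   using T(3) post_cst[OF X T(1) Y ss(2) h] zmap_post[OF X T(1) Y h] by simp
  ultimately show "ALL m. ALL x:Sx (sphere k) m. post T Y m h (al m x) = sphere_map (mp X Y) (zmap X Y) k z m x"
   using sphere_map_unique[of k "mp X Y" "%m x. post T Y m h (al m x)" "zmap X Y"] unfolding e by blast
 qed
 show "EX! h. h : hom (sph k X) Y 0 & post (sph k X) Y k h (sph_cycle k X) = z"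
  unfolding xi T_def[symmetric]
 proof -
  obtain h where h: "h : hom T Y 0" "post T Y k h (al k (Some [0..<Suc k])) = z" using ex eq by metis
  show "EX! h. h : hom T Y 0 & post T Y k h (al k (Some [0..<Suc k])) = z"
  proof (rule ex1I[of _ h])
   show "h' = h" if "h' : hom T Y 0 & post T Y k h' (al k (Some [0..<Suc k])) = z" for h'
   proof (rule unique_eqI[OF ex])
    show "h' : hom T Y 0 & (ALL m. ALL x:Sx (sphere k) m. post T Y m h' (al m x) = sphere_map (mp X Y) (zmap X Y) k z m x)"
     using that eq[of h'] by simp
    show "h : hom T Y 0 & (ALL m. ALL x:Sx (sphere k) m. post T Y m h (al m x) = sphere_map (mp X Y) (zmap X Y) k z m x)"
     using h eq[of h] by simp
   qed
  qed (use h in blast)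
 qed
qed

lemma post_pmap: "X : sob M ==> Y : sob M ==> Z : sob M ==> g : hom Y Z 0 ==>
  pmap (mp X Y) (zmap X Y) (mp X Z) (zmap X Z) (%n. post Y Z n g)"
 unfolding pmap_def using sset zmap_in smap_post zmap_post by simp

lemma pre_pmap: "X : sob M ==> Y : sob M ==> Z : sob M ==> f : hom X Y 0 ==>
  pmap (mp Y Z) (zmap Y Z) (mp X Z) (zmap X Z) (%n. pre X Y n f)"
 unfolding pmap_def using sset zmap_in smap_pre zmap_pre by simp

lemma sph_cofibrant:
 assumes X: "cofibrant M X"
 shows "cofibrant M (sph k X)"
proof -
 note X0 = cofibrant_ob[OF X] and S = sph_rep[OF cofibrant_ob[OF X], where k = k]
 show ?thesis
 proof (rule cofibrant_by_lifting[OF S(1)])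
  fix E D p b assume p: "(E, D, p) : fib M" "(E, D, p) : weq M" and b: "b : hom (sph k X) D 0"
  have d: "E : sob M" "D : sob M" "p : hom E D 0" using fib_arr[OF p(1)] by auto
  have bc: "post (sph k X) D k b (sph_cycle k X) : cyc X D k"
   by (rule pmap_cycle[OF post_pmap[OF X0 S(1) d(2) b] S(2)])
  obtain z where z: "z : cyc X E k" "post E D k p z = post (sph k X) D k b (sph_cycle k X)"
   by (rule trivial_cycle_lift[OF fib_kan(2)[OF X p] pmapD[OF post_pmap[OF X0 d]] bc])
  obtain h where h: "h : hom (sph k X) E 0" "post (sph k X) E k h (sph_cycle k X) = z" using S(3)[OF d(1) z(1)] by blast
  have "p ** h = b"
   by (rule unique_eqI[OF S(3)[OF d(2) bc]])
    (use comp0_in[OF S(1) d(1,2) h(1) d(3)] post_post[OF X0 S(1) d(1,2) cycle_in[OF S(2)] h(1) d(3)] h(2) z(2) b in auto)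
  thus "EX h:hom (sph k X) E 0. p ** h = b" using h by blast
 qed
qed

lemma sph_susp:
 assumes X: "X : sob M"
 shows "is_susp X (sph 1 X) (sph_cycle 1 X)"
proof -
 note S = sph_rep[OF X, where k = 1]
 have c: "z : cyc X Y 1 \<longleftrightarrow> z : hom X Y (Suc 0) & src X Y z = zmap X Y & tgt X Y z = zmap X Y" for Y z
  by (auto simp: pi_cycles_def le_Suc_eq)
 show ?thesis unfolding is_susp_def using S c by simp
qed

text \<open>Both sides say that \<open>g\<close> lifts to the object of paths that start at zero: edges out of zero are maps
 to it, and its mapping spaces are contractible, so that all cycles in them are null.\<close>

lemma null_iff_edge:
 assumes X: "cofibrant M X" and Y: "fibrant M Y" and g: "g : hom (sph k X) Y 0"
 shows "nul X Y k (post (sph k X) Y k g (sph_cycle k X)) \<longleftrightarrow> edge_rel (sph k X) Y (zmap (sph k X) Y) g"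
proof -
 note X0 = cofibrant_ob[OF X] and Y0 = fibrant_ob[OF Y] and S = sph_rep[OF cofibrant_ob[OF X], where k = k]
 obtain P p where b: "is_based Y P p" by (rule based_ex[OF Y0])
 have P: "P : sob M" "p : hom P Y (Suc 0)" "src P Y p = zmap P Y"
  and u: "!!X e. X : sob M ==> e : hom X Y (Suc 0) ==> src X Y e = zmap X Y ==> EX! h. h : hom X P 0 & pre X P (Suc 0) h p = e"
  using b by (auto simp: is_based_def)
 define q where "q = tgt P Y p"
 have q: "q : hom P Y 0" unfolding q_def by (rule edge_faces(2)[OF P(1) Y0 P(2)])
 note bf = based_fib[OF b Y, folded q_def]
 let ?P = "mp X P" and ?Y = "mp X Y"
 note pm = post_pmap[OF X0 P(1) Y0 q]
 note sP = pmapD(1,2)[OF pm]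
 have qc: "post P Y n q (cst ?P n (zmap X P)) = cst ?Y n (zmap X Y)" for n
  using smap_cst[OF pmapD(3,1,2)[OF pm]] pmapD(4)[OF pm] by simp
 have gc: "post (sph k X) Y k g (sph_cycle k X) : pi_cycles ?Y (zmap X Y) k" by (rule pmap_cycle[OF post_pmap[OF X0 S(1) Y0 g] S(2)])
 show ?thesis
 proof
  assume "edge_rel (sph k X) Y (zmap (sph k X) Y) g"
  then obtain e where e: "e : hom (sph k X) Y (Suc 0)" "src (sph k X) Y e = zmap (sph k X) Y" "tgt (sph k X) Y e = g" by (auto simp: edge_rel_def)
  obtain h where h: "h : hom (sph k X) P 0" "pre (sph k X) P (Suc 0) h p = e" using u[OF S(1) e(1,2)] by blast
  have qh: "q ** h = g" using pre_edge(2)[OF S(1) P(1) Y0 h(1) P(2)] h(2) e(3) by (simp add: q_def)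
  define z where "z = post (sph k X) P k h (sph_cycle k X)"
  have z: "z : pi_cycles ?P (zmap X P) k" unfolding z_def by (rule pmap_cycle[OF post_pmap[OF X0 S(1) P(1) h(1)] S(2)])
  have qz: "post P Y k q z = post (sph k X) Y k g (sph_cycle k X)"
   unfolding z_def using post_post[OF X0 S(1) P(1) Y0 cycle_in[OF S(2)] h(1) q] qh by simp
  have t: "trivial_kan_fibration ?P point (%_ _. ())" using bf(3)[OF X] by (simp add: contractible_def)
  have "null ?P (zmap X P) k z"
  proof (rule trivial_null[OF t sP _ _ z, of "()"])
   show "smap ?P point (%_ _. ())" by (simp add: smap_def point_def)
   show "null point () k ()" by (simp add: pi_rel_def point_def)
  qed simp
  from smap_null[OF pmapD(3,1,2,4)[OF pm] this]
  show "null ?Y (zmap X Y) k (post (sph k X) Y k g (sph_cycle k X))" unfolding qz .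
 next
  assume "null ?Y (zmap X Y) k (post (sph k X) Y k g (sph_cycle k X))"
  then obtain w where w: "w : hom X Y (Suc k)" "Fc ?Y (Suc k) 0 w = post (sph k X) Y k g (sph_cycle k X)"
   "!!i. 1 <= i ==> i <= Suc k ==> Fc ?Y (Suc k) i w = cst ?Y k (zmap X Y)" unfolding null_alt by blast
  have "compat3 ?P (zmap X P) k (cst ?P k (zmap X P)) (cst ?P k (zmap X P)) (cst ?P k (zmap X P))"
   unfolding compat3_def using cst_in[OF sP] cst_face'[OF sP] by auto
  note c3 = this
  have wq: "1 <= i ==> i <= Suc k ==> Fc ?Y (Suc k) i w = post P Y k q (cst ?P k (zmap X P))" for i
   using w(3)[of i] qc by simp
  obtain v where v: "v : hom X P (Suc k)" "post P Y (Suc k) q v = w"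
   and vf: "!!i. 1 <= i ==> i <= Suc k ==> Fc ?P (Suc k) i v = cst ?P k (zmap X P)"
  proof (rule kan_lift3[OF fib_kan(1)[OF X bf(1)] sP c3 w(1)])
   fix v assume v: "v : hom X P (Suc k)" "post P Y (Suc k) q v = w"
    and v1: "Fc ?P (Suc k) 1 v = cst ?P k (zmap X P)" and v2: "1 <= k ==> Fc ?P (Suc k) 2 v = cst ?P k (zmap X P)"
    and v3: "2 <= k ==> Fc ?P (Suc k) 3 v = cst ?P k (zmap X P)"
    and v4: "!!i. 4 <= i ==> i <= Suc k ==> Fc ?P (Suc k) i v = cst ?P k (zmap X P)"
   have "Fc ?P (Suc k) i v = cst ?P k (zmap X P)" if i: "1 <= i" "i <= Suc k" for i
   proof -
    consider "i = 1" | "i = 2" | "i = 3" | "4 <= i" using i by linarith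
    thus ?thesis using v1 v2 v3 v4[of i] i by cases auto
   qed
   thus thesis using that v by blast
  qed (use wq[of 1] wq[of 2] wq[of 3] wq in simp_all)
  define z where "z = Fc ?P (Suc k) 0 v"
  have "Fc ?P k i z = cst ?P (k - 1) (zmap X P)" if i: "0 < k" "i <= k" for i
  proof -
   obtain m where m: "k = Suc m" using i by (cases k) auto
   have "Fc ?P k i z = Fc ?P k 0 (Fc ?P (Suc k) (Suc i) v)"
    unfolding z_def using sset_face_face[OF sP(1), of v m 0 "Suc i"] v(1) i m by simp
   thus ?thesis using vf[of "Suc i"] i cst_face'[OF sP, of k 0] by simp
  qed
  hence z: "z : pi_cycles ?P (zmap X P) k" using sset_face[OF sP(1) v(1), of 0] by (simp add: pi_cycles_def z_def)
  obtain h where h: "h : hom (sph k X) P 0" "post (sph k X) P k h (sph_cycle k X) = z" using S(3)[OF P(1) z] by blast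
  have "post P Y k q z = post (sph k X) Y k g (sph_cycle k X)"
   using smap_face[OF pmapD(3)[OF pm] v(1), of 0] v(2) w(2) by (simp add: z_def)
  hence "q ** h = g"
   by (intro unique_eqI[OF S(3)[OF Y0 gc]])
    (use comp0_in[OF S(1) P(1) Y0 h(1) q] post_post[OF X0 S(1) P(1) Y0 cycle_in[OF S(2)] h(1) q] h(2) g in auto)
  thus "edge_rel (sph k X) Y (zmap (sph k X) Y) g" unfolding edge_rel_def
   using pre_in[OF S(1) P(1) Y0 h(1) P(2)] pre_edge[OF S(1) P(1) Y0 h(1) P(2)] P(3) zmap_pre[OF S(1) P(1) Y0 h(1)]
   by (intro bexI[of _ "pre (sph k X) P (Suc 0) h p"]) (auto simp: q_def)
 qed
qed

text \<open>A homotopy of maps is a map to the path object, whose source map is a trivial fibration.  The given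
 homotopy and the constant one have the same source, so they agree on homotopy groups, and the target map
 carries this to the claim.\<close>

lemma edge_pi_rel:
 assumes X: "cofibrant M X" and Y: "fibrant M Y" and e: "edge_rel (sph k X) Y g g'"
 shows "pi_rel (mp X Y) (zmap X Y) k (post (sph k X) Y k g' (sph_cycle k X)) (post (sph k X) Y k g (sph_cycle k X))"
proof -
 note X0 = cofibrant_ob[OF X] and Y0 = fibrant_ob[OF Y] and S = sph_rep[OF cofibrant_ob[OF X], where k = k]
 obtain P p where b: "is_path Y P p" by (rule path_ex[OF Y0])
 have P: "P : sob M" "p : hom P Y (Suc 0)"
  and u: "!!X e. X : sob M ==> e : hom X Y (Suc 0) ==> EX! h. h : hom X P 0 & pre X P (Suc 0) h p = e"
  using b by (auto simp: is_path_def)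
 define s t where "s = src P Y p" and "t = tgt P Y p"
 have st: "s : hom P Y 0" "t : hom P Y 0" unfolding s_def t_def using edge_faces[OF P(1) Y0 P(2)] by auto
 have sf: "(P, Y, s) : fib M" "(P, Y, s) : weq M" using path_fib[OF b Y] by (auto simp: s_def)
 obtain e' where e': "e' : hom (sph k X) Y (Suc 0)" "src (sph k X) Y e' = g" "tgt (sph k X) Y e' = g'" using e by (auto simp: edge_rel_def)
 obtain h where h: "h : hom (sph k X) P 0" "pre (sph k X) P (Suc 0) h p = e'" using u[OF S(1) e'(1)] by blast
 have hs: "s ** h = g" "t ** h = g'" using pre_edge[OF S(1) P(1) Y0 h(1) P(2)] h(2) e'(2,3) by (auto simp: s_def t_def)
 obtain ce where ce: "ce : hom Y Y (Suc 0)" "src Y Y ce = sid M Y" "tgt Y Y ce = sid M Y"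
  using edge_refl[OF Y0 Y0 sid_in[OF Y0]] by (auto simp: edge_rel_def)
 obtain c where c: "c : hom Y P 0" "pre Y P (Suc 0) c p = ce" using u[OF Y0 ce(1)] by blast
 have cs: "s ** c = sid M Y" "t ** c = sid M Y" using pre_edge[OF Y0 P(1) Y0 c(1) P(2)] c(2) ce(2,3) by (auto simp: s_def t_def)
 let ?P = "mp X P" and ?Y = "mp X Y" and ?T = "sph k X" and ?x = "sph_cycle k X"
 note x0 = cycle_in[OF S(2)]
 have g0: "g : hom ?T Y 0" using edge_faces(1)[OF S(1) Y0 e'(1)] e'(2) by simp
 define x where "x = post ?T Y k g ?x"
 define z where "z = post ?T P k h ?x"
 have x: "x : pi_cycles ?Y (zmap X Y) k" unfolding x_def by (rule pmap_cycle[OF post_pmap[OF X0 S(1) Y0 g0] S(2)])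
 have z: "z : pi_cycles ?P (zmap X P) k" unfolding z_def by (rule pmap_cycle[OF post_pmap[OF X0 S(1) P(1) h(1)] S(2)])
 define y where "y = post Y P k c x"
 have y: "y : pi_cycles ?P (zmap X P) k" unfolding y_def by (rule pmap_cycle[OF post_pmap[OF X0 Y0 P(1) c(1)] x])
 have sy: "post P Y k s y = x" "post P Y k t y = x"
  unfolding y_def using post_post[OF X0 Y0 P(1) Y0 cycle_in[OF x] c(1) st(1)] post_post[OF X0 Y0 P(1) Y0 cycle_in[OF x] c(1) st(2)]
   cs post_id[OF X0 Y0 cycle_in[OF x]] by auto
 have sz: "post P Y k s z = x" "post P Y k t z = post ?T Y k g' ?x"
  unfolding z_def x_def using post_post[OF X0 S(1) P(1) Y0 x0 h(1) st(1)] post_post[OF X0 S(1) P(1) Y0 x0 h(1) st(2)] hs by auto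
 have sY: "is_sset ?Y" "zmap X Y : hom X Y 0" using sset zmap_in X0 Y0 by auto
 have r: "pi_rel ?Y (zmap X Y) k x x" unfolding pi_rel_def
 proof (intro bexI[of _ "Dg ?Y k 0 x"] conjI allI impI)
  show "Dg ?Y k 0 x : hom X Y (Suc k)" using sset_degen[OF sY(1) cycle_in[OF x]] by simp
  note f = sset_face_degen[OF sY(1) cycle_in[OF x] le0]
  show "Fc ?Y (Suc k) 0 (Dg ?Y k 0 x) = x" "Fc ?Y (Suc k) 1 (Dg ?Y k 0 x) = x" using f[of 0] f[of 1] by simp_all
  fix i assume i: "2 <= i & i <= Suc k"
  then obtain m where m: "k = Suc m" by (cases k) auto
  have h: "0 < k" "i - 1 <= k" using i m by auto
  show "Fc ?Y (Suc k) i (Dg ?Y k 0 x) = cst ?Y k (zmap X Y)"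
   using f[of i] cycle_face[OF x h] i m cst_degen[OF sY, of 0 m] by simp
 qed
 have "pi_rel ?P (zmap X P) k z y"
  by (rule trivial_pi_rel[OF fib_kan(2)[OF X sf] pmapD[OF post_pmap[OF X0 P(1) Y0 st(1)]] z y]) (use r sy sz in simp)
 from smap_pi_rel[OF pmapD(3,1,2,4)[OF post_pmap[OF X0 P(1) Y0 st(2)]] this]
 show ?thesis using sy(2) sz(2) by (simp add: x_def)
qed

end

context pointed_smc begin

text \<open>The generating operations are formed on cofibrant replacements, so a property of cofibrant objects
 suffices.  A weak equivalence lifts to the replacements, and \<open>weq_invariant\<close> then only leaves
 trivial cofibrations to be considered.\<close>

lemma MA_induct:
 assumes A: "\<A> \<subseteq> sob M" and base: "!!A. A : \<A> ==> P (Qob M A)"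
  and susp: "!!X. cofibrant M X ==> P X ==> P (sph 1 X)"
  and coprod: "!!(I :: 's set) X Y inc. (!!i. i : I ==> cofibrant M (X i)) ==> (!!i. i : I ==> P (X i)) ==>
   is_coprod (uc M) I X Y inc ==> P Y"
  and inv: "!!X Z j. cofibrant M X ==> cofibrant M Z ==> (X, Z, j) : cof M ==> (X, Z, j) : weq M ==> P X = P Z"
  and X: "X : MA u M \<A>"
 shows "X : sob M & P (Qob M X)"
proof -
 have weq: "P (Qob M X) = P (Qob M Y)" if f: "(X, Y, f) : weq M" for X Y f
 proof -
  have o: "X : sob M" "Y : sob M" "f : hom X Y 0" using weq_arr[OF f] by auto
  note X = QR_maps[OF o(1)] and Y = QR_maps[OF o(2)] and QX = Qob[OF o(1)] and QY = Qob[OF o(2)]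
  have fq: "f ** snd (crep M X) : hom (Qob M X) Y 0" by (rule comp0_in[OF X(1) o(1,2) X(3) o(3)])
  have qY: "(Qob M Y, Y, snd (crep M Y)) : fib M" "(Qob M Y, Y, snd (crep M Y)) : weq M" using QY(2) by auto
  obtain c where c: "c : hom (Qob M X) (Qob M Y) 0" "snd (crep M Y) ** c = f ** snd (crep M X)"
   by (rule lift_vertex[OF QX(1) qY fq])
  have ar: "(Qob M X, X, snd (crep M X)) : arrs (uc M)" "(X, Y, f) : arrs (uc M)"
   "(Qob M X, Qob M Y, c) : arrs (uc M)" "(Qob M Y, Y, snd (crep M Y)) : arrs (uc M)"
   using X Y o c(1) by (auto simp: arrs_def)
  have "(Qob M X, Y, f ** snd (crep M X)) : weq M"
   using ms_two_of_three[OF ms, rule_format, of "Qob M X" X "snd (crep M X)" Y f] ar(1,2) QX(2) f by simp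
  hence w: "(Qob M X, Qob M Y, c) : weq M"
   using ms_two_of_three[OF ms, rule_format, of "Qob M X" "Qob M Y" c Y "snd (crep M Y)"] ar(3,4) QY(2) c(2) by simp
  show ?thesis by (rule weq_invariant[where Q = P, OF _ QX(1) QY(1) w]) (rule inv)
 qed
 show ?thesis using X
 proof (induction rule: MA.induct)
  case (1 A)
  thus ?case using A base by blast
 next
  case (2 X)
  hence X: "cofibrant M (Qob M X)" "P (Qob M X)" using Qob by auto
  have e: "susp M 1 X = sph 1 (Qob M X)" by (simp add: susp_def sph_def)
  have c: "cofibrant M (sph 1 (Qob M X))" by (rule sph_cofibrant[OF X(1)])
  show ?case unfolding e using cofibrant_ob[OF c] susp[OF X] Qob_cofibrant[OF c] by simp
 next
  case (3 I X Y inc)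
  have c3: "is_coprod (uc M) I (%i. Qob M (X i)) Y inc" using 3 by blast
  have X: "!!i. i : I ==> cofibrant M (Qob M (X i))" "!!i. i : I ==> P (Qob M (X i))" using 3 Qob by auto
  have c: "cofibrant M Y" by (rule coprod_cofibrant[OF c3 X(1)])
  show ?case using cofibrant_ob[OF c] coprod[OF X c3] Qob_cofibrant[OF c] by simp
 next
  case (4 X Y f)
  thus ?case using weq[OF 4(2)] weq_arr[OF 4(2)] by simp
 next
  case (5 Y X f)
  thus ?case using weq[OF 5(2)] weq_arr[OF 5(2)] by simp
 qed
qed

definition hom_exact :: "nat => 'o => 'o => 'o => 'a => 'a => 'o => bool" where
 "hom_exact \<kappa> Y2 Y1 Y0 p q X \<longleftrightarrow> sexact \<kappa> (mp X Y2) (zmap X Y2) (mp X Y1) (zmap X Y1) (mp X Y0) (zmap X Y0)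
     (%n. post Y2 Y1 n p) (%n. post Y1 Y0 n q)"

text \<open>The three maps to \<open>Y2\<close>, \<open>Y1\<close>, \<open>Y0\<close> are natural in the cone sequence of \<open>X\<close>, which takes care of
 suspensions.  For a coproduct, simplices of mapping spaces are families of simplices, so the cycle and the
 homotopy are assembled from those of the summands.\<close>

lemma hom_exact_MA:
 assumes Y: "fibrant M Y2" "fibrant M Y1" "fibrant M Y0" and p: "p : hom Y2 Y1 0" and q: "q : hom Y1 Y0 0"
  and A: "\<A> \<subseteq> sob M" and base: "!!A. A : \<A> ==> hom_exact \<kappa> Y2 Y1 Y0 p q (Qob M A)"
  and B: "B : MA u M \<A>" "cofibrant M B"
 shows "hom_exact \<kappa> Y2 Y1 Y0 p q B"
proof -
 note Y0 = fibrant_ob[OF Y(1)] fibrant_ob[OF Y(2)] fibrant_ob[OF Y(3)]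
 have "B : sob M & hom_exact \<kappa> Y2 Y1 Y0 p q (Qob M B)"
 proof (rule MA_induct[where P = "hom_exact \<kappa> Y2 Y1 Y0 p q", OF A _ _ _ _ B(1)], rule base, assumption)
  fix X assume X: "cofibrant M X" and e: "hom_exact \<kappa> Y2 Y1 Y0 p q X"
  note X0 = cofibrant_ob[OF X] and S = sph_rep(1)[OF cofibrant_ob[OF X], where k = 1] and Sc = sph_cofibrant[OF X, of 1]
  obtain C c where C: "is_cone_ob X C c" by (rule cone_ex[OF X0])
  have C0: "C : sob M" using C by (simp add: is_cone_ob_def)
  obtain r where r: "r : hom C (sph 1 X) 0" and ls: "!!Y. fibrant M Y ==>
    loop_seq (mp (sph 1 X) Y) (zmap (sph 1 X) Y) (mp C Y) (zmap C Y) (mp X Y) (zmap X Y)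
     (%n. pre C (sph 1 X) n r) (%n. pre X C n (tgt X C c))"
   using loop_seq_susp[OF X C sph_susp[OF X0]] by blast
  have t: "tgt X C c : hom X C 0" using edge_faces(2)[OF X0 C0] C by (simp add: is_cone_ob_def)
  show "hom_exact \<kappa> Y2 Y1 Y0 p q (sph 1 X)" unfolding hom_exact_def
   by (rule sexact_loop[OF ls[OF Y(1)] ls[OF Y(2)] ls[OF Y(3)] kan_hom[OF Sc Y(2)]
     post_pmap[OF S Y0(1,2) p] post_pmap[OF C0 Y0(1,2) p] post_pre[OF C0 S Y0(1,2) _ r p] post_pre[OF X0 C0 Y0(1,2) _ t p, symmetric]
     post_pmap[OF S Y0(2,3) q] post_pmap[OF C0 Y0(2,3) q] post_pre[OF C0 S Y0(2,3) _ r q] post_pre[OF X0 C0 Y0(2,3) _ t q, symmetric]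
     e[unfolded hom_exact_def]])
 next
  fix I :: "'s set" and X P inc
  assume Xc: "!!i. i : I ==> cofibrant M (X i)" and e: "!!i. i : I ==> hom_exact \<kappa> Y2 Y1 Y0 p q (X i)"
   and c: "is_coprod (uc M) I X P inc"
  note X = cofibrant_ob[OF Xc]
  have P: "P : sob M" "!!i. i : I ==> inc i : hom (X i) P 0" using c by (auto simp: is_coprod_def)
  note pp = pre_pmap[OF X P(1) _ P(2)]
  show "hom_exact \<kappa> Y2 Y1 Y0 p q P" unfolding hom_exact_def sexact_def
  proof (intro allI impI ballI)
   fix k x assume k: "\<kappa> <= k" and x: "x : cyc P Y1 k"
    and n: "nul P Y0 k (post Y1 Y0 k q x)"
   define Q where "Q = (%i v w. v : cyc (X i) Y2 k & w : hom (X i) Y1 (Suc k) &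
     fc (X i) Y1 (Suc k) 0 w = post Y2 Y1 k p v &
     fc (X i) Y1 (Suc k) 1 w = pre (X i) P k (inc i) x &
     (ALL l. 2 <= l & l <= Suc k --> fc (X i) Y1 (Suc k) l w = zcst (X i) Y1 k))"
   have "EX v w. Q i v w" if i: "i : I" for i
   proof -
    have xi: "pre (X i) P k (inc i) x : cyc (X i) Y1 k" by (rule pmap_cycle[OF pp[OF i Y0(2) i] x])
    have "nul (X i) Y0 k (post Y1 Y0 k q (pre (X i) P k (inc i) x))"
     using smap_null[OF pmapD(3,1,2,4)[OF pp[OF i Y0(3) i]] n]
     unfolding post_pre[OF X[OF i] P(1) Y0(2,3) cycle_in[OF x] P(2)[OF i] q] .
    thus ?thesis using e[OF i] k xi unfolding hom_exact_def sexact_def pi_rel_def Q_def by blast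
   qed
   then obtain v w where vw: "!!i. i : I ==> Q i (v i) (w i)" by metis
   have v: "!!i. i : I ==> v i : cyc (X i) Y2 k"
    and w: "!!i. i : I ==> w i : hom (X i) Y1 (Suc k)"
    and w1: "!!i. i : I ==> fc (X i) Y1 (Suc k) 1 (w i) = pre (X i) P k (inc i) x"
    and w2: "!!i. i : I ==> fc (X i) Y1 (Suc k) 0 (w i) = post Y2 Y1 k p (v i)"
    and w3: "!!i l. i : I ==> 2 <= l ==> l <= Suc k ==> fc (X i) Y1 (Suc k) l (w i) = zcst (X i) Y1 k"
    using vw unfolding Q_def by simp_all
   have "EX! z. z : hom P Y2 k & (ALL i:I. pre (X i) P k (inc i) z = v i)"
    by (rule coproduct_simplex[OF c X Y0(1)]) (use cycle_in[OF v] in auto)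
   then obtain z where z: "z : hom P Y2 k" "!!i. i : I ==> pre (X i) P k (inc i) z = v i" by auto
   have "EX! z. z : hom P Y1 (Suc k) & (ALL i:I. pre (X i) P (Suc k) (inc i) z = w i)"
    by (rule coproduct_simplex[OF c X Y0(2)]) (use w in auto)
   then obtain y where y: "y : hom P Y1 (Suc k)" "!!i. i : I ==> pre (X i) P (Suc k) (inc i) y = w i" by auto
   have sm: "smap (mp P Y) (mp (X i) Y) (%n. pre (X i) P n (inc i))" if "i : I" "Y : sob M" for i Y
    by (rule smap_pre[OF X P(1) that(2) P(2)]) (use that in auto)
   have cp: "pre (X i) P n (inc i) (zcst P Y n) = zcst (X i) Y n"
    if "i : I" "Y : sob M" for i n Y
    using pre_cst[OF X[OF that(1)] P(1) that(2) P(2)[OF that(1)] zmap_in[OF P(1) that(2)]] zmap_pre[OF X[OF that(1)] P(1) that(2) P(2)[OF that(1)]] by simp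
   have cin: "zcst P Y n : hom P Y n" if "Y : sob M" for n Y
    by (rule cst_hom[OF P(1) that zmap_in[OF P(1) that]])
   note ceq1 = coprod_eq[OF c X Y0(1)] and ceq = coprod_eq[OF c X Y0(2)]
   have zf: "fc P Y2 k l z = zcst P Y2 (k - 1)" if l: "0 < k" "l <= k" for l
   proof (rule ceq1)
    obtain m where m: "k = Suc m" using l by (cases k) auto
    show "fc P Y2 k l z : hom P Y2 (k - 1)" using sset_face[OF sset[OF P(1) Y0(1)], of z m l] z(1) l m by simp
    show "zcst P Y2 (k - 1) : hom P Y2 (k - 1)" by (rule cin[OF Y0(1)])
    fix i assume i: "i : I"
    have "pre (X i) P (k - 1) (inc i) (fc P Y2 k l z) = fc (X i) Y2 k l (v i)"
     using smap_face[OF sm[OF i Y0(1)], of z m l] z l m i by simp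
    thus "pre (X i) P (k - 1) (inc i) (fc P Y2 k l z) =
      pre (X i) P (k - 1) (inc i) (zcst P Y2 (k - 1))"
     using cycle_face[OF v[OF i], of l] l cp[OF i Y0(1)] by simp
   qed
   hence zc: "z : cyc P Y2 k" using z(1) by (simp add: pi_cycles_def)
   have yf: "fc P Y1 (Suc k) l y = t" if l: "l <= Suc k" and t: "t : hom P Y1 k"
    "!!i. i : I ==> fc (X i) Y1 (Suc k) l (w i) = pre (X i) P k (inc i) t" for l t
   proof (rule ceq[OF _ _ t(1)])
    show "fc P Y1 (Suc k) l y : hom P Y1 k" by (rule sset_face[OF sset[OF P(1) Y0(2)] y(1) l])
    fix i assume i: "i : I"
    show "pre (X i) P k (inc i) (fc P Y1 (Suc k) l y) = pre (X i) P k (inc i) t"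
     using smap_face[OF sm[OF i Y0(2)] y(1) l] y(2)[OF i] t(2)[OF i] by simp
   qed assumption
   have "pi_rel (mp P Y1) (zmap P Y1) k (post Y2 Y1 k p z) x" unfolding pi_rel_def
   proof (intro bexI[OF _ y(1)] conjI allI impI)
    show "fc P Y1 (Suc k) 1 y = x" by (rule yf[OF _ cycle_in[OF x]]) (use w1 in auto)
    show "fc P Y1 (Suc k) 0 y = post Y2 Y1 k p z"
    proof (rule yf[OF _ post_in[OF P(1) Y0(1,2) p z(1)]])
     fix i assume i: "i : I"
     show "fc (X i) Y1 (Suc k) 0 (w i) = pre (X i) P k (inc i) (post Y2 Y1 k p z)"
      using w2[OF i] post_pre[OF X[OF i] P(1) Y0(1,2) z(1) P(2)[OF i] p] z(2)[OF i] by simp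
    qed simp
    fix l assume l: "2 <= l & l <= Suc k"
    show "fc P Y1 (Suc k) l y = zcst P Y1 k"
     by (rule yf[OF _ cin[OF Y0(2)]]) (use w3 l cp[OF _ Y0(2)] in auto)
   qed
   thus "EX v:cyc P Y2 k. pi_rel (mp P Y1) (zmap P Y1) k (post Y2 Y1 k p v) x" using zc by blast
  qed
 next
  fix X Z j assume X: "cofibrant M X" and Z: "cofibrant M Z" and j: "(X, Z, j) : cof M" "(X, Z, j) : weq M"
  have o: "X : sob M" "Z : sob M" "j : hom X Z 0" using cof_arr[OF j(1)] by auto
  note t = cof_kan(2)[OF j(1) _ j(2)]
  have "hom_exact \<kappa> Y2 Y1 Y0 p q Z = hom_exact \<kappa> Y2 Y1 Y0 p q X" unfolding hom_exact_def
   by (rule sexact_trivial[OF t[OF Y(1)] pre_pmap[OF o(1,2) Y0(1) o(3)] t[OF Y(2)] pre_pmap[OF o(1,2) Y0(2) o(3)]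
     t[OF Y(3)] pre_pmap[OF o(1,2) Y0(3) o(3)] post_pmap[OF o(2) Y0(1,2) p] post_pmap[OF o(2) Y0(2,3) q]
     post_pre[OF o(1,2) Y0(1,2) _ o(3) p, symmetric] post_pre[OF o(1,2) Y0(2,3) _ o(3) q, symmetric]])
  thus "hom_exact \<kappa> Y2 Y1 Y0 p q X = hom_exact \<kappa> Y2 Y1 Y0 p q Z" by simp
 qed
 thus ?thesis using Qob_cofibrant[OF B(2)] by simp
qed

text \<open>Triviality of the fibration \<open>g\<close> on homotopy groups means that \<open>F \<rightarrow> R \<rightarrow> 0\<close> is exact in all degrees, for \<open>F\<close>
 the fibre of \<open>g\<close>.  Exactness passes from \<open>\<A>\<close> to all objects built from it, and in degree zero it says
 that every map to \<open>R\<close> factors through \<open>F\<close> up to homotopy.\<close>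

lemma trivial_on_homotopy:
 assumes g: "(R, Y, g) : fib M" and f: "fibrant M R" "fibrant M Y" and A: "\<A> \<subseteq> sob M"
  and null: "!!A k z. A : \<A> ==> z : cyc (Qob M A) R k ==>
   nul (Qob M A) Y k (post R Y k g z)"
  and B: "B : MA u M \<A>" "cofibrant M B" and r: "r : hom B R 0"
 shows "edge_rel B Y (zmap B Y) (g ** r)"
proof -
 note R0 = fibrant_ob[OF f(1)] and Y0 = fibrant_ob[OF f(2)] and B0 = cofibrant_ob[OF B(2)]
 have g0: "g : hom R Y 0" using fib_arr[OF g] by simp
 obtain F j where kr: "is_kernel (uc M) R Y g F j" and F: "F : sob M" "j : hom F R 0" "g ** j = zmap F Y"
  and Fu: "!!T t. T : sob M ==> t : hom T R 0 ==> g ** t = zmap T Y ==> EX! h. h : hom T F 0 & j ** h = t"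
  by (rule kernel_ex[OF R0 Y0 g0]) (rule that)
 have Ff: "fibrant M F"
 proof (rule fibrant_by_lifting[OF F(1)])
  fix C D i a assume i: "(C, D, i) : cof M" "(C, D, i) : weq M" and a: "a : hom C F 0"
  have o: "C : sob M" "D : sob M" "i : hom C D 0" using cof_arr[OF i(1)] by auto
  have ja: "j ** a : hom C R 0" by (rule comp0_in[OF o(1) F(1) R0 a F(2)])
  have gj: "g ** (j ** a) = zmap C Y" using comp0_assoc[OF o(1) F(1) R0 Y0 a F(2) g0] F(3) zmap_pre[OF o(1) F(1) Y0 a] by simp
  obtain h where h: "h : hom D R 0" "h ** i = j ** a" "g ** h = zmap D Y"
   by (rule lift_cof[OF i(1) g _ ja zmap_in[OF o(2) Y0]]) (use i gj zmap_pre[OF o(1,2) Y0 o(3)] in auto)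
  obtain b where b: "b : hom D F 0" "j ** b = h" using Fu[OF o(2) h(1,3)] by blast
  have "b ** i = a"
   by (rule unique_eqI[OF Fu[OF o(1) ja gj]]) (use comp0_in[OF o(1,2) F(1) o(3) b(1)] comp0_assoc[OF o(1,2) F(1) R0 o(3) b(1) F(2)] b(2) h(2) a in auto)
  thus "EX h:hom D F 0. h ** i = a" using b(1) by blast
 qed
 obtain Z where Z: "is_zero (uc M) Z" "Z : sob M" by (rule zero_ex)
 have Zf: "fibrant M Z" unfolding fibrant_def using Z id_classes(1)[OF Z(2)] by blast
 have z0: "zmap R Z : hom R Z 0" by (rule zmap_in[OF R0 Z(2)])
 have "hom_exact 0 F R Z j (zmap R Z) B"
 proof (rule hom_exact_MA[OF Ff f(1) Zf F(2) z0 A _ B])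
  fix A assume A': "A : \<A>"
  define X where "X = Qob M A"
  have X: "cofibrant M X" using Qob(1) A A' by (auto simp: X_def)
  note X0 = cofibrant_ob[OF X]
  let ?R = "mp X R" and ?Y = "mp X Y"
  note pR = post_pmap[OF X0 R0 Y0 g0]
  have cR: "post R Y n g (cst ?R n (zmap X R)) = cst ?Y n (zmap X Y)" for n
   using smap_cst[OF pmapD(3,1,2)[OF pR]] pmapD(4)[OF pR] by simp
  have sY: "is_sset ?Y" "zmap X Y : hom X Y 0" using sset[OF X0 Y0] zmap_in[OF X0 Y0] by auto
  show "hom_exact 0 F R Z j (zmap R Z) (Qob M A)" unfolding X_def[symmetric] hom_exact_def sexact_def
  proof (intro allI impI ballI)
   fix k x assume x: "x : pi_cycles ?R (zmap X R) k"
   \<comment> \<open>A nullhomotopy of \<open>g x\<close> starting at the base point lifts to a homotopy from a cycle of the fibre to \<open>x\<close>.\<close>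
   have "pi_rel ?Y (zmap X Y) k (cst ?Y k (zmap X Y)) (post R Y k g x)"
    by (rule pi_rel_sym[OF kan_hom[OF X f(2)] sY pmap_cycle[OF pR x] cst_cycle[OF sY]])
     (use null[OF A'] x in \<open>simp add: X_def\<close>)
   then obtain w where w: "w : hom X Y (Suc k)" "Fc ?Y (Suc k) 0 w = cst ?Y k (zmap X Y)" "Fc ?Y (Suc k) 1 w = post R Y k g x"
    and w2: "!!i. 2 <= i ==> i <= Suc k ==> Fc ?Y (Suc k) i w = post R Y k g (cst ?R k (zmap X R))"
    unfolding pi_rel_def cR by blast
   have c3: "compat3 ?R (zmap X R) k x (cst ?R k (zmap X R)) (cst ?R k (zmap X R))"
    unfolding compat3_def using cst_in[OF pmapD(1,2)[OF pR]] cst_face'[OF pmapD(1,2)[OF pR]] cycle_in[OF x] cycle_face[OF x] by auto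
   obtain z where z: "z : hom X R (Suc k)" "post R Y (Suc k) g z = w" "Fc ?R (Suc k) 1 z = x"
    and zi: "!!i. 2 <= i ==> i <= Suc k ==> Fc ?R (Suc k) i z = cst ?R k (zmap X R)"
   proof (rule kan_lift3[OF fib_kan(1)[OF X g] pmapD(1,2)[OF pR] c3 w(1,3)])
    fix z assume z: "z : hom X R (Suc k)" "post R Y (Suc k) g z = w" "Fc ?R (Suc k) 1 z = x"
     and z2: "1 <= k ==> Fc ?R (Suc k) 2 z = cst ?R k (zmap X R)" "2 <= k ==> Fc ?R (Suc k) 3 z = cst ?R k (zmap X R)"
     and z4: "!!i. 4 <= i ==> i <= Suc k ==> Fc ?R (Suc k) i z = cst ?R k (zmap X R)"
    have "Fc ?R (Suc k) i z = cst ?R k (zmap X R)" if i: "2 <= i" "i <= Suc k" for i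
    proof -
     consider "i = 2" | "i = 3" | "4 <= i" using i by linarith
     thus ?thesis using z2 z4[of i] i by cases auto
    qed
    thus thesis using that z by blast
   qed (use w2[of 2] w2[of 3] w2 in simp_all)
   define v where "v = Fc ?R (Suc k) 0 z"
   have v: "v : hom X R k" unfolding v_def using sset_face[OF pmapD(1)[OF pR] z(1), of 0] by simp
   have gv: "post R Y k g v = zsimp M X Y k"
    using smap_face[OF pmapD(3)[OF pR] z(1), of 0] z(2) w(2) by (simp add: v_def zsimp_def)
   have vf: "Fc ?R k i v = cst ?R (k - 1) (zmap X R)" if i: "0 < k" "i <= k" for i
   proof -
    obtain m where m: "k = Suc m" using i by (cases k) auto
    have "Fc ?R k i v = Fc ?R k 0 (Fc ?R (Suc k) (Suc i) z)"
     unfolding v_def using sset_face_face[OF pmapD(1)[OF pR], of z m 0 "Suc i"] z(1) i m by simp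
    thus ?thesis using zi[of "Suc i"] z(3) i cst_face'[OF pmapD(1,2)[OF pR], of k 0] cycle_face[OF x, of 0] by (cases "i = 0") auto
   qed
   obtain y where y: "y : hom X F k" "post F R k j y = v" using kernel_simplex[OF kr R0 Y0 g0 X0 v gv] by blast
   note pF = post_pmap[OF X0 F(1) R0 F(2)]
   have "fc X F k i y = zcst X F (k - 1)" if i: "0 < k" "i <= k" for i
   proof -
    obtain m where m: "k = Suc m" using i by (cases k) auto
    have c: "post F R m j (zcst X F m) = zsimp M X R m"
     using smap_cst[OF pmapD(3,1,2)[OF pF]] pmapD(4)[OF pF] by (simp add: zsimp_def)
    have "post F R m j (fc X F k i y) = zsimp M X R m"
     using smap_face[OF pmapD(3)[OF pF], of y m i] y vf[OF i] i m by (simp add: zsimp_def)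
    thus ?thesis
     using unique_eqI[OF kernel_simplex[OF kr R0 Y0 g0 X0 zsimp_in[OF X0 R0] post_zsimp[OF X0 R0 Y0 g0], of m]]
      c cst_in[OF pmapD(1,2)[OF pF]] sset_face[OF pmapD(1)[OF pF], of y m i] y(1) i m by simp
   qed
   hence "y : cyc X F k" using y(1) by (simp add: pi_cycles_def)
   moreover have "pi_rel ?R (zmap X R) k v x" unfolding pi_rel_def using z zi by (auto simp: v_def)
   ultimately show "EX v:cyc X F k. pi_rel ?R (zmap X R) k (post F R k j v) x" using y(2) by blast
  qed
 qed
 moreover have "r : cyc B R 0" using r by (simp add: pi_cycles_def)
 moreover have "nul B Z 0 (post R Z 0 (zmap R Z) r)"
  using cst_null[OF sset[OF B0 Z(2)] zmap_in[OF B0 Z(2)], of 0] zmap_pre[OF B0 R0 Z(2) r] by simp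
 ultimately obtain v where v: "v : hom B F 0" "pi_rel (mp B R) (zmap B R) 0 (post F R 0 j v) r"
  unfolding hom_exact_def sexact_def pi_cycles_def by blast
 then obtain w where w: "w : hom B R (Suc 0)" "tgt B R w = j ** v" "src B R w = r" unfolding pi_rel_def by auto
 have "g ** (j ** v) = zmap B Y" using comp0_assoc[OF B0 F(1) R0 Y0 v(1) F(2) g0] F(3) zmap_pre[OF B0 F(1) Y0 v(1)] by simp
 hence "edge_rel B Y (g ** r) (zmap B Y)" unfolding edge_rel_def
  using post_in[OF B0 R0 Y0 g0 w(1)] post_edge[OF B0 R0 Y0 g0 w(1)] w(2,3) by (intro bexI[of _ "post R Y (Suc 0) g w"]) auto
 thus ?thesis by (rule edge_sym_trans(1)[OF B(2) f(2)])
qed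

end

section \<open>Chains objects\<close>

lemma simp_obj_lev: "simp_obj C k X ==> enat m <= k ==> lev X m : ob C"
 and simp_obj_fce: "simp_obj C k X ==> enat (Suc m) <= k ==> i <= Suc m ==> fce X (Suc m) i : ar C (lev X (Suc m)) (lev X m)"
 and simp_obj_dgn: "simp_obj C k X ==> enat (Suc m) <= k ==> i <= m ==> dgn X m i : ar C (lev X m) (lev X (Suc m))"
 and simp_obj_face_face: "simp_obj C k X ==> enat (Suc (Suc m)) <= k ==> i < j ==> j <= Suc (Suc m) ==>
  cmp C (fce X (Suc m) i) (fce X (Suc (Suc m)) j) = cmp C (fce X (Suc m) (j - 1)) (fce X (Suc (Suc m)) i)"
 by (auto simp: simp_obj_def)

lemma enat_le_Suc: "enat (Suc m) <= k ==> enat m <= k"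
 by (metis Suc_ile_eq less_imp_le)

context pointed_smc begin

lemma kers_ex:
 assumes S: "finite S" and X: "lev X m : sob M" "lev X (m - 1) : sob M"
  and f: "!!i. i : S ==> fce X m i : hom (lev X m) (lev X (m - 1)) 0"
 shows "EX E j. is_kers (uc M) X m S E j"
 using S f
proof (induction S rule: finite_induct)
 case empty
 have "is_kers (uc M) X m {} (lev X m) (sid M (lev X m))"
  unfolding is_kers_def using X sid_in comp0_id by auto
 thus ?case by blast
next
 case (insert i S)
 then obtain E j where E: "is_kers (uc M) X m S E j" by auto
 have E0: "E : sob M" "j : hom E (lev X m) 0" "!!l. l : S ==> fce X m l ** j = zmap E (lev X (m - 1))"
  and Eu: "!!T t. T : sob M ==> t : hom T (lev X m) 0 ==> (!!l. l : S ==> fce X m l ** t = zmap T (lev X (m - 1))) ==>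
   EX! h. h : hom T E 0 & j ** h = t"
  using E by (auto simp: is_kers_def)
 have fi: "fce X m l : hom (lev X m) (lev X (m - 1)) 0" if "l : insert i S" for l using insert.prems that by blast
 have fij: "fce X m i ** j : hom E (lev X (m - 1)) 0" by (rule comp0_in[OF E0(1) X E0(2) fi]) simp
 show ?case
 proof (rule kernel_ex[OF E0(1) X(2) fij])
  fix F r assume F: "F : sob M" "r : hom F E 0" "(fce X m i ** j) ** r = zmap F (lev X (m - 1))"
   and Fu: "!!T t. T : sob M ==> t : hom T E 0 ==> (fce X m i ** j) ** t = zmap T (lev X (m - 1)) ==> EX! h. h : hom T F 0 & r ** h = t"
  have "is_kers (uc M) X m (insert i S) F (j ** r)"
   unfolding is_kers_def uc_simps
  proof (intro conjI ballI impI)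
   show "F : sob M" by (rule F)
   show "j ** r : hom F (lev X m) 0" by (rule comp0_in[OF F(1) E0(1) X(1) F(2) E0(2)])
   fix l assume l: "l : insert i S"
   have a: "(fce X m l ** j) ** r = fce X m l ** (j ** r)" by (rule comp0_assoc[OF F(1) E0(1) X F(2) E0(2) fi[OF l]])
   show "fce X m l ** (j ** r) = zmap F (lev X (m - 1))"
    using a l F(3) E0(3)[of l] zmap_pre[OF F(1) E0(1) X(2) F(2)] by auto
  next
   fix T t assume T: "T : sob M" and t: "t : hom T (lev X m) 0"
    and tz: "ALL l:insert i S. fce X m l ** t = zmap T (lev X (m - 1))"
   have u: "EX! h. h : hom T E 0 & j ** h = t" by (rule Eu[OF T t]) (use tz in simp)
   obtain h where h: "h : hom T E 0" "j ** h = t" using u by blast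
   have "(fce X m i ** j) ** h = zmap T (lev X (m - 1))"
    using comp0_assoc[OF T E0(1) X h(1) E0(2) fi] h(2) tz by simp
   hence v: "EX! g. g : hom T F 0 & r ** g = h" by (rule Fu[OF T h(1)])
   then obtain g where g: "g : hom T F 0" "r ** g = h" by blast
   show "EX! g. g : hom T F 0 & (j ** r) ** g = t"
   proof (rule ex1I[of _ g])
    show "g : hom T F 0 & (j ** r) ** g = t" using g h comp0_assoc[OF T F(1) E0(1) X(1) g(1) F(2) E0(2)] by simp
    fix g' assume g': "g' : hom T F 0 & (j ** r) ** g' = t"
    have "r ** g' = h"
     by (rule unique_eqI[OF u]) (use g' h comp0_in[OF T F(1) E0(1) _ F(2)] comp0_assoc[OF T F(1) E0(1) X(1) _ F(2) E0(2)] in auto)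
    thus "g' = g" by (intro unique_eqI[OF v]) (use g' g in auto)
   qed
  qed
  thus ?thesis by blast
 qed
qed

text \<open>Prescribed faces that satisfy the simplicial identities are a map to the matching object, so this is
 lifting against the fibration to it.\<close>

lemma matching_extend:
 assumes X: "reedy_fibrant M k X" and m: "enat m <= k" and i: "(A, D, i) : cof M" "(A, D, i) : weq M"
  and t: "t : hom A (lev X m) 0" and c: "match_cone (uc M) X m D b"
  and e: "!!l. 0 < m ==> l <= m ==> fce X m l ** t = b l ** i"
 obtains h where "h : hom D (lev X m) 0" "h ** i = t" "!!l. 0 < m ==> l <= m ==> fce X m l ** h = b l"
proof -
 obtain E p v where E: "is_matching (uc M) X m E p" "(lev X m, E, v) : fib M" "!!l. 0 < m ==> l <= m ==> p l ** v = fce X m l"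
  using X m unfolding reedy_fibrant_def uc_simps by blast
 have s: "simp_obj (uc M) k X" using X by (simp add: reedy_fibrant_def)
 have o: "A : sob M" "D : sob M" "i : hom A D 0" "lev X m : sob M" "E : sob M" "v : hom (lev X m) E 0"
  using cof_arr[OF i(1)] fib_arr[OF E(2)] by auto
 have p: "p l : hom E (lev X (m - 1)) 0" if "0 < m" "l <= m" for l using E(1) that by (auto simp: is_matching_def match_cone_def)
 have bl: "b l : hom D (lev X (m - 1)) 0" if "0 < m" "l <= m" for l using c that by (auto simp: match_cone_def)
 have Y: "lev X (m - 1) : sob M" if "0 < m"
  using simp_obj_lev[OF s, of "m - 1"] enat_le_Suc[of "m - 1" k] m that by simp
 have u: "!!T t. match_cone (uc M) X m T t ==> EX! h. h : hom T E 0 & (0 < m --> (ALL l<=m. p l ** h = t l))"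
  using E(1) by (simp add: is_matching_def)
 obtain b' where b': "b' : hom D E 0" "!!l. 0 < m ==> l <= m ==> p l ** b' = b l" using u[OF c] by blast
 have fX: "fce X (m - 1) l : hom (lev X (m - 1)) (lev X (m - 2)) 0" "lev X (m - 2) : sob M" if "1 < m" "l <= m - 1" for l
 proof -
  define m' where "m' = m - 2"
  have m': "m = Suc (Suc m')" using that(1) by (simp add: m'_def)
  thus "fce X (m - 1) l : hom (lev X (m - 1)) (lev X (m - 2)) 0" "lev X (m - 2) : sob M"
   using simp_obj_fce[OF s, of m' l] simp_obj_lev[OF s, of m'] enat_le_Suc[of "Suc m'" k] enat_le_Suc[of m' k] m that by auto
 qed
 have ca: "match_cone (uc M) X m A (%l. b l ** i)" unfolding match_cone_def uc_simps
 proof (intro conjI impI allI)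
  show "b l ** i : hom A (lev X (m - 1)) 0" if "0 < m" "l <= m" for l by (rule comp0_in[OF o(1,2) Y[OF that(1)] o(3) bl[OF that]])
  fix r l assume "1 < m" and l: "r < l & l <= m"
  hence q: "1 < m" "r <= m - 1" "l - 1 <= m - 1" "0 < m" "r <= m" by auto
  have "fce X (m - 1) r ** b l = fce X (m - 1) (l - 1) ** b r" using c q l by (simp add: match_cone_def)
  thus "fce X (m - 1) r ** (b l ** i) = fce X (m - 1) (l - 1) ** (b r ** i)"
   using comp0_assoc[OF o(1,2) Y[OF q(4)] fX(2)[OF q(1,2)] o(3) bl fX(1)[OF q(1,2)], of l]
    comp0_assoc[OF o(1,2) Y[OF q(4)] fX(2)[OF q(1,2)] o(3) bl fX(1)[OF q(1,3)], of r] q l by simp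
 qed (use o in auto)
 have "v ** t = b' ** i"
 proof (rule unique_eqI[OF u[OF ca]])
  have "p l ** (v ** t) = b l ** i" if "0 < m" "l <= m" for l
   using comp0_assoc[OF o(1,4,5) Y[OF that(1)] t o(6) p[OF that]] E(3)[OF that] e[OF that] by simp
  thus "v ** t : hom A E 0 & (0 < m --> (ALL l<=m. p l ** (v ** t) = b l ** i))" using comp0_in[OF o(1,4,5) t o(6)] by blast
  have "p l ** (b' ** i) = b l ** i" if "0 < m" "l <= m" for l
   using comp0_assoc[OF o(1,2,5) Y[OF that(1)] o(3) b'(1) p[OF that]] b'(2)[OF that] by simp
  thus "b' ** i : hom A E 0 & (0 < m --> (ALL l<=m. p l ** (b' ** i) = b l ** i))" using comp0_in[OF o(1,2,5,3) b'(1)] by blast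
 qed
 then obtain h where h: "h : hom D (lev X m) 0" "h ** i = t" "v ** h = b'"
  using lift_cof[OF i(1) E(2) disjI1[OF i(2)] t b'(1)] by blast
 have "fce X m l ** h = b l" if "0 < m" "l <= m" for l
  using comp0_assoc[OF o(2,4,5) Y[OF that(1)] h(1) o(6) p[OF that]] E(3)[OF that] b'(2)[OF that] h(3) by simp
 thus thesis using that h by blast
qed

lemma zero_faces_extend:
 assumes X: "reedy_fibrant M k X" and m: "enat m <= k" and i: "(A, D, i) : cof M" "(A, D, i) : weq M"
  and t: "t : hom A (lev X m) 0" "!!l. 0 < m ==> l <= m ==> fce X m l ** t = zmap A (lev X (m - 1))"
 obtains h where "h : hom D (lev X m) 0" "h ** i = t" "!!l. 0 < m ==> l <= m ==> fce X m l ** h = zmap D (lev X (m - 1))"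
proof -
 have s: "simp_obj (uc M) k X" using X by (simp add: reedy_fibrant_def)
 have o: "A : sob M" "D : sob M" "i : hom A D 0" using cof_arr[OF i(1)] by auto
 have Y: "lev X (m - 1) : sob M" if "0 < m"
  using simp_obj_lev[OF s, of "m - 1"] enat_le_Suc[of "m - 1" k] m that by simp
 have fX: "fce X (m - 1) l : hom (lev X (m - 1)) (lev X (m - 2)) 0" "lev X (m - 2) : sob M" if "1 < m" "l <= m - 1" for l
 proof -
  define m' where "m' = m - 2"
  have m': "m = Suc (Suc m')" using that(1) by (simp add: m'_def)
  thus "fce X (m - 1) l : hom (lev X (m - 1)) (lev X (m - 2)) 0" "lev X (m - 2) : sob M"
   using simp_obj_fce[OF s, of m' l] simp_obj_lev[OF s, of m'] enat_le_Suc[of "Suc m'" k] enat_le_Suc[of m' k] m that by auto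
 qed
 have c: "match_cone (uc M) X m D (%_. zmap D (lev X (m - 1)))" unfolding match_cone_def uc_simps
 proof (intro conjI impI allI)
  fix r l assume "1 < m" and l: "r < l & l <= m"
  hence q: "1 < m" "r <= m - 1" "l - 1 <= m - 1" "0 < m" by auto
  show "fce X (m - 1) r ** zmap D (lev X (m - 1)) = fce X (m - 1) (l - 1) ** zmap D (lev X (m - 1))"
   using zmap_post[OF o(2) Y[OF q(4)] fX(2,1)[OF q(1,2)]] zmap_post[OF o(2) Y[OF q(4)] fX(2,1)[OF q(1,3)]] by simp
 qed (use o Y zmap_in in auto)
 show thesis
  by (rule matching_extend[OF X m i t(1) c]) (use t(2) zmap_pre[OF o(1,2) Y o(3)] that in auto)
qed

lemma zero_level_fibrant:
 assumes X: "reedy_fibrant M k X"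
 shows "fibrant M (lev X 0)"
proof (rule fibrant_by_lifting)
 have k: "enat 0 <= k" by (simp add: zero_enat_def[symmetric])
 show "lev X 0 : sob M" using simp_obj_lev[OF X[unfolded reedy_fibrant_def, THEN conjunct1] k] by simp
 fix A D i a assume i: "(A, D, i) : cof M" "(A, D, i) : weq M" and a: "a : hom A (lev X 0) 0"
 show "EX h:hom D (lev X 0) 0. h ** i = a" by (rule zero_faces_extend[OF X k i a]) auto
qed

lemma chainsD:
 assumes C: "is_chains (uc M) X m E j"
 shows "E : sob M" and "j : hom E (lev X m) 0" and "!!i. 1 <= i ==> i <= m ==> fce X m i ** j = zmap E (lev X (m - 1))"
  and "!!T t. T : sob M ==> t : hom T (lev X m) 0 ==> (!!i. 1 <= i ==> i <= m ==> fce X m i ** t = zmap T (lev X (m - 1))) ==>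
   EX! h. h : hom T E 0 & j ** h = t"
 using C by (auto simp: is_chains_def is_kers_def)

lemma chains_mono:
 assumes C: "is_chains (uc M) X m E j" and X: "lev X m : sob M" "lev X (m - 1) : sob M"
  and f: "!!i. 1 <= i ==> i <= m ==> fce X m i : hom (lev X m) (lev X (m - 1)) 0"
  and T: "T : sob M" and h: "h : hom T E 0" "h' : hom T E 0" "j ** h = j ** h'"
 shows "h = h'"
proof -
 note C' = chainsD[OF C]
 have "fce X m i ** (j ** h) = zmap T (lev X (m - 1))" if i: "1 <= i" "i <= m" for i
  using comp0_assoc[OF T C'(1) X h(1) C'(2) f[OF i]] C'(3)[OF i] zmap_pre[OF T C'(1) X(2) h(1)] by simp
 hence "EX! g. g : hom T E 0 & j ** g = j ** h" by (rule C'(4)[OF T comp0_in[OF T C'(1) X(1) h(1) C'(2)]])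
 thus ?thesis by (rule unique_eqI) (use h in auto)
qed

text \<open>To extend a map \<open>a\<close> into the chains, its face \<open>d\<^sub>0a\<close> is extended first: all faces of \<open>d\<^sub>0a\<close> vanish, and
 they can be kept zero.  The result, together with zeros, is a compatible family of faces for the extension
 of \<open>a\<close> itself.\<close>

lemma chains_fibrant:
 assumes X: "reedy_fibrant M k X" and m: "enat m <= k" and C: "is_chains (uc M) X m E j"
 shows "fibrant M E"
proof (rule fibrant_by_lifting)
 note C' = chainsD[OF C]
 have s: "simp_obj (uc M) k X" using X by (simp add: reedy_fibrant_def)
 show E0: "E : sob M" by (rule C'(1))
 fix A D i a assume i: "(A, D, i) : cof M" "(A, D, i) : weq M" and a: "a : hom A E 0"
 have o: "A : sob M" "D : sob M" "i : hom A D 0" using cof_arr[OF i(1)] by auto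
 have Xm: "lev X m : sob M" using simp_obj_lev[OF s m] by simp
 have ja: "j ** a : hom A (lev X m) 0" by (rule comp0_in[OF o(1) E0 Xm a C'(2)])
 have Y: "lev X (m - 1) : sob M" using simp_obj_lev[OF s, of "m - 1"] enat_le_Suc[of "m - 1" k] m Xm by (cases m) auto
 have f: "fce X m l : hom (lev X m) (lev X (m - 1)) 0" if "0 < m" "l <= m" for l
  using simp_obj_fce[OF s, of "m - 1" l] m that by simp
 have fa: "fce X m l ** (j ** a) = zmap A (lev X (m - 1))" if "1 <= l" "l <= m" for l
 proof -
  have fl: "fce X m l : hom (lev X m) (lev X (m - 1)) 0" using f[of l] that by simp
  show ?thesis using comp0_assoc[OF o(1) E0 Xm Y a C'(2) fl] C'(3)[OF that] zmap_pre[OF o(1) E0 Y a] by simp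
 qed
 obtain h where h: "h : hom D (lev X m) 0" "h ** i = j ** a" "!!l. 1 <= l ==> l <= m ==> fce X m l ** h = zmap D (lev X (m - 1))"
 proof (cases m)
  case 0
  show thesis by (rule zero_faces_extend[OF X m i ja]) (use 0 that in auto)
 next
  case (Suc m')
  have m': "enat m' <= k" using enat_le_Suc m Suc by simp
  have Xm': "lev X m' : sob M" using Y Suc by simp
  have f0: "fce X m 0 : hom (lev X m) (lev X m') 0" using f[of 0] Suc by simp
  have t: "fce X m 0 ** (j ** a) : hom A (lev X m') 0" by (rule comp0_in[OF o(1) Xm Xm' ja f0])
  have ff: "fce X m' l : hom (lev X m') (lev X (m' - 1)) 0" "lev X (m' - 1) : sob M" if "0 < m'" "l <= m'" for l
   using simp_obj_fce[OF s, of "m' - 1" l] simp_obj_lev[OF s, of "m' - 1"] enat_le_Suc[of "m' - 1" k] m' that by auto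
  have tz: "fce X m' l ** (fce X m 0 ** (j ** a)) = zmap A (lev X (m' - 1))" if l: "0 < m'" "l <= m'" for l
  proof -
   have e: "fce X m' 0 ** fce X m (Suc l) = fce X m' l ** fce X m 0"
    using simp_obj_face_face[OF s, of "m' - 1" 0 "Suc l"] m Suc l by simp
   have fl: "fce X m (Suc l) : hom (lev X m) (lev X m') 0" using f[of "Suc l"] Suc l by simp
   have "fce X m' l ** (fce X m 0 ** (j ** a)) = fce X m' 0 ** (fce X m (Suc l) ** (j ** a))"
    using comp0_assoc[OF o(1) Xm Xm' ff(2)[OF l] ja f0 ff(1)[OF l]]
     comp0_assoc[OF o(1) Xm Xm' ff(2)[OF l] ja fl ff(1)[OF l(1) le0]] e by simp
   thus ?thesis using fa[of "Suc l"] Suc l zmap_post[OF o(1) Xm' ff(2)[OF l] ff(1)[OF l(1) le0]] by simp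
  qed
  obtain r where r: "r : hom D (lev X m') 0" "r ** i = fce X m 0 ** (j ** a)"
   "!!l. 0 < m' ==> l <= m' ==> fce X m' l ** r = zmap D (lev X (m' - 1))"
   by (rule zero_faces_extend[OF X m' i t tz]) (assumption, assumption, rule that)
  define b where "b = (%l :: nat. if l = 0 then r else zmap D (lev X m'))"
  have "match_cone (uc M) X m D b" unfolding match_cone_def uc_simps
  proof (intro conjI impI allI)
   show "b l : hom D (lev X (m - 1)) 0" for l using r(1) zmap_in[OF o(2) Xm'] Suc by (simp add: b_def)
   fix p l assume "1 < m" and l: "p < l & l <= m"
   hence q: "0 < m'" "p <= m'" "l - 1 <= m'" using Suc by auto
   show "fce X (m - 1) p ** b l = fce X (m - 1) (l - 1) ** b p"
    using zmap_post[OF o(2) Xm' ff(2,1)[OF q(1,2)]] zmap_post[OF o(2) Xm' ff(2,1)[OF q(1,3)]] r(3)[OF q(1,3)] l Suc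
    by (auto simp: b_def)
  qed (use o in auto)
  moreover have "fce X m l ** (j ** a) = b l ** i" if "l <= m" for l
   using fa[of l] that r(2) zmap_pre[OF o(1,2) Xm' o(3)] Suc by (auto simp: b_def)
  ultimately show thesis
   by (rule matching_extend[OF X m i ja]) (use that Suc in \<open>auto simp: b_def\<close>)
 qed
 obtain g where g: "g : hom D E 0" "j ** g = h" using C'(4)[OF o(2) h(1,3)] by blast
 have "g ** i = a"
  by (rule chains_mono[OF C Xm Y f o(1) comp0_in[OF o(1,2) E0 o(3) g(1)] a])
   (use comp0_assoc[OF o(1,2) E0 Xm o(3) g(1) C'(2)] g(2) h(2) in auto)
 thus "EX h:hom D E 0. h ** i = a" using g(1) by blast
qed

end

section \<open>The category of algebras\<close>

lemma Alg_ar: "h : ar (Alg M \<A>) L L' ==> B : ob (Pi_cat M \<A>) ==> bpt L B : val L B ==> app h B (bpt L B) = bpt L' B"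
 and Alg_ar_val: "h : ar (Alg M \<A>) L L' ==> B : ob (Pi_cat M \<A>) ==> x : val L B ==> app h B x : val L' B"
 by (auto simp: Alg_def pext_def palg_map_def)

lemma Alg_idt: "B : ob (Pi_cat M \<A>) ==> x : val L B ==> app (idt (Alg M \<A>) L) B x = x"
 by (simp add: Alg_def pext_def)

lemma Alg_cmp: "f : ar (Alg M \<A>) L L' ==> B : ob (Pi_cat M \<A>) ==> x : val L B ==>
  app (cmp (Alg M \<A>) g f) B x = app g B (app f B x)"
 by (auto simp: Alg_def pext_def split_beta)

lemma Alg_ob_bpt: "L : ob (Alg M \<A>) ==> B : ob (Pi_cat M \<A>) ==> bpt L B : val L B"
 by (simp add: Alg_def is_palg_def)

lemma palg_map_comp: "palg_map P L L' f ==> palg_map P L' L'' g ==> palg_map P L L'' (%B x. g B (f B x))"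
 unfolding palg_map_def by auto

lemma palg_map_cong:
 assumes L: "is_palg P L" and f: "palg_map P L L' f" and e: "!!B x. B : ob P ==> x : val L B ==> g B x = f B x"
 shows "palg_map P L L' g"
 unfolding palg_map_def
proof (intro conjI ballI)
 show "g B (bpt L B) = bpt L' B" "x : val L B ==> g B x : val L' B" if "B : ob P" for B x
  using that L f e by (auto simp: is_palg_def palg_map_def)
 show "g B (act L B B' h x) = act L' B B' h (g B' x)" if "B : ob P" "B' : ob P" "h : ar P B B'" "x : val L B'" for B B' h x
 proof -
  have "act L B B' h x : val L B" using L[unfolded is_palg_def, THEN conjunct2, THEN conjunct1] that by blast
  thus ?thesis using that f e unfolding palg_map_def by simp
 qed
qed

lemma category_Alg: "category (Alg M \<A> :: (('o, 'a, 's) alg, ('o, 'a, 's) algarr) cat)"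
proof -
 let ?P = "Pi_cat M \<A>"
 have pc: "pext ?P L (%B x. g B (f B x)) = pext ?P L (%B x. pext ?P L' g B (pext ?P L f B x))"
  if "palg_map ?P L L' f" for L L' f and g :: "'o => 's => 's"
  using that unfolding pext_def palg_map_def by (auto simp: fun_eq_iff)
 have i: "palg_map ?P L L (%_ x. x)" for L by (simp add: palg_map_def)
 have pe: "palg_map ?P L L' (pext ?P L f)" if "is_palg ?P L" "palg_map ?P L L' f" for L L' f
  by (rule palg_map_cong[OF that]) (simp add: pext_def)
 have pi: "pext ?P L (pext ?P L f) = pext ?P L f" for L and f :: "'o => 's => 's" by (auto simp: pext_def fun_eq_iff)
 show ?thesis
  unfolding category_def
 proof (intro conjI ballI)
  fix X assume "X : ob (Alg M \<A> :: (('o, 'a, 's) alg, ('o, 'a, 's) algarr) cat)"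
  show "idt (Alg M \<A>) X : ar (Alg M \<A>) X X" using i by (auto simp: Alg_def)
 next
  fix X Y Z :: "('o, 'a, 's) alg" and f g assume o: "X : ob (Alg M \<A>)" and f: "f : ar (Alg M \<A>) X Y" and g: "g : ar (Alg M \<A>) Y Z"
  obtain f' g' where fg: "f = (X, Y, pext ?P X f')" "palg_map ?P X Y f'" "g = (Y, Z, pext ?P Y g')" "palg_map ?P Y Z g'"
   using f g by (auto simp: Alg_def)
  have "cmp (Alg M \<A>) g f = (X, Z, pext ?P X (%B x. g' B (f' B x)))" using pc[OF fg(2), of g'] by (simp add: Alg_def fg)
  thus "cmp (Alg M \<A>) g f : ar (Alg M \<A>) X Z" using palg_map_comp[OF fg(2,4)] by (auto simp: Alg_def)
 next
  fix X Y :: "('o, 'a, 's) alg" and f assume f: "f : ar (Alg M \<A>) X Y"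
  thus "cmp (Alg M \<A>) f (idt (Alg M \<A>) X) = f" "cmp (Alg M \<A>) (idt (Alg M \<A>) Y) f = f"
   by (auto simp: Alg_def pext_def fun_eq_iff palg_map_def)
 next
  fix X Y Z W :: "('o, 'a, 's) alg" and f g h
  assume f: "f : ar (Alg M \<A>) X Y" and g: "g : ar (Alg M \<A>) Y Z" and h: "h : ar (Alg M \<A>) Z W"
  thus "cmp (Alg M \<A>) h (cmp (Alg M \<A>) g f) = cmp (Alg M \<A>) (cmp (Alg M \<A>) h g) f"
   by (auto simp: Alg_def pext_def fun_eq_iff palg_map_def)
 qed
qed

lemma zero_Alg:
 assumes u: "infinite (UNIV :: 's set)"
 obtains Z where "is_zero (Alg M \<A> :: (('o, 'a, 's) alg, ('o, 'a, 's) algarr) cat) Z" "!!B. val Z B = {bpt Z B}"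
proof
 define Z :: "('o, 'a, 's) alg" where "Z = \<lparr>val = (%_. {undefined}), bpt = (%_. undefined), act = (%_ _ _ _. undefined)\<rparr>"
 have Z: "val Z B = {undefined}" "bpt Z B = undefined" "act Z B B' h x = undefined" for B B' h x by (simp_all add: Z_def)
 let ?P = "Pi_cat M \<A>"
 have sm: "small TYPE('s) {undefined :: 's}" by (rule small_finite[OF u]) simp
 have zp: "is_palg ?P Z" unfolding is_palg_def
 proof (intro conjI ballI allI impI)
  fix I :: "nat set" and F B inc
  have "inj_on (%x. \<lambda>j\<in>I. act Z (F j) B (inc j) x) (val Z B)" by (simp add: Z)
  moreover have "(\<Pi>\<^sub>E j\<in>I. val Z (F j)) = {\<lambda>j\<in>I. undefined}" by (auto simp: Z PiE_def extensional_def fun_eq_iff restrict_def)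
  ultimately show "bij_betw (%x. \<lambda>j\<in>I. act Z (F j) B (inc j) x) (val Z B) (\<Pi>\<^sub>E j\<in>I. val Z (F j))"
   unfolding bij_betw_def by (simp add: Z)
 qed (use sm in \<open>auto simp: Z\<close>)
 show "is_zero (Alg M \<A>) Z" unfolding is_zero_def
 proof (intro conjI ballI)
  show "Z : ob (Alg M \<A>)" using zp by (simp add: Alg_def)
  fix X :: "('o, 'a, 's) alg" assume "X : ob (Alg M \<A>)"
  hence X: "is_palg ?P X" by (simp add: Alg_def)
  show "EX! f. f : ar (Alg M \<A>) X Z"
  proof (rule ex1I[of _ "(X, Z, pext ?P X (%_ _. undefined))"])
   have "palg_map ?P X Z (%_ _. undefined)" by (simp add: palg_map_def Z)
   thus "(X, Z, pext ?P X (%_ _. undefined)) : ar (Alg M \<A>) X Z" by (auto simp: Alg_def)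
   fix f assume "f : ar (Alg M \<A>) X Z"
   thus "f = (X, Z, pext ?P X (%_ _. undefined))" by (auto simp: Alg_def palg_map_def Z pext_def fun_eq_iff)
  qed
  show "EX! f. f : ar (Alg M \<A>) Z X"
  proof (rule ex1I[of _ "(Z, X, pext ?P Z (%B _. bpt X B))"])
   have "palg_map ?P Z X (%B _. bpt X B)" using X by (auto simp: palg_map_def is_palg_def Z)
   thus "(Z, X, pext ?P Z (%B _. bpt X B)) : ar (Alg M \<A>) Z X" by (auto simp: Alg_def)
   fix f assume "f : ar (Alg M \<A>) Z X"
   thus "f = (Z, X, pext ?P Z (%B _. bpt X B))" by (auto simp: Alg_def palg_map_def Z pext_def fun_eq_iff)
  qed
 qed
 show "!!B. val Z B = {bpt Z B}" by (simp add: Z)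
qed

lemma Alg_zarr:
 fixes L :: "('o, 'a, 's) alg"
 assumes u: "infinite (UNIV :: 's set)" and L: "L : ob (Alg M \<A>)" "L' : ob (Alg M \<A>)"
  and B: "B : ob (Pi_cat M \<A>)" and x: "x : val L B"
 shows "app (zarr (Alg M \<A>) L L') B x = bpt L' B"
proof -
 obtain Z where Z: "is_zero (Alg M \<A> :: (('o, 'a, 's) alg, ('o, 'a, 's) algarr) cat) Z" "!!B. val Z B = {bpt Z B}"
  using zero_Alg[OF u] by blast
 obtain f g where f: "f : ar (Alg M \<A>) L Z" "g : ar (Alg M \<A>) Z L'" using Z(1) L unfolding is_zero_def by metis
 have "zarr (Alg M \<A>) L L' = cmp (Alg M \<A>) g f" by (rule zarr_eq[OF category_Alg Z(1) L f])
 thus ?thesis using Alg_cmp[OF f(1) B x] Alg_ar_val[OF f(1) B x] Alg_ar[OF f(2) B] Z(2) by auto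
qed

section \<open>The tower of nullhomotopies\<close>

locale realization = pointed_smc M u for M :: "('o, 'a) smc" and u :: "'s itself" +
 fixes \<A> :: "'o set" and n :: nat and \<Lambda> :: "('o, 'a, 's) alg"
  and G :: "(('o, 'a, 's) alg, ('o, 'a, 's) algarr) sobj" and Gbar gbar \<epsilon> V Vbar vbar \<theta> B \<beta> C \<iota> dbar
 assumes A_sob: "\<A> \<subseteq> sob M" and E2: "E2_model_category u M \<A>" and n: "1 <= n"
  and free: "free_resolution M \<A> \<Lambda> G Gbar gbar \<epsilon>"
  and real: "truncated_realization M \<A> G Gbar (n + 1) V Vbar vbar \<theta>"
  and B: "B : MA u M \<A>" "cofibrant M B"
  and \<beta>: "palg_iso (Pi_cat M \<A>) (piA M B) (Gbar (n + 2)) \<beta>"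
  and C: "is_chains (uc M) V (n + 1) C \<iota>" and dbar: "dbar : hom B C 0"
  and attaching: "ALL B':ob (Pi_cat M \<A>). ALL x:ar (hocat M) B' B.
           \<theta> (n + 1) B' (hcmp M (loc M B (lev V (n + 1)) (cmp (uc M) \<iota> dbar)) x) =
           app (cmp (Alg M \<A>) (fce G (n + 2) 0) (gbar (n + 2))) B' (\<beta> B' x)"
begin

abbreviation "P == Pi_cat M \<A>"

lemma V_reedy: "reedy_fibrant M (enat (n + 1)) V" and V_simp: "simp_obj (uc M) (enat (n + 1)) V"
 using real by (auto simp: truncated_realization_def reedy_fibrant_def)

lemma V_ob: "m <= n + 1 ==> lev V m : sob M"
 using simp_obj_lev[OF V_simp, of m] by simp

lemma V_fce: "m <= n ==> i <= Suc m ==> fce V (Suc m) i : hom (lev V (Suc m)) (lev V m) 0"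
 using simp_obj_fce[OF V_simp, of m i] by simp

lemma V_face_face: "Suc m <= n ==> i < j ==> j <= Suc (Suc m) ==>
  fce V (Suc m) i ** fce V (Suc (Suc m)) j = fce V (Suc m) (j - 1) ** fce V (Suc (Suc m)) i"
 using simp_obj_face_face[OF V_simp, of m i j] by simp

text \<open>The given chains object has to be kept in the top degree, because the attaching map ends there.\<close>

definition Cp :: "nat => 'o \<times> 'a" where
 "Cp m = (if m = n + 1 then (C, \<iota>) else (SOME p. is_chains (uc M) V m (fst p) (snd p)))"

definition "Cob m = fst (Cp m)"
definition "ci m = snd (Cp m)"

lemma Cob_top: "Cob (n + 1) = C" "ci (n + 1) = \<iota>"
 by (simp_all add: Cob_def ci_def Cp_def)

lemma chains: assumes m: "m <= n + 1" shows "is_chains (uc M) V m (Cob m) (ci m)"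
proof (cases "m = n + 1")
 case True
 thus ?thesis using C Cob_top by simp
next
 case False
 have "EX E j. is_kers (uc M) V m {1..m} E j"
 proof (rule kers_ex)
  show "lev V m : sob M" "lev V (m - 1) : sob M" using V_ob m by auto
  show "fce V m i : hom (lev V m) (lev V (m - 1)) 0" if "i : {1..m}" for i
   using V_fce[of "m - 1" i] that m by auto
 qed simp
 then obtain E j where "is_chains (uc M) V m E j" by (auto simp: is_chains_def)
 hence "EX p. is_chains (uc M) V m (fst p) (snd p)" by auto
 from someI_ex[OF this] show ?thesis using False by (auto simp: Cob_def ci_def Cp_def split_beta)
qed

lemma Cob: "m <= n + 1 ==> Cob m : sob M" and Cob_fibrant: "m <= n + 1 ==> fibrant M (Cob m)"
 and ci_in: "m <= n + 1 ==> ci m : hom (Cob m) (lev V m) 0"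
 and ci_face: "m <= n + 1 ==> 1 <= i ==> i <= m ==> fce V m i ** ci m = zmap (Cob m) (lev V (m - 1))"
 using chainsD(1-3)[OF chains] chains_fibrant[OF V_reedy _ chains] by auto

lemma ci_mono:
 assumes m: "m <= n + 1" and T: "T : sob M" and h: "h : hom T (Cob m) 0" "h' : hom T (Cob m) 0" "ci m ** h = ci m ** h'"
 shows "h = h'"
proof (rule chains_mono[OF chains[OF m] _ _ _ T h])
 show "lev V m : sob M" "lev V (m - 1) : sob M" using V_ob m by auto
 show "fce V m i : hom (lev V m) (lev V (m - 1)) 0" if "1 <= i" "i <= m" for i using V_fce[of "m - 1" i] that m by auto
qed

lemma bdry_ex:
 assumes m: "m <= n"
 shows "EX! d. d : hom (Cob (Suc m)) (Cob m) 0 & ci m ** d = fce V (Suc m) 0 ** ci (Suc m)"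
proof (rule chainsD(4)[OF chains])
 have o: "Cob (Suc m) : sob M" "lev V (Suc m) : sob M" "lev V m : sob M" "lev V (m - 1) : sob M"
  and c: "ci (Suc m) : hom (Cob (Suc m)) (lev V (Suc m)) 0"
  using Cob V_ob ci_in m by auto
 show "m <= n + 1" "Cob (Suc m) : sob M" using m o by auto
 show "fce V (Suc m) 0 ** ci (Suc m) : hom (Cob (Suc m)) (lev V m) 0" by (rule comp0_in[OF o(1-3) c V_fce[OF m le0]])
 fix i assume i: "1 <= i" "i <= m"
 obtain m' where m': "m = Suc m'" using i by (cases m) auto
 have f: "fce V m j : hom (lev V m) (lev V (m - 1)) 0" if "j <= m" for j using V_fce[of m' j] that m m' by simp
 have "fce V m i ** (fce V (Suc m) 0 ** ci (Suc m)) = (fce V m i ** fce V (Suc m) 0) ** ci (Suc m)"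
  by (rule comp0_assoc[OF o c V_fce[OF m le0] f[OF i(2)], symmetric])
 also have "\<dots> = (fce V m 0 ** fce V (Suc m) (Suc i)) ** ci (Suc m)"
  using V_face_face[of m' 0 "Suc i"] i m m' by simp
 also have "\<dots> = fce V m 0 ** (fce V (Suc m) (Suc i) ** ci (Suc m))"
  by (rule comp0_assoc[OF o c V_fce[OF m] f[OF le0]]) (use i in simp)
 also have "\<dots> = zmap (Cob (Suc m)) (lev V (m - 1))"
  using ci_face[of "Suc m" "Suc i"] i m zmap_post[OF o(1,3,4) f[OF le0]] by simp
 finally show "fce V m i ** (fce V (Suc m) 0 ** ci (Suc m)) = zmap (Cob (Suc m)) (lev V (m - 1))" .
qed

definition "bdry m = (THE d. d : hom (Cob (Suc m)) (Cob m) 0 & ci m ** d = fce V (Suc m) 0 ** ci (Suc m))"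

lemma bdry_in: "m <= n ==> bdry m : hom (Cob (Suc m)) (Cob m) 0"
 and ci_bdry: "m <= n ==> ci m ** bdry m = fce V (Suc m) 0 ** ci (Suc m)"
 using theI'[OF bdry_ex] unfolding bdry_def by blast+

lemma bdry_bdry:
 assumes m: "Suc m <= n"
 shows "bdry m ** bdry (Suc m) = zmap (Cob (Suc (Suc m))) (Cob m)"
proof (rule ci_mono)
 have o: "Cob (Suc (Suc m)) : sob M" "Cob (Suc m) : sob M" "Cob m : sob M" "lev V (Suc (Suc m)) : sob M" "lev V (Suc m) : sob M" "lev V m : sob M"
  using Cob V_ob m by auto
 have b: "bdry (Suc m) : hom (Cob (Suc (Suc m))) (Cob (Suc m)) 0" "bdry m : hom (Cob (Suc m)) (Cob m) 0"
  and c: "ci (Suc (Suc m)) : hom (Cob (Suc (Suc m))) (lev V (Suc (Suc m))) 0"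
   "ci (Suc m) : hom (Cob (Suc m)) (lev V (Suc m)) 0" "ci m : hom (Cob m) (lev V m) 0"
  and f: "!!i. i <= Suc m ==> fce V (Suc m) i : hom (lev V (Suc m)) (lev V m) 0"
   "!!i. i <= Suc (Suc m) ==> fce V (Suc (Suc m)) i : hom (lev V (Suc (Suc m))) (lev V (Suc m)) 0"
  using bdry_in ci_in V_fce m by auto
 show "m <= n + 1" "Cob (Suc (Suc m)) : sob M" using m o by auto
 show "bdry m ** bdry (Suc m) : hom (Cob (Suc (Suc m))) (Cob m) 0" "zmap (Cob (Suc (Suc m))) (Cob m) : hom (Cob (Suc (Suc m))) (Cob m) 0"
  using comp0_in[OF o(1-3) b] zmap_in[OF o(1,3)] by auto
 have "ci m ** (bdry m ** bdry (Suc m)) = (ci m ** bdry m) ** bdry (Suc m)" by (rule comp0_assoc[OF o(1-3,6) b c(3), symmetric])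
 also have "\<dots> = (fce V (Suc m) 0 ** ci (Suc m)) ** bdry (Suc m)" using ci_bdry[of m] m by simp
 also have "\<dots> = fce V (Suc m) 0 ** (ci (Suc m) ** bdry (Suc m))" by (rule comp0_assoc[OF o(1,2,5,6) b(1) c(2) f(1)[OF le0]])
 also have "\<dots> = fce V (Suc m) 0 ** (fce V (Suc (Suc m)) 0 ** ci (Suc (Suc m)))" using ci_bdry[of "Suc m"] m by simp
 also have "\<dots> = (fce V (Suc m) 0 ** fce V (Suc (Suc m)) 0) ** ci (Suc (Suc m))"
  by (rule comp0_assoc[OF o(1,4,5,6) c(1) f(2)[OF le0] f(1)[OF le0], symmetric])
 also have "\<dots> = (fce V (Suc m) 0 ** fce V (Suc (Suc m)) 1) ** ci (Suc (Suc m))" using V_face_face[OF m, of 0 1] by simp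
 also have "\<dots> = fce V (Suc m) 0 ** (fce V (Suc (Suc m)) 1 ** ci (Suc (Suc m)))"
  by (rule comp0_assoc[OF o(1,4,5,6) c(1) f(2) f(1)[OF le0]]) simp
 also have "\<dots> = zmap (Cob (Suc (Suc m))) (lev V m)" using ci_face[of "Suc (Suc m)" 1] m zmap_post[OF o(1,5,6) f(1)[OF le0]] by simp
 also have "\<dots> = ci m ** zmap (Cob (Suc (Suc m))) (Cob m)" using zmap_post[OF o(1,3,6) c(3)] by simp
 finally show "ci m ** (bdry m ** bdry (Suc m)) = ci m ** zmap (Cob (Suc (Suc m))) (Cob m)" .
qed

subsection \<open>Homotopy groups of the chains objects\<close>

text \<open>By the hypothesis on \<open>\<pi>\<^sub>\<A>\<close> of the chains objects, \<open>[T, C\<^sub>m]\<close> is the set of Moore chains of \<open>[T, V]\<close>.\<close>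

lemma E2_inj:
 assumes m: "m <= n + 1" and T: "T : ob P" and x: "x : ar (hocat M) T (Cob m)" "y : ar (hocat M) T (Cob m)"
  and e: "hcmp M (loc M (Cob m) (lev V m) (ci m)) x = hcmp M (loc M (Cob m) (lev V m) (ci m)) y"
 shows "x = y"
 and E2_surj: "!!z. z : ar (hocat M) T (lev V m) ==> (!!i. 1 <= i ==> i <= m ==>
   Fc (hset M T V) m i z = zarr (hocat M) T (lev V (m - 1))) ==>
   EX x:ar (hocat M) T (Cob m). hcmp M (loc M (Cob m) (lev V m) (ci m)) x = z"
proof -
 have "ALL k X m C j. reedy_fibrant M k X & enat m <= k & is_chains (uc M) X m C j -->
    (ALL B:ob P. bij_betw (%x. hcmp M (loc M C (lev X m) j) x) (ar (hocat M) B C)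
             {x : ar (hocat M) B (lev X m). ALL i. 1 <= i & i <= m -->
        Fc (hset M B X) m i x = zarr (hocat M) B (lev X (m - 1))})"
  using E2[unfolded E2_model_category_def] by (elim conjE)
 hence b: "bij_betw (%x. hcmp M (loc M (Cob m) (lev V m) (ci m)) x) (ar (hocat M) T (Cob m))
             {x : ar (hocat M) T (lev V m). ALL i. 1 <= i & i <= m -->
        Fc (hset M T V) m i x = zarr (hocat M) T (lev V (m - 1))}"
  using V_reedy chains[OF m] m T by fastforce
 show "x = y" using inj_onD[OF bij_betw_imp_inj_on[OF b] e x] .
 show "EX x:ar (hocat M) T (Cob m). hcmp M (loc M (Cob m) (lev V m) (ci m)) x = z"
  if "z : ar (hocat M) T (lev V m)" "!!i. 1 <= i ==> i <= m ==> Fc (hset M T V) m i z = zarr (hocat M) T (lev V (m - 1))" for z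
 proof -
  have "z : (%x. hcmp M (loc M (Cob m) (lev V m) (ci m)) x) ` ar (hocat M) T (Cob m)"
   unfolding bij_betw_imp_surj_on[OF b] using that by simp
  thus ?thesis by blast
 qed
qed

lemma Pi_sob: "T : ob P ==> T : sob M"
 by (simp add: Pi_cat_def)

lemma sph_Pi:
 assumes A: "A : \<A>"
 shows "sph k (Qob M A) : ob P" and "sph k (Qob M A) = susp M k A" and "cofibrant M (sph k (Qob M A))"
proof -
 show e: "sph k (Qob M A) = susp M k A" by (simp add: sph_def susp_def)
 show c: "cofibrant M (sph k (Qob M A))" using sph_cofibrant[OF Qob(1)] A A_sob by blast
 have "is_coprod (hocat M) {0 :: nat} (%j. susp M k A) (sph k (Qob M A)) (%_. idt (hocat M) (sph k (Qob M A)))"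
  using hocat_trivial_coprod[OF cofibrant_ob[OF c]] e by simp
 hence "EX (I :: nat set) A' k' inc. finite I & (ALL j:I. A' j : \<A>) &
     is_coprod (hocat M) I (%j. susp M (k' j) (A' j)) (sph k (Qob M A)) inc"
  using A by (intro exI[of _ "{0 :: nat}"] exI[of _ "%_. A"] exI[of _ "%_. k"] exI) auto
 thus "sph k (Qob M A) : ob P" using cofibrant_ob[OF c] by (simp add: Pi_cat_def)
qed

lemma hcmp_in: "X : sob M ==> Y : sob M ==> Z : sob M ==> x : ar (hocat M) X Y ==> y : ar (hocat M) Y Z ==> hcmp M y x : ar (hocat M) X Z"
 using cat_comp[OF category_hocat] by (simp add: hocat_simps(1))

lemma hcmp_assoc: "X : sob M ==> Y : sob M ==> Z : sob M ==> W : sob M ==> x : ar (hocat M) X Y ==> y : ar (hocat M) Y Z ==>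
  z : ar (hocat M) Z W ==> hcmp M z (hcmp M y x) = hcmp M (hcmp M z y) x"
 using category_hocat unfolding category_def hocat_simps(1) by blast

lemma hcmp_zarr: "X : sob M ==> Y : sob M ==> Z : sob M ==> y : ar (hocat M) Y Z ==> hcmp M y (zarr (hocat M) X Y) = zarr (hocat M) X Z"
 by (rule zero_ex) (use zarr_post[OF category_hocat zero_hocat(1), of _ X Y Z y] in \<open>simp add: hocat_simps(1)\<close>)

lemma zarr_hin: "X : sob M ==> Y : sob M ==> zarr (hocat M) X Y : ar (hocat M) X Y"
 by (rule zero_ex) (use zarr_in[OF category_hocat zero_hocat(1), of _ X Y] in \<open>simp add: hocat_simps(1)\<close>)

lemma theta_map: "m <= n + 1 ==> palg_map P (piA M (lev V m)) (lev G m) (\<theta> m)"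
 and theta_bij: "m <= n + 1 ==> T : ob P ==> bij_betw (\<theta> m T) (ar (hocat M) T (lev V m)) (val (lev G m) T)"
 and theta_face: "T : ob P ==> m <= n ==> x : ar (hocat M) T (lev V (Suc m)) ==> i <= Suc m ==>
  \<theta> m T (hcmp M (loc M (lev V (Suc m)) (lev V m) (fce V (Suc m) i)) x) = app (fce G (Suc m) i) T (\<theta> (Suc m) T x)"
 using real unfolding truncated_realization_def palg_iso_def piA_map_def by (auto simp: piA_def hset_def)

lemma theta_zero: "m <= n + 1 ==> T : ob P ==> \<theta> m T (zarr (hocat M) T (lev V m)) = bpt (lev G m) T"
 and theta_in: "m <= n + 1 ==> T : ob P ==> x : ar (hocat M) T (lev V m) ==> \<theta> m T x : val (lev G m) T"
 using theta_map[of m] unfolding palg_map_def by (auto simp: piA_def)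

lemma theta_inj: "m <= n + 1 ==> T : ob P ==> x : ar (hocat M) T (lev V m) ==> y : ar (hocat M) T (lev V m) ==>
  \<theta> m T x = \<theta> m T y ==> x = y"
 using theta_bij[of m T] by (auto simp: bij_betw_def inj_on_def)

lemma G_simp: "simp_obj (Alg M \<A>) \<infinity> G"
 and G_basis: "gbar m : ar (Alg M \<A>) (Gbar m) (lev G m)" "Gbar m : ob (Alg M \<A>)"
 and G_attach: "1 <= i ==> i <= m ==> cmp (Alg M \<A>) (fce G m i) (gbar m) = zarr (Alg M \<A>) (Gbar m) (lev G (m - 1))"
 using free unfolding free_resolution_def cw_object_def by auto

lemma G_ob: "lev G m : ob (Alg M \<A>)"
 and G_fce: "i <= Suc m ==> fce G (Suc m) i : ar (Alg M \<A>) (lev G (Suc m)) (lev G m)"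
 and G_dgn: "i <= m ==> dgn G m i : ar (Alg M \<A>) (lev G m) (lev G (Suc m))"
 and G_face_face: "i < j ==> j <= Suc (Suc m) ==>
  cmp (Alg M \<A>) (fce G (Suc m) i) (fce G (Suc (Suc m)) j) = cmp (Alg M \<A>) (fce G (Suc m) (j - 1)) (fce G (Suc (Suc m)) i)"
 using simp_obj_lev[OF G_simp] simp_obj_fce[OF G_simp] simp_obj_dgn[OF G_simp] simp_obj_face_face[OF G_simp] by auto

lemma G_bpt: "T : ob P ==> bpt (lev G m) T : val (lev G m) T"
 by (rule Alg_ob_bpt[OF G_ob])

lemma G_cst: "T : ob P ==> cst (evset G T) m (bpt (lev G 0) T) = bpt (lev G m) T"
proof (induction m)
 case (Suc m)
 thus ?case using Alg_ar[OF G_dgn[of 0 m] _ G_bpt[of T m]] cst.simps(2)[of "evset G T" m] by (simp add: evset_def)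
qed simp

text \<open>In positive degrees all cycles of the constant object \<open>\<Lambda>{T}\<close> are equal to the base point, and
 \<open>G{T} \<rightarrow> \<Lambda>{T}\<close> is injective on homotopy.\<close>

lemma G_acyclic:
 assumes A: "A : \<A>" and T: "T = susp M k A" "T : ob P" and m: "1 <= m" and g: "g : val (lev G m) T"
  and f: "!!i. i <= m ==> app (fce G m i) T g = bpt (lev G (m - 1)) T"
 obtains w where "w : val (lev G (Suc m)) T" "app (fce G (Suc m) 0) T w = g"
  "!!i. 1 <= i ==> i <= Suc m ==> app (fce G (Suc m) i) T w = bpt (lev G m) T"
proof -
 let ?K = "evset G T" and ?L = "evset (sconst (Alg M \<A>) \<Lambda>) T" and ?b = "bpt (lev G 0) T"
 have pe: "pi_equivalence ?K ?b ?L (bpt \<Lambda> T) (%m. app (\<epsilon> m) T)" and sm: "simp_map (Alg M \<A>) \<infinity> G (sconst (Alg M \<A>) \<Lambda>) \<epsilon>"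
  using free A T(1) unfolding free_resolution_def by (auto simp: Let_def)
 have em: "\<epsilon> j : ar (Alg M \<A>) (lev G j) \<Lambda>" for j using sm by (auto simp: simp_map_def sconst_def)
 obtain m' where m': "m = Suc m'" using m by (cases m) auto
 have ef: "cmp (Alg M \<A>) (\<epsilon> m') (fce G m 0) = cmp (Alg M \<A>) (idt (Alg M \<A>) \<Lambda>) (\<epsilon> m)"
  using sm m' by (auto simp: simp_map_def sconst_def)
 have eb: "app (\<epsilon> j) T (bpt (lev G j) T) = bpt \<Lambda> T" for j by (rule Alg_ar[OF em T(2) G_bpt[OF T(2)]])
 have ev: "app (\<epsilon> m) T g : val \<Lambda> T" by (rule Alg_ar_val[OF em T(2) g])
 have f0: "fce G m 0 : ar (Alg M \<A>) (lev G m) (lev G m')" using G_fce[of 0 m'] m' by simp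
 have "app (\<epsilon> m) T g = app (\<epsilon> m') T (app (fce G m 0) T g)"
  using Alg_cmp[OF f0 T(2) g, of "\<epsilon> m'"] Alg_cmp[OF em T(2) g, of "idt (Alg M \<A>) \<Lambda>"] Alg_idt[OF T(2) ev] ef by simp
 hence eg: "app (\<epsilon> m) T g = bpt \<Lambda> T" using f[of 0] eb m' by simp
 have bL: "bpt \<Lambda> T : val \<Lambda> T" using ev eg by simp
 have cL: "cst ?L j (bpt \<Lambda> T) = bpt \<Lambda> T" for j
 proof (induction j)
  case (Suc j)
  thus ?case using Alg_idt[OF T(2) bL] cst.simps(2)[of ?L j] by (simp add: evset_def sconst_def)
 qed simp
 have gc: "g : pi_cycles ?K ?b m" using g f G_cst[OF T(2)] by (simp add: pi_cycles_def evset_def)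
 have cc: "cst ?K m ?b : pi_cycles ?K ?b m"
  unfolding pi_cycles_def G_cst[OF T(2)]
  using G_bpt[OF T(2)] Alg_ar[OF G_fce T(2) G_bpt[OF T(2)], of _ m'] m' by (simp add: evset_def)
 have "pi_rel ?L (bpt \<Lambda> T) m (app (\<epsilon> m) T g) (app (\<epsilon> m) T (cst ?K m ?b))"
  unfolding G_cst[OF T(2)] eg eb pi_rel_def cL
  using bL Alg_idt[OF T(2) bL] by (intro bexI[of _ "bpt \<Lambda> T"]) (auto simp: evset_def sconst_def)
 hence "null ?K ?b m g" using pe gc cc unfolding pi_equivalence_def by blast
 then obtain w where w: "w : Sx ?K (Suc m)" "Fc ?K (Suc m) 0 w = g"
  "!!i. 1 <= i ==> i <= Suc m ==> Fc ?K (Suc m) i w = cst ?K m ?b"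
  unfolding null_alt by blast
 show thesis by (rule that[of w]) (use w(1,2) w(3)[unfolded G_cst[OF T(2)]] in \<open>auto simp: evset_def\<close>)
qed

text \<open>A cycle of degree \<open>k\<close> with trivial image is a map \<open>v\<close> from \<open>T = \<Sigma>\<^sup>kA\<close> to \<open>C\<^sub>m\<close> whose class is a Moore cycle of
 \<open>[T, V] \<cong> G{T}\<close>.  There it bounds a Moore chain, which is the class of a map from \<open>T\<close> to \<open>C\<^sub>m\<^sub>+\<^sub>1\<close>.\<close>

lemma chains_exact:
 assumes A: "A : \<A>" and m: "1 <= m" "m <= n"
 shows "hom_exact 1 (Cob (Suc m)) (Cob m) (Cob (m - 1)) (bdry m) (bdry (m - 1)) (Qob M A)"
 unfolding hom_exact_def sexact_def
proof (intro allI impI ballI)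
 fix k x
 let ?X = "Qob M A"
 have X: "cofibrant M ?X" using Qob(1) A A_sob by blast
 note X0 = cofibrant_ob[OF X] and S = sph_rep[OF cofibrant_ob[OF X], where k = k]
 assume k: "1 <= k" and x: "x : cyc ?X (Cob m) k"
  and nl: "nul ?X (Cob (m - 1)) k (post (Cob m) (Cob (m - 1)) k (bdry (m - 1)) x)"
 define T where "T = sph k ?X"
 have T: "T : ob P" "T = susp M k A" "cofibrant M T" using sph_Pi[OF A] by (auto simp: T_def)
 note T0 = cofibrant_ob[OF T(3)]
 obtain m' where m': "m = Suc m'" using m by (cases m) auto
 have o: "Cob (Suc m) : sob M" "Cob m : sob M" "Cob m' : sob M" "lev V (Suc m) : sob M" "lev V m : sob M" "lev V m' : sob M"
  using Cob V_ob m m' by auto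
 have b: "bdry m : hom (Cob (Suc m)) (Cob m) 0" "bdry m' : hom (Cob m) (Cob m') 0" using bdry_in m m' by auto
 have c: "ci (Suc m) : hom (Cob (Suc m)) (lev V (Suc m)) 0" "ci m : hom (Cob m) (lev V m) 0" "ci m' : hom (Cob m') (lev V m') 0"
  using ci_in m m' by auto
 have f: "!!i. i <= m ==> fce V m i : hom (lev V m) (lev V m') 0"
   "!!i. i <= Suc m ==> fce V (Suc m) i : hom (lev V (Suc m)) (lev V m) 0" using V_fce m m' by auto
 obtain v where v: "v : hom T (Cob m) 0" "post T (Cob m) k v (sph_cycle k ?X) = x" using S(3)[OF o(2) x] unfolding T_def by blast
 have bv: "bdry m' ** v : hom T (Cob m') 0" by (rule comp0_in[OF T0 o(2,3) v(1) b(2)])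
 have "post (Cob m) (Cob m') k (bdry m') x = post T (Cob m') k (bdry m' ** v) (sph_cycle k ?X)"
  using post_post[OF X0 S(1) o(2,3) cycle_in[OF S(2)] v(1)[unfolded T_def] b(2)] v(2) by (simp add: T_def)
 hence "edge_rel T (Cob m') (zmap T (Cob m')) (bdry m' ** v)"
  using nl null_iff_edge[OF X Cob_fibrant bv[unfolded T_def]] m m' by (simp add: T_def)
 hence lz: "loc M T (Cob m') (bdry m' ** v) = zarr (hocat M) T (Cob m')"
  using loc_inj[OF T(3) Cob_fibrant zmap_in[OF T0 o(3)] bv] edge_htp loc_zero[OF T0 o(3)] m m' by simp
 \<comment> \<open>The class of \<open>v\<close> in \<open>[T, V\<^sub>m]\<close> is a Moore cycle.\<close>
 define a where "a = loc M T (lev V m) (ci m ** v)"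
 have cv: "ci m ** v : hom T (lev V m) 0" by (rule comp0_in[OF T0 o(2,5) v(1) c(2)])
 have a: "a : ar (hocat M) T (lev V m)" unfolding a_def by (rule loc_in[OF T0 o(5) cv])
 have a': "a = hcmp M (loc M (Cob m) (lev V m) (ci m)) (loc M T (Cob m) v)" unfolding a_def by (rule loc_comp[OF T0 o(2,5) v(1) c(2), symmetric])
 have af: "hcmp M (loc M (lev V m) (lev V m') (fce V m i)) a = zarr (hocat M) T (lev V m')" if i: "i <= m" for i
 proof -
  have 1: "hcmp M (loc M (lev V m) (lev V m') (fce V m i)) a = loc M T (lev V m') ((fce V m i ** ci m) ** v)"
   unfolding a_def using loc_comp[OF T0 o(5,6) cv f(1)[OF i]] comp0_assoc[OF T0 o(2,5,6) v(1) c(2) f(1)[OF i]] by simp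
  show ?thesis
  proof (cases "i = 0")
   case True
   have "(fce V m i ** ci m) ** v = ci m' ** (bdry m' ** v)"
    using ci_bdry[of m'] m m' True comp0_assoc[OF T0 o(2,3,6) v(1) b(2) c(3)] by simp
   thus ?thesis unfolding 1 using loc_comp[OF T0 o(3,6) bv c(3)] lz hcmp_zarr[OF T0 o(3,6) loc_in[OF o(3,6) c(3)]] by simp
  next
   case False
   hence "(fce V m i ** ci m) ** v = zmap T (lev V m')"
    using ci_face[of m i] i m m' zmap_pre[OF T0 o(2,6) v(1)] by simp
   thus ?thesis unfolding 1 using loc_zero[OF T0 o(6)] by simp
  qed
 qed
 have "app (fce G m i) T (\<theta> m T a) = bpt (lev G (m - 1)) T" if "i <= m" for i
  using theta_face[OF T(1), of m' a i] af[OF that] theta_zero[OF _ T(1), of m'] a that m m' by simp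
 then obtain w where w: "w : val (lev G (Suc m)) T" "app (fce G (Suc m) 0) T w = \<theta> m T a"
   "!!i. 1 <= i ==> i <= Suc m ==> app (fce G (Suc m) i) T w = bpt (lev G m) T"
  using G_acyclic[OF A T(2,1) m(1) theta_in[OF _ T(1) a]] m by auto
 have "w : \<theta> (Suc m) T ` ar (hocat M) T (lev V (Suc m))"
  using bij_betw_imp_surj_on[OF theta_bij[of "Suc m" T]] w(1) m T(1) by simp
 then obtain w' where w': "w' : ar (hocat M) T (lev V (Suc m))" "\<theta> (Suc m) T w' = w" by blast
 have fw: "hcmp M (loc M (lev V (Suc m)) (lev V m) (fce V (Suc m) i)) w' = (if i = 0 then a else zarr (hocat M) T (lev V m))" if i: "i <= Suc m" for i
 proof (rule theta_inj[of m])
  show "hcmp M (loc M (lev V (Suc m)) (lev V m) (fce V (Suc m) i)) w' : ar (hocat M) T (lev V m)"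
   by (rule hcmp_in[OF T0 o(4,5) w'(1) loc_in[OF o(4,5) f(2)[OF i]]])
  show "(if i = 0 then a else zarr (hocat M) T (lev V m)) : ar (hocat M) T (lev V m)" using a zarr_hin[OF T0 o(5)] by simp
  show "\<theta> m T (hcmp M (loc M (lev V (Suc m)) (lev V m) (fce V (Suc m) i)) w') = \<theta> m T (if i = 0 then a else zarr (hocat M) T (lev V m))"
   using theta_face[OF T(1) m(2) w'(1) i] w'(2) w(2,3) i theta_zero[OF _ T(1), of m] m by auto
 qed (use m T in auto)
 have "Fc (hset M T V) (Suc m) i w' = zarr (hocat M) T (lev V (Suc m - 1))" if "1 <= i" "i <= Suc m" for i
  using fw[of i] that by (simp add: hset_def)
 then obtain y where y: "y : ar (hocat M) T (Cob (Suc m))" "hcmp M (loc M (Cob (Suc m)) (lev V (Suc m)) (ci (Suc m))) y = w'"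
  using E2_surj[OF _ T(1) _ _ _ w'(1)] zarr_hin[OF T0 o(1)] m by (metis Suc_eq_plus1 Suc_le_mono)
 obtain z where z: "z : hom T (Cob (Suc m)) 0" "loc M T (Cob (Suc m)) z = y"
  by (rule loc_surj[OF T(3) Cob_fibrant y(1)]) (use m in auto)
 have bz: "bdry m ** z : hom T (Cob m) 0" by (rule comp0_in[OF T0 o(1,2) z(1) b(1)])
 have cz: "ci (Suc m) ** z : hom T (lev V (Suc m)) 0" by (rule comp0_in[OF T0 o(1,4) z(1) c(1)])
 have eq: "ci m ** (bdry m ** z) = fce V (Suc m) 0 ** (ci (Suc m) ** z)"
  using comp0_assoc[OF T0 o(1,2,5) z(1) b(1) c(2)] comp0_assoc[OF T0 o(1,4,5) z(1) c(1) f(2)[OF le0]] ci_bdry[OF m(2)] by simp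
 have "loc M T (Cob m) v = loc M T (Cob m) (bdry m ** z)"
 proof (rule E2_inj[OF _ T(1)])
  have "hcmp M (loc M (Cob m) (lev V m) (ci m)) (loc M T (Cob m) (bdry m ** z)) = loc M T (lev V m) (fce V (Suc m) 0 ** (ci (Suc m) ** z))"
   using loc_comp[OF T0 o(2,5) bz c(2)] eq by simp
  also have "\<dots> = hcmp M (loc M (lev V (Suc m)) (lev V m) (fce V (Suc m) 0)) w'"
   using loc_comp[OF T0 o(4,5) cz f(2)[OF le0]] loc_comp[OF T0 o(1,4) z(1) c(1)] z(2) y(2) by simp
  also have "\<dots> = a" using fw[of 0] by simp
  finally show "hcmp M (loc M (Cob m) (lev V m) (ci m)) (loc M T (Cob m) v) = hcmp M (loc M (Cob m) (lev V m) (ci m)) (loc M T (Cob m) (bdry m ** z))"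
   using a' by simp
 qed (use m loc_in[OF T0 o(2) v(1)] loc_in[OF T0 o(2) bz] in auto)
 hence "htp M T (Cob m) v (bdry m ** z)" using loc_inj[OF T(3) Cob_fibrant v(1) bz] m by simp
 hence "edge_rel T (Cob m) v (bdry m ** z)" using htp_edge[OF T(3) Cob_fibrant v(1)] m by simp
 hence "pi_rel (mp ?X (Cob m)) (zmap ?X (Cob m)) k (post T (Cob m) k (bdry m ** z) (sph_cycle k ?X)) x"
  using edge_pi_rel[OF X Cob_fibrant, of m k v "bdry m ** z"] v(2) m by (simp add: T_def)
 moreover have "post T (Cob m) k (bdry m ** z) (sph_cycle k ?X) = post (Cob (Suc m)) (Cob m) k (bdry m) (post T (Cob (Suc m)) k z (sph_cycle k ?X))"
  using post_post[OF X0 S(1) o(1,2) cycle_in[OF S(2)] z(1)[unfolded T_def] b(1)] by (simp add: T_def)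
 moreover have "post T (Cob (Suc m)) k z (sph_cycle k ?X) : cyc ?X (Cob (Suc m)) k"
  unfolding T_def by (rule pmap_cycle[OF post_pmap[OF X0 S(1) o(1) z(1)[unfolded T_def]] S(2)])
 ultimately show "EX v:cyc ?X (Cob (Suc m)) k.
   pi_rel (mp ?X (Cob m)) (zmap ?X (Cob m)) k (post (Cob (Suc m)) (Cob m) k (bdry m) v) x" by auto
qed

lemma chains_exact_B:
 assumes m: "1 <= m" "m <= n"
 shows "hom_exact 1 (Cob (Suc m)) (Cob m) (Cob (m - 1)) (bdry m) (bdry (m - 1)) B"
 by (rule hom_exact_MA[OF Cob_fibrant Cob_fibrant Cob_fibrant _ _ A_sob chains_exact B])
  (use m bdry_in[of m] bdry_in[of "m - 1"] in auto)

subsection \<open>The attaching map composed with \<open>d\<^sub>0\<close> is nullhomotopic\<close>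

text \<open>In \<open>G\<close> this is \<open>d\<^sub>0d\<^sub>0 = d\<^sub>0d\<^sub>1\<close> on the basis, where \<open>d\<^sub>1\<close> vanishes.\<close>

lemma attaching_trivial:
 assumes T: "T : ob P" and x: "x : ar (hocat M) T B"
 shows "hcmp M (loc M B (Cob n) (bdry n ** dbar)) x = zarr (hocat M) T (Cob n)"
proof (rule E2_inj[OF _ T])
 note B0 = cofibrant_ob[OF B(2)] and T0 = Pi_sob[OF T]
 have o: "Cob (Suc n) : sob M" "Cob n : sob M" "lev V (Suc n) : sob M" "lev V n : sob M" using Cob V_ob by auto
 have b: "bdry n : hom (Cob (Suc n)) (Cob n) 0" by (rule bdry_in) simp
 have c: "ci (Suc n) : hom (Cob (Suc n)) (lev V (Suc n)) 0" "ci n : hom (Cob n) (lev V n) 0" using ci_in by auto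
 have d: "dbar : hom B (Cob (Suc n)) 0" using dbar Cob_top by simp
 have f: "fce V (Suc n) 0 : hom (lev V (Suc n)) (lev V n) 0" by (rule V_fce) auto
 define a where "a = ci (Suc n) ** dbar"
 have a: "a : hom B (lev V (Suc n)) 0" unfolding a_def by (rule comp0_in[OF B0 o(1,3) d c(1)])
 have bd: "bdry n ** dbar : hom B (Cob n) 0" by (rule comp0_in[OF B0 o(1,2) d b])
 have cb: "ci n ** (bdry n ** dbar) = fce V (Suc n) 0 ** a"
  unfolding a_def using comp0_assoc[OF B0 o(1,2,4) d b c(2)] comp0_assoc[OF B0 o(1,3,4) d c(1) f] ci_bdry[of n] by simp
 let ?a = "loc M B (lev V (Suc n)) a"
 have la: "?a : ar (hocat M) B (lev V (Suc n))" by (rule loc_in[OF B0 o(3) a])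
 have ax: "hcmp M ?a x : ar (hocat M) T (lev V (Suc n))" by (rule hcmp_in[OF T0 B0 o(3) x la])
 define y where "y = \<beta> T x"
 have y: "y : val (Gbar (n + 2)) T" using \<beta> T x unfolding y_def palg_iso_def palg_map_def by (simp add: piA_def)
 note gb = G_basis(1)[of "n + 2"]
 have gy: "app (gbar (n + 2)) T y : val (lev G (n + 2)) T" by (rule Alg_ar_val[OF gb T y])
 have fG: "fce G (n + 2) i : ar (Alg M \<A>) (lev G (n + 2)) (lev G (n + 1))" if "i <= n + 2" for i using G_fce[of i "n + 1"] that by simp
 have fG': "fce G (n + 1) i : ar (Alg M \<A>) (lev G (n + 1)) (lev G n)" if "i <= n + 1" for i using G_fce[of i n] that by simp
 have "\<theta> n T (hcmp M (loc M (lev V (Suc n)) (lev V n) (fce V (Suc n) 0)) (hcmp M ?a x)) = app (fce G (n + 1) 0) T (\<theta> (Suc n) T (hcmp M ?a x))"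
  using theta_face[OF T, of n "hcmp M ?a x" 0] ax by simp
 also have "\<theta> (Suc n) T (hcmp M ?a x) = app (fce G (n + 2) 0) T (app (gbar (n + 2)) T y)"
  using attaching[rule_format, OF T x] Alg_cmp[OF gb T y, of "fce G (n + 2) 0"] Cob_top by (simp add: a_def y_def)
 also have "app (fce G (n + 1) 0) T \<dots> = app (cmp (Alg M \<A>) (fce G (n + 1) 0) (fce G (n + 2) 0)) T (app (gbar (n + 2)) T y)"
  using Alg_cmp[OF fG[of 0] T gy, of "fce G (n + 1) 0"] by simp
 also have "\<dots> = app (cmp (Alg M \<A>) (fce G (n + 1) 0) (fce G (n + 2) 1)) T (app (gbar (n + 2)) T y)"
  using G_face_face[of 0 1 n] by simp
 also have "\<dots> = app (fce G (n + 1) 0) T (app (cmp (Alg M \<A>) (fce G (n + 2) 1) (gbar (n + 2))) T y)"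
  using Alg_cmp[OF fG[of 1] T gy, of "fce G (n + 1) 0"] Alg_cmp[OF gb T y, of "fce G (n + 2) 1"] by simp
 also have "app (cmp (Alg M \<A>) (fce G (n + 2) 1) (gbar (n + 2))) T y = bpt (lev G (n + 1)) T"
  using G_attach[of 1 "n + 2"] Alg_zarr[OF inf_univ G_basis(2) G_ob T y, of "n + 1"] by simp
 also have "app (fce G (n + 1) 0) T \<dots> = bpt (lev G n) T" by (rule Alg_ar[OF fG'[OF le0] T G_bpt[OF T]])
 also have "\<dots> = \<theta> n T (zarr (hocat M) T (lev V n))" using theta_zero[OF _ T, of n] by simp
 finally have "hcmp M (loc M (lev V (Suc n)) (lev V n) (fce V (Suc n) 0)) (hcmp M ?a x) = zarr (hocat M) T (lev V n)"
  by (intro theta_inj[OF _ T, of n] hcmp_in[OF T0 o(3,4) ax loc_in[OF o(3,4) f]] zarr_hin[OF T0 o(4)]) auto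
 moreover have "hcmp M (loc M (lev V (Suc n)) (lev V n) (fce V (Suc n) 0)) (hcmp M ?a x) = hcmp M (loc M B (lev V n) (ci n ** (bdry n ** dbar))) x"
  using hcmp_assoc[OF T0 B0 o(3,4) x la loc_in[OF o(3,4) f]] loc_comp[OF B0 o(3,4) a f] cb by simp
 moreover have "\<dots> = hcmp M (loc M (Cob n) (lev V n) (ci n)) (hcmp M (loc M B (Cob n) (bdry n ** dbar)) x)"
  using hcmp_assoc[OF T0 B0 o(2,4) x loc_in[OF B0 o(2) bd] loc_in[OF o(2,4) c(2)]] loc_comp[OF B0 o(2,4) bd c(2)] by simp
 ultimately show "hcmp M (loc M (Cob n) (lev V n) (ci n)) (hcmp M (loc M B (Cob n) (bdry n ** dbar)) x) =
   hcmp M (loc M (Cob n) (lev V n) (ci n)) (zarr (hocat M) T (Cob n))"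
  using hcmp_zarr[OF T0 o(2,4) loc_in[OF o(2,4) c(2)]] by simp
 show "hcmp M (loc M B (Cob n) (bdry n ** dbar)) x : ar (hocat M) T (Cob n)" by (rule hcmp_in[OF T0 B0 o(2) x loc_in[OF B0 o(2) bd]])
 show "zarr (hocat M) T (Cob n) : ar (hocat M) T (Cob n)" by (rule zarr_hin[OF T0 o(2)])
qed simp

text \<open>The map is replaced by a fibration \<open>g\<close> on an object \<open>R\<close> equivalent to \<open>B\<close>.  Maps from suspensions to \<open>R\<close>
 factor through \<open>B\<close> in the homotopy category, so \<open>g\<close> is trivial on homotopy groups.\<close>

lemma attaching_null: "edge_rel B (Cob n) (zmap B (Cob n)) (bdry n ** dbar)"
proof -
 note B0 = cofibrant_ob[OF B(2)]
 have Q: "crep M B = (B, sid M B)" by (rule Qob_cofibrant[OF B(2)])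
 have Cn: "Cob n : sob M" "fibrant M (Cob n)" using Cob Cob_fibrant by auto
 have bd: "bdry n ** dbar : hom B (Cob n) 0"
  using comp0_in[OF B0 Cob Cn(1) _ bdry_in] dbar Cob_top by simp
 have "(B, Cob n, bdry n ** dbar) : arrs (uc M)" using B0 Cn bd by (simp add: arrs_def)
 then obtain R j g where jg: "(B, R, j) : cof M \<inter> weq M" "(R, Cob n, g) : fib M" "bdry n ** dbar = g ** j"
  using ms_factor[OF ms] uc_simps(4) by metis
 have j: "(B, R, j) : cof M" "(B, R, j) : weq M" "R : sob M" "j : hom B R 0" "g : hom R (Cob n) 0"
  using jg cof_arr fib_arr by auto
 note R0 = j(3)
 have R: "cofibrant M R" "fibrant M R" using cofibrant_cof[OF B(2) j(1)] fibrant_fib[OF Cn(2) jg(2)] by auto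
 have RR: "crep M R = (R, sid M R)" "brep M R = (R, sid M R)"
  using Qob_cofibrant[OF R(1)] RQob_fibrant[OF R(2)] by auto
 let ?Q = "RQob M B" and ?r = "snd (brep M B)"
 have rq: "fibrant M ?Q" "(B, ?Q, ?r) : cof M" "(B, ?Q, ?r) : weq M" using RQob[OF B0] Q by auto
 have q0: "?Q : sob M" "?r : hom B ?Q 0" using cof_arr[OF rq(2)] by auto
 \<comment> \<open>\<open>j\<close> is an isomorphism in the homotopy category: \<open>k\<close> represents it and \<open>l\<close> its inverse.\<close>
 obtain k where k: "k : hom ?Q R 0" "k ** ?r = j" by (rule extend_fibrant[OF rq(2,3) R(2) j(4)])
 obtain l where l: "l : hom R ?Q 0" "l ** j = ?r" by (rule extend_fibrant[OF j(1,2) rq(1) q0(2)])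
 have kl: "k ** l : hom R R 0" by (rule comp0_in[OF R0 q0(1) R0 l(1) k(1)])
 have "(k ** l) ** j = sid M R ** j"
  using comp0_assoc[OF B0 R0 q0(1) R0 j(4) l(1) k(1)] k(2) l(2) comp0_id(2)[OF B0 R0 j(4)] by simp
 hence hkl: "htp M R R (k ** l) (sid M R)"
  using htp_extend[OF j(1,2) B(2) R(2) kl sid_in[OF R0]] htp_refl by simp
 have lj: "loc M B R j = hcls B R k"
  by (rule loc_eq[OF B0 R0 j(4), of j]) (use Q RR R0 j(4) k q0 comp0_id[OF B0 R0 j(4)] htp_refl in auto)
 have kills: "nul (Qob M A) (Cob n) i (post R (Cob n) i g z)"
  if A: "A : \<A>" and z: "z : cyc (Qob M A) R i" for A i z
 proof -
  have X: "cofibrant M (Qob M A)" using Qob(1) A A_sob by blast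
  note X0 = cofibrant_ob[OF X] and S = sph_rep[OF cofibrant_ob[OF X], where k = i]
  let ?T = "sph i (Qob M A)"
  have T: "?T : ob P" "cofibrant M ?T" using sph_Pi[OF A] by auto
  obtain h where h: "h : hom ?T R 0" "post ?T R i h (sph_cycle i (Qob M A)) = z" using S(3)[OF R0 z] by blast
  have gh: "g ** h : hom ?T (Cob n) 0" by (rule comp0_in[OF S(1) R0 Cn(1) h(1) j(5)])
  obtain b where b: "b : hom (RQob M ?T) R 0" "loc M ?T R h = hcls ?T R b"
   using loc_in[OF S(1) R0 h(1)] RR unfolding hocat_simps by auto
  note T' = QR_maps(2)[OF S(1)]
  have lb: "l ** b : hom (RQob M ?T) ?Q 0" by (rule comp0_in[OF T' R0 q0(1) b(1) l(1)])
  define x where "x = hcls ?T B (l ** b)"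
  have x: "x : ar (hocat M) ?T B" unfolding hocat_simps x_def using lb by simp
  have "htp M (RQob M ?T) R (k ** (l ** b)) b"
   using htp_pre[OF T' R0 R0 b(1) hkl] comp0_assoc[OF T' R0 q0(1) R0 b(1) l(1) k(1)] comp0_id(2)[OF T' R0 b(1)] by simp
  hence "hcmp M (loc M B R j) x = loc M ?T R h"
   unfolding lj x_def using hcmp_hcls[OF S(1) B0 R0 lb, of k] k(1) RR b(2) hcls_eq[of ?T R "k ** (l ** b)" b] by simp
  hence "loc M ?T (Cob n) (g ** h) = hcmp M (loc M R (Cob n) g) (hcmp M (loc M B R j) x)"
   using loc_comp[OF S(1) R0 Cn(1) h(1) j(5)] by simp
  also have "\<dots> = hcmp M (loc M B (Cob n) (bdry n ** dbar)) x"
   using hcmp_assoc[OF S(1) B0 R0 Cn(1) x loc_in[OF B0 R0 j(4)] loc_in[OF R0 Cn(1) j(5)]] loc_comp[OF B0 R0 Cn(1) j(4,5)] jg(3) by simp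
  also have "\<dots> = loc M ?T (Cob n) (zmap ?T (Cob n))" using attaching_trivial[OF T(1) x] loc_zero[OF S(1) Cn(1)] by simp
  finally have "htp M ?T (Cob n) (zmap ?T (Cob n)) (g ** h)"
   using loc_inj[OF T(2) Cn(2) zmap_in[OF S(1) Cn(1)] gh] by simp
  hence "edge_rel ?T (Cob n) (zmap ?T (Cob n)) (g ** h)" by (rule htp_edge[OF T(2) Cn(2) zmap_in[OF S(1) Cn(1)]])
  hence "nul (Qob M A) (Cob n) i (post ?T (Cob n) i (g ** h) (sph_cycle i (Qob M A)))"
   using null_iff_edge[OF X Cn(2) gh] by simp
  thus ?thesis using post_post[OF X0 S(1) R0 Cn(1) cycle_in[OF S(2)] h(1) j(5)] h(2) by simp
 qed
 show ?thesis using trivial_on_homotopy[OF jg(2) R(2) Cn(2) A_sob kills B j(4)] jg(3) by simp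
qed

subsection \<open>The tower\<close>

definition is_tower :: "nat => (nat => 'a) => bool" where
 "is_tower k H \<longleftrightarrow> H 0 = dbar & (ALL j. j < k --> H (Suc j) : hom B (Cob (n - j)) (Suc j) &
     fc B (Cob (n - j)) (Suc j) 0 (H (Suc j)) = post (Cob (Suc (n - j))) (Cob (n - j)) j (bdry (n - j)) (H j) &
     (ALL i. 1 <= i & i <= Suc j --> fc B (Cob (n - j)) (Suc j) i (H (Suc j)) = zsimp M B (Cob (n - j)) j))"

text \<open>In a step the last simplex of the tower is corrected by a cycle before its image is filled; its
 faces, and hence the earlier part of the tower, stay the same.\<close>

lemma tower_ex: "k <= n ==> 1 <= k ==> EX H. is_tower k H"
proof (induction k rule: nat_induct)
 case (Suc k)
 note B0 = cofibrant_ob[OF B(2)]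
 show ?case
 proof (cases k)
  case 0
  obtain e where e: "e : hom B (Cob n) (Suc 0)" "src B (Cob n) e = zmap B (Cob n)" "tgt B (Cob n) e = bdry n ** dbar"
   using attaching_null by (auto simp: edge_rel_def)
  have "is_tower (Suc 0) (%j. if j = 0 then dbar else e)"
   unfolding is_tower_def using e by (auto simp: zsimp_def le_Suc_eq)
  thus ?thesis using 0 by blast
 next
  case (Suc k')
  hence k: "k = Suc k'" "1 <= k" "k <= n" "k < n" using Suc.prems by auto
  obtain H where H: "is_tower k H" using Suc.IH[OF k(3,2)] by blast
  define m where "m = n - k"
  have m: "n - k' = Suc m" "1 <= m" "m <= n" "Suc m <= n" "m - 1 <= n + 1" "m - 1 <= n" using k by (auto simp: m_def)
  have o: "Cob (Suc (Suc m)) : sob M" "Cob (Suc m) : sob M" "Cob m : sob M" "Cob (m - 1) : sob M" using Cob m by auto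
  have b: "bdry (Suc m) : hom (Cob (Suc (Suc m))) (Cob (Suc m)) 0" "bdry m : hom (Cob (Suc m)) (Cob m) 0"
   "bdry (m - 1) : hom (Cob m) (Cob (m - 1)) 0" using bdry_in[of "Suc m"] bdry_in[of m] bdry_in[of "m - 1"] m by auto
  have h: "H k : hom B (Cob (Suc m)) k" and h0: "fc B (Cob (Suc m)) k 0 (H k) = post (Cob (Suc (Suc m))) (Cob (Suc m)) k' (bdry (Suc m)) (H k')"
   and hi: "!!i. 1 <= i ==> i <= k ==> fc B (Cob (Suc m)) k i (H k) = zcst B (Cob (Suc m)) (k - 1)"
   using H k m(1) unfolding is_tower_def by (auto simp: zsimp_def)
  have hk': "H k' : hom B (Cob (Suc (Suc m))) k'"
  proof (cases k')
   case 0
   thus ?thesis using H dbar Cob_top k m by (auto simp: is_tower_def)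
  next
   case (Suc k'')
   moreover have "n - k'' = Suc (Suc m)" using m(1) Suc k by simp
   ultimately show ?thesis using H k unfolding is_tower_def by (metis lessI less_SucI)
  qed
  let ?K = "mp B (Cob (Suc m))" and ?L = "mp B (Cob m)"
  note pm = post_pmap[OF B0 o(2,3) b(2)]
  have bb: "post (Cob (Suc m)) (Cob m) j (bdry m) (post (Cob (Suc (Suc m))) (Cob (Suc m)) j (bdry (Suc m)) x) = cst ?L j (zmap B (Cob m))"
   if x: "x : hom B (Cob (Suc (Suc m))) j" for x j
  proof -
   have "post (Cob (Suc m)) (Cob m) j (bdry m) (post (Cob (Suc (Suc m))) (Cob (Suc m)) j (bdry (Suc m)) x) =
     scmp M j (zcst (Cob (Suc (Suc m))) (Cob m) j) x"
    using post_post[OF B0 o(1-3) x b(1,2)] bdry_bdry[OF m(4)] by (simp add: postc_def)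
   also have "\<dots> = cst ?L j (zmap B (Cob m))" using post_zmap[OF B0 o(1,3) x] by (simp add: postc_def zsimp_def)
   finally show ?thesis .
  qed
  have fh: "post (Cob (Suc m)) (Cob m) k (bdry m) (H k) : pi_cycles ?L (zmap B (Cob m)) k"
  proof -
   have "Fc ?L k i (post (Cob (Suc m)) (Cob m) k (bdry m) (H k)) = cst ?L (k - 1) (zmap B (Cob m))" if i: "i <= k" for i
   proof -
    have e: "Fc ?L k i (post (Cob (Suc m)) (Cob m) k (bdry m) (H k)) = post (Cob (Suc m)) (Cob m) k' (bdry m) (Fc ?K k i (H k))"
     using smap_face[OF pmapD(3)[OF pm], of "H k" k' i] h i k by simp
    have z: "post (Cob (Suc m)) (Cob m) k' (bdry m) (cst ?K k' (zmap B (Cob (Suc m)))) = cst ?L k' (zmap B (Cob m))"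
     using smap_cst[OF pmapD(3,1,2)[OF pm]] pmapD(4)[OF pm] by simp
    show ?thesis unfolding e using h0 hi[of i] bb[OF hk'] z i k by (cases "i = 0") auto
   qed
   thus ?thesis using smap_in[OF pmapD(3)[OF pm] h] by (simp add: pi_cycles_def)
  qed
  have "nul B (Cob (m - 1)) k (post (Cob m) (Cob (m - 1)) k (bdry (m - 1)) (post (Cob (Suc m)) (Cob m) k (bdry m) (H k)))"
  proof -
   have "bdry (m - 1) ** bdry m = zmap (Cob (Suc m)) (Cob (m - 1))" using bdry_bdry[of "m - 1"] m by simp
   hence "post (Cob m) (Cob (m - 1)) k (bdry (m - 1)) (post (Cob (Suc m)) (Cob m) k (bdry m) (H k)) = zcst B (Cob (m - 1)) k"
    using post_post[OF B0 o(2-4) h b(2,3)] post_zmap[OF B0 o(2,4) h] by (simp add: zsimp_def)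
   thus ?thesis using cst_null[OF sset[OF B0 o(4)] zmap_in[OF B0 o(4)]] by simp
  qed
  then obtain v where v0: "v : pi_cycles ?K (zmap B (Cob (Suc m))) k"
   "pi_rel ?L (zmap B (Cob m)) k (post (Cob (Suc m)) (Cob m) k (bdry m) v) (post (Cob (Suc m)) (Cob m) k (bdry m) (H k))"
   using chains_exact_B[OF m(2,3)] fh k(2) unfolding hom_exact_def sexact_def by blast
  have kan: "kan ?K" "kan ?L" using kan_hom[OF B(2) Cob_fibrant] m by auto
  note v = v0(1) pi_rel_imp_rel12[OF kan(2) sset[OF B0 o(3)] zmap_in[OF B0 o(3)] k(2) fh pmap_cycle[OF pm v0(1)] v0(2)]
  obtain h' where h': "h' : hom B (Cob (Suc m)) k" "Fc ?K k 0 h' = Fc ?K k 0 (H k)"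
   and h'i: "!!i. 1 <= i ==> i <= k ==> Fc ?K k i h' = cst ?K (k - 1) (zmap B (Cob (Suc m)))"
   and nl: "null ?L (zmap B (Cob m)) k (post (Cob (Suc m)) (Cob m) k (bdry m) h')"
   by (rule subtract_cycle[OF kan(1) pmapD(1,2)[OF pm] kan(2) sset[OF B0 o(3)] pmapD(3,4)[OF pm] k(2) h hi v(1) fh v(2)])
    (assumption, assumption, rule that)
  obtain w where w: "w : hom B (Cob m) (Suc k)" "Fc ?L (Suc k) 0 w = post (Cob (Suc m)) (Cob m) k (bdry m) h'"
   and wi: "!!i. 1 <= i ==> i <= Suc k ==> Fc ?L (Suc k) i w = cst ?L k (zmap B (Cob m))"
   using nl unfolding null_alt by blast
  have "is_tower (Suc k) (%j. if j = k then h' else if j = Suc k then w else H j)"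
   unfolding is_tower_def
  proof (intro conjI allI impI)
   show "(if 0 = k then h' else if 0 = Suc k then w else H 0) = dbar" using H k by (simp add: is_tower_def)
   fix j assume j: "j < Suc k"
   consider "j = k" | "j = k'" | "j < k'" using j k by linarith
   hence "(if Suc j = k then h' else if Suc j = Suc k then w else H (Suc j)) : hom B (Cob (n - j)) (Suc j) &
    fc B (Cob (n - j)) (Suc j) 0 (if Suc j = k then h' else if Suc j = Suc k then w else H (Suc j)) =
     post (Cob (Suc (n - j))) (Cob (n - j)) j (bdry (n - j)) (if j = k then h' else if j = Suc k then w else H j) &
    (ALL i. 1 <= i & i <= Suc j --> fc B (Cob (n - j)) (Suc j) i (if Suc j = k then h' else if Suc j = Suc k then w else H (Suc j)) = zsimp M B (Cob (n - j)) j)"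
   proof cases
    case 1
    have "n - j = m" using 1 by (simp add: m_def)
    thus ?thesis using 1 w wi by (auto simp: zsimp_def)
   next
    case 2
    thus ?thesis using h' h'i h0 m(1) k(1) by (auto simp: zsimp_def)
   next
    case 3
    hence "j < k" "Suc j ~= k" "j ~= k" "Suc j ~= Suc k" "j ~= Suc k" using k(1) by auto
    thus ?thesis using H unfolding is_tower_def by simp
   qed
   thus "(if Suc j = k then h' else if Suc j = Suc k then w else H (Suc j)) : hom B (Cob (n - j)) (Suc j)"
    "fc B (Cob (n - j)) (Suc j) 0 (if Suc j = k then h' else if Suc j = Suc k then w else H (Suc j)) =
     post (Cob (Suc (n - j))) (Cob (n - j)) j (bdry (n - j)) (if j = k then h' else if j = Suc k then w else H j)"
    "1 <= i & i <= Suc j ==> fc B (Cob (n - j)) (Suc j) i (if Suc j = k then h' else if Suc j = Suc k then w else H (Suc j)) = zsimp M B (Cob (n - j)) j" for i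
    by blast+
  qed
  thus ?thesis by blast
 qed
qed simp

text \<open>In \<open>V\<close> there are two simplicial directions, that of the mapping complexes and that of \<open>V\<close>.  The other
 faces of the tower vanish in the one by construction and in the other because the tower
 consists of chains.\<close>

lemma V_tower:
 obtains H where "H 0 = \<iota> ** dbar" "!!k. k <= n ==> H k : hom B (lev V (n + 1 - k)) k"
  "!!k. k < n ==> fc B (lev V (n - k)) (Suc k) 0 (H (Suc k)) = post (lev V (n + 1 - k)) (lev V (n - k)) k (fce V (n + 1 - k) 0) (H k)"
  "!!k i. k < n ==> 1 <= i ==> i <= Suc k ==> fc B (lev V (n - k)) (Suc k) i (H (Suc k)) = zsimp M B (lev V (n - k)) k"
  "!!k i. k <= n ==> 1 <= i ==> i <= n + 1 - k ==> post (lev V (n + 1 - k)) (lev V (n - k)) k (fce V (n + 1 - k) i) (H k) = zsimp M B (lev V (n - k)) k"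
proof -
 note B0 = cofibrant_ob[OF B(2)]
 obtain T where T: "is_tower n T" using tower_ex[OF order_refl n] by blast
 define H where "H k = post (Cob (n + 1 - k)) (lev V (n + 1 - k)) k (ci (n + 1 - k)) (T k)" for k
 have Tin: "T k : hom B (Cob (n + 1 - k)) k" if "k <= n" for k
  using that T dbar Cob_top unfolding is_tower_def by (cases k) auto
 show thesis
 proof (rule that[of H])
  show "H 0 = \<iota> ** dbar" using T Cob_top by (simp add: H_def is_tower_def)
  show "H k : hom B (lev V (n + 1 - k)) k" if "k <= n" for k
   unfolding H_def by (rule post_in[OF B0 Cob V_ob ci_in Tin[OF that]]) auto
  fix k assume k: "k < n"
  define m where "m = n - k"
  have m: "n + 1 - k = Suc m" "n + 1 - Suc k = m" "m <= n" using k by (auto simp: m_def)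
  have o: "Cob (Suc m) : sob M" "Cob m : sob M" "lev V (Suc m) : sob M" "lev V m : sob M" using Cob V_ob m by auto
  have c: "ci (Suc m) : hom (Cob (Suc m)) (lev V (Suc m)) 0" "ci m : hom (Cob m) (lev V m) 0" using ci_in m by auto
  have Tk: "T (Suc k) : hom B (Cob m) (Suc k)" "T k : hom B (Cob (Suc m)) k" using Tin[of "Suc k"] Tin[of k] k m by auto
  have T0: "fc B (Cob m) (Suc k) 0 (T (Suc k)) = post (Cob (Suc m)) (Cob m) k (bdry m) (T k)"
   and Ti: "!!i. 1 <= i ==> i <= Suc k ==> fc B (Cob m) (Suc k) i (T (Suc k)) = zsimp M B (Cob m) k"
   using T k by (auto simp: is_tower_def m_def)
  have f: "fc B (lev V m) (Suc k) i (H (Suc k)) = post (Cob m) (lev V m) k (ci m) (fc B (Cob m) (Suc k) i (T (Suc k)))" if "i <= Suc k" for i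
   using smap_face[OF smap_post[OF B0 o(2,4) c(2)] Tk(1) that] m(2) by (simp add: H_def)
  have fV: "fce V (Suc m) 0 : hom (lev V (Suc m)) (lev V m) 0" by (rule V_fce) (use m in auto)
  show "fc B (lev V (n - k)) (Suc k) 0 (H (Suc k)) = post (lev V (n + 1 - k)) (lev V (n - k)) k (fce V (n + 1 - k) 0) (H k)"
   using f[of 0] T0 post_post[OF B0 o(1,2,4) Tk(2) bdry_in[OF m(3)] c(2)] post_post[OF B0 o(1,3,4) Tk(2) c(1) fV] ci_bdry[OF m(3)] m(1)
   by (simp add: H_def m_def[symmetric])
  show "fc B (lev V (n - k)) (Suc k) i (H (Suc k)) = zsimp M B (lev V (n - k)) k" if "1 <= i" "i <= Suc k" for i
   using f[of i] Ti[OF that] that post_zsimp[OF B0 o(2,4) c(2)] by (simp add: m_def[symmetric])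
 next
  fix k i assume k: "k <= n" and i: "1 <= i" "i <= n + 1 - k"
  define m where "m = n - k"
  have m: "n + 1 - k = Suc m" "m <= n" using k by (auto simp: m_def)
  have o: "Cob (Suc m) : sob M" "lev V (Suc m) : sob M" "lev V m : sob M" using Cob V_ob m by auto
  have c: "ci (Suc m) : hom (Cob (Suc m)) (lev V (Suc m)) 0" using ci_in m by auto
  have Tk: "T k : hom B (Cob (Suc m)) k" using Tin[OF k] m by simp
  have fV: "fce V (Suc m) i : hom (lev V (Suc m)) (lev V m) 0" by (rule V_fce) (use m i in auto)
  have "fce V (Suc m) i ** ci (Suc m) = zmap (Cob (Suc m)) (lev V m)" using ci_face[of "Suc m" i] i m by simp
  hence "post (lev V (Suc m)) (lev V m) k (fce V (Suc m) i) (post (Cob (Suc m)) (lev V (Suc m)) k (ci (Suc m)) (T k)) = zsimp M B (lev V m) k"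
   using post_post[OF B0 o Tk c fV] post_zmap[OF B0 o(1,3) Tk] by simp
  thus "post (lev V (n + 1 - k)) (lev V (n - k)) k (fce V (n + 1 - k) i) (H k) = zsimp M B (lev V (n - k)) k"
   using m(1) by (simp add: H_def m_def[symmetric])
 qed
qed

end

section \<open>Words and flag complexes\<close>

lemma length_ins [simp]: "length (ins i w) = Suc (length w)"
 by (induction i w rule: ins.induct) auto

lemma ins_low: "ALL k:set w. i < k ==> ins i w = i # w"
 by (cases w) auto

lemma set_ins_low: "c <= i ==> ALL k:set w. c <= k ==> ALL k:set (ins i w). c <= k"
 by (induction i w rule: ins.induct) auto

lemma sorted_ins: "sorted_wrt (<) w ==> sorted_wrt (<) (ins i w)"
proof (induction i w rule: ins.induct)
 case (2 i j w)
 have "ALL k:set (ins (Suc i) w). Suc j <= k" if "j <= i" by (rule set_ins_low) (use 2 that in auto)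
 thus ?case using 2 by (auto simp: Suc_le_eq)
qed simp

lemma ins_ins: "j <= i ==> ins i (ins j w) = ins j (ins (Suc i) w)"
proof (induction w arbitrary: i j)
 case (Cons k w)
 show ?case using Cons.prems Cons.IH[of "Suc j" "Suc i"] by auto
qed auto

lemma foldr_ins: "foldr ins (ins i v) x = ins i (foldr ins v x)"
proof (induction i v rule: ins.induct)
 case (2 i j w)
 thus ?case using ins_ins[of j i] by auto
qed simp

text \<open>The increasing words form a module over all words under composition, so a word may be
 normalized at any place inside a longer one.\<close>

lemma foldr_norm: "foldr ins (norm_word v) x = foldr ins v x"
 by (induction v) (simp_all add: norm_word_def foldr_ins)

lemma norm_norm: "norm_word (u @ norm_word v @ w) = norm_word (u @ v @ w)"
 using foldr_norm[of v] by (simp add: norm_word_def)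

lemma norm_norm_left: "norm_word (norm_word v @ w) = norm_word (v @ w)"
 and norm_norm_right: "norm_word (u @ norm_word v) = norm_word (u @ v)"
 using norm_norm[of "[]" v w] norm_norm[of u v "[]"] by simp_all

lemma length_norm [simp]: "length (norm_word w) = length w"
 by (induction w) (simp_all add: norm_word_def)

lemma sorted_norm: "sorted_wrt (<) (norm_word w)"
 by (induction w) (simp_all add: norm_word_def sorted_ins)

lemma norm_sorted: "sorted_wrt (<) w ==> norm_word w = w"
 by (induction w) (auto simp: norm_word_def ins_low)

lemma norm_Nil [simp]: "norm_word [] = []" and norm_single [simp]: "norm_word [c] = [c]"
 by (simp_all add: norm_word_def)

lemma norm_eq_Nil [simp]: "norm_word w = [] \<longleftrightarrow> w = []"
 using length_norm[of w] by (metis length_0_conv)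

lemma sum_ins: "i + sum_list w <= sum_list (ins i w)"
 by (induction i w rule: ins.induct) auto

text \<open>Rewriting only increases letters.  This bounds the letters of the words in a flag complex, which is
 therefore finite in each degree.\<close>

lemma sum_norm: "sum_list w <= sum_list (norm_word w)"
proof (induction w)
 case (Cons i w)
 thus ?case using sum_ins[of i "norm_word w"] by (simp add: norm_word_def)
qed simp

lemma ins_upt: "ins c [c..<c + q] = [c..<Suc (c + q)]"
proof (induction q arbitrary: c)
 case (Suc q)
 have "[c..<c + Suc q] = c # [Suc c..<Suc c + q]" by (simp add: upt_conv_Cons del: upt_Suc)
 thus ?case using Suc[of "Suc c"] by (simp add: upt_conv_Cons del: upt_Suc)
qed simp

lemma norm_zeros: "norm_word (replicate q 0) = [0..<q]"
proof (induction q)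
 case (Suc q)
 thus ?case using ins_upt[of 0 q] by (simp add: norm_word_def)
qed simp

definition merge_at :: "nat => nat list list => nat list list" where
 "merge_at i s = take i s @ [norm_word (s ! i @ s ! Suc i)] @ drop (i + 2) s"

definition empty_at :: "nat => nat list list => nat list list" where
 "empty_at i s = take (Suc i) s @ [[]] @ drop (Suc i) s"

lemma merge_split [simp]: "length xs = i ==> merge_at i (xs @ u # v # ys) = xs @ norm_word (u @ v) # ys"
 and empty_split [simp]: "length xs = i ==> empty_at i (xs @ u # ys) = xs @ u # [] # ys"
 by (auto simp: merge_at_def empty_at_def nth_append)

lemma flag_Sx: "s : Sx (flag_complex \<phi>) j \<longleftrightarrow> length s = j + 2 & (ALL w:set s. sorted_wrt (<) w) & norm_word (concat s) = \<phi>"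
 and flag_Fc: "Fc (flag_complex \<phi>) n i s = merge_at i s" and flag_Dg: "Dg (flag_complex \<phi>) n i s = empty_at i s"
 by (simp_all add: flag_complex_def merge_at_def empty_at_def)

lemma split2:
 assumes "Suc i < length s"
 obtains xs u v ys where "s = xs @ u # v # ys" "length xs = i"
proof -
 obtain xs u zs where 1: "s = xs @ u # zs" "length xs = i" using split_list_at[of i s] assms by auto
 then obtain v ys where "zs = v # ys" using assms by (cases zs) auto
 thus thesis using that 1 by blast
qed

lemma merge_merge:
 assumes "i < j" "Suc j < length s"
 shows "merge_at i (merge_at j s) = merge_at (j - 1) (merge_at i s)"
proof -
 obtain xs u v ys where s: "s = xs @ u # v # ys" "length xs = i" by (rule split2[of i s]) (use assms in auto)
 show ?thesis
 proof (cases "j = Suc i")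
  case True
  then obtain w zs where y: "ys = w # zs" using assms s by (cases ys) auto
  have "merge_at j s = xs @ u # norm_word (v @ w) # zs" using merge_split[of "xs @ [u]" j v w zs] s y True by simp
  thus ?thesis using True s y by (simp add: norm_norm_left norm_norm_right)
 next
  case False
  then obtain d where d: "j = Suc (Suc (i + d))" using assms less_iff_Suc_add[of "Suc i" j] by auto
  obtain zs a b ws where z: "ys = zs @ a # b # ws" "length zs = d" by (rule split2[of d ys]) (use assms s d in auto)
  have "merge_at j s = xs @ u # v # zs @ norm_word (a @ b) # ws" using merge_split[of "xs @ u # v # zs" j a b ws] s z d by simp
  moreover have "merge_at (j - 1) (merge_at i s) = xs @ norm_word (u @ v) # zs @ norm_word (a @ b) # ws"
   using merge_split[of "xs @ norm_word (u @ v) # zs" "j - 1" a b ws] s z d by simp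
  ultimately show ?thesis using s by simp
 qed
qed

lemma empty_empty:
 assumes "i <= j" "j < length s"
 shows "empty_at i (empty_at j s) = empty_at (Suc j) (empty_at i s)"
proof -
 obtain xs u ys where s: "s = xs @ u # ys" "length xs = i" by (rule split_list_at[of i s]) (use assms in auto)
 show ?thesis
 proof (cases "i = j")
  case True
  thus ?thesis using s empty_split[of "xs @ [u]" "Suc j" "[]" ys] by simp
 next
  case False
  then obtain d where d: "j = Suc (i + d)" using assms less_iff_Suc_add[of i j] by auto
  obtain zs a ws where z: "ys = zs @ a # ws" "length zs = d" by (rule split_list_at[of d ys]) (use assms s d in auto)
  have "empty_at j s = xs @ u # zs @ a # [] # ws" using empty_split[of "xs @ u # zs" j a ws] s z d by simp
  moreover have "empty_at (Suc j) (empty_at i s) = xs @ u # [] # zs @ a # [] # ws"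
   using empty_split[of "xs @ u # [] # zs" "Suc j" a ws] s z d by simp
  ultimately show ?thesis using s by simp
 qed
qed

lemma merge_empty:
 assumes "j < length s - 1" "i < length s" and srt: "ALL w:set s. sorted_wrt (<) w"
 shows "merge_at i (empty_at j s) =
  (if i < j then empty_at (j - 1) (merge_at i s) else if i <= Suc j then s else empty_at j (merge_at (i - 1) s))"
proof -
 have n: "norm_word w = w" if "w : set s" for w using srt that norm_sorted by blast
 consider "i < j" | "i = j" | "i = Suc j" | "Suc j < i" by linarith
 thus ?thesis
 proof cases
  case 1
  obtain xs u v ys where s: "s = xs @ u # v # ys" "length xs = i" by (rule split2[of i s]) (use assms 1 in auto)
  show ?thesis
  proof (cases "j = Suc i")
   case True
   thus ?thesis using s empty_split[of "xs @ [u]" j v ys] by simp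
  next
   case False
   then obtain d where d: "j = Suc (Suc (i + d))" using 1 less_iff_Suc_add[of "Suc i" j] by auto
   obtain zs a ws where z: "ys = zs @ a # ws" "length zs = d" by (rule split_list_at[of d ys]) (use assms s d in auto)
   have "empty_at j s = xs @ u # v # zs @ a # [] # ws" using empty_split[of "xs @ u # v # zs" j a ws] s z d by simp
   moreover have "empty_at (j - 1) (merge_at i s) = xs @ norm_word (u @ v) # zs @ a # [] # ws"
    using empty_split[of "xs @ norm_word (u @ v) # zs" "j - 1" a ws] s z d by simp
   ultimately show ?thesis using s 1 by simp
  qed
 next
  case 2
  obtain xs u ys where s: "s = xs @ u # ys" "length xs = j" by (rule split_list_at[of j s]) (use assms in auto)
  thus ?thesis using 2 n[of u] by simp
 next
  case 3
  obtain xs u v ys where s: "s = xs @ u # v # ys" "length xs = j" by (rule split2[of j s]) (use assms in auto)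
  thus ?thesis using 3 n[of v] merge_split[of "xs @ [u]" i "[]" v ys] by simp
 next
  case 4
  obtain xs u ys where s: "s = xs @ u # ys" "length xs = j" by (rule split_list_at[of j s]) (use assms in auto)
  obtain d where d: "i = Suc (Suc (j + d))" using 4 less_iff_Suc_add[of "Suc j" i] by auto
  show ?thesis
  proof (cases d)
   case 0
   then obtain v w zs where y: "ys = v # zs" using assms s d by (cases ys) auto
   have "EX w ws. zs = w # ws | zs = []" by (cases zs) auto
   show ?thesis
   proof (cases zs)
    case Nil
    thus ?thesis using assms s d y 0 by simp
   next
    case (Cons w ws)
    have "merge_at i (empty_at j s) = xs @ u # [] # norm_word (v @ w) # ws"
     using merge_split[of "xs @ [u, []]" i v w ws] s y Cons d 0 by simp
    moreover have "merge_at (i - 1) s = xs @ u # norm_word (v @ w) # ws"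
     using merge_split[of "xs @ [u]" "i - 1" v w ws] s y Cons d 0 by simp
    ultimately show ?thesis using s 4 by simp
   qed
  next
   case (Suc d')
   obtain zs a b ws where z: "ys = zs @ a # b # ws" "length zs = d" by (rule split2[of d ys]) (use assms s d in auto)
   have "merge_at i (empty_at j s) = xs @ u # [] # zs @ norm_word (a @ b) # ws"
    using merge_split[of "xs @ u # [] # zs" i a b ws] s z d by simp
   moreover have "merge_at (i - 1) s = xs @ u # zs @ norm_word (a @ b) # ws"
    using merge_split[of "xs @ u # zs" "i - 1" a b ws] s z d by simp
   ultimately show ?thesis using s 4 by simp
  qed
 qed
qed

lemma merge_in:
 assumes "s : Sx (flag_complex \<phi>) (Suc n)" "i <= Suc n"
 shows "merge_at i s : Sx (flag_complex \<phi>) n"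
proof -
 obtain xs u v ys where s: "s = xs @ u # v # ys" "length xs = i" by (rule split2[of i s]) (use assms in \<open>auto simp: flag_Sx\<close>)
 thus ?thesis using assms norm_norm[of "concat xs" "u @ v" "concat ys"] by (auto simp: flag_Sx sorted_norm)
qed

lemma empty_in:
 assumes "s : Sx (flag_complex \<phi>) n" "i <= n"
 shows "empty_at i s : Sx (flag_complex \<phi>) (Suc n)"
proof -
 obtain xs u ys where s: "s = xs @ u # ys" "length xs = i" by (rule split_list_at[of i s]) (use assms in \<open>auto simp: flag_Sx\<close>)
 thus ?thesis using assms by (auto simp: flag_Sx)
qed

lemma is_sset_flag: "is_sset (flag_complex \<phi>)"
 unfolding is_sset_def flag_Fc flag_Dg
proof (intro conjI allI ballI impI, goal_cases)
 case (1 n s i)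
 thus ?case by (rule merge_in)
next
 case (2 n s i)
 thus ?case by (rule empty_in)
next
 case (3 n s i j)
 thus ?case by (intro merge_merge) (auto simp: flag_Sx)
next
 case (4 n s j i)
 thus ?case by (intro merge_empty) (auto simp: flag_Sx)
next
 case (5 n s i j)
 thus ?case by (intro empty_empty) (auto simp: flag_Sx)
qed

lemma finite_flag: "finite (Sx (flag_complex \<phi>) n)"
proof (rule finite_subset)
 let ?W = "{w. set w \<subseteq> {..sum_list \<phi>} & length w <= length \<phi>}"
 show "finite {s. set s \<subseteq> ?W & length s = n + 2}" by (intro finite_lists_length_eq finite_lists_length_le) simp
 show "Sx (flag_complex \<phi>) n \<subseteq> {s. set s \<subseteq> ?W & length s = n + 2}"
 proof
  fix s assume s: "s : Sx (flag_complex \<phi>) n"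
  have "w : ?W" if "w : set s" for w
  proof -
  from that
  obtain xs ys where "s = xs @ w # ys" by (meson split_list)
  hence c: "concat s = concat xs @ w @ concat ys" by simp
  have "length (concat s) = length \<phi>" "sum_list (concat s) <= sum_list \<phi>"
   using s length_norm[of "concat s"] sum_norm[of "concat s"] by (auto simp: flag_Sx)
  hence "length w <= length \<phi>" "sum_list w <= sum_list \<phi>" using c by simp_all
  thus ?thesis using member_le_sum_list[of _ w] by (auto intro: order_trans)
  qed
  thus "s : {s. set s \<subseteq> ?W & length s = n + 2}" using s by (auto simp: flag_Sx)
 qed
qed

text \<open>An empty word between two bars makes a simplex degenerate, so in top degree the \<open>k\<close> letters of a \<open>k\<close>-flag
 are used up by the \<open>k\<close> words between the bars.\<close>

lemma nondegenerate_flag: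
 assumes s: "nondegenerate (flag_complex \<phi>) k s" and k: "length \<phi> = k"
 obtains mid where "s = [] # mid @ [[]]" "length mid = k" "!!w. w : set mid ==> length w = 1"
proof -
 have in_s: "s : Sx (flag_complex \<phi>) k" and nd: "\<nexists>m i y. k = Suc m & i <= m & y : Sx (flag_complex \<phi>) m & s = empty_at i y"
  using s by (auto simp: nondegenerate_def flag_Dg)
 hence "length s = k + 2" by (simp add: flag_Sx)
 then obtain h t where ht: "s = h # t" "length t = Suc k" by (cases s) auto
 then obtain mid l where t: "t = mid @ [l]" "length mid = k" by (cases t rule: rev_cases) auto
 have ne: "[] ~: set mid"
 proof
  assume "[] : set mid"
  then obtain xs ys where m: "mid = xs @ [] # ys" by (meson split_list)
  let ?y = "(h # xs) @ ys @ [l]"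
  have "s = empty_at (length xs) ?y" using ht t m by (simp add: empty_at_def)
  moreover have "?y : Sx (flag_complex \<phi>) (k - 1)" using in_s ht t m by (auto simp: flag_Sx)
  ultimately show False using nd t m by (metis add_Suc_right diff_Suc_1 le_add1 length_Cons length_append)
 qed
 have "length (concat s) = k" using in_s k length_norm[of "concat s"] by (simp add: flag_Sx)
 hence len: "length h + length (concat mid) + length l = k" using ht t by simp
 have "length ws <= length (concat ws) & (length (concat ws) <= length ws --> (ALL w:set ws. length w = 1))" if "[] ~: set ws" for ws :: "nat list list"
  using that
 proof (induction ws)
  case (Cons w ws)
  hence "1 <= length w" by (cases w) auto
  thus ?case using Cons by auto
 qed simp
 from this[OF ne] have "h = []" "l = []" "ALL w:set mid. length w = 1" using len t by auto
 thus thesis using that ht t by auto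
qed

lemma spanned_in:
 assumes K: "is_sset K" and S: "!!n x. x : S n ==> x : Sx K n" and x: "spanned K S n x"
 shows "x : Sx K n"
 using x by (induction rule: spanned.induct) (use S sset_face[OF K] sset_degen[OF K] in auto)

lemma spanned_subcomplex:
 assumes "is_sset K" "!!n x. x : S n ==> x : Sx K n"
 shows "subcomplex K (%n. Collect (spanned K S n))"
 unfolding subcomplex_def using spanned_in[OF assms] by (auto intro: spanned.intros)

lemma bd_zero_sub: "subcomplex (flag_complex \<phi>) (bd_zero \<phi>)" and bd_tilde_sub: "subcomplex (flag_complex \<phi>) (bd_tilde \<phi>)"
 unfolding bd_zero_def[abs_def] bd_tilde_def[abs_def]
 by (rule spanned_subcomplex[OF is_sset_flag]; use sset_face[OF is_sset_flag] in \<open>auto simp: nondegenerate_def\<close>)+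

lemma bd_in: "s : bd_zero \<phi> j ==> s : Sx (flag_complex \<phi>) j" "s : bd_tilde \<phi> j ==> s : Sx (flag_complex \<phi>) j"
 using bd_zero_sub[of \<phi>, unfolded subcomplex_def, THEN conjunct1] bd_tilde_sub[of \<phi>, unfolded subcomplex_def, THEN conjunct1] by blast+

lemma boundary_Sx: "Sx (flag_boundary \<phi>) j = bd_zero \<phi> j \<union> bd_tilde \<phi> j"
 and boundary_Fc: "Fc (flag_boundary \<phi>) = Fc (flag_complex \<phi>)" and boundary_Dg: "Dg (flag_boundary \<phi>) = Dg (flag_complex \<phi>)"
 by (simp_all add: flag_boundary_def)

lemma boundary_in: "s : Sx (flag_boundary \<phi>) j ==> s : Sx (flag_complex \<phi>) j"
 using bd_in by (auto simp: boundary_Sx)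

lemma is_sset_boundary: "is_sset (flag_boundary \<phi>)" and tilde_sub_boundary: "subcomplex (flag_boundary \<phi>) (bd_tilde \<phi>)"
proof -
 have cl: "Fc (flag_complex \<phi>) (Suc n) i s : Sx (flag_boundary \<phi>) n" if "s : Sx (flag_boundary \<phi>) (Suc n)" "i <= Suc n" for n i s
  using that bd_zero_sub[of \<phi>, unfolded subcomplex_def, THEN conjunct2, THEN conjunct1]
   bd_tilde_sub[of \<phi>, unfolded subcomplex_def, THEN conjunct2, THEN conjunct1] unfolding boundary_Sx by auto
 have dg: "Dg (flag_complex \<phi>) n i s : Sx (flag_boundary \<phi>) (Suc n)" if "s : Sx (flag_boundary \<phi>) n" "i <= n" for n i s
  using that bd_zero_sub[of \<phi>, unfolded subcomplex_def, THEN conjunct2, THEN conjunct2]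
   bd_tilde_sub[of \<phi>, unfolded subcomplex_def, THEN conjunct2, THEN conjunct2] unfolding boundary_Sx by auto
 show "is_sset (flag_boundary \<phi>)"
  unfolding is_sset_def boundary_Fc boundary_Dg
 proof (intro conjI allI ballI impI, goal_cases)
  case (1 n x i)
  thus ?case by (rule cl)
 next
  case (2 n x i)
  thus ?case by (rule dg)
 next
  case (3 n x i j)
  thus ?case by (intro sset_face_face[OF is_sset_flag boundary_in]) auto
 next
  case (4 n x i j)
  thus ?case by (intro sset_face_degen[OF is_sset_flag boundary_in]) auto
 next
  case (5 n x i j)
  thus ?case by (intro sset_degen_degen[OF is_sset_flag boundary_in]) auto
 qed
 show "subcomplex (flag_boundary \<phi>) (bd_tilde \<phi>)"
  using bd_tilde_sub[of \<phi>] unfolding subcomplex_def boundary_Fc boundary_Dg boundary_Sx by (elim conjE) (intro conjI, blast, assumption+)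
qed

text \<open>Removing the last bar moves a letter into the last word, removing the first bar moves one into the
 first word, and no further face or degeneracy takes letters out of these words.\<close>

lemma bd_tilde_last: assumes "s : bd_tilde \<phi> j" shows "last s ~= []"
proof -
 have "spanned (flag_complex \<phi>) (%m. {Fc (flag_complex \<phi>) (Suc m) (Suc m) s | s.
    Suc m = length \<phi> & nondegenerate (flag_complex \<phi>) (Suc m) s}) j s" using assms by (simp add: bd_tilde_def)
 hence "s : Sx (flag_complex \<phi>) j & last s ~= []"
 proof (induction rule: spanned.induct)
  case (1 x n)
  then obtain s where s0: "x = Fc (flag_complex \<phi>) (Suc n) (Suc n) s" "Suc n = length \<phi>" "nondegenerate (flag_complex \<phi>) (Suc n) s" by blast
  note s = s0(1)[unfolded flag_Fc] s0(2)[symmetric] s0(3)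
  obtain mid where m: "s = [] # mid @ [[]]" "length mid = Suc n" "!!w. w : set mid ==> length w = 1"
   by (rule nondegenerate_flag[OF s(3,2)]) (rule that)
  obtain mid' w where w: "mid = mid' @ [w]" using m(2) by (cases mid rule: rev_cases) auto
  have "x = [] # mid' @ [norm_word w]" using merge_split[of "[] # mid'" "Suc n" w "[]" "[]"] s(1) m w by simp
  moreover have "x : Sx (flag_complex \<phi>) n" unfolding s(1) by (rule merge_in) (use s(3) in \<open>auto simp: nondegenerate_def\<close>)
  ultimately show ?case using m(3)[of w] w by auto
 next
  case (2 n x i)
  hence "merge_at i x : Sx (flag_complex \<phi>) n" by (intro merge_in) auto
  moreover obtain xs u v ys where "x = xs @ u # v # ys" "length xs = i" by (rule split2[of i x]) (use 2 in \<open>auto simp: flag_Sx\<close>)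
  ultimately show ?case using 2 by (auto simp: flag_Fc split: if_splits)
 next
  case (3 n x i)
  hence "empty_at i x : Sx (flag_complex \<phi>) (Suc n)" by (intro empty_in) auto
  moreover obtain xs u v ys where "x = xs @ u # v # ys" "length xs = i" by (rule split2[of i x]) (use 3 in \<open>auto simp: flag_Sx\<close>)
  ultimately show ?case using 3 by (auto simp: flag_Dg)
 qed
 thus ?thesis ..
qed

lemma bd_zero_hd: assumes "s : bd_zero \<phi> j" shows "hd s ~= []"
proof -
 have "spanned (flag_complex \<phi>) (%m. {Fc (flag_complex \<phi>) (Suc m) 0 s | s.
    Suc m = length \<phi> & nondegenerate (flag_complex \<phi>) (Suc m) s}) j s" using assms by (simp add: bd_zero_def)
 hence "s : Sx (flag_complex \<phi>) j & hd s ~= []"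
 proof (induction rule: spanned.induct)
  case (1 x n)
  then obtain s where s0: "x = Fc (flag_complex \<phi>) (Suc n) 0 s" "Suc n = length \<phi>" "nondegenerate (flag_complex \<phi>) (Suc n) s" by blast
  note s = s0(1)[unfolded flag_Fc] s0(2)[symmetric] s0(3)
  obtain mid where m: "s = [] # mid @ [[]]" "length mid = Suc n" "!!w. w : set mid ==> length w = 1"
   by (rule nondegenerate_flag[OF s(3,2)]) (rule that)
  obtain mid' w where w: "mid = w # mid'" using m(2) by (cases mid) auto
  have "x = norm_word w # mid' @ [[]]" using merge_split[of "[]" 0 "[]" w "mid' @ [[]]"] s(1) m w by simp
  moreover have "x : Sx (flag_complex \<phi>) n" unfolding s(1) by (rule merge_in) (use s(3) in \<open>auto simp: nondegenerate_def\<close>)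
  ultimately show ?case using m(3)[of w] w by auto
 next
  case (2 n x i)
  hence "merge_at i x : Sx (flag_complex \<phi>) n" by (intro merge_in) auto
  moreover obtain xs u v ys where x: "x = xs @ u # v # ys" "length xs = i" by (rule split2[of i x]) (use 2 in \<open>auto simp: flag_Sx\<close>)
  have "hd x ~= []" using 2 by simp
  hence "hd (merge_at i x) ~= []" unfolding x(1) merge_split[OF x(2)] by (cases xs) auto
  ultimately show ?case by (simp add: flag_Fc)
 next
  case (3 n x i)
  hence "empty_at i x : Sx (flag_complex \<phi>) (Suc n)" by (intro empty_in) auto
  moreover obtain xs u v ys where x: "x = xs @ u # v # ys" "length xs = i" by (rule split2[of i x]) (use 3 in \<open>auto simp: flag_Sx\<close>)
  have "hd x ~= []" using 3 by simp
  hence "hd (empty_at i x) ~= []" unfolding x(1) empty_split[OF x(2)] by (cases xs) auto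
  ultimately show ?case by (simp add: flag_Dg)
 qed
 thus ?thesis ..
qed

text \<open>The vertices of a simplex of a flag complex are the bars; \<open>cnt\<close> counts the letters between the first bar and
 each of the bars.  Faces and degeneracies delete and repeat entries of this list.\<close>

primrec cnt :: "nat list list => nat list" where
 "cnt [] = []"
| "cnt (u # ws) = 0 # map ((+) (length u)) (cnt ws)"

lemma length_cnt [simp]: "length (cnt ws) = length ws"
 by (induction ws) auto

lemma cnt_append: "cnt (xs @ ys) = cnt xs @ map ((+) (length (concat xs))) (cnt ys)"
 by (induction xs) (simp_all add: add.assoc comp_def)

lemma cnt_bound: "x : set (cnt ws) ==> x <= length (concat ws)"
 by (induction ws arbitrary: x) auto

lemma cnt_sorted: "sorted (cnt ws)"
 by (induction ws) (auto simp: sorted_map intro!: sorted_wrt_mono_rel[of _ "(<=)"])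

lemma cnt_Delta: "length ws = Suc j ==> cnt ws : Sx (Delta (length (concat ws))) j"
 using cnt_bound[of _ ws] cnt_sorted[of ws] by (auto simp: Delta_Sx)

lemma yoneda_coface:
 assumes K: "is_sset K" and x: "x : Sx K (Suc r)" and v: "v <= Suc r" and ys: "ys : Sx (Delta r) k"
 shows "yoneda K (Suc r) x k (map (%y. if y < v then y else Suc y) ys) = yoneda K r (Fc K (Suc r) v x) k ys"
proof -
 let ?d = "%y. if y < v then y else Suc y"
 have d: "smap (Delta r) (Delta (Suc r)) (%_. map ?d)" unfolding smap_def
 proof (intro allI ballI conjI impI)
  show "map ?d zs : Sx (Delta (Suc r)) n" if "zs : Sx (Delta r) n" for zs n
  proof -
   have "sorted zs" "set zs \<subseteq> {0..r}" "length zs = Suc n" using that by (auto simp: Delta_Sx)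
   moreover have "sorted (map ?d zs)" using \<open>sorted zs\<close> unfolding sorted_map by (rule sorted_wrt_mono_rel[rotated]) auto
   ultimately show ?thesis by (auto simp: Delta_Sx)
  qed
 qed (simp_all add: Delta_Dg Delta_Fc take_map drop_map)
 have f: "smap (Delta r) K (%k ys. yoneda K (Suc r) x k (map ?d ys))"
  by (rule smap_comp[OF d]) (use yoneda_smap[OF K x] in \<open>simp add: smaps_def\<close>)
 have y: "smap (Delta (Suc r)) K (yoneda K (Suc r) x)" using yoneda_smap[OF K x] by (simp add: smaps_def)
 have "map ?d [0..<Suc r] = Fc (Delta (Suc r)) (Suc r) v [0..<Suc (Suc r)]"
 proof (rule nth_equalityI)
  fix i assume "i < length (map ?d [0..<Suc r])"
  thus "map ?d [0..<Suc r] ! i = Fc (Delta (Suc r)) (Suc r) v [0..<Suc (Suc r)] ! i"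
   using v by (auto simp: Delta_Fc nth_append simp del: upt_Suc)
 qed (use v in \<open>simp add: Delta_Fc del: upt_Suc\<close>)
 hence "yoneda K (Suc r) x r (map ?d [0..<Suc r]) = Fc K (Suc r) v x"
  using smap_face[OF y top_simplex_in v] yoneda_top[OF K x] by simp
 thus ?thesis using yoneda_unique[OF f ys] by simp
qed

lemma yoneda_cst:
 assumes K: "is_sset K" "b : Sx K 0" and xs: "xs : Sx (Delta r) k"
 shows "yoneda K r (cst K r b) k xs = cst K k b"
proof -
 have "smap (Delta r) K (%k _. cst K k b)" unfolding smap_def using cst_in[OF K] cst_face'[OF K] cst_degen[OF K] by auto
 from yoneda_unique[OF this xs] show ?thesis by simp
qed

lemma yoneda_nat:
 assumes K: "is_sset K" and f: "smap K L f" and x: "x : Sx K r" and xs: "xs : Sx (Delta r) k"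
 shows "f k (yoneda K r x k xs) = yoneda L r (f r x) k xs"
proof -
 have "smap (Delta r) L (%k xs. f k (yoneda K r x k xs))"
  by (rule smap_comp[OF _ f]) (use yoneda_smap[OF K x] in \<open>simp add: smaps_def\<close>)
 from yoneda_unique[OF this xs] show ?thesis using yoneda_top[OF K x] by simp
qed

section \<open>The minimal lift\<close>

text \<open>The simplices that carry the tower.\<close>

definition live :: "nat list list => bool" where
 "live s \<longleftrightarrow> last s = [] & set (butlast s) \<subseteq> {[], [0]}"

lemma norm_live: "norm_word (u @ v) : {[], [0]} \<longleftrightarrow> u = [] & v : {[], [0]} | u = [0] & v = []"
proof -
 have "w = [] | (EX c. w = [c]) | 2 <= length w" for w :: "nat list" by (cases w; cases "tl w") auto
 note c = this[of u] this[of v]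
 have l: "2 <= length w ==> w ~: {[], [0 :: nat]}" for w by auto
 show ?thesis
 proof (cases "2 <= length u + length v")
  case True
  hence "norm_word (u @ v) ~: {[], [0]}" using l[of "norm_word (u @ v)"] by simp
  thus ?thesis using True by auto
 next
  case False
  thus ?thesis using c by (cases u; cases v) auto
 qed
qed

lemma live_split: "live (xs @ u # v # ys) \<longleftrightarrow> set xs \<subseteq> {[], [0]} & u : {[], [0]} &
  (if ys = [] then v = [] else v : {[], [0]} & live ys)"
 by (auto simp: live_def butlast_append)

lemma live_merged: "live (xs @ w # ys) \<longleftrightarrow> set xs \<subseteq> {[], [0]} & (if ys = [] then w = [] else w : {[], [0]} & live ys)"
 by (auto simp: live_def butlast_append)

lemma live_Cons: "live (w # ys) \<longleftrightarrow> (if ys = [] then w = [] else w : {[], [0]} & live ys)"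
 using live_merged[of "[]" w ys] by simp

lemma live_merge:
 assumes "live (xs @ norm_word (u @ v) # ys)"
 shows "live (xs @ u # v # ys)"
 using assms norm_live[of u v] unfolding live_split live_merged[of xs] by (auto simp: live_Cons split: if_splits)

lemma live_empty: "live (xs @ u # [] # ys) \<longleftrightarrow> live (xs @ u # ys)" if "ys ~= []"
 using that unfolding live_split live_merged[of xs] by (auto simp: live_Cons)

lemma live_concat:
 assumes "live s" "s ~= []"
 shows "concat s = replicate (length (concat s)) 0"
proof -
 have "concat ws = replicate (length (concat ws)) 0" if "set ws \<subseteq> {[], [0 :: nat]}" for ws
  using that by (induction ws) auto
 moreover have "s = butlast s @ [[]]" using assms append_butlast_last_id[of s] by (simp add: live_def)
 ultimately show ?thesis using assms(1) unfolding live_def by (metis append.right_neutral concat.simps concat_append)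
qed

locale tower = pointed_smc M u for M :: "('o, 'a) smc" and u :: "'s itself" +
 fixes B :: 'o and V :: "('o, 'a) sobj" and N :: nat and H :: "nat => 'a"
 assumes B0: "B : sob M" and V: "simp_obj (uc M) (enat (N + 1)) V"
  and H_in: "!!k. k <= N ==> H k : hom B (lev V (N + 1 - k)) k"
  and H_face0: "!!k. k < N ==> fc B (lev V (N - k)) (Suc k) 0 (H (Suc k)) =
   post (lev V (N + 1 - k)) (lev V (N - k)) k (fce V (N + 1 - k) 0) (H k)"
  and H_face: "!!k i. k < N ==> 1 <= i ==> i <= Suc k ==> fc B (lev V (N - k)) (Suc k) i (H (Suc k)) = zsimp M B (lev V (N - k)) k"
  and H_fce: "!!k i. k <= N ==> 1 <= i ==> i <= N + 1 - k ==>
   post (lev V (N + 1 - k)) (lev V (N - k)) k (fce V (N + 1 - k) i) (H k) = zsimp M B (lev V (N - k)) k"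
begin

lemma lev_in: "m <= N + 1 ==> lev V m : sob M"
 using simp_obj_lev[OF V, of m] by simp

lemma fce_in: "m <= N ==> i <= Suc m ==> fce V (Suc m) i : hom (lev V (Suc m)) (lev V m) 0"
 using simp_obj_fce[OF V, of m i] by simp

definition Y :: "nat => nat => nat list => 'a" where
 "Y r = yoneda (mp B (lev V (N + 1 - r))) r (H r)"

lemma Y_smap: "r <= N ==> smap (Delta r) (mp B (lev V (N + 1 - r))) (Y r)"
 using yoneda_smap[OF sset[OF B0 lev_in] H_in] unfolding Y_def by (simp add: smaps_def)

lemma Y_post:
 assumes r: "r <= N" and X: "X : sob M" and g: "g : hom (lev V (N + 1 - r)) X 0" and xs: "xs : Sx (Delta r) j"
 shows "post (lev V (N + 1 - r)) X j g (Y r j xs) = yoneda (mp B X) r (post (lev V (N + 1 - r)) X r g (H r)) j xs"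
 unfolding Y_def using yoneda_nat[OF sset[OF B0 lev_in] smap_post[OF B0 lev_in X g] H_in[OF r] xs] by simp

lemma Y_zero: "X : sob M ==> xs : Sx (Delta r) j ==> yoneda (mp B X) r (zsimp M B X r) j xs = zsimp M B X j"
 unfolding zsimp_def by (rule yoneda_cst[OF sset[OF B0] zmap_in[OF B0]])

text \<open>A monotone map that only misses the value \<open>0\<close> factors through the zeroth face of \<open>H\<close>.\<close>

lemma Y_d0:
 assumes r: "r < N" and ys: "ys : Sx (Delta r) j"
 shows "Y (Suc r) j (map Suc ys) = post (lev V (N + 1 - r)) (lev V (N - r)) j (fce V (N + 1 - r) 0) (Y r j ys)"
proof -
 have l: "lev V (N - r) : sob M" by (rule lev_in) simp
 have f: "fce V (N + 1 - r) 0 : hom (lev V (N + 1 - r)) (lev V (N - r)) 0" using fce_in[of "N - r" 0] r by (simp add: Suc_diff_le)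
 have h: "H (Suc r) : hom B (lev V (N - r)) (Suc r)" using H_in[of "Suc r"] r by simp
 have "Y (Suc r) j (map Suc ys) = yoneda (mp B (lev V (N - r))) r (fc B (lev V (N - r)) (Suc r) 0 (H (Suc r))) j ys"
  using yoneda_coface[OF sset[OF B0 l] h le0 ys] by (simp add: Y_def)
 thus ?thesis using H_face0[OF r] Y_post[OF _ l f ys] r by simp
qed

text \<open>A monotone map that misses a value \<open>v \<ge> 1\<close> factors through a face of \<open>H\<close> that is zero.\<close>

lemma Y_missing:
 assumes r: "r < N" and v: "1 <= v" "v <= Suc r" and xs: "xs : Sx (Delta (Suc r)) j" "v ~: set xs"
 shows "Y (Suc r) j xs = zsimp M B (lev V (N - r)) j"
proof -
 have l: "lev V (N - r) : sob M" by (rule lev_in) simp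
 have h: "H (Suc r) : hom B (lev V (N - r)) (Suc r)" using H_in[of "Suc r"] r by simp
 define ys where "ys = map (%y. if y < v then y else y - 1) xs"
 have x: "length xs = Suc j" "sorted xs" "set xs \<subseteq> {0..Suc r}" using xs(1) by (auto simp: Delta_Sx)
 have "sorted ys" unfolding ys_def sorted_map using x(2) by (rule sorted_wrt_mono_rel[rotated]) auto
 moreover have "set ys \<subseteq> {0..r}"
 proof
  fix y assume "y : set ys"
  then obtain z where z: "z : set xs" "y = (if z < v then z else z - 1)" by (auto simp: ys_def)
  hence "z <= Suc r" "z ~= v" using x(3) xs(2) by auto
  thus "y : {0..r}" using z(2) v by (auto split: if_splits)
 qed
 ultimately have ys: "ys : Sx (Delta r) j" using x(1) by (simp add: Delta_Sx ys_def)
 have "(if (if y < v then y else y - 1) < v then (if y < v then y else y - 1) else Suc (if y < v then y else y - 1)) = y" if "y : set xs" for y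
 proof -
  have "y ~= v" using that xs(2) by blast
  thus ?thesis using v(1) by (cases "y < v") auto
 qed
 hence e: "map (%y. if y < v then y else Suc y) ys = xs" unfolding ys_def map_map comp_def by (intro map_idI) auto
 have "Y (Suc r) j xs = yoneda (mp B (lev V (N - r))) r (fc B (lev V (N - r)) (Suc r) v (H (Suc r))) j ys"
  using yoneda_coface[OF sset[OF B0 l] h v(2) ys] e by (simp add: Y_def)
 thus ?thesis using H_face[OF r v] Y_zero[OF l ys] by simp
qed

lemma Y_fce:
 assumes r: "r <= N" and i: "1 <= i" "i <= N + 1 - r" and xs: "xs : Sx (Delta r) j"
 shows "post (lev V (N + 1 - r)) (lev V (N - r)) j (fce V (N + 1 - r) i) (Y r j xs) = zsimp M B (lev V (N - r)) j"
proof -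
 have l: "lev V (N - r) : sob M" by (rule lev_in) simp
 have f: "fce V (N + 1 - r) i : hom (lev V (N + 1 - r)) (lev V (N - r)) 0" using fce_in[of "N - r" i] r i by (simp add: Suc_diff_le)
 show ?thesis using Y_post[OF r l f xs] H_fce[OF r i] Y_zero[OF l xs] by simp
qed

lemma Y_d0_fce:
 assumes r: "r < N" and c: "c <= N - r" and xs: "xs : Sx (Delta r) j"
 shows "post (lev V (N - r)) (lev V (N - r - 1)) j (fce V (N - r) c)
   (post (lev V (N + 1 - r)) (lev V (N - r)) j (fce V (N + 1 - r) 0) (Y r j xs)) = zsimp M B (lev V (N - r - 1)) j"
proof -
 obtain m where m: "N - r = Suc m" using r by (cases "N - r") auto
 have mN: "N + 1 - r = Suc (Suc m)" "Suc m <= N" using m r by auto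
 have l: "lev V (Suc (Suc m)) : sob M" "lev V (Suc m) : sob M" "lev V m : sob M" using lev_in mN by auto
 have f: "!!i. i <= Suc (Suc m) ==> fce V (Suc (Suc m)) i : hom (lev V (Suc (Suc m))) (lev V (Suc m)) 0"
  "!!i. i <= Suc m ==> fce V (Suc m) i : hom (lev V (Suc m)) (lev V m) 0" using fce_in mN by auto
 have y: "Y r j xs : hom B (lev V (Suc (Suc m))) j" using smap_in[OF Y_smap xs] r mN by simp
 have c': "c <= Suc m" using c m by simp
 have e: "fce V (Suc m) c ** fce V (Suc (Suc m)) 0 = fce V (Suc m) 0 ** fce V (Suc (Suc m)) (Suc c)"
  using simp_obj_face_face[OF V, of m 0 "Suc c"] mN c' by simp
 have "post (lev V (Suc m)) (lev V m) j (fce V (Suc m) c) (post (lev V (Suc (Suc m))) (lev V (Suc m)) j (fce V (Suc (Suc m)) 0) (Y r j xs)) =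
   post (lev V (Suc m)) (lev V m) j (fce V (Suc m) 0) (post (lev V (Suc (Suc m))) (lev V (Suc m)) j (fce V (Suc (Suc m)) (Suc c)) (Y r j xs))"
  using post_post[OF B0 l y f(1)[OF le0] f(2)[OF c']] post_post[OF B0 l y f(1)[of "Suc c"] f(2)[OF le0]] e c' by simp
 also have "\<dots> = zsimp M B (lev V m) j"
  using Y_fce[of r "Suc c" xs j] xs r c mN m post_zsimp[OF B0 l(2,3) f(2)[OF le0]] by simp
 finally show ?thesis using m mN by simp
qed

definition EY :: "nat list => nat => nat => nat list => 'a" where
 "EY w r j xs = (if w = [] then Y r j xs else post (lev V (N + 1 - r)) (lev V (N - r)) j (fce V (N + 1 - r) 0) (Y r j xs))"

lemma EY_smap:
 assumes r: "r <= N" and w: "w : {[], [0]}"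
 shows "smap (Delta r) (mp B (lev V (N + 1 - (length w + r)))) (EY w r)"
proof (cases "w = []")
 case True
 thus ?thesis using Y_smap[OF r] by (simp add: EY_def[abs_def])
next
 case False
 have "fce V (N + 1 - r) 0 : hom (lev V (N + 1 - r)) (lev V (N - r)) 0" using fce_in[of "N - r" 0] r by (simp add: Suc_diff_le)
 from smap_comp[OF Y_smap[OF r] smap_post[OF B0 lev_in lev_in this]] show ?thesis using False w by (simp add: EY_def[abs_def])
qed

lemma EY_missing:
 assumes r: "r < N" and w: "w : {[], [0]}" and v: "1 <= v" "v <= Suc r" and xs: "xs : Sx (Delta (Suc r)) j" "v ~: set xs"
 shows "EY w (Suc r) j xs = zsimp M B (lev V (N - (length w + r))) j"
proof (cases "w = []")
 case True
 thus ?thesis using Y_missing[OF r v xs] by (simp add: EY_def)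
next
 case False
 obtain m where m: "N - r = Suc m" using r by (cases "N - r") auto
 have f: "fce V (Suc m) 0 : hom (lev V (Suc m)) (lev V m) 0" by (rule fce_in) (use m in auto)
 have "N - Suc r = m" "N - (length w + r) = m" using m w False by auto
 thus ?thesis using Y_missing[OF r v xs] False m post_zsimp[OF B0 lev_in lev_in f] r by (simp add: EY_def)
qed

text \<open>The simplices outside the support of the lift are sent to the zero simplices of \<open>map(B, V\<^sub>N\<^sub>+\<^sub>1\<^sub>-\<^sub>k)\<close>, where
 \<open>k\<close> is the length of the flag.\<close>

definition hv :: "nat list => nat => nat list list => 'a" where
 "hv \<phi> j s = (if live s then EY (hd s) (length (concat (tl s))) j (cnt (tl s)) else zsimp M B (lev V (N + 1 - length \<phi>)) j)"

lemma flag_live: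
 assumes s: "w # ws : Sx (flag_complex \<phi>) j" "live (w # ws)"
 shows "length ws = Suc j" and "w : {[], [0]}" and "length \<phi> = length w + length (concat ws)"
  and "cnt ws : Sx (Delta (length (concat ws))) j"
proof -
 show 1: "length ws = Suc j" using s(1) by (simp add: flag_Sx)
 thus "w : {[], [0]}" using s(2) by (cases ws) (auto simp: live_def)
 show "length \<phi> = length w + length (concat ws)" using s(1) length_norm[of "concat (w # ws)"] by (simp add: flag_Sx)
 show "cnt ws : Sx (Delta (length (concat ws))) j" by (rule cnt_Delta[OF 1])
qed

lemma flag_Cons: "s : Sx (flag_complex \<phi>) j ==> EX w ws. s = w # ws"
 by (cases s) (auto simp: flag_Sx)

lemma hv_in:
 assumes s: "s : Sx (flag_complex \<phi>) j" and b: "live s ==> length (concat (tl s)) <= N"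
 shows "hv \<phi> j s : hom B (lev V (N + 1 - length \<phi>)) j"
proof (cases "live s")
 case True
 obtain w ws where w: "s = w # ws" using flag_Cons[OF s] by blast
 note f = flag_live[OF s[unfolded w] True[unfolded w]]
 show ?thesis using smap_in[OF EY_smap[OF _ f(2)] f(4)] b True f(3) w by (simp add: hv_def)
next
 case False
 thus ?thesis using zsimp_in[OF B0 lev_in] by (simp add: hv_def)
qed

lemma hv_degen:
 assumes s: "s : Sx (flag_complex \<phi>) j" and b: "live s ==> length (concat (tl s)) <= N" and i: "i <= j"
 shows "hv \<phi> (Suc j) (empty_at i s) = Dg (mp B (lev V (N + 1 - length \<phi>))) j i (hv \<phi> j s)"
proof -
 have ls: "length s = j + 2" using s by (simp add: flag_Sx)
 obtain xs a ys where x: "s = xs @ a # ys" "length xs = i" by (rule split_list_at[of i s]) (use ls i in auto)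
 have ys: "ys ~= []" using ls x i by auto
 have e: "empty_at i s = xs @ a # [] # ys" using x by simp
 have le: "live (empty_at i s) \<longleftrightarrow> live s" using live_empty[OF ys, of xs a] e x(1) by simp
 show ?thesis
 proof (cases "live s")
  case True
  obtain w ws where w: "s = w # ws" using flag_Cons[OF s] by blast
  note f = flag_live[OF s[unfolded w] True[unfolded w]]
  have r: "length (concat ws) <= N" using b True w by simp
  have "hd (empty_at i s) = w & concat (tl (empty_at i s)) = concat ws & cnt (tl (empty_at i s)) = Dg (Delta (length (concat ws))) j i (cnt ws)"
  proof (cases xs)
   case Nil
   then obtain y zs where "ys = y # zs" using ys by (cases ys) auto
   thus ?thesis using Nil x e w by (simp add: Delta_Dg)
  next
   case (Cons w' xs')
   obtain y zs where "ys = y # zs" using ys by (cases ys) auto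
   thus ?thesis using Cons x(1) x(2)[symmetric] e w by (simp add: Delta_Dg cnt_append comp_def)
  qed
  hence "hv \<phi> (Suc j) (empty_at i s) = EY w (length (concat ws)) (Suc j) (Dg (Delta (length (concat ws))) j i (cnt ws))"
   using True le by (simp add: hv_def)
  thus ?thesis using smap_degen[OF EY_smap[OF r f(2)] f(4) i] True w f(3) by (simp add: hv_def)
 next
  case False
  thus ?thesis using le cst_degen[OF sset[OF B0 lev_in] zmap_in[OF B0 lev_in] i] by (simp add: hv_def zsimp_def)
 qed
qed

text \<open>Merging the first two words moves a letter \<open>d\<^sub>0\<close> into the first word, which is \<open>Y_d0\<close>, or gives \<open>d\<^sub>0d\<^sub>0\<close> there,
 which vanishes by \<open>Y_d0_fce\<close>.  If another merger produces a word other than the empty one and \<open>d\<^sub>0\<close>, or a letter in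
 the last word, then the removed entry of the count is a value that no other entry takes.  The bound
 excludes simplices of top degree that would need \<open>H\<close> beyond the end of the tower.\<close>

lemma hv_face:
 assumes s: "s : Sx (flag_complex \<phi>) (Suc j)" and b: "live s ==> length (concat (tl s)) <= N" and i: "i <= Suc j"
 shows "hv \<phi> j (merge_at i s) = fc B (lev V (N + 1 - length \<phi>)) (Suc j) i (hv \<phi> (Suc j) s)"
proof (cases "live s")
 case False
 obtain xs a c ys where x: "s = xs @ a # c # ys" "length xs = i" by (rule split2[of i s]) (use s i in \<open>auto simp: flag_Sx\<close>)
 have "\<not> live (merge_at i s)" using live_merge[of xs a c ys] False x by auto
 thus ?thesis using False zsimp_face[OF B0 lev_in i] by (simp add: hv_def)
next
 case True
 obtain w ws where w: "s = w # ws" using flag_Cons[OF s] by blast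
 note f = flag_live[OF s[unfolded w] True[unfolded w]]
 define r where "r = length (concat ws)"
 have r: "r <= N" using b True w by (simp add: r_def)
 have E: "fc B (lev V (N + 1 - length \<phi>)) (Suc j) i (hv \<phi> (Suc j) s) = EY w r j (Fc (Delta r) (Suc j) i (cnt ws))"
  using smap_face[OF EY_smap[OF r f(2)] f(4)[folded r_def] i] True w f(3) by (simp add: hv_def r_def)
 show ?thesis
 proof (cases i)
  case 0
  obtain u' ws' where ws0: "ws = u' # ws'" using f(1) by (cases ws) auto
  have "ws' ~= []" using f(1) ws0 by auto
  note ws = ws0 this
  have mg: "merge_at i s = norm_word (w @ u') # ws'" using 0 w ws merge_split[of "[]" 0 w u' ws'] by simp
  have lv: "live ws'" "u' : {[], [0]}" using True w ws live_split[of "[]" w u' ws'] by auto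
  have lm: "live (merge_at i s) \<longleftrightarrow> norm_word (w @ u') : {[], [0]}" unfolding mg using live_merged[of "[]" "norm_word (w @ u')" ws'] ws(2) lv by simp
  have Fd: "Fc (Delta r) (Suc j) i (cnt ws) = map ((+) (length u')) (cnt ws')" using ws 0 by (simp add: Delta_Fc)
  have cw: "cnt ws' : Sx (Delta (length (concat ws'))) j" by (rule cnt_Delta) (use f(1) ws in simp)
  show ?thesis
  proof (cases "u' = []")
   case True
   have nw: "norm_word (w @ u') = w" using True f(2) by auto
   hence "live (merge_at i s)" using lm f(2) by simp
   moreover have "map ((+) (length u')) (cnt ws') = cnt ws'" using True by (simp add: map_idI)
   ultimately show ?thesis using E Fd mg nw True ws by (simp add: hv_def r_def)
  next
   case False
   hence u': "u' = [0]" using lv by auto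
   obtain r' where r': "r = Suc r'" "r' = length (concat ws')" "r' < N" using ws u' r by (auto simp: r_def)
   have m: "map ((+) (length u')) (cnt ws') = map Suc (cnt ws')" using u' by simp
   have Yd: "Y (Suc r') j (map Suc (cnt ws')) = post (lev V (N + 1 - r')) (lev V (N - r')) j (fce V (N + 1 - r') 0) (Y r' j (cnt ws'))"
    using Y_d0[OF r'(3)] cw r'(2) by simp
   show ?thesis
   proof (cases "w = []")
    case True
    hence "hv \<phi> j (merge_at i s) = EY [0] r' j (cnt ws')" using lm mg u' r' by (simp add: hv_def)
    thus ?thesis using E Fd m Yd r' True by (simp add: EY_def)
   next
    case False
    hence w0: "w = [0]" using f(2) by auto
    have "norm_word (w @ u') ~: {[], [0]}" unfolding norm_live using w0 u' by simp
    hence "\<not> live (merge_at i s)" using lm by blast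
    hence "hv \<phi> j (merge_at i s) = zsimp M B (lev V (N + 1 - length \<phi>)) j" by (simp add: hv_def)
    moreover have "EY w r j (map Suc (cnt ws')) = zsimp M B (lev V (N - r' - 1)) j"
     using Y_d0_fce[OF r'(3) le0, of "cnt ws'" j] cw r' Yd w0 by (simp add: EY_def)
    moreover have "N + 1 - length \<phi> = N - r' - 1" using f(3) w0 r' by (simp add: r_def)
    ultimately show ?thesis using E Fd m by simp
   qed
  qed
 next
  case (Suc i')
  obtain xs a c ys where x: "ws = xs @ a # c # ys" "length xs = i'" by (rule split2[of i' ws]) (use f(1) i Suc in auto)
  have mg: "merge_at i s = w # xs @ norm_word (a @ c) # ys" using merge_split[of "w # xs" i a c ys] w x Suc by simp
  let ?m = "xs @ norm_word (a @ c) # ys"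
  have Fd: "Fc (Delta r) (Suc j) i (cnt ws) = cnt ?m"
   using x Suc by (simp add: Delta_Fc cnt_append add.assoc comp_def)
  have lr: "length (concat ?m) = r" using x by (simp add: r_def)
  have ls: "w : {[], [0]}" "a : {[], [0]}" "if ys = [] then c = [] else c : {[], [0]} & live ys" "set xs \<subseteq> {[], [0]}"
   using True w x live_split[of "w # xs" a c ys] by auto
  show ?thesis
  proof (cases "live (merge_at i s)")
   case True
   thus ?thesis using E Fd mg lr by (simp add: hv_def)
  next
   case False
   hence "\<not> (if ys = [] then norm_word (a @ c) = [] else norm_word (a @ c) : {[], [0]})"
    unfolding mg using live_merged[of "w # xs" "norm_word (a @ c)" ys] ls by auto
   hence a: "a = [0]" "ys = [] & c = [] | c = [0]" using ls(2,3) norm_live[of a c] by (auto split: if_splits)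
   have "0 < r" using lr a by auto
   then obtain r' where r': "r = Suc r'" "r' < N" using r by (cases r) auto
   let ?v = "Suc (length (concat xs))"
   have v: "1 <= ?v" "?v <= Suc r'" using x a r' by (auto simp: r_def)
   have "?v ~: set (cnt ?m)" using a cnt_bound[of ?v xs] by (auto simp: cnt_append)
   moreover have "cnt ?m : Sx (Delta (Suc r')) j" using cnt_Delta[of ?m j] f(1) x lr r' by simp
   ultimately have "EY w r j (cnt ?m) = zsimp M B (lev V (N - (length w + r'))) j" using EY_missing[OF r'(2) ls(1) v] r' by simp
   moreover have "N + 1 - length \<phi> = N - (length w + r')" using f(3) r' by (simp add: r_def)
   ultimately show ?thesis using E Fd False by (simp add: hv_def)
  qed
 qed
qed

lemma omit_length: "p < length \<phi> ==> length (omit p \<phi>) = length \<phi> - 1"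
 by (auto simp: omit_def)

lemma flag_gap:
 assumes \<phi>: "is_flag N \<phi>" and p: "p < length \<phi>"
 shows "\<phi> ! p - p <= N + 2 - length \<phi>" and "p <= \<phi> ! p"
proof -
 have srt: "sorted_wrt (<) \<phi>" "ALL i:set \<phi>. i <= N + 1" using \<phi> by (auto simp: is_flag_def)
 have up: "p + d < length \<phi> ==> \<phi> ! p + d <= \<phi> ! (p + d)" for d
 proof (induction d)
  case (Suc d)
  have "\<phi> ! (p + d) < \<phi> ! (p + Suc d)" using sorted_wrt_nth_less[OF srt(1), of "p + d" "p + Suc d"] Suc.prems by simp
  thus ?case using Suc by simp
 qed simp
 have "\<phi> ! p + (length \<phi> - 1 - p) <= \<phi> ! (length \<phi> - 1)" using up[of "length \<phi> - 1 - p"] p by simp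
 moreover have "\<phi> ! (length \<phi> - 1) <= N + 1" using srt(2) p by (metis diff_less gr_implies_not0 nth_mem less_numeral_extra(1) length_greater_0_conv list.size(3))
 ultimately show "\<phi> ! p - p <= N + 2 - length \<phi>" using p by simp
 show "p <= \<phi> ! p" using p
 proof (induction p)
  case (Suc p)
  thus ?case using sorted_wrt_nth_less[OF srt(1), of p "Suc p"] by simp
 qed simp
qed

lemma hv_left:
 assumes \<phi>: "is_flag N \<phi>" "length \<phi> <= N + 1" and p: "p < length \<phi>" and s: "s : Sx (flag_complex (omit p \<phi>)) j"
 shows "hv \<phi> j (left_comp (\<phi> ! p - p) s) =
  post (lev V (N + 2 - length \<phi>)) (lev V (N + 1 - length \<phi>)) j (fce V (N + 2 - length \<phi>) (\<phi> ! p - p)) (hv (omit p \<phi>) j s)"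
proof -
 define c where "c = \<phi> ! p - p"
 define L where "L = length \<phi>"
 have c: "c <= N + 2 - L" using flag_gap(1)[OF \<phi>(1) p] by (simp add: c_def L_def)
 have L: "1 <= L" "L <= N + 1" "length (omit p \<phi>) = L - 1" using p \<phi> omit_length[OF p] by (auto simp: L_def)
 have f: "fce V (N + 2 - L) c : hom (lev V (N + 2 - L)) (lev V (N + 1 - L)) 0" using fce_in[of "N + 1 - L" c] L c by (simp add: Suc_diff_le)
 obtain w ws where w: "s = w # ws" using flag_Cons[OF s] by blast
 have ws: "ws ~= []" using s w by (auto simp: flag_Sx)
 have lc: "left_comp c s = norm_word (c # w) # ws" by (simp add: left_comp_def w)
 have ll: "live (left_comp c s) \<longleftrightarrow> c = 0 & w = [] & live ws"
  unfolding lc using live_merged[of "[]" "norm_word (c # w)" ws] ws norm_live[of "[c]" w] by auto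
 have lvs: "live s \<longleftrightarrow> w : {[], [0]} & live ws" unfolding w using live_merged[of "[]" w ws] ws by simp
 have z: "post (lev V (N + 2 - L)) (lev V (N + 1 - L)) j (fce V (N + 2 - L) c) (zsimp M B (lev V (N + 2 - L)) j) = zsimp M B (lev V (N + 1 - L)) j"
  by (rule post_zsimp[OF B0 lev_in lev_in f]) (use L in auto)
 have NL: "N + 1 - (L - 1) = N + 2 - L" using L by simp
 have "hv \<phi> j (left_comp c s) = post (lev V (N + 2 - L)) (lev V (N + 1 - L)) j (fce V (N + 2 - L) c) (hv (omit p \<phi>) j s)"
 proof (cases "live s")
  case False
  hence "\<not> live (left_comp c s)" using ll lvs by auto
  thus ?thesis using False z L NL by (simp add: hv_def L_def[symmetric])
 next
  case True
  note g = flag_live[OF s[unfolded w] True[unfolded w]]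
  define r where "r = length (concat ws)"
  have r: "length w + r = L - 1" using g(3) L by (simp add: r_def)
  have cw: "cnt ws : Sx (Delta r) j" using g(4) by (simp add: r_def)
  have rN: "r <= N" using r L by simp
  show ?thesis
  proof (cases "w = []")
   case True
   hence n: "N + 2 - L = N + 1 - r" "N + 1 - L = N - r" using r L by auto
   have R: "hv (omit p \<phi>) j s = Y r j (cnt ws)" using \<open>live s\<close> w True by (simp add: hv_def EY_def r_def)
   show ?thesis
   proof (cases "c = 0")
    case True
    hence "live (left_comp c s)" using ll lvs \<open>live s\<close> \<open>w = []\<close> by simp
    hence "hv \<phi> j (left_comp c s) = EY [0] r j (cnt ws)" using lc True \<open>w = []\<close> by (simp add: hv_def r_def)
    thus ?thesis using R n True by (simp add: EY_def)
   next
    case False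
    hence "\<not> live (left_comp c s)" using ll by simp
    hence "hv \<phi> j (left_comp c s) = zsimp M B (lev V (N - r)) j" using n by (simp add: hv_def L_def[symmetric])
    thus ?thesis using R n Y_fce[OF rN _ _ cw, of c] False c by simp
   qed
  next
   case False
   hence w0: "w = [0]" using g(2) by auto
   hence n: "N + 2 - L = N - r" "N + 1 - L = N - r - 1" "r < N" using r L by auto
   have "\<not> live (left_comp c s)" using ll False by simp
   hence "hv \<phi> j (left_comp c s) = zsimp M B (lev V (N - r - 1)) j" using n by (simp add: hv_def L_def[symmetric])
   moreover have "hv (omit p \<phi>) j s = post (lev V (N + 1 - r)) (lev V (N - r)) j (fce V (N + 1 - r) 0) (Y r j (cnt ws))"
    using True w w0 by (simp add: hv_def EY_def r_def)
   ultimately show ?thesis using n Y_d0_fce[OF n(3) _ cw, of c] c by simp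
  qed
 qed
 thus ?thesis by (simp add: c_def L_def)
qed

lemma hv_tilde: "s : bd_tilde \<phi> j ==> hv \<phi> j s = zsimp M B (lev V (N + 1 - length \<phi>)) j"
 using bd_tilde_last[of s \<phi> j] by (simp add: hv_def live_def)

lemma short_bound:
 assumes "s : Sx (flag_complex \<phi>) j" "length \<phi> <= N"
 shows "length (concat (tl s)) <= N"
proof -
 obtain w ws where w: "s = w # ws" using flag_Cons[OF assms(1)] by blast
 thus ?thesis using assms length_norm[of "concat s"] by (simp add: flag_Sx)
qed

lemma hv_smap: "length \<phi> <= N ==> smap (flag_complex \<phi>) (mp B (lev V (N + 1 - length \<phi>))) (hv \<phi>)"
 unfolding smap_def flag_Fc flag_Dg
proof (intro allI ballI conjI impI)
 fix j s assume l: "length \<phi> <= N" and s: "s : Sx (flag_complex \<phi>) j"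
 note b = short_bound[OF s l]
 show "hv \<phi> j s : hom B (lev V (N + 1 - length \<phi>)) j" by (rule hv_in[OF s b])
 show "hv \<phi> (Suc j) (empty_at i s) = Dg (mp B (lev V (N + 1 - length \<phi>))) j i (hv \<phi> j s)" if "i <= j" for i
  by (rule hv_degen[OF s b that])
 show "hv \<phi> (j - 1) (merge_at i s) = fc B (lev V (N + 1 - length \<phi>)) j i (hv \<phi> j s)" if "0 < j" "i <= j" for i
  using hv_face[of s \<phi> "j - 1" i] s b that by simp
qed

text \<open>The last word is not empty in \<open>bd_tilde\<close> and the first word is not empty in \<open>bd_zero\<close>, so a boundary
 simplex on which the lift does not vanish has a letter in its first word.  The others number at most \<open>N\<close>.\<close>

lemma boundary_bound:
 assumes s: "s : Sx (flag_boundary \<phi>) j" and \<phi>: "length \<phi> = N + 1" and l: "live s"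
 shows "length (concat (tl s)) <= N"
proof -
 have "s : bd_zero \<phi> j" using s l bd_tilde_last[of s \<phi> j] by (auto simp: boundary_Sx live_def)
 hence "hd s ~= []" by (rule bd_zero_hd)
 moreover obtain w ws where w: "s = w # ws" using flag_Cons[OF boundary_in[OF s]] by blast
 ultimately show ?thesis using boundary_in[OF s] \<phi> length_norm[of "concat s"] by (cases w) (auto simp: flag_Sx)
qed

lemma hv_smap_boundary:
 assumes \<phi>: "length \<phi> = N + 1"
 shows "smap (flag_boundary \<phi>) (mp B (lev V 0)) (hv \<phi>)"
 unfolding smap_def boundary_Fc boundary_Dg flag_Fc flag_Dg
proof (intro allI ballI conjI impI)
 fix j s assume s: "s : Sx (flag_boundary \<phi>) j"
 note s' = boundary_in[OF s] and b = boundary_bound[OF s \<phi>]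
 show "hv \<phi> j s : hom B (lev V 0) j" using hv_in[OF s' b] \<phi> by simp
 show "hv \<phi> (Suc j) (empty_at i s) = Dg (mp B (lev V 0)) j i (hv \<phi> j s)" if "i <= j" for i
  using hv_degen[OF s' b that] \<phi> by simp
 show "hv \<phi> (j - 1) (merge_at i s) = fc B (lev V 0) j i (hv \<phi> j s)" if "0 < j" "i <= j" for i
  using hv_face[of s \<phi> "j - 1" i] s' b that \<phi> by simp
qed

lemma hv_boundary_map:
 assumes \<phi>: "\<phi> : Psi N"
 shows "boundary_map M V B hv \<phi> (hv \<phi>)"
proof -
 have f: "is_flag N \<phi>" "length \<phi> = N + 1" using \<phi> by (auto simp: Psi_def)
 show ?thesis unfolding boundary_map_def
  using hv_smap_boundary[OF f(2)] hv_tilde[of _ \<phi>] hv_left[OF f(1)] f(2) by simp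
qed

lemma hv_level_lift: "level_lift M V B N (H 0) N hv"
 unfolding level_lift_def
proof (intro allI impI, elim conjE, intro conjI impI)
 fix \<phi> assume f: "is_flag N \<phi>" "length \<phi> <= N"
 show "smap (flag_complex \<phi>) (mp B (lev V (N + 1 - length \<phi>))) (hv \<phi>)" by (rule hv_smap[OF f(2)])
 show "ALL j. ALL s:Sx (flag_complex []) j. hv [] j s = cst (mp B (lev V (N + 1))) j (H 0)"
 proof (intro allI ballI)
  fix j s assume s: "s : Sx (flag_complex []) j"
  hence c: "concat s = []" "s ~= []" by (auto simp: flag_Sx)
  have "set (butlast s) \<subseteq> {[]}" "last s = []" using c by (auto dest: in_set_butlastD)
  hence l: "live s" by (auto simp: live_def)
  obtain w ws where w: "s = w # ws" using flag_Cons[OF s] by blast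
  note g = flag_live[OF s[unfolded w] l[unfolded w]]
  have h: "H 0 : hom B (lev V (N + 1)) 0" using H_in[of 0] by simp
  have r0: "length (concat ws) = 0" "w = []" using c(1) w by simp_all
  have "hv [] j s = EY w (length (concat ws)) j (cnt ws)" using l w by (simp add: hv_def)
  also have "\<dots> = yoneda (mp B (lev V (N + 1))) 0 (cst (mp B (lev V (N + 1))) 0 (H 0)) j (cnt ws)"
   unfolding r0 by (simp add: EY_def Y_def)
  also have "\<dots> = cst (mp B (lev V (N + 1))) j (H 0)"
   by (rule yoneda_cst[OF sset[OF B0 lev_in] h g(4)[unfolded r0]]) simp
  finally show "hv [] j s = cst (mp B (lev V (N + 1))) j (H 0)" .
 qed
 show "ALL j. ALL s:bd_tilde \<phi> j. hv \<phi> j s = zsimp M B (lev V (N + 1 - length \<phi>)) j" using hv_tilde by blast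
 show "ALL p<length \<phi>. ALL j. ALL s:Sx (flag_complex (omit p \<phi>)) j. hv \<phi> j (left_comp (\<phi> ! p - p) s) =
   post (lev V (N + 2 - length \<phi>)) (lev V (N + 1 - length \<phi>)) j (fce V (N + 2 - length \<phi>) (\<phi> ! p - p)) (hv (omit p \<phi>) j s)"
  using hv_left[OF f(1)] f(2) by simp
qed

text \<open>If \<open>\<phi> ! p = p\<close> and the other entries are \<open>0, \<dots>, N - 1\<close>, then \<open>p\<close> can only be the last position.\<close>

lemma omit_upt:
 assumes \<phi>: "is_flag N \<phi>" "length \<phi> = N + 1" and p: "p < length \<phi>" "omit p \<phi> = [0..<N]" "\<phi> ! p - p = 0"
 shows "\<phi> = [0..<N + 1]"
proof (rule nth_equalityI)
 have pp: "\<phi> ! p = p" using p flag_gap(2)[OF \<phi>(1) p(1)] by simp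
 fix i assume i: "i < length \<phi>"
 have lt: "\<phi> ! i = i" if "i < p" for i
 proof -
  have "omit p \<phi> ! i = \<phi> ! i" using that p(1) by (simp add: omit_def nth_append)
  thus ?thesis using p(2) that p(1) \<phi>(2) by simp
 qed
 have "\<not> p < i"
 proof
  assume "p < i"
  hence q: "p < N" "Suc p < length \<phi>" using i \<phi>(2) by auto
  have "omit p \<phi> ! p = \<phi> ! Suc p" using q by (simp add: omit_def nth_append)
  hence "\<phi> ! Suc p = p" using p(2) q by simp
  thus False using sorted_wrt_nth_less[of "(<)" \<phi> p "Suc p"] \<phi>(1) q pp by (simp add: is_flag_def)
 qed
 thus "\<phi> ! i = [0..<N + 1] ! i" using lt[of i] pp i \<phi>(2) by (cases "i = p") (auto simp del: upt_Suc)
qed (use \<phi> in simp)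

text \<open>If a face \<open>d\<^sub>c \<circ> s\<close> of the flag complex of \<open>\<phi>\<close> has only words on which the lift does not vanish, then \<open>c = 0\<close>
 and \<open>s\<close> is made of letters \<open>d\<^sub>0\<close>, which determines \<open>\<phi>\<close>.\<close>

lemma hv_minimal: "minimal_lift M V B N hv"
 unfolding minimal_lift_def
proof (intro conjI ballI impI allI; (elim conjE)?)
 fix \<phi> assume \<phi>: "\<phi> : Psi N" "\<phi> ~= [0..<N + 1]"
 have f: "is_flag N \<phi>" "length \<phi> = N + 1" using \<phi>(1) by (auto simp: Psi_def)
 note l0 = lev_in[of 0, simplified]
 show "boundary_map M V B hv \<phi> (%j _. zsimp M B (lev V 0) j)" unfolding boundary_map_def
 proof (intro conjI allI ballI impI)
  show "smap (flag_boundary \<phi>) (mp B (lev V 0)) (%j _. zsimp M B (lev V 0) j)"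
   unfolding smap_def zsimp_def using cst_in[OF sset[OF B0 l0] zmap_in[OF B0 l0]] cst_face'[OF sset[OF B0 l0] zmap_in[OF B0 l0]]
    cst_degen[OF sset[OF B0 l0] zmap_in[OF B0 l0]] by simp
  fix p j s assume p: "p < length \<phi>" and s: "s : Sx (flag_complex (omit p \<phi>)) j"
  have "\<not> live (left_comp (\<phi> ! p - p) s)"
  proof
   assume l: "live (left_comp (\<phi> ! p - p) s)"
   obtain w ws where w: "s = w # ws" using flag_Cons[OF s] by blast
   have ws: "ws ~= []" using s w by (auto simp: flag_Sx)
   have "norm_word ((\<phi> ! p - p) # w) : {[], [0]}" "live ws"
    using l live_merged[of "[]" "norm_word ((\<phi> ! p - p) # w)" ws] ws by (auto simp: left_comp_def w)
   hence c: "\<phi> ! p - p = 0" "w = []" using norm_live[of "[\<phi> ! p - p]" w] by auto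
   have "live s" unfolding w using live_merged[of "[]" w ws] ws c \<open>live ws\<close> by simp
   from live_concat[OF this] have "concat s = replicate (length (concat s)) 0" using w by simp
   moreover have "norm_word (concat s) = omit p \<phi>" using s by (simp add: flag_Sx)
   moreover from this have "length (concat s) = N" using length_norm[of "concat s"] omit_length[OF p] f(2) by simp
   ultimately have "omit p \<phi> = [0..<N]" using norm_zeros[of N] by simp
   thus False using omit_upt[OF f p _ c(1)] \<phi>(2) by simp
  qed
  thus "zsimp M B (lev V 0) j = post (lev V 1) (lev V 0) j (fce V 1 (\<phi> ! p - p)) (hv (omit p \<phi>) j s)"
   using hv_left[OF f(1) _ p s] f(2) by (simp add: hv_def)
 qed simp
next
 fix k \<phi> s assume k: "length \<phi> = k" "nondegenerate (flag_complex \<phi>) k s" and ne: "s ~= [[]] @ replicate k [0] @ [[]]"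
 obtain mid where m: "s = [] # mid @ [[]]" "length mid = k" "!!w. w : set mid ==> length w = 1"
  by (rule nondegenerate_flag[OF k(2,1)]) (rule that)
 have "\<not> live s"
 proof
  assume "live s"
  hence "set mid \<subseteq> {[], [0]}" using m(1) by (auto simp: live_def)
  hence "ALL w:set mid. w = [0]" using m(3) by fastforce
  hence "mid = replicate k [0]" using m(2) by (metis replicate_eqI)
  thus False using ne m(1) by simp
 qed
 thus "hv \<phi> k s = zsimp M B (lev V (N + 1 - k)) k" using k(1) by (simp add: hv_def)
qed

lemma finite_Psi: "finite (Psi N)"
 by (rule finite_subset[OF _ finite_lists_length_eq[of "{..N + 1}" "N + 1"]]) (auto simp: Psi_def is_flag_def)

text \<open>The half-smash product represents the factorization of the boundary map; its class, composed with
 \<open>e \<phi>\<close>, comes from a map because suspensions of \<open>B\<close> are cofibrant and \<open>V\<^sub>0\<close> is fibrant.\<close>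

lemma value_ex:
 assumes Bc: "cofibrant M B" and V0: "fibrant M (lev V 0)"
  and e: "ALL \<phi>:Psi N. is_iso (hocat M) (susp M N B) (fst (flag_smash M B \<phi>)) (e \<phi>)"
 obtains w where "hho_value M V B N e hv w"
proof -
 note V00 = fibrant_ob[OF V0]
 have S: "susp M N B = sph N B" using Qob_cofibrant[OF Bc] by (simp add: susp_def sph_def)
 have Sc: "cofibrant M (susp M N B)" unfolding S by (rule sph_cofibrant[OF Bc])
 have "EX g ft. is_adjoint M V B \<phi> (hv \<phi>) g & ft : hom (susp M N B) (lev V 0) 0 &
   loc M (susp M N B) (lev V 0) ft = hcmp M (loc M (fst (flag_smash M B \<phi>)) (lev V 0) g) (e \<phi>)" if \<phi>: "\<phi> : Psi N" for \<phi>
 proof -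
  let ?K = "squot (flag_boundary \<phi>) (bd_tilde \<phi>)" and ?T = "fst (flag_smash M B \<phi>)" and ?al = "snd (flag_smash M B \<phi>)"
  have l: "length \<phi> = N + 1" using \<phi> by (simp add: Psi_def)
  have K: "is_sset ?K" by (rule is_sset_squot[OF is_sset_boundary tilde_sub_boundary])
  have k: "None : Sx ?K 0" by (simp add: squot_Sx)
  have fin: "finite (Sx ?K m)" for m
   unfolding squot_Sx using finite_subset[of "Sx (flag_boundary \<phi>) m" "Sx (flag_complex \<phi>) m"] boundary_in finite_flag by auto
  have sm: "is_smash M B ?K None ?T ?al" unfolding flag_smash_def by (rule smash_exists[OF K fin k B0])
  have T: "?T : sob M" using sm by (simp add: is_smash_def)
  have f: "smap ?K (mp B (lev V 0)) (from_quot (mp B (lev V 0)) (zmap B (lev V 0)) (hv \<phi>))"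
   by (rule smap_from_quot[OF sset[OF B0 V00] zmap_in[OF B0 V00] hv_smap_boundary[OF l]]) (use hv_tilde[of _ \<phi>] l in \<open>simp add: zsimp_def\<close>)
  have "EX! g. g : hom ?T (lev V 0) 0 & (ALL m. ALL x:Sx ?K m. post ?T (lev V 0) m g (?al m x) = from_quot (mp B (lev V 0)) (zmap B (lev V 0)) (hv \<phi>) m x)"
   by (rule smash_rep[OF K B0 sm V00 f _ k]) (simp add: cst_squot from_quot_def zsimp_def)
  then obtain g where g: "g : hom ?T (lev V 0) 0"
   "!!m x. x : Sx ?K m ==> post ?T (lev V 0) m g (?al m x) = from_quot (mp B (lev V 0)) (zmap B (lev V 0)) (hv \<phi>) m x" by blast
  have ad: "is_adjoint M V B \<phi> (hv \<phi>) g" unfolding is_adjoint_def using g by (simp add: squot_Sx from_quot_def)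
  have "e \<phi> : ar (hocat M) (susp M N B) ?T" using e \<phi> by (simp add: is_iso_def)
  hence "hcmp M (loc M ?T (lev V 0) g) (e \<phi>) : ar (hocat M) (susp M N B) (lev V 0)"
   using cat_comp[OF category_hocat] cofibrant_ob[OF Sc] T V00 loc_in[OF T V00 g(1)] by (simp add: hocat_simps(1))
  then obtain ft where "ft : hom (susp M N B) (lev V 0) 0" "loc M (susp M N B) (lev V 0) ft = hcmp M (loc M ?T (lev V 0) g) (e \<phi>)"
   by (rule loc_surj[OF Sc V0])
  thus ?thesis using ad by blast
 qed
 then obtain g ft where gf: "!!\<phi>. \<phi> : Psi N ==> is_adjoint M V B \<phi> (hv \<phi>) (g \<phi>) & ft \<phi> : hom (susp M N B) (lev V 0) 0 &
   loc M (susp M N B) (lev V 0) (ft \<phi>) = hcmp M (loc M (fst (flag_smash M B \<phi>)) (lev V 0) (g \<phi>)) (e \<phi>)" by metis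
 obtain P inc where "is_coprod (uc M) (Psi N) (%_. susp M N B) P inc"
  by (rule coproduct_exists[OF category_uc cocomplete_uc inf_univ finite_Psi, of "%_. susp M N B"]) (use cofibrant_ob[OF Sc] in auto)
 hence "EX p. case p of (P, inc) => is_coprod (uc M) (Psi N) (%_. susp M N B) P inc" by auto
 from someI_ex[OF this] have W: "is_coprod (uc M) (Psi N) (%_. susp M N B) (fst (susp_wedge M B N)) (snd (susp_wedge M B N))"
  unfolding susp_wedge_def wedge_def by (simp add: case_prod_beta')
 have "EX! t. t : hom (fst (susp_wedge M B N)) (lev V 0) 0 & (ALL \<phi>:Psi N. t ** snd (susp_wedge M B N) \<phi> = ft \<phi>)"
  using W V00 gf unfolding is_coprod_def by simp
 then obtain t where t: "t : hom (fst (susp_wedge M B N)) (lev V 0) 0" "ALL \<phi>:Psi N. t ** snd (susp_wedge M B N) \<phi> = ft \<phi>" by blast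
 have "hho_value M V B N e hv (loc M (fst (susp_wedge M B N)) (lev V 0) t)"
  unfolding hho_value_def using gf t hv_boundary_map by (intro exI[of _ hv] exI[of _ g] exI[of _ ft] exI[of _ t]) simp
 thus thesis by (rule that)
qed

lemma minimal_value_ex:
 assumes "cofibrant M B" "fibrant M (lev V 0)"
  and "ALL \<phi>:Psi N. is_iso (hocat M) (susp M N B) (fst (flag_smash M B \<phi>)) (e \<phi>)"
 shows "minimal_values M V B N (H 0) e ~= {}"
proof -
 obtain w where "hho_value M V B N e hv w" by (rule value_ex[OF assms])
 thus ?thesis using hv_level_lift hv_minimal unfolding minimal_values_def by blast
qed

end

lemma minimal_values_sub: "minimal_values M V B N a e \<subseteq> hho M V B N a e"
 by (auto simp: minimal_values_def hho_def)

theorem corollary6p9: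
  fixes M :: "('o, 'a) smc" and \<A> :: "'o set" and n :: nat
    and \<Lambda> :: "('o, 'a, 's) alg"
    and G :: "(('o, 'a, 's) alg, ('o, 'a, 's) algarr) sobj"
  assumes "infinite (UNIV :: 's set)"
    and "pointed_simplicial_model_category TYPE('s) M"
    and "cofibrantly_generated TYPE('s) (uc M) (weq M) (fib M)"
    and "right_proper (uc M) (weq M) (fib M)"
    and "\<A> \<subseteq> sob M" and "\<forall>A\<in>\<A>. cogroup_object (hocat M) A"
    and "E2_model_category TYPE('s) M \<A>"
    and "1 \<le> n"
    and "\<Lambda> \<in> ob (Alg M \<A>)"
    and "free_resolution M \<A> \<Lambda> G Gbar gbar \<epsilon>"
    and "truncated_realization M \<A> G Gbar (n + 1) V Vbar vbar \<theta>"
    and "B \<in> MA TYPE('s) M \<A>" and "cofibrant M B"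
    and "palg_iso (Pi_cat M \<A>) (piA M B) (Gbar (n + 2)) \<beta>"
    and "is_chains (uc M) V (n + 1) C \<iota>" and "dbar \<in> ar (uc M) B C"
    and attaching: "\<forall>B'\<in>ob (Pi_cat M \<A>). \<forall>x\<in>ar (hocat M) B' B.
           \<theta> (n + 1) B' (hcmp M (loc M B (lev V (n + 1)) (cmp (uc M) \<iota> dbar)) x) =
           app (cmp (Alg M \<A>) (fce G (n + 2) 0) (gbar (n + 2))) B' (\<beta> B' x)"
    and "\<forall>\<phi>\<in>Psi n. is_iso (hocat M) (susp M n B) (fst (flag_smash M B \<phi>)) (e \<phi>)"
  shows "minimal_values M V B n (cmp (uc M) \<iota> dbar) e \<noteq> {} \<and>
         hho M V B n (cmp (uc M) \<iota> dbar) e \<noteq> {} \<and>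
         (\<forall>w\<in>minimal_values M V B n (cmp (uc M) \<iota> dbar) e.
           w = hho_zero M V B n \<longrightarrow> hho_vanishes M V B n (cmp (uc M) \<iota> dbar) e)"
proof -
 have p: "pointed_smc M TYPE('s)" using assms(1,2) by (simp add: pointed_smc_def)
 have d: "dbar : Sx (mapc M B C) 0" using assms(16) by (simp add: uc_def)
 interpret realization M "TYPE('s)" \<A> n \<Lambda> G Gbar gbar \<epsilon> V Vbar vbar \<theta> B \<beta> C \<iota> dbar
  by (intro realization.intro realization_axioms.intro p) (use assms d in auto)
 obtain H where H: "H 0 = \<iota> ** dbar" "!!k. k <= n ==> H k : hom B (lev V (n + 1 - k)) k"
  "!!k. k < n ==> Fc (mapc M B (lev V (n - k))) (Suc k) 0 (H (Suc k)) = postc M (lev V (n + 1 - k)) (lev V (n - k)) k (fce V (n + 1 - k) 0) (H k)"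
  "!!k i. k < n ==> 1 <= i ==> i <= Suc k ==> Fc (mapc M B (lev V (n - k))) (Suc k) i (H (Suc k)) = zsimp M B (lev V (n - k)) k"
  "!!k i. k <= n ==> 1 <= i ==> i <= n + 1 - k ==> postc M (lev V (n + 1 - k)) (lev V (n - k)) k (fce V (n + 1 - k) i) (H k) = zsimp M B (lev V (n - k)) k"
  by (rule V_tower) (rule that)
 interpret T: tower M "TYPE('s)" B V n H
  by (intro tower.intro tower_axioms.intro p cofibrant_ob[OF B(2)] V_simp H(2-5))
 have "minimal_values M V B n (cmp (uc M) \<iota> dbar) e ~= {}"
  using T.minimal_value_ex[OF B(2) zero_level_fibrant[OF V_reedy] assms(18)] H(1) by simp
 thus ?thesis using minimal_values_sub[of M V B n "cmp (uc M) \<iota> dbar" e] by (auto simp: hho_vanishes_def)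
qed

end
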